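(* Let $\mathbf{Pin}^{a,b,c,d,e,f,g}(n,\mathbb{C})$ be a universal covering of the complex orthogonal group $O(n,\mathbb{C})$ of the space $\mathbb{C}^n$ associated with the complex algebra $\mathbb{C}_n$. The symbols $a,b,c,d,e,f,g\in\{-,+\}$ correspond to squares of the elements of the finite group $\mathsf{Ext}=\{\mathsf{I},\mathsf{W},\mathsf{E},\mathsf{C},\Pi,\mathsf{K},\mathsf{S},\mathsf{F}\}$: $a=\mathsf{W}^2$, $b=\mathsf{E}^2$, $c=\mathsf{C}^2$, $d=\Pi^2$, $e=\mathsf{K}^2$, $f=\mathsf{S}^2$, $g=\mathsf{F}^2$, where $\mathsf{W},\mathsf{E},\mathsf{C},\Pi,\mathsf{K},\mathsf{S},\mathsf{F}$ are spinor representations of $\mathcal{A}\to\mathcal{A}^\star$, $\mathcal{A}\to\widetilde{\mathcal{A}}$, $\mathcal{A}\to\widetilde{\mathcal{A}^\star}$, $\mathcal{A}\to\overline{\mathcal{A}}$, $\mathcal{A}\to\overline{\mathcal{A}^\star}$, $\mathcal{A}\to\overline{\widetilde{\mathcal{A}}}$, $\mathcal{A}\to\overline{\widetilde{\mathcal{A}^\star}}$. Then over the field $\mathbb{F}=\mathbb{C}$, depending on the division ring structure $\mathbb{K}=fC\ell_{p,q}f$ of the real subalgebras $C\ell_{p,q}\subset\mathbb{C}_n$, there exist the following universal coverings ($CPT$-structures) of the group $O(n,\mathbb{C})$: 1) $\mathbb{K}\simeq\mathbb{R}$, $p-q\equiv 0,2\pmod 8$. The $CPT$-structures are reduced to the eight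 Shirokov–Dąbrowski $PT$-structures $$\mathbf{Pin}^{a,b,c}(n,\mathbb{C})\simeq\frac{(\mathbf{Spin}_+(n,\mathbb{C})\odot C^{a,b,c})}{\mathbb{Z}_2},$$ where $C^{a,b,c}$ are double coverings of the group $\{1,P,T,PT\}\simeq\{\mathsf{I},\mathsf{W},\mathsf{E},\mathsf{C}\}\simeq\mathbb{Z}_2\otimes\mathbb{Z}_2$. 2) $\mathbb{K}\simeq\mathbb{H}$, $p-q\equiv 4,6\pmod 8$. In this case there are 64 universal coverings: a) The non-Cliffordian group $$\mathbf{Pin}^{+,+,+,+,+,+,+}(n,\mathbb{C})\simeq\frac{(\mathbf{Spin}_+(n,\mathbb{C})\odot\mathbb{Z}_2\otimes\mathbb{Z}_2\otimes\mathbb{Z}_2\otimes\mathbb{Z}_2)}{\mathbb{Z}_2}$$ exists if the subalgebra $C\ell_{p,q}$ has the type $p-q\equiv 4\pmod 8$. Non-Cliffordian groups $$\mathbf{Pin}^{a,b,c,d,e,f,g}(n,\mathbb{C})\simeq\frac{(\mathbf{Spin}_+(n,\mathbb{C})\odot\mathbb{Z}_4\otimes\mathbb{Z}_2\otimes\mathbb{Z}_2)}{\mathbb{Z}_2}$$ exist with the signature $(+,+,+,-,-,-,-)$ when $p-q\equiv 4\pmod 8$, and also with the signatures $(a,b,c,d,e,f,g)$ when $p-q\equiv 6\pmod 8$, where among $a,b,c$ there are two minuses and one plus, and among $d,e,f,g$ two pluses and two minuses. b) Cliffordian groups $$\mathbf{Pin}^{a,b,c,d,e,f,g}(n,\mathbb{C})\simeq\frac{(\mathbf{Spin}_+(n,\mathbb{C})\odot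 Q_4\otimes\mathbb{Z}_2)}{\mathbb{Z}_2}$$ exist with the signature $(+,-,-,-,-,-,-)$ when $p-q\equiv 4\pmod 8$ and with the signatures $(-,+,-,-,-,-,-)$, $(-,-,+,-,-,-,-)$ when $p-q\equiv 6\pmod 8$; they also exist with the signature $(-,-,-,d,e,f,g)$ if $p-q\equiv 6\pmod 8$, where among $d,e,f,g$ there are one plus and three minuses. Cliffordian groups $$\mathbf{Pin}^{a,b,c,d,e,f,g}(n,\mathbb{C})\simeq\frac{(\mathbf{Spin}_+(n,\mathbb{C})\odot D_4\otimes\mathbb{Z}_2)}{\mathbb{Z}_2}$$ exist with the signatures $(+,-,-,+,+,+,+)$ and $(+,+,+,d,e,f,g)$ when $p-q\equiv 4\pmod 8$ and among $d,e,f,g$ there are two minuses and two pluses, and also with $(+,-,+,d,e,f,g)$ and $(+,+,-,d,e,f,g)$, where among $d,e,f,g$ there are three pluses and one minus. Cliffordian groups of this type exist also with the signatures $(a,b,c,+,+,+,+)$ and $(-,+,+,d,e,f,g)$ when $p-q\equiv 6\pmod 8$, where among $a,b,c$ there are two minuses and one plus, and among $d,e,f,g$ there are three pluses and one minus. Cliffordian groups $$\mathbf{Pin}^{a,b,c,d,e,f,g}(n,\mathbb{C})\simeq\frac{(\mathbf{Spin}_+(n,\mathbb{C})\odot\overset{\ast}{\mathbb{Z}}_4\otimes\mathbb{Z}_2\otimes\mathbb{Z}_2)}{\mathbb{Z}_2}$$ exist with the signatures $(+,-,-,d,e,f,g)$ when $p-q\equiv 4\pmod 8$ and among $d,e,f,g$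 there are two pluses and two minuses, and also with $(+,-,+,d,e,f,g)$ and $(+,+,-,d,e,f,g)$, where $p-q\equiv 4\pmod 8$ and among $d,e,f,g$ there are one plus and three minuses. Cliffordian groups of this type exist also with $(-,+,-,d,e,f,g)$ and $(-,-,+,d,e,f,g)$ if $p-q\equiv 6\pmod 8$, where among $d,e,f,g$ there are two pluses and two minuses, and with $(-,-,-,d,e,f,g)$ if $p-q\equiv 6\pmod 8$, where among $d,e,f,g$ there are three pluses and one minus.
   Context: Clifford algebras: $C\ell_{p,q}$ is the real Clifford algebra with anticommuting generators, $\mathbf{e}_i^2=+1$ for $i\le p$, $-1$ for $p<i\le p+q$; $\mathbb{C}_n=\mathbb{C}\otimes C\ell_{p,q}$, $n=p+q$ even; $f$ is a primitive idempotent. Transformations of $\mathbb{C}_n$: $\star$ is the automorphism with $\mathbf{e}_i\to-\mathbf{e}_i$; $\widetilde{\phantom{cc}}$ the antiautomorphism with $\mathbf{e}_i\to\mathbf{e}_i$; $\overline{\mathcal{A}_1+i\mathcal{A}_2}=\mathcal{A}_1-i\mathcal{A}_2$ for $\mathcal{A}_j\in C\ell_{p,q}$; the others are compositions. Spinor representations: $\mathcal{E}_i$ are the matrices of the generators of $C\ell_{p,q}$ (spinbasis), each real ($\dot{\mathcal{E}}_i=\mathcal{E}_i$) or complex ($\dot{\mathcal{E}}_i=-\mathcal{E}_i$), symmetric or skewsymmetric; dot is entrywise complex conjugation. $\mathsf{A}^\star=\mathsf{W}\mathsf{A}\mathsf{W}^{-1}$, $\widetilde{\mathsf{A}}=\mathsf{E}\mathsf{A}^T\mathsf{E}^{-1}$,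 $\widetilde{\mathsf{A}^\star}=\mathsf{C}\mathsf{A}^T\mathsf{C}^{-1}$, $\overline{\mathsf{A}}=\Pi\dot{\mathsf{A}}\Pi^{-1}$, $\overline{\mathsf{A}^\star}=\mathsf{K}\dot{\mathsf{A}}\mathsf{K}^{-1}$, $\overline{\widetilde{\mathsf{A}}}=\mathsf{S}\dot{\mathsf{A}}^T\mathsf{S}^{-1}$, $\overline{\widetilde{\mathsf{A}^\star}}=\mathsf{F}\dot{\mathsf{A}}^T\mathsf{F}^{-1}$; all are products of spinbasis matrices, with $\mathsf{W}=\mathcal{E}_1\cdots\mathcal{E}_{p+q}$, $\mathsf{C}=\mathsf{E}\mathsf{W}$, $\mathsf{K}=\Pi\mathsf{W}$, $\mathsf{S}=\Pi\mathsf{E}$, $\mathsf{F}=\Pi\mathsf{C}$, so each squares to $\pm\mathsf{I}$. For $\mathbb{K}\simeq\mathbb{H}$: $\Pi$ is the product of all complex spinbasis matrices if their number is even, or of all real ones if the number of real ones is odd; $\mathsf{E}$ is the product of all skewsymmetric spinbasis matrices if their number is even, and of all symmetric ones otherwise. For $\mathbb{K}\simeq\mathbb{R}$, $\Pi$ is proportional to the unit matrix. Groups: $\mathbf{\Gamma}_n=\{s\in\mathbb{C}_n^+\cup\mathbb{C}_n^-\ \text{invertible}: s\mathbf{x}s^{-1}\in\mathbb{C}^n\ \forall\mathbf{x}\in\mathbb{C}^n\}$; $\mathbf{Pin}(n,\mathbb{C})=\{s\in\mathbf{\Gamma}_n: N(s)=\pm1\}$ with $N(s)=s\widetilde{s}$;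 $\mathbf{Spin}_+(n,\mathbb{C})$ is the subgroup of even elements with $N(s)=1$. "Universal covering" is the paper's term for these double coverings. $\odot$ is semidirect product and $\otimes$ direct product of groups. $PT$-structures: $C^{a,b,c}$ is the double covering of $\mathbb{Z}_2\otimes\mathbb{Z}_2=\{1,P,T,PT\}$ in which lifts of $P,T,PT$ have squares of signs $a,b,c$: $\mathbb{Z}_2\otimes\mathbb{Z}_2\otimes\mathbb{Z}_2$ for $(+,+,+)$; $\mathbb{Z}_2\otimes\mathbb{Z}_4$ for one $+$ and two $-$; $Q_4$ (quaternion group) for $(-,-,-)$; $D_4$ (dihedral group of order 8) for two $+$ and one $-$. $CPT$-structures: by definition $$\mathbf{Pin}^{a,b,c,d,e,f,g}(n,\mathbb{C})\simeq\frac{(\mathbf{Spin}_+(n,\mathbb{C})\odot C^{a,b,c,d,e,f,g})}{\mathbb{Z}_2},$$ where $C^{a,b,c,d,e,f,g}$ is a double covering of $\mathbb{Z}_2\otimes\mathbb{Z}_2\otimes\mathbb{Z}_2$ with squares of lifts of the seven non-identity elements given by the signature: Abelian cases $\mathbb{Z}_2^{\otimes4}$ (all $+$) and $\mathbb{Z}_4\otimes\mathbb{Z}_2\otimes\mathbb{Z}_2$ (three $+$, four $-$); non-Abelian cases $Q_4\otimes\mathbb{Z}_2$ (one $+$, six $-$), $D_4\otimes\mathbb{Z}_2$ (five $+$, two $-$), and the one the paper denotes $\overset{\ast}{\mathbb{Z}}_4\otimes\mathbb{Z}_2\otimes\mathbb{Z}_2$ (non-Abelian, three $+$, four $-$). The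 covering group is called Cliffordian if $C^{a,b,c,d,e,f,g}$ is non-Abelian, and non-Cliffordian if it is Abelian.
   Formalization: Existence is for suitable p,q; if d=+, matrices of any degree are allowed (degree 2^{n/2} forces d=−); where a,b,c have two minuses and d,e,f,g two, the type (Abelian or starred) is the one the signature forces; a=− if p−q≡6; in 1) I,W,E,C must differ up to sign. *)

theory Defs
  imports
    Complex_Main
    "HOL-Algebra.Coset"
    "HOL-Algebra.Elementary_Groups"
    "HOL-Algebra.QuotRing"
    "Jordan_Normal_Form.Matrix"
begin

section \<open>The Clifford algebras\<close>

text \<open>
  An element of $\mathbb{C}_n = \mathbb{C} \otimes C\ell_{p,q}$, $n = p + q$, is given by its
  coordinates with respect to the products $e_S = e_{i_1} \cdots e_{i_k}$ for
  $S = \{i_1 < \dots < i_k\} \subseteq \{0, \dots, n-1\}$; the generators are numbered from $0$,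
  and $e_i^2 = 1$ for $i < p$, $e_i^2 = -1$ for $p \le i < p + q$.
\<close>

type_synonym clif = "nat set \<Rightarrow> complex"

definition cl_complex :: "nat \<Rightarrow> nat \<Rightarrow> clif set" where
  "cl_complex p q = {A. \<forall>S. A S \<noteq> 0 \<longrightarrow> S \<subseteq> {..<p + q}}"

definition cl_real :: "nat \<Rightarrow> nat \<Rightarrow> clif set" where
  "cl_real p q = {A \<in> cl_complex p q. \<forall>S. A S \<in> \<real>}"

definition cl_zero :: clif where
  "cl_zero = (\<lambda>S. 0)"

definition cl_one :: clif where
  "cl_one = (\<lambda>S. if S = {} then 1 else 0)"

definition cl_gen :: "nat \<Rightarrow> clif" where
  "cl_gen i = (\<lambda>S. if S = {i} then 1 else 0)"

definition cl_add :: "clif \<Rightarrow> clif \<Rightarrow> clif" where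
  "cl_add A B = (\<lambda>S. A S + B S)"

definition cl_neg :: "clif \<Rightarrow> clif" where
  "cl_neg A = (\<lambda>S. - A S)"

text \<open>
  $e_S e_T = \pm e_{S \bigtriangleup T}$: sorting the concatenated product takes one transposition
  for every pair $i \in S$, $j \in T$ with $j < i$, and then $e_i^2$ is cancelled for every
  $i \in S \cap T$.
\<close>

definition blade_sign :: "nat \<Rightarrow> nat set \<Rightarrow> nat set \<Rightarrow> complex" where
  "blade_sign p S T =
     (- 1) ^ card {(i, j). i \<in> S \<and> j \<in> T \<and> j < i} * (- 1) ^ card {i \<in> S \<inter> T. p \<le> i}"

definition cl_mult :: "nat \<Rightarrow> nat \<Rightarrow> clif \<Rightarrow> clif \<Rightarrow> clif" where
  "cl_mult p q A B =
     (\<lambda>U. \<Sum>S\<in>Pow {..<p + q}. A S * B (sym_diff S U) * blade_sign p S (sym_diff S U))"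

definition cl_even :: "nat \<Rightarrow> nat \<Rightarrow> clif set" where
  "cl_even p q = {A \<in> cl_complex p q. \<forall>S. A S \<noteq> 0 \<longrightarrow> even (card S)}"

definition cl_odd :: "nat \<Rightarrow> nat \<Rightarrow> clif set" where
  "cl_odd p q = {A \<in> cl_complex p q. \<forall>S. A S \<noteq> 0 \<longrightarrow> odd (card S)}"

definition cl_vectors :: "nat \<Rightarrow> nat \<Rightarrow> clif set" where
  "cl_vectors p q = {A \<in> cl_complex p q. \<forall>S. A S \<noteq> 0 \<longrightarrow> card S = 1}"

text \<open>
  On a product of $k$ distinct generators, $e_i \mapsto -e_i$ gives the sign $(-1)^k$, and
  reversing the order of the factors gives $(-1)^{k(k-1)/2}$.
\<close>

definition cl_star :: "clif \<Rightarrow> clif" where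
  "cl_star A = (\<lambda>S. (- 1) ^ card S * A S)"

definition cl_tilde :: "clif \<Rightarrow> clif" where
  "cl_tilde A = (\<lambda>S. (- 1) ^ (card S * (card S - 1) div 2) * A S)"

definition cl_bar :: "clif \<Rightarrow> clif" where
  "cl_bar A = (\<lambda>S. cnj (A S))"

text \<open>
  The definitions agree with the usual ones by generators: the relations between the generators
  hold, $\star$ is an automorphism, the reversion is an antiautomorphism, and they take the
  prescribed values on the generators.
\<close>

lemma minus_one_power_square: "((-1)::complex)^m * (-1)^m = 1" by (simp flip: power_add)

lemma cl_star_gen: "cl_star (cl_gen i) = cl_neg (cl_gen i)"
  by (auto simp: cl_star_def cl_gen_def cl_neg_def)

lemma cl_tilde_gen: "cl_tilde (cl_gen i) = cl_gen i"
  by (auto simp: cl_tilde_def cl_gen_def)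

lemma card_sym_diff: assumes "finite S" "finite T"
  shows "card (sym_diff S T) + 2 * card (S \<inter> T) = card S + card T"
proof -
  have "card (sym_diff S T) = card (S - T) + card (T - S)"
    using assms by (intro card_Un_disjoint) auto
  moreover have "card S = card (S - T) + card (S \<inter> T)" using assms
    by (metis card_Diff_subset_Int card_mono finite_Int inf_le1 le_add_diff_inverse2)
  moreover have "card T = card (T - S) + card (S \<inter> T)" using assms
    by (metis Int_commute card_Diff_subset_Int card_mono finite_Int inf_le1 le_add_diff_inverse2)
  ultimately show ?thesis by simp
qed

lemma cl_star_mult: "cl_star (cl_mult p q A B) = cl_mult p q (cl_star A) (cl_star B)" if "A \<in> cl_complex p q" "B \<in> cl_complex p q"
proof
  fix U
  show "cl_star (cl_mult p q A B) U = cl_mult p q (cl_star A) (cl_star B) U"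
  proof (cases "U \<subseteq> {..<p+q}")
    case True
    have "(-1)^card U = (-1)^card S * ((-1)::complex)^card (sym_diff S U)" if "S \<in> Pow {..<p+q}" for S
    proof -
      have "finite S" "finite U" using that True by (auto intro: finite_subset)
      from card_sym_diff[OF this] have "card S + card (sym_diff S U) = card U + 2*(card S - card (S \<inter> U))"
        using card_mono[OF \<open>finite S\<close>, of "S \<inter> U"] by auto
      then show ?thesis by (metis power_add power_minus1_even mult.right_neutral)
    qed
    then show ?thesis unfolding cl_star_def cl_mult_def sum_distrib_left
      by (intro sum.cong) auto
  next
    case False
    have "sym_diff S U \<subseteq> {..<p+q} \<Longrightarrow> S \<in> Pow {..<p+q} \<Longrightarrow> False" for S using False by blast
    then have "B (sym_diff S U) = 0" if "S \<in> Pow {..<p+q}" for S using that \<open>B \<in> _\<close> unfolding cl_complex_def by blast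
    then show ?thesis unfolding cl_star_def cl_mult_def by auto
  qed
qed

lemma sum_indicator_mult: "finite P \<Longrightarrow> (\<Sum>S\<in>P. (if S = a then 1 else 0) * f S) = (if a \<in> P then f a else (0::complex))"
proof -
  assume "finite P"
  have "(\<Sum>S\<in>P. (if S = a then 1 else 0) * f S) = (\<Sum>S\<in>P. if S = a then f S else 0)" by (intro sum.cong) auto
  with \<open>finite P\<close> show ?thesis by simp
qed

lemma cl_gen_mult: assumes "i < p+q" "j < p+q"
  shows "cl_mult p q (cl_gen i) (cl_gen j) = (\<lambda>U. if U = sym_diff {i} {j} then blade_sign p {i} {j} else 0)"
proof
  fix U
  have e: "sym_diff {i} U = {j} \<longleftrightarrow> U = sym_diff {i} {j}" by blast
  have "cl_mult p q (cl_gen i) (cl_gen j) U = (\<Sum>S\<in>Pow {..<p+q}. (if S = {i} then 1 else 0) * ((if sym_diff S U = {j} then 1 else 0) * blade_sign p S (sym_diff S U)))"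
    unfolding cl_mult_def cl_gen_def by (simp add: mult.assoc)
  also have "\<dots> = (if sym_diff {i} U = {j} then 1 else 0) * blade_sign p {i} (sym_diff {i} U)"
    using assms by (subst sum_indicator_mult) auto
  finally show "cl_mult p q (cl_gen i) (cl_gen j) U = (if U = sym_diff {i} {j} then blade_sign p {i} {j} else 0)"
    using e by (cases "U = sym_diff {i} {j}") auto
qed

lemma blade_sign_gen: "blade_sign p {i} {j} = (if j < i then -1 else 1) * (if i = j \<and> p \<le> i then -1 else 1)"
proof -
  have "{(a, b). a \<in> {i} \<and> b \<in> {j} \<and> b < a} = (if j < i then {(i,j)} else {})" by auto
  moreover have "{a \<in> {i} \<inter> {j}. p \<le> a} = (if i = j \<and> p \<le> i then {i} else {})" by auto
  ultimately show ?thesis unfolding blade_sign_def by simp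
qed

lemma cl_gen_square:
  "i < p+q \<Longrightarrow> cl_mult p q (cl_gen i) (cl_gen i) = (if i < p then cl_one else cl_neg cl_one)"
  by (auto simp: cl_gen_mult blade_sign_gen cl_one_def cl_neg_def fun_eq_iff)

lemma cl_gen_anticommute:
  "i < p+q \<Longrightarrow> j < p+q \<Longrightarrow> i \<noteq> j \<Longrightarrow> cl_mult p q (cl_gen i) (cl_gen j) = cl_neg (cl_mult p q (cl_gen j) (cl_gen i))"
  by (auto simp: cl_gen_mult blade_sign_gen cl_neg_def fun_eq_iff insert_commute)

lemma triangle_add: "(a + b) * (a + b - 1) div 2 = a * (a - 1) div 2 + b * (b - 1) div 2 + a * (b::nat)"
proof -
  have "even (a*(a-1))" "even (b*(b-1))" "even ((a+b)*(a+b-1))" by (auto simp: odd_pos)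
  then obtain x y z where "a*(a-1) = 2*x" "b*(b-1) = 2*y" "(a+b)*(a+b-1) = 2*z" by (meson evenE)
  moreover have "(a+b)*(a+b-1) = a*(a-1) + b*(b-1) + 2*(a*b)"
    by (cases a; cases b) (auto simp: algebra_simps)
  ultimately show ?thesis by simp
qed

definition reversion_sign :: "nat \<Rightarrow> complex" where "reversion_sign k = (-1)^(k*(k-1) div 2)"

lemma reversion_sign_add: "reversion_sign (a+b) = reversion_sign a * reversion_sign b * (-1)^(a*b)" unfolding reversion_sign_def triangle_add by (simp add: power_add)

lemma reversion_sign_double: "reversion_sign (2*m) = (-1)^m"
proof -
  have "2*m*(2*m-1) div 2 = m*(2*m-1)" by simp
  moreover have "even (m*(2*m-1)) = even m" by (cases m) auto
  ultimately show ?thesis unfolding reversion_sign_def by (metis minus_one_power_iff)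
qed

lemma reversion_sign_sq: "reversion_sign a * reversion_sign a = 1" by (simp add: reversion_sign_def minus_one_power_square)

lemma blade_sign_swap:
  assumes f: "finite S" "finite T"
  shows "reversion_sign (card (sym_diff S T)) * blade_sign p S T = reversion_sign (card S) * reversion_sign (card T) * blade_sign p T S"
proof -
  let ?m = "card (S \<inter> T)"
  have "reversion_sign (card S + card T) = reversion_sign (card (sym_diff S T) + 2 * ?m)" using card_sym_diff[OF f] by simp
  also have "\<dots> = reversion_sign (card (sym_diff S T)) * (-1)^?m" by (simp add: reversion_sign_add reversion_sign_double)
  finally have 1: "reversion_sign (card (sym_diff S T)) = reversion_sign (card S) * reversion_sign (card T) * (-1)^(card S * card T) * (-1)^?m"
    by (simp add: reversion_sign_add)
  let ?A = "{(i, j). i \<in> S \<and> j \<in> T \<and> j < i}" and ?B = "{(i, j). i \<in> S \<and> j \<in> T \<and> i < j}" and ?D = "(\<lambda>i. (i,i)) ` (S \<inter> T)"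
  have fin: "finite ?A" "finite ?B" "finite ?D"
    by (rule finite_subset[of _ "S \<times> T"]; use f in auto)+
  have u: "S \<times> T = (?A \<union> ?B) \<union> ?D" by auto
  have "card (S \<times> T) = card ?A + card ?B + card ?D"
    unfolding u using fin by (subst card_Un_disjoint; auto)+
  moreover have "card ?D = ?m" by (rule card_image) (auto simp: inj_on_def)
  moreover have "card ?B = card {(i, j). i \<in> T \<and> j \<in> S \<and> j < i}"
    by (rule bij_betw_same_card[of prod.swap]) (auto simp: bij_betw_def inj_on_def image_iff)
  ultimately have c: "card S * card T = card ?A + card {(i, j). i \<in> T \<and> j \<in> S \<and> j < i} + ?m"
    by (simp add: card_cartesian_product)
  have x: "a * a = 1 \<Longrightarrow> b * b = 1 \<Longrightarrow> t * (a * w * b) * b * (a * y) = t * (w * y)" for a b t w y :: complex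
  proof -
    assume h: "a * a = 1" "b * b = 1"
    have "t * (a * w * b) * b * (a * y) = (a * a) * (b * b) * (t * (w * y))" by (simp only: ac_simps)
    then show ?thesis unfolding h by simp
  qed
  have "T \<inter> S = S \<inter> T" by blast
  then show ?thesis unfolding 1 c blade_sign_def power_add
    by (simp only:) (rule x; rule minus_one_power_square)
qed

lemma sign_rearrange: "t * w = a * b * v \<Longrightarrow> b * B * (a * A) * v = t * (A * B * w)" for t w a b v A B :: complex
proof -
  assume "t * w = a * b * v"
  then show ?thesis by (simp add: ac_simps)
qed

lemma cl_tilde_mult:
  assumes "A \<in> cl_complex p q" "B \<in> cl_complex p q"
  shows "cl_tilde (cl_mult p q A B) = cl_mult p q (cl_tilde B) (cl_tilde A)"
proof
  fix U
  have tl: "cl_tilde A = (\<lambda>S. reversion_sign (card S) * A S)" for A by (simp add: cl_tilde_def reversion_sign_def)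
  show "cl_tilde (cl_mult p q A B) U = cl_mult p q (cl_tilde B) (cl_tilde A) U"
  proof (cases "U \<subseteq> {..<p+q}")
    case True
    have "cl_mult p q (cl_tilde B) (cl_tilde A) U =
      (\<Sum>S\<in>Pow {..<p+q}. cl_tilde B (sym_diff S U) * cl_tilde A S * blade_sign p (sym_diff S U) S)"
      unfolding cl_mult_def
      by (rule sum.reindex_bij_witness[where i="\<lambda>S. sym_diff S U" and j="\<lambda>S. sym_diff S U"])
        (use True in \<open>auto intro!: arg_cong2[where f="(*)"] arg_cong2[where f="blade_sign p"] arg_cong[where f="cl_tilde A"] arg_cong[where f="cl_tilde B"]\<close>)
    also have "\<dots> = (\<Sum>S\<in>Pow {..<p+q}. reversion_sign (card U) * (A S * B (sym_diff S U) * blade_sign p S (sym_diff S U)))"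
    proof (rule sum.cong[OF refl])
      fix S assume "S \<in> Pow {..<p+q}"
      then have f: "finite S" "finite (sym_diff S U)" using True by (auto intro: finite_subset)
      have "sym_diff S (sym_diff S U) = U" by blast
      from blade_sign_swap[OF f, of p, unfolded this]
      show "cl_tilde B (sym_diff S U) * cl_tilde A S * blade_sign p (sym_diff S U) S =
         reversion_sign (card U) * (A S * B (sym_diff S U) * blade_sign p S (sym_diff S U))"
        unfolding tl by (rule sign_rearrange)
    qed
    finally show ?thesis by (simp add: tl cl_mult_def sum_distrib_left)
  next
    case False
    have "sym_diff S U \<subseteq> {..<p+q} \<Longrightarrow> S \<in> Pow {..<p+q} \<Longrightarrow> False" for S using False by blast
    then have "B (sym_diff S U) = 0" "A (sym_diff S U) = 0" if "S \<in> Pow {..<p+q}" for S using that assms unfolding cl_complex_def by blast+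
    then show ?thesis unfolding tl cl_mult_def by simp
  qed
qed

section \<open>Division ring of a real Clifford algebra\<close>

definition primitive_idempotent :: "nat \<Rightarrow> nat \<Rightarrow> clif \<Rightarrow> bool" where
  "primitive_idempotent p q f \<longleftrightarrow>
     f \<in> cl_real p q \<and> f \<noteq> cl_zero \<and> cl_mult p q f f = f \<and>
     \<not> (\<exists>g\<in>cl_real p q. \<exists>h\<in>cl_real p q.
          g \<noteq> cl_zero \<and> h \<noteq> cl_zero \<and>
          cl_mult p q g g = g \<and> cl_mult p q h h = h \<and>
          cl_mult p q g h = cl_zero \<and> cl_mult p q h g = cl_zero \<and> f = cl_add g h)"

definition corner_ring :: "nat \<Rightarrow> nat \<Rightarrow> clif \<Rightarrow> clif ring" where
  "corner_ring p q f =
     \<lparr>carrier = (\<lambda>A. cl_mult p q (cl_mult p q f A) f) ` cl_real p q,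
      monoid.mult = cl_mult p q, one = f, zero = cl_zero, add = cl_add\<rparr>"

definition real_ring :: "real ring" where
  "real_ring = \<lparr>carrier = UNIV, monoid.mult = (*), one = 1, zero = 0, add = (+)\<rparr>"

text \<open>The quadruple $(a, b, c, d)$ stands for $a + b\mathbf{i} + c\mathbf{j} + d\mathbf{k}$.\<close>

type_synonym quat = "real \<times> real \<times> real \<times> real"

fun quat_add :: "quat \<Rightarrow> quat \<Rightarrow> quat" where
  "quat_add (a, b, c, d) (a', b', c', d') = (a + a', b + b', c + c', d + d')"

fun quat_mult :: "quat \<Rightarrow> quat \<Rightarrow> quat" where
  "quat_mult (a, b, c, d) (a', b', c', d') =
     (a * a' - b * b' - c * c' - d * d',
      a * b' + b * a' + c * d' - d * c',
      a * c' - b * d' + c * a' + d * b',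
      a * d' + b * c' - c * b' + d * a')"

definition quat_ring :: "quat ring" where
  "quat_ring =
     \<lparr>carrier = UNIV, monoid.mult = quat_mult, one = (1, 0, 0, 0), zero = (0, 0, 0, 0),
      add = quat_add\<rparr>"

definition real_type :: "nat \<Rightarrow> nat \<Rightarrow> bool" where
  "real_type p q \<longleftrightarrow> (\<exists>f. primitive_idempotent p q f \<and> corner_ring p q f \<simeq> real_ring)"

definition quat_type :: "nat \<Rightarrow> nat \<Rightarrow> bool" where
  "quat_type p q \<longleftrightarrow> (\<exists>f. primitive_idempotent p q f \<and> corner_ring p q f \<simeq> quat_ring)"

section \<open>Clifford--Lipschitz groups\<close>

definition clifford_group :: "nat \<Rightarrow> nat \<Rightarrow> clif set" where
  "clifford_group p q =
     {s \<in> cl_even p q \<union> cl_odd p q.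
        \<exists>t\<in>cl_complex p q. cl_mult p q s t = cl_one \<and> cl_mult p q t s = cl_one \<and>
          (\<forall>x\<in>cl_vectors p q. cl_mult p q (cl_mult p q s x) t \<in> cl_vectors p q)}"

definition spinor_norm :: "nat \<Rightarrow> nat \<Rightarrow> clif \<Rightarrow> clif" where
  "spinor_norm p q s = cl_mult p q s (cl_tilde s)"

definition pin_set :: "nat \<Rightarrow> nat \<Rightarrow> clif set" where
  "pin_set p q =
     {s \<in> clifford_group p q. spinor_norm p q s = cl_one \<or> spinor_norm p q s = cl_neg cl_one}"

definition spin_plus :: "nat \<Rightarrow> nat \<Rightarrow> clif monoid" where
  "spin_plus p q =
     \<lparr>carrier = {s \<in> pin_set p q. s \<in> cl_even p q \<and> spinor_norm p q s = cl_one},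
      monoid.mult = cl_mult p q, one = cl_one\<rparr>"

section \<open>The group of transformations\<close>

text \<open>
  The label $(x, y, z)$ stands for the composition of $\star$ (if $x$), of the reversion (if $y$)
  and of the conjugation (if $z$). These three commute and are involutions, so that the eight
  labels form the group $\mathbb{Z}_2 \otimes \mathbb{Z}_2 \otimes \mathbb{Z}_2$; the labels
  $(x, y)$ without conjugation form $\{1, P, T, PT\}$.
\<close>

definition bool_group :: "bool monoid" where
  "bool_group = \<lparr>carrier = UNIV, monoid.mult = (\<noteq>), one = False\<rparr>"

type_synonym cpt_label = "bool \<times> bool \<times> bool"
type_synonym pt_label = "bool \<times> bool"

definition cpt_labels :: "cpt_label monoid" where
  "cpt_labels = bool_group \<times>\<times> bool_group \<times>\<times> bool_group"

definition pt_labels :: "pt_label monoid" where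
  "pt_labels = bool_group \<times>\<times> bool_group"

fun cl_transform :: "cpt_label \<Rightarrow> clif \<Rightarrow> clif" where
  "cl_transform (x, y, z) A =
     (if x then cl_star else id) ((if y then cl_tilde else id) ((if z then cl_bar else id) A))"

text \<open>
  An antiautomorphism $\phi$ acts on a group of invertible elements by the automorphism
  $s \mapsto \phi(s)^{-1}$.
\<close>

fun spin_action :: "nat \<Rightarrow> nat \<Rightarrow> cpt_label \<Rightarrow> clif \<Rightarrow> clif" where
  "spin_action p q (x, y, z) s =
     (if y then inv\<^bsub>spin_plus p q\<^esub> (cl_transform (x, y, z) s) else cl_transform (x, y, z) s)"

section \<open>Spinor representations\<close>

definition mat_list_prod :: "nat \<Rightarrow> complex mat list \<Rightarrow> complex mat" where
  "mat_list_prod N Ms = foldr (*) Ms (1\<^sub>m N)"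

definition mat_prod :: "nat \<Rightarrow> (nat \<Rightarrow> complex mat) \<Rightarrow> nat set \<Rightarrow> complex mat" where
  "mat_prod N Es S = mat_list_prod N (map Es (sorted_list_of_set S))"

definition mat_cnj :: "complex mat \<Rightarrow> complex mat" where
  "mat_cnj M = map_mat cnj M"

definition spin_rep ::
  "nat \<Rightarrow> nat \<Rightarrow> nat \<Rightarrow> (nat \<Rightarrow> complex mat) \<Rightarrow> clif \<Rightarrow> complex mat" where
  "spin_rep p q N Es A =
     mat N N (\<lambda>ij. \<Sum>S\<in>Pow {..<p + q}. A S * (mat_prod N Es S $$ ij))"

definition spinbasis :: "nat \<Rightarrow> nat \<Rightarrow> nat \<Rightarrow> (nat \<Rightarrow> complex mat) \<Rightarrow> bool" where
  "spinbasis p q N Es \<longleftrightarrow>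
     0 < N \<and>
     (\<forall>i<p + q. Es i \<in> carrier_mat N N \<and>
        Es i * Es i = (if i < p then 1\<^sub>m N else - 1\<^sub>m N) \<and>
        (mat_cnj (Es i) = Es i \<or> mat_cnj (Es i) = - Es i) \<and>
        (transpose_mat (Es i) = Es i \<or> transpose_mat (Es i) = - Es i)) \<and>
     (\<forall>i<p + q. \<forall>j<p + q. i \<noteq> j \<longrightarrow> Es i * Es j = - (Es j * Es i))"

definition real_indices :: "nat \<Rightarrow> (nat \<Rightarrow> complex mat) \<Rightarrow> nat set" where
  "real_indices n Es = {i. i < n \<and> mat_cnj (Es i) = Es i}"

definition complex_indices :: "nat \<Rightarrow> (nat \<Rightarrow> complex mat) \<Rightarrow> nat set" where
  "complex_indices n Es = {i. i < n \<and> mat_cnj (Es i) = - Es i}"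

definition sym_indices :: "nat \<Rightarrow> (nat \<Rightarrow> complex mat) \<Rightarrow> nat set" where
  "sym_indices n Es = {i. i < n \<and> transpose_mat (Es i) = Es i}"

definition skew_indices :: "nat \<Rightarrow> (nat \<Rightarrow> complex mat) \<Rightarrow> nat set" where
  "skew_indices n Es = {i. i < n \<and> transpose_mat (Es i) = - Es i}"

definition W_mat :: "nat \<Rightarrow> nat \<Rightarrow> (nat \<Rightarrow> complex mat) \<Rightarrow> complex mat" where
  "W_mat n N Es = mat_prod N Es {..<n}"

definition E_mat :: "nat \<Rightarrow> nat \<Rightarrow> (nat \<Rightarrow> complex mat) \<Rightarrow> complex mat" where
  "E_mat n N Es =
     mat_prod N Es (if even (card (skew_indices n Es)) then skew_indices n Es
                    else sym_indices n Es)"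

text \<open>
  For even $n$ the numbers of complex and of real matrices have the same parity. If all matrices
  are real, the product is empty and equals the unit matrix.
\<close>

definition Pi_mat :: "nat \<Rightarrow> nat \<Rightarrow> (nat \<Rightarrow> complex mat) \<Rightarrow> complex mat" where
  "Pi_mat n N Es =
     mat_prod N Es (if even (card (complex_indices n Es)) then complex_indices n Es
                    else real_indices n Es)"

definition C_mat :: "nat \<Rightarrow> nat \<Rightarrow> (nat \<Rightarrow> complex mat) \<Rightarrow> complex mat" where
  "C_mat n N Es = E_mat n N Es * W_mat n N Es"

definition K_mat :: "nat \<Rightarrow> nat \<Rightarrow> (nat \<Rightarrow> complex mat) \<Rightarrow> complex mat" where
  "K_mat n N Es = Pi_mat n N Es * W_mat n N Es"

definition S_mat :: "nat \<Rightarrow> nat \<Rightarrow> (nat \<Rightarrow> complex mat) \<Rightarrow> complex mat" where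
  "S_mat n N Es = Pi_mat n N Es * E_mat n N Es"

definition F_mat :: "nat \<Rightarrow> nat \<Rightarrow> (nat \<Rightarrow> complex mat) \<Rightarrow> complex mat" where
  "F_mat n N Es = Pi_mat n N Es * C_mat n N Es"

fun ext_mat :: "nat \<Rightarrow> nat \<Rightarrow> (nat \<Rightarrow> complex mat) \<Rightarrow> cpt_label \<Rightarrow> complex mat" where
  "ext_mat n N Es (False, False, False) = 1\<^sub>m N"
| "ext_mat n N Es (True, False, False) = W_mat n N Es"
| "ext_mat n N Es (False, True, False) = E_mat n N Es"
| "ext_mat n N Es (True, True, False) = C_mat n N Es"
| "ext_mat n N Es (False, False, True) = Pi_mat n N Es"
| "ext_mat n N Es (True, False, True) = K_mat n N Es"
| "ext_mat n N Es (False, True, True) = S_mat n N Es"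
| "ext_mat n N Es (True, True, True) = F_mat n N Es"

fun pt_mat :: "nat \<Rightarrow> nat \<Rightarrow> (nat \<Rightarrow> complex mat) \<Rightarrow> pt_label \<Rightarrow> complex mat" where
  "pt_mat n N Es (x, y) = ext_mat n N Es (x, y, False)"

text \<open>
  \<open>X\<close> represents the transformation labelled \<open>v\<close>: for instance
  $\overline{\widetilde{\mathsf{A}}} = X \dot{\mathsf{A}}^T X^{-1}$.
\<close>

fun mat_transform :: "cpt_label \<Rightarrow> complex mat \<Rightarrow> complex mat" where
  "mat_transform (x, y, z) M =
     (if y then transpose_mat else id) ((if z then mat_cnj else id) M)"

definition represents ::
  "nat \<Rightarrow> nat \<Rightarrow> nat \<Rightarrow> (nat \<Rightarrow> complex mat) \<Rightarrow> cpt_label \<Rightarrow> complex mat \<Rightarrow> bool" where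
  "represents p q N Es v X \<longleftrightarrow>
     X \<in> carrier_mat N N \<and>
     (\<exists>Y\<in>carrier_mat N N. X * Y = 1\<^sub>m N \<and> Y * X = 1\<^sub>m N \<and>
        (\<forall>A\<in>cl_complex p q.
           spin_rep p q N Es (cl_transform v A) = X * mat_transform v (spin_rep p q N Es A) * Y))"

definition spinor_system :: "nat \<Rightarrow> nat \<Rightarrow> nat \<Rightarrow> (nat \<Rightarrow> complex mat) \<Rightarrow> bool" where
  "spinor_system p q N Es \<longleftrightarrow>
     spinbasis p q N Es \<and> (\<forall>v. represents p q N Es v (ext_mat (p + q) N Es v))"

section \<open>Signatures and double coverings\<close>

datatype sign = Plus | Minus

type_synonym cpt_sign = "sign \<times> sign \<times> sign \<times> sign \<times> sign \<times> sign \<times> sign"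
type_synonym pt_sign = "sign \<times> sign \<times> sign"

fun cpt_sign_at :: "cpt_sign \<Rightarrow> cpt_label \<Rightarrow> sign" where
  "cpt_sign_at (a, b, c, d, e, f, g) (False, False, False) = Plus"
| "cpt_sign_at (a, b, c, d, e, f, g) (True, False, False) = a"
| "cpt_sign_at (a, b, c, d, e, f, g) (False, True, False) = b"
| "cpt_sign_at (a, b, c, d, e, f, g) (True, True, False) = c"
| "cpt_sign_at (a, b, c, d, e, f, g) (False, False, True) = d"
| "cpt_sign_at (a, b, c, d, e, f, g) (True, False, True) = e"
| "cpt_sign_at (a, b, c, d, e, f, g) (False, True, True) = f"
| "cpt_sign_at (a, b, c, d, e, f, g) (True, True, True) = g"

fun pt_sign_at :: "pt_sign \<Rightarrow> pt_label \<Rightarrow> sign" where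
  "pt_sign_at (a, b, c) (False, False) = Plus"
| "pt_sign_at (a, b, c) (True, False) = a"
| "pt_sign_at (a, b, c) (False, True) = b"
| "pt_sign_at (a, b, c) (True, True) = c"

definition pluses :: "sign list \<Rightarrow> nat" where
  "pluses xs = count_list xs Plus"

definition minuses :: "sign list \<Rightarrow> nat" where
  "minuses xs = count_list xs Minus"

definition has_squares :: "nat \<Rightarrow> ('v \<Rightarrow> complex mat) \<Rightarrow> ('v \<Rightarrow> sign) \<Rightarrow> bool" where
  "has_squares N X \<sigma> \<longleftrightarrow>
     (\<forall>v. X v * X v = (case \<sigma> v of Plus \<Rightarrow> 1\<^sub>m N | Minus \<Rightarrow> - 1\<^sub>m N))"

text \<open>
  \<open>C\<close> with projection \<open>\<pi>\<close> is a double covering of \<open>Q\<close>, where \<open>z\<close> is the nontrivial element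
  of the kernel, that is, the element written $-1$.
\<close>

definition double_covering :: "'c monoid \<Rightarrow> 'v monoid \<Rightarrow> ('c \<Rightarrow> 'v) \<Rightarrow> 'c \<Rightarrow> bool" where
  "double_covering C Q \<pi> z \<longleftrightarrow>
     group C \<and> \<pi> \<in> hom C Q \<and> \<pi> ` carrier C = carrier Q \<and>
     z \<noteq> \<one>\<^bsub>C\<^esub> \<and> kernel C Q \<pi> = {\<one>\<^bsub>C\<^esub>, z}"

definition lift_squares :: "'c monoid \<Rightarrow> ('c \<Rightarrow> 'v) \<Rightarrow> 'c \<Rightarrow> ('v \<Rightarrow> sign) \<Rightarrow> bool" where
  "lift_squares C \<pi> z \<sigma> \<longleftrightarrow>
     (\<forall>x\<in>carrier C. x \<otimes>\<^bsub>C\<^esub> x = (case \<sigma> (\<pi> x) of Plus \<Rightarrow> \<one>\<^bsub>C\<^esub> | Minus \<Rightarrow> z))"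

text \<open>
  The group of the matrices $\pm X_v$, and its projection $\pm X_v \mapsto v$, which is
  meaningful if the $X_v$ are distinct up to sign.
\<close>

definition signed_group :: "nat \<Rightarrow> ('v \<Rightarrow> complex mat) \<Rightarrow> complex mat monoid" where
  "signed_group N X =
     \<lparr>carrier = {M. \<exists>v. M = X v \<or> M = - X v}, monoid.mult = (*), one = 1\<^sub>m N\<rparr>"

definition signed_proj :: "('v \<Rightarrow> complex mat) \<Rightarrow> complex mat \<Rightarrow> 'v" where
  "signed_proj X M = (THE v. M = X v \<or> M = - X v)"

definition distinct_up_to_sign :: "('v \<Rightarrow> complex mat) \<Rightarrow> bool" where
  "distinct_up_to_sign X \<longleftrightarrow> (\<forall>u v. X u = X v \<or> X u = - X v \<longrightarrow> u = v)"

section \<open>The covering groups\<close>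

definition semidirect ::
  "'s monoid \<Rightarrow> 'c monoid \<Rightarrow> ('c \<Rightarrow> 's \<Rightarrow> 's) \<Rightarrow> ('s \<times> 'c) monoid" where
  "semidirect S C \<theta> =
     \<lparr>carrier = carrier S \<times> carrier C,
      monoid.mult = (\<lambda>(s, c) (s', c'). (s \<otimes>\<^bsub>S\<^esub> \<theta> c s', c \<otimes>\<^bsub>C\<^esub> c')),
      one = (\<one>\<^bsub>S\<^esub>, \<one>\<^bsub>C\<^esub>)\<rparr>"

text \<open>
  The group $(\mathbf{Spin}_+(n,\mathbb{C}) \odot C)/\mathbb{Z}_2$: elements of \<open>C\<close> act through
  the transformation they cover, and $\mathbb{Z}_2 = \{(1, 1), (-1, -1)\}$.
\<close>

definition cpt_pin ::
  "nat \<Rightarrow> nat \<Rightarrow> 'c monoid \<Rightarrow> ('c \<Rightarrow> cpt_label) \<Rightarrow> 'c \<Rightarrow> (clif \<times> 'c) set monoid" where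
  "cpt_pin p q C \<pi> z =
     semidirect (spin_plus p q) C (\<lambda>c. spin_action p q (\<pi> c)) Mod
       {(cl_one, \<one>\<^bsub>C\<^esub>), (cl_neg cl_one, z)}"

definition pt_pin ::
  "nat \<Rightarrow> nat \<Rightarrow> 'c monoid \<Rightarrow> ('c \<Rightarrow> pt_label) \<Rightarrow> 'c \<Rightarrow> (clif \<times> 'c) set monoid" where
  "pt_pin p q C \<pi> z = cpt_pin p q C (\<lambda>c. (fst (\<pi> c), snd (\<pi> c), False)) z"

definition cpt_cover :: "nat \<Rightarrow> nat \<Rightarrow> (nat \<Rightarrow> complex mat) \<Rightarrow> complex mat monoid" where
  "cpt_cover n N Es = signed_group N (ext_mat n N Es)"

definition pt_cover :: "nat \<Rightarrow> nat \<Rightarrow> (nat \<Rightarrow> complex mat) \<Rightarrow> complex mat monoid" where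
  "pt_cover n N Es = signed_group N (pt_mat n N Es)"

definition Pin_cpt ::
  "nat \<Rightarrow> nat \<Rightarrow> nat \<Rightarrow> (nat \<Rightarrow> complex mat) \<Rightarrow> (clif \<times> complex mat) set monoid" where
  "Pin_cpt p q N Es =
     cpt_pin p q (cpt_cover (p + q) N Es) (signed_proj (ext_mat (p + q) N Es)) (- 1\<^sub>m N)"

definition Pin_pt ::
  "nat \<Rightarrow> nat \<Rightarrow> nat \<Rightarrow> (nat \<Rightarrow> complex mat) \<Rightarrow> (clif \<times> complex mat) set monoid" where
  "Pin_pt p q N Es =
     pt_pin p q (pt_cover (p + q) N Es) (signed_proj (pt_mat (p + q) N Es)) (- 1\<^sub>m N)"

definition cpt_structure ::
  "nat \<Rightarrow> nat \<Rightarrow> nat \<Rightarrow> (nat \<Rightarrow> complex mat) \<Rightarrow> cpt_sign \<Rightarrow> bool" where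
  "cpt_structure p q N Es \<sigma> \<longleftrightarrow>
     spinor_system p q N Es \<and>
     has_squares N (ext_mat (p + q) N Es) (cpt_sign_at \<sigma>) \<and>
     distinct_up_to_sign (ext_mat (p + q) N Es) \<and>
     double_covering (cpt_cover (p + q) N Es) cpt_labels (signed_proj (ext_mat (p + q) N Es))
       (- 1\<^sub>m N) \<and>
     group (Pin_cpt p q N Es)"

definition pt_structure ::
  "nat \<Rightarrow> nat \<Rightarrow> nat \<Rightarrow> (nat \<Rightarrow> complex mat) \<Rightarrow> pt_sign \<Rightarrow> bool" where
  "pt_structure p q N Es \<sigma> \<longleftrightarrow>
     spinor_system p q N Es \<and>
     has_squares N (pt_mat (p + q) N Es) (pt_sign_at \<sigma>) \<and>
     distinct_up_to_sign (pt_mat (p + q) N Es) \<and>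
     double_covering (pt_cover (p + q) N Es) pt_labels (signed_proj (pt_mat (p + q) N Es))
       (- 1\<^sub>m N) \<and>
     group (Pin_pt p q N Es)"

definition cliffordian :: "nat \<Rightarrow> nat \<Rightarrow> nat \<Rightarrow> (nat \<Rightarrow> complex mat) \<Rightarrow> bool" where
  "cliffordian p q N Es \<longleftrightarrow> \<not> comm_group (cpt_cover (p + q) N Es)"

section \<open>The finite groups\<close>

definition Z2 :: "int monoid" where
  "Z2 = integer_mod_group 2"

definition Z4 :: "int monoid" where
  "Z4 = integer_mod_group 4"

text \<open>
  The pair $(i, j)$ stands for $x^i y^j$ with $x^4 = 1$, $y x y^{-1} = x^{-1}$ and $y^2 = 1$
  (dihedral group) or $y^2 = x^2$ (quaternion group).
\<close>

definition D4 :: "(int \<times> int) monoid" where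
  "D4 = \<lparr>carrier = {0..<4} \<times> {0..<2},
         monoid.mult = (\<lambda>(i, j) (k, l). ((if j = 0 then i + k else i - k) mod 4, (j + l) mod 2)),
         one = (0, 0)\<rparr>"

definition Q4 :: "(int \<times> int) monoid" where
  "Q4 = \<lparr>carrier = {0..<4} \<times> {0..<2},
         monoid.mult = (\<lambda>(i, j) (k, l).
           ((if j = 0 then i + k else i - k + 2 * l) mod 4, (j + l) mod 2)),
         one = (0, 0)\<rparr>"

section \<open>Existence of coverings of a given type\<close>

text \<open>
  \<open>C\<close> is the group $C^{a,b,c,d,e,f,g}$, and
  $\mathbf{Pin}^{a,b,c,d,e,f,g}(n,\mathbb{C}) \simeq (\mathbf{Spin}_+(n,\mathbb{C}) \odot C)/\mathbb{Z}_2$.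
\<close>

definition Pin_cpt_is ::
  "nat \<Rightarrow> nat \<Rightarrow> nat \<Rightarrow> (nat \<Rightarrow> complex mat) \<Rightarrow> cpt_sign \<Rightarrow> 'c monoid \<Rightarrow> bool" where
  "Pin_cpt_is p q N Es \<sigma> C \<longleftrightarrow>
     cpt_cover (p + q) N Es \<cong> C \<and>
     (\<exists>\<pi> z. double_covering C cpt_labels \<pi> z \<and> lift_squares C \<pi> z (cpt_sign_at \<sigma>) \<and>
        Pin_cpt p q N Es \<cong> cpt_pin p q C \<pi> z)"

definition Pin_pt_is ::
  "nat \<Rightarrow> nat \<Rightarrow> nat \<Rightarrow> (nat \<Rightarrow> complex mat) \<Rightarrow> pt_sign \<Rightarrow> 'c monoid \<Rightarrow> bool" where
  "Pin_pt_is p q N Es \<sigma> C \<longleftrightarrow>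
     pt_cover (p + q) N Es \<cong> C \<and>
     (\<exists>\<pi> z. double_covering C pt_labels \<pi> z \<and> lift_squares C \<pi> z (pt_sign_at \<sigma>) \<and>
        Pin_pt p q N Es \<cong> pt_pin p q C \<pi> z)"

definition pt_type :: "nat \<Rightarrow> nat \<Rightarrow> nat \<Rightarrow> (nat \<Rightarrow> complex mat) \<Rightarrow> pt_sign \<Rightarrow> bool" where
  "pt_type p q N Es \<sigma> = (case \<sigma> of (a, b, c) \<Rightarrow>
     (pluses [a, b, c] = 3 \<longrightarrow> Pin_pt_is p q N Es \<sigma> (Z2 \<times>\<times> Z2 \<times>\<times> Z2)) \<and>
     (pluses [a, b, c] = 2 \<longrightarrow> Pin_pt_is p q N Es \<sigma> D4) \<and>
     (pluses [a, b, c] = 1 \<longrightarrow> Pin_pt_is p q N Es \<sigma> (Z2 \<times>\<times> Z4)) \<and>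
     (pluses [a, b, c] = 0 \<longrightarrow> Pin_pt_is p q N Es \<sigma> Q4))"

definition covering_signature :: "cpt_sign \<Rightarrow> 'c monoid \<Rightarrow> bool" where
  "covering_signature \<sigma> C \<longleftrightarrow>
     (\<exists>\<pi> z. double_covering C cpt_labels \<pi> z \<and> lift_squares C \<pi> z (cpt_sign_at \<sigma>))"

text \<open>
  The irreducible matrix representation of $\mathbb{C}_n$ has degree $2^{n/2}$. For
  $\mathbb{K} \simeq \mathbb{H}$ it forces $\Pi\dot\Pi = -\mathsf{I}$, while $\Pi$ is always real,
  so $\Pi^2 = -\mathsf{I}$ for every spinbasis; the signatures with $d = +$ require a spinbasis
  of larger degree.
\<close>

definition cpt_realized :: "int \<Rightarrow> cpt_sign \<Rightarrow>
    (nat \<Rightarrow> nat \<Rightarrow> nat \<Rightarrow> (nat \<Rightarrow> complex mat) \<Rightarrow> bool) \<Rightarrow> bool" where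
  "cpt_realized r \<sigma> P \<longleftrightarrow>
     (\<exists>p q N Es. (int p - int q) mod 8 = r \<and> quat_type p q \<and> cpt_structure p q N Es \<sigma> \<and>
        (cpt_sign_at \<sigma> (False, False, True) = Minus \<longrightarrow> N = 2 ^ ((p + q) div 2)) \<and>
        P p q N Es)"

definition non_cliffordian_exists :: "int \<Rightarrow> cpt_sign \<Rightarrow> 'c monoid \<Rightarrow> bool" where
  "non_cliffordian_exists r \<sigma> C \<longleftrightarrow>
     cpt_realized r \<sigma> (\<lambda>p q N Es. \<not> cliffordian p q N Es \<and> Pin_cpt_is p q N Es \<sigma> C)"

definition cliffordian_exists :: "int \<Rightarrow> cpt_sign \<Rightarrow> 'c monoid \<Rightarrow> bool" where
  "cliffordian_exists r \<sigma> C \<longleftrightarrow>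
     cpt_realized r \<sigma> (\<lambda>p q N Es. cliffordian p q N Es \<and> Pin_cpt_is p q N Es \<sigma> C)"

text \<open>
  $\overset{\ast}{\mathbb{Z}}_4 \otimes \mathbb{Z}_2 \otimes \mathbb{Z}_2$ denotes the non-Abelian
  double covering whose signature has three pluses and four minuses.
\<close>

definition cliffordian_star_exists :: "int \<Rightarrow> cpt_sign \<Rightarrow> bool" where
  "cliffordian_star_exists r \<sigma> \<longleftrightarrow>
     (case \<sigma> of (a, b, c, d, e, f, g) \<Rightarrow>
        pluses [a, b, c, d, e, f, g] = 3 \<and> minuses [a, b, c, d, e, f, g] = 4) \<and>
     cpt_realized r \<sigma> cliffordian"

end

theory Submission
  imports Defs "Jordan_Normal_Form.Determinant"
begin

text \<open>
  Products of spinbasis matrices multiply like the blades of the Clifford algebra, with a sign that is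
  multiplicative in both arguments on symmetric differences. The matrices of $\mathsf{Ext}$ are such
  products up to sign, so together with their negatives they form a double covering of an elementary
  Abelian 2-group.

  A double covering of $\mathbb{Z}_2^k$ is determined up to isomorphism by the signs of the squares of its
  lifts: the commutator of two lifts is the product of the signs of the two and of their product.
  Hence the finite group is found by choosing generators. The sign of the square is a quadratic form on
  $\mathbb{Z}_2^3$, so the number of minuses is even, which leaves 64 signatures; the covering is Abelian
  if and only if the form is linear.

  The squares and the products $\Pi$, $\mathsf{E}$, $\mathsf{W}$ depend only on the numbers of real symmetric,
  complex skewsymmetric, complex symmetric and real skewsymmetric matrices in the spinbasis. Each of the
  64 signatures comes from suitable numbers, and all such numbers occur for spinbases obtained
  by doubling real matrices and multiplying some of them by $i$. The division ring of $C\ell_{p,q}$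
  is computed with the primitive idempotent $\prod_T (1 + e_T)/2$ over commuting blades $e_T$ with square $1$.
\<close>

section \<open>The blade signs\<close>

text \<open>Evenness of \<open>p + q\<close> enters twice. It makes every nonempty blade noncentral:
  a blade of even grade anticommutes with each of its factors, one of odd grade with every generator
  missing from it, and at least one is missing. Hence blades on different index sets are never
  proportional, and Pi proportional to the unit matrix means an empty product. It also makes the
  volume element anticommute with every generator, so passing to the complement of an index set of
  odd size corrects the unwanted grade sign; this is the origin of the parity cases in
  \<open>E_mat\<close> and \<open>Pi_mat\<close>. The polar form of a quadratic form in three
  variables over the field with two elements is alternating, so it is zero or its radical is spanned
  by one vector r. If the form is Plus at r, it comes from the quotient plane and has 2 or 6 minuses
  (\<open>D4\<close>, \<open>Q4\<close>); if it is Minus at r, the values at v and v + r always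
  differ and there are 4. A linear form has 0 or 4. So the number of minuses settles the group
  except for 4, where linearity decides.\<close>

definition gen_sign :: "nat \<Rightarrow> nat \<Rightarrow> nat \<Rightarrow> complex" where
  "gen_sign p i j = (if j < i \<or> (i = j \<and> p \<le> i) then - 1 else 1)"

lemma gen_sign_square: "gen_sign p i j * gen_sign p i j = 1"
  by (simp add: gen_sign_def)

lemma prod_neg_one_if:
  "finite A \<Longrightarrow> (\<Prod>x\<in>A. if P x then - 1 else 1) = (- 1 :: complex) ^ card {x \<in> A. P x}"
  by (simp add: prod.If_cases Int_def)

text \<open>Writing the sign as a product over pairs of indices exhibits it as multiplicative in
  each argument: the factors off the diagonal count inversions, those on it the generators with
  square -1.\<close>

lemma blade_sign_prod:
  assumes "finite S" "finite T"
  shows "blade_sign p S T = (\<Prod>i\<in>S. \<Prod>j\<in>T. gen_sign p i j)"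
proof -
  let ?A = "{(i, j). i \<in> S \<and> j \<in> T \<and> j < i}" and ?B = "(\<lambda>i. (i, i)) ` {i \<in> S \<inter> T. p \<le> i}"
  have fin: "finite ?A" "finite ?B"
    by (rule finite_subset[of _ "S \<times> T"]; use assms in auto)+
  have "(\<Prod>i\<in>S. \<Prod>j\<in>T. gen_sign p i j) = (\<Prod>x\<in>S \<times> T. gen_sign p (fst x) (snd x))"
    by (simp add: prod.cartesian_product case_prod_unfold)
  also have "\<dots> = (- 1) ^ card {x \<in> S \<times> T. snd x < fst x \<or> (fst x = snd x \<and> p \<le> fst x)}"
    unfolding gen_sign_def using assms by (subst prod_neg_one_if) auto
  also have "{x \<in> S \<times> T. snd x < fst x \<or> (fst x = snd x \<and> p \<le> fst x)} = ?A \<union> ?B"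
    by auto
  also have "card (?A \<union> ?B) = card ?A + card ?B"
    using fin by (intro card_Un_disjoint) auto
  also have "card ?B = card {i \<in> S \<inter> T. p \<le> i}"
    by (rule card_image) (auto simp: inj_on_def)
  finally show ?thesis by (simp add: blade_sign_def power_add)
qed

text \<open>Factors of square 1 cancel on the intersection, so the product is a character of the
  group of finite sets under symmetric difference.\<close>

lemma prod_sym_diff:
  fixes g :: "'a \<Rightarrow> complex"
  assumes "finite S" "finite T" "\<And>i. g i * g i = 1"
  shows "prod g (sym_diff S T) = prod g S * prod g T"
proof -
  have "prod g S = prod g (S - T) * prod g (S \<inter> T)"
    using assms by (subst prod.union_disjoint[symmetric]) (auto intro!: prod.cong)
  moreover have "prod g T = prod g (T - S) * prod g (S \<inter> T)"
    using assms by (subst prod.union_disjoint[symmetric]) (auto intro!: prod.cong)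
  moreover have "prod g (sym_diff S T) = prod g (S - T) * prod g (T - S)"
    using assms by (subst prod.union_disjoint) auto
  moreover have "prod g (S \<inter> T) * prod g (S \<inter> T) = 1"
    by (simp add: prod.distrib[symmetric] assms)
  ultimately show ?thesis by (simp add: ac_simps)
qed

lemma prod_square_one:
  fixes g :: "'a \<Rightarrow> complex"
  assumes "\<And>i. g i * g i = 1"
  shows "prod g S * prod g S = 1"
  by (simp add: prod.distrib[symmetric] assms)

lemma blade_sign_sym_diff_left:
  assumes "finite S" "finite T" "finite U"
  shows "blade_sign p (sym_diff S T) U = blade_sign p S U * blade_sign p T U"
  using assms by (simp add: blade_sign_prod prod_sym_diff prod_square_one gen_sign_square)

lemma blade_sign_sym_diff_right:
  assumes "finite S" "finite T" "finite U"
  shows "blade_sign p U (sym_diff S T) = blade_sign p U S * blade_sign p U T"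
  using assms by (simp add: blade_sign_prod prod_sym_diff prod.distrib gen_sign_square)

lemma blade_sign_empty [simp]: "blade_sign p {} S = 1" "blade_sign p S {} = 1"
  by (simp_all add: blade_sign_def)

lemma blade_sign_square: "blade_sign p S T * blade_sign p S T = 1"
proof -
  have e: "a * b * (a * b) = (a * a) * (b * b)" for a b :: complex by (simp only: ac_simps)
  show ?thesis unfolding blade_sign_def
    by (rule trans[OF e]) (simp only: minus_one_power_square mult_1)
qed

lemma blade_sign_cases: "blade_sign p S T = 1 \<or> blade_sign p S T = - 1"
  using blade_sign_square[of p S T] by (simp add: square_eq_1_iff)

lemma cnj_blade_sign [simp]: "cnj (blade_sign p S T) = blade_sign p S T"
  by (simp add: blade_sign_def)

lemma blade_sign_real [simp]: "blade_sign p S T \<in> \<real>"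
  by (simp add: blade_sign_def)

text \<open>By multiplicativity in each argument both sides are the product of the signs of (S, T),
  (S, U) and (T, U). This identity is the associativity of the product on blades.\<close>

lemma blade_sign_cocycle:
  assumes "finite S" "finite T" "finite U"
  shows "blade_sign p S T * blade_sign p (sym_diff S T) U =
    blade_sign p T U * blade_sign p S (sym_diff T U)"
  using assms by (simp add: blade_sign_sym_diff_left blade_sign_sym_diff_right)

text \<open>The sign of moving one blade past the other: each pair of generators contributes -1
  unless the two are equal. The squares of the generators cancel, so the signature \<open>p\<close>,
  \<open>q\<close> does not occur.\<close>

definition comm_sign :: "nat set \<Rightarrow> nat set \<Rightarrow> complex" where
  "comm_sign S T = (- 1) ^ (card S * card T + card (S \<inter> T))"

lemma comm_sign_prod:
  assumes "finite S" "finite T"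
  shows "comm_sign S T = (\<Prod>i\<in>S. \<Prod>j\<in>T. if i = j then 1 else - 1)"
proof -
  have 1: "(\<Prod>j\<in>T. if i = j then 1 else - 1) = (- 1 :: complex) ^ card T * (if i \<in> T then - 1 else 1)" for i
  proof -
    have "(\<Prod>j\<in>T. if i = j then 1 else - 1) = (\<Prod>j\<in>T. - 1 * (if i = j then - 1 else (1 :: complex)))"
      by (intro prod.cong) auto
    also have "\<dots> = (- 1) ^ card T * (\<Prod>j\<in>T. if i = j then - 1 else 1)"
      by (subst prod.distrib) simp
    finally show ?thesis using assms by simp
  qed
  have "{x \<in> S. x \<in> T} = S \<inter> T" by blast
  with assms(1) show ?thesis unfolding 1 comm_sign_def
    by (simp add: prod.distrib prod_neg_one_if power_add mult.commute flip: power_mult)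
qed

lemma comm_sign_blade_sign:
  assumes "finite S" "finite T"
  shows "comm_sign S T = blade_sign p S T * blade_sign p T S"
proof -
  have "blade_sign p T S = (\<Prod>i\<in>S. \<Prod>j\<in>T. gen_sign p j i)"
    using assms by (simp add: blade_sign_prod) (rule prod.swap)
  then have "blade_sign p S T * blade_sign p T S =
      (\<Prod>i\<in>S. \<Prod>j\<in>T. gen_sign p i j * gen_sign p j i)"
    using assms by (simp add: blade_sign_prod prod.distrib)
  also have "\<dots> = comm_sign S T"
    unfolding comm_sign_prod[OF assms]
    by (intro prod.cong refl) (auto simp: gen_sign_def)
  finally show ?thesis by simp
qed

lemma comm_sign_commute: "comm_sign S T = comm_sign T S"
  by (simp add: comm_sign_def Int_commute mult.commute)

lemma comm_sign_square: "comm_sign S T * comm_sign S T = 1"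
  by (simp add: comm_sign_def minus_one_power_square)

lemma comm_sign_cases: "comm_sign S T = 1 \<or> comm_sign S T = - 1"
  using comm_sign_square[of S T] by (simp add: square_eq_1_iff)

lemma comm_sign_empty [simp]: "comm_sign {} S = 1" "comm_sign S {} = 1"
  by (simp_all add: comm_sign_def)

lemma comm_sign_sym_diff_left:
  assumes "finite S" "finite T" "finite U"
  shows "comm_sign (sym_diff S T) U = comm_sign S U * comm_sign T U"
  using assms
  by (simp add: comm_sign_blade_sign[of _ _ 0] blade_sign_sym_diff_left blade_sign_sym_diff_right)

lemma comm_sign_sym_diff_right:
  assumes "finite S" "finite T" "finite U"
  shows "comm_sign U (sym_diff S T) = comm_sign U S * comm_sign U T"
  using comm_sign_sym_diff_left[OF assms] by (simp add: comm_sign_commute)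

text \<open>This is the sign of the square of a blade. Each unordered pair of its indices is
  inverted exactly once, and splitting the square of \<open>S\<close> by the order of the components
  counts these pairs.\<close>

lemma blade_sign_self:
  assumes "finite S"
  shows "blade_sign p S S = reversion_sign (card S) * (- 1) ^ card {i \<in> S. p \<le> i}"
proof -
  have "card {(i, j). i \<in> S \<and> j \<in> S \<and> j < i} = card S * (card S - 1) div 2"
  proof -
    let ?A = "{(i, j). i \<in> S \<and> j \<in> S \<and> j < i}" and ?B = "{(i, j). i \<in> S \<and> j \<in> S \<and> i < j}"
      and ?D = "(\<lambda>i. (i, i)) ` S"
    have fin: "finite ?A" "finite ?B" "finite ?D"
      by (rule finite_subset[of _ "S \<times> S"]; use assms in auto)+
    have u: "S \<times> S = (?A \<union> ?B) \<union> ?D" by auto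
    have "card (S \<times> S) = card ?A + card ?B + card ?D"
      unfolding u using fin by (subst card_Un_disjoint; auto)+
    moreover have "card ?D = card S" by (rule card_image) (auto simp: inj_on_def)
    moreover have "card ?B = card ?A"
      by (rule bij_betw_same_card[of prod.swap]) (auto simp: bij_betw_def inj_on_def image_iff)
    ultimately have "card S * card S = 2 * card ?A + card S"
      by (simp add: card_cartesian_product)
    then have "card S * (card S - 1) = 2 * card ?A"
      by (simp add: diff_mult_distrib2)
    then show ?thesis by simp
  qed
  then show ?thesis by (simp add: blade_sign_def reversion_sign_def)
qed

section \<open>The ring structure of the Clifford algebra\<close>

lemma cl_complex_zero: "A \<in> cl_complex p q \<Longrightarrow> \<not> S \<subseteq> {..<p + q} \<Longrightarrow> A S = 0"
  by (auto simp: cl_complex_def)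

lemma cl_real_complex: "A \<in> cl_real p q \<Longrightarrow> A \<in> cl_complex p q"
  by (simp add: cl_real_def)

lemma sym_diff_subset_iff: "S \<subseteq> N \<Longrightarrow> sym_diff S U \<subseteq> N \<longleftrightarrow> U \<subseteq> N"
  by blast

lemma cl_mult_closed [simp]:
  assumes "B \<in> cl_complex p q"
  shows "cl_mult p q A B \<in> cl_complex p q"
  unfolding cl_complex_def
proof (intro CollectI allI impI)
  fix U assume "cl_mult p q A B U \<noteq> 0"
  then obtain S where "S \<in> Pow {..<p + q}" "B (sym_diff S U) \<noteq> 0"
    unfolding cl_mult_def by (metis (no_types, lifting) mult_eq_0_iff sum.neutral)
  then show "U \<subseteq> {..<p + q}"
    using cl_complex_zero[OF assms] sym_diff_subset_iff by (metis PowD)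
qed

lemma cl_one_closed [simp]: "cl_one \<in> cl_complex p q"
  by (auto simp: cl_complex_def cl_one_def)

lemma cl_neg_closed [simp]: "A \<in> cl_complex p q \<Longrightarrow> cl_neg A \<in> cl_complex p q"
  by (auto simp: cl_complex_def cl_neg_def)

lemma cl_add_closed [simp]:
  "A \<in> cl_complex p q \<Longrightarrow> B \<in> cl_complex p q \<Longrightarrow> cl_add A B \<in> cl_complex p q"
  unfolding cl_complex_def cl_add_def by (auto; metis add.right_neutral subsetD lessThan_iff)

lemma cl_tilde_closed [simp]: "A \<in> cl_complex p q \<Longrightarrow> cl_tilde A \<in> cl_complex p q"
  by (auto simp: cl_complex_def cl_tilde_def)

lemma cl_mult_assoc:
  assumes "A \<in> cl_complex p q" "B \<in> cl_complex p q" "C \<in> cl_complex p q"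
  shows "cl_mult p q (cl_mult p q A B) C = cl_mult p q A (cl_mult p q B C)"
proof
  fix U
  let ?P = "Pow {..<p + q}"
  show "cl_mult p q (cl_mult p q A B) C U = cl_mult p q A (cl_mult p q B C) U"
  proof (cases "U \<subseteq> {..<p + q}")
    case False
    then show ?thesis
      using assms cl_complex_zero[OF cl_mult_closed[OF assms(3)]]
        cl_complex_zero[OF cl_mult_closed[OF cl_mult_closed[OF assms(3)]]] by metis
  next
    case True
    have "cl_mult p q (cl_mult p q A B) C U = (\<Sum>V\<in>?P. \<Sum>S\<in>?P.
        A S * B (sym_diff S V) * blade_sign p S (sym_diff S V) * C (sym_diff V U) *
          blade_sign p V (sym_diff V U))"
      by (simp add: cl_mult_def sum_distrib_right)
    also have "\<dots> = (\<Sum>S\<in>?P. \<Sum>V\<in>?P.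
        A S * B (sym_diff S V) * blade_sign p S (sym_diff S V) * C (sym_diff V U) *
          blade_sign p V (sym_diff V U))"
      by (rule sum.swap)
    also have "\<dots> = (\<Sum>S\<in>?P. \<Sum>V\<in>?P.
        A S * (B V * C (sym_diff V (sym_diff S U)) * blade_sign p V (sym_diff V (sym_diff S U))) *
          blade_sign p S (sym_diff S U))"
    proof (rule sum.cong[OF refl])
      fix S assume S: "S \<in> ?P"
      show "(\<Sum>V\<in>?P. A S * B (sym_diff S V) * blade_sign p S (sym_diff S V) *
            C (sym_diff V U) * blade_sign p V (sym_diff V U)) =
          (\<Sum>V\<in>?P. A S * (B V * C (sym_diff V (sym_diff S U)) *
            blade_sign p V (sym_diff V (sym_diff S U))) * blade_sign p S (sym_diff S U))"
      \<comment> \<open>Symmetric difference with \<open>S\<close> is its own inverse and serves for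
        both directions. The signs match by the cocycle identity for \<open>S\<close>,
        \<open>sym_diff S V\<close> and \<open>sym_diff V U\<close>.\<close>
      proof (rule sum.reindex_bij_witness[where i="sym_diff S" and j="sym_diff S"])
        fix V assume V: "V \<in> ?P"
        have fin: "finite S" "finite (sym_diff S V)" "finite (sym_diff V U)"
          using S V True by (auto intro: finite_subset)
        have e: "sym_diff S (sym_diff S V) = V" "sym_diff (sym_diff S V) (sym_diff V U) = sym_diff S U"
          "sym_diff (sym_diff S V) (sym_diff S U) = sym_diff V U" by blast+
        from blade_sign_cocycle[OF fin, of p, unfolded e]
        show "A S * (B (sym_diff S V) * C (sym_diff (sym_diff S V) (sym_diff S U)) *
            blade_sign p (sym_diff S V) (sym_diff (sym_diff S V) (sym_diff S U))) *
            blade_sign p S (sym_diff S U) =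
          A S * B (sym_diff S V) * blade_sign p S (sym_diff S V) *
            C (sym_diff V U) * blade_sign p V (sym_diff V U)"
          unfolding e by (simp add: ac_simps)
      qed (use S in auto)
    qed
    also have "\<dots> = cl_mult p q A (cl_mult p q B C) U"
      by (simp add: cl_mult_def sum_distrib_right sum_distrib_left)
    finally show ?thesis .
  qed
qed

section \<open>Blades and scalar multiples\<close>

definition cl_blade :: "nat set \<Rightarrow> clif" where
  "cl_blade S = (\<lambda>U. if U = S then 1 else 0)"

definition cl_scale :: "complex \<Rightarrow> clif \<Rightarrow> clif" where
  "cl_scale c A = (\<lambda>S. c * A S)"

lemma cl_one_blade: "cl_one = cl_blade {}"
  by (simp add: cl_one_def cl_blade_def)

lemma cl_neg_scale: "cl_neg A = cl_scale (- 1) A"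
  by (simp add: cl_neg_def cl_scale_def)

lemma cl_scale_closed [simp]: "A \<in> cl_complex p q \<Longrightarrow> cl_scale c A \<in> cl_complex p q"
  by (auto simp: cl_complex_def cl_scale_def)

lemma cl_blade_closed [simp]: "S \<subseteq> {..<p + q} \<Longrightarrow> cl_blade S \<in> cl_complex p q"
  by (auto simp: cl_complex_def cl_blade_def)

lemma cl_mult_scale_left: "cl_mult p q (cl_scale c A) B = cl_scale c (cl_mult p q A B)"
  by (auto simp: cl_mult_def cl_scale_def sum_distrib_left ac_simps intro!: sum.cong)

lemma cl_mult_scale_right: "cl_mult p q A (cl_scale c B) = cl_scale c (cl_mult p q A B)"
  by (auto simp: cl_mult_def cl_scale_def sum_distrib_left ac_simps intro!: sum.cong)

lemma cl_mult_add_left: "cl_mult p q (cl_add A B) C = cl_add (cl_mult p q A C) (cl_mult p q B C)"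
  by (simp add: cl_mult_def cl_add_def algebra_simps sum.distrib)

lemma cl_mult_add_right: "cl_mult p q A (cl_add B C) = cl_add (cl_mult p q A B) (cl_mult p q A C)"
  by (simp add: cl_mult_def cl_add_def algebra_simps sum.distrib)

lemma cl_mult_zero_left: "cl_mult p q cl_zero A = cl_zero"
  by (simp add: cl_mult_def cl_zero_def)

lemma cl_mult_zero_right: "cl_mult p q A cl_zero = cl_zero"
  by (simp add: cl_mult_def cl_zero_def)

lemma cl_mult_blade_left:
  assumes "S \<subseteq> {..<p + q}"
  shows "cl_mult p q (cl_blade S) B = (\<lambda>U. B (sym_diff S U) * blade_sign p S (sym_diff S U))"
proof
  fix U
  have "cl_mult p q (cl_blade S) B U =
    (\<Sum>S'\<in>Pow {..<p + q}. (if S' = S then 1 else 0) * (B (sym_diff S' U) * blade_sign p S' (sym_diff S' U)))"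
    unfolding cl_mult_def cl_blade_def by (simp add: mult.assoc)
  also have "\<dots> = B (sym_diff S U) * blade_sign p S (sym_diff S U)"
    using assms by (subst sum_indicator_mult) auto
  finally show "cl_mult p q (cl_blade S) B U = B (sym_diff S U) * blade_sign p S (sym_diff S U)" .
qed

lemma cl_mult_blade:
  assumes "S \<subseteq> {..<p + q}"
  shows "cl_mult p q (cl_blade S) (cl_blade T) = cl_scale (blade_sign p S T) (cl_blade (sym_diff S T))"
proof
  fix U
  have e: "sym_diff S U = T \<longleftrightarrow> U = sym_diff S T" by blast
  have "sym_diff S (sym_diff S T) = T" by blast
  with assms e show "cl_mult p q (cl_blade S) (cl_blade T) U =
      cl_scale (blade_sign p S T) (cl_blade (sym_diff S T)) U"
    by (simp add: cl_mult_blade_left cl_scale_def) (simp add: cl_blade_def)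
qed

lemma cl_mult_one_left [simp]: "cl_mult p q cl_one A = A"
  by (simp add: cl_one_blade cl_mult_blade_left)

lemma cl_mult_one_right [simp]:
  assumes "A \<in> cl_complex p q"
  shows "cl_mult p q A cl_one = A"
proof
  fix U
  have "sym_diff S U = {} \<longleftrightarrow> S = U" for S :: "nat set" by blast
  then have "cl_mult p q A cl_one U =
      (\<Sum>S\<in>Pow {..<p + q}. (if S = U then 1 else 0) * (A S * blade_sign p S (sym_diff S U)))"
    unfolding cl_mult_def cl_one_def by (auto intro!: sum.cong)
  also have "\<dots> = (if U \<in> Pow {..<p + q} then A U else 0)"
    by (subst sum_indicator_mult) auto
  also have "\<dots> = A U" using cl_complex_zero[OF assms] by auto
  finally show "cl_mult p q A cl_one U = A U" .
qed

lemma cl_bar_mult: "cl_bar (cl_mult p q A B) = cl_mult p q (cl_bar A) (cl_bar B)"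
  by (simp add: cl_bar_def cl_mult_def)

lemma cl_bar_one [simp]: "cl_bar cl_one = cl_one"
  by (auto simp: cl_bar_def cl_one_def)

lemma cl_bar_neg: "cl_bar (cl_neg A) = cl_neg (cl_bar A)"
  by (simp add: cl_bar_def cl_neg_def)

lemma cl_bar_bar [simp]: "cl_bar (cl_bar A) = A"
  by (simp add: cl_bar_def)

lemma cl_bar_tilde: "cl_bar (cl_tilde A) = cl_tilde (cl_bar A)"
  by (simp add: cl_bar_def cl_tilde_def)

lemma cl_tilde_tilde [simp]: "cl_tilde (cl_tilde A) = A"
  by (simp add: cl_tilde_def minus_one_power_square flip: mult.assoc)

lemma cl_tilde_one [simp]: "cl_tilde cl_one = cl_one"
  by (auto simp: cl_tilde_def cl_one_def)

lemma cl_mult_neg_left: "cl_mult p q (cl_neg A) B = cl_neg (cl_mult p q A B)"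
  by (simp add: cl_neg_scale cl_mult_scale_left)

lemma cl_mult_neg_right: "cl_mult p q A (cl_neg B) = cl_neg (cl_mult p q A B)"
  by (simp add: cl_neg_scale cl_mult_scale_right)

lemma cl_neg_neg [simp]: "cl_neg (cl_neg A) = A"
  by (simp add: cl_neg_def)

section \<open>The covering groups\<close>

lemma cl_even_complex: "A \<in> cl_even p q \<Longrightarrow> A \<in> cl_complex p q"
  by (simp add: cl_even_def)

lemma cl_even_mult:
  assumes "A \<in> cl_even p q" "B \<in> cl_even p q"
  shows "cl_mult p q A B \<in> cl_even p q"
proof -
  have "even (card U)" if U: "cl_mult p q A B U \<noteq> 0" for U
  proof -
    from U obtain S where S: "S \<in> Pow {..<p + q}" "A S * B (sym_diff S U) \<noteq> 0"
      unfolding cl_mult_def by (metis (no_types, lifting) mult_eq_0_iff sum.neutral)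
    then have "even (card S)" "even (card (sym_diff S U))"
      using assms by (auto simp: cl_even_def)
    moreover have "U \<subseteq> {..<p + q}"
      using U cl_complex_zero[OF cl_mult_closed[of B p q A]] assms(2) by (metis cl_even_complex)
    with S have "card (sym_diff S U) + 2 * card (S \<inter> U) = card S + card U"
      by (intro card_sym_diff) (auto intro: finite_subset)
    ultimately show ?thesis by presburger
  qed
  with assms show ?thesis by (auto simp: cl_even_def)
qed

lemma cl_star_even: "A \<in> cl_even p q \<Longrightarrow> cl_star A = A"
  by (fastforce simp: cl_even_def cl_star_def fun_eq_iff)

lemma cl_tilde_even: "A \<in> cl_even p q \<Longrightarrow> cl_tilde A \<in> cl_even p q"
  by (auto simp: cl_even_def cl_complex_def cl_tilde_def)

lemma cl_bar_even: "A \<in> cl_even p q \<Longrightarrow> cl_bar A \<in> cl_even p q"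
  by (auto simp: cl_even_def cl_complex_def cl_bar_def)

lemma cl_bar_vectors: "A \<in> cl_vectors p q \<Longrightarrow> cl_bar A \<in> cl_vectors p q"
  by (auto simp: cl_vectors_def cl_complex_def cl_bar_def)

lemma cl_vectors_complex: "A \<in> cl_vectors p q \<Longrightarrow> A \<in> cl_complex p q"
  by (simp add: cl_vectors_def)

text \<open>Norm 1 makes the reversion of \<open>s\<close> a right inverse, hence equal to the
  two-sided inverse supplied by the Clifford group. This eliminates the existential quantifier over
  inverses.\<close>

lemma spin_plus_carrier:
  "s \<in> carrier (spin_plus p q) \<longleftrightarrow>
     s \<in> cl_even p q \<and> cl_mult p q s (cl_tilde s) = cl_one \<and> cl_mult p q (cl_tilde s) s = cl_one \<and>
     (\<forall>x\<in>cl_vectors p q. cl_mult p q (cl_mult p q s x) (cl_tilde s) \<in> cl_vectors p q)"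
  (is "?L \<longleftrightarrow> ?R")
proof
  assume ?L
  then have s: "s \<in> clifford_group p q" and ev: "s \<in> cl_even p q"
    and n: "cl_mult p q s (cl_tilde s) = cl_one"
    by (auto simp: spin_plus_def pin_set_def spinor_norm_def)
  from s obtain t where t: "t \<in> cl_complex p q" "cl_mult p q s t = cl_one" "cl_mult p q t s = cl_one"
    "\<forall>x\<in>cl_vectors p q. cl_mult p q (cl_mult p q s x) t \<in> cl_vectors p q"
    by (auto simp: clifford_group_def)
  have sc: "s \<in> cl_complex p q" using ev by (rule cl_even_complex)
  have "t = cl_mult p q t (cl_mult p q s (cl_tilde s))"
    using t n by simp
  also have "\<dots> = cl_tilde s"
    using t sc by (simp add: cl_mult_assoc[symmetric])
  finally show ?R using t ev by blast
next
  assume ?R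
  then show ?L
    by (auto simp: spin_plus_def pin_set_def spinor_norm_def clifford_group_def cl_even_complex
        intro!: bexI[of _ "cl_tilde s"])
qed

lemma spin_plus_complex: "s \<in> carrier (spin_plus p q) \<Longrightarrow> s \<in> cl_complex p q"
  by (simp add: spin_plus_carrier cl_even_complex)

lemma spin_plus_mult: "s \<otimes>\<^bsub>spin_plus p q\<^esub> t = cl_mult p q s t"
  and spin_plus_one: "\<one>\<^bsub>spin_plus p q\<^esub> = cl_one"
  by (simp_all add: spin_plus_def)

lemma spin_plus_mult_closed:
  assumes s: "s \<in> carrier (spin_plus p q)" and t: "t \<in> carrier (spin_plus p q)"
  shows "cl_mult p q s t \<in> carrier (spin_plus p q)"
proof -
  note c[simp] = spin_plus_complex[OF s] spin_plus_complex[OF t]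
  note s' = s[unfolded spin_plus_carrier] and t' = t[unfolded spin_plus_carrier]
  have tl: "cl_tilde (cl_mult p q s t) = cl_mult p q (cl_tilde t) (cl_tilde s)"
    by (rule cl_tilde_mult) simp_all
  have "cl_mult p q (cl_mult p q s t) (cl_mult p q (cl_tilde t) (cl_tilde s)) =
      cl_mult p q s (cl_mult p q (cl_mult p q t (cl_tilde t)) (cl_tilde s))"
    by (simp add: cl_mult_assoc)
  then have 1: "cl_mult p q (cl_mult p q s t) (cl_mult p q (cl_tilde t) (cl_tilde s)) = cl_one"
    using s' t' by simp
  have "cl_mult p q (cl_mult p q (cl_tilde t) (cl_tilde s)) (cl_mult p q s t) =
      cl_mult p q (cl_tilde t) (cl_mult p q (cl_mult p q (cl_tilde s) s) t)"
    by (simp add: cl_mult_assoc)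
  then have 2: "cl_mult p q (cl_mult p q (cl_tilde t) (cl_tilde s)) (cl_mult p q s t) = cl_one"
    using s' t' by simp
  have 3: "cl_mult p q (cl_mult p q (cl_mult p q s t) x) (cl_mult p q (cl_tilde t) (cl_tilde s))
      \<in> cl_vectors p q" if x: "x \<in> cl_vectors p q" for x
  proof -
    have [simp]: "x \<in> cl_complex p q" using x by (rule cl_vectors_complex)
    have "cl_mult p q (cl_mult p q (cl_mult p q s t) x) (cl_mult p q (cl_tilde t) (cl_tilde s)) =
      cl_mult p q (cl_mult p q s (cl_mult p q (cl_mult p q t x) (cl_tilde t))) (cl_tilde s)"
      by (simp add: cl_mult_assoc)
    with s' t' x show ?thesis by simp
  qed
  from s' t' 1 2 3 show ?thesis
    unfolding spin_plus_carrier tl by (simp add: cl_even_mult)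
qed

lemma cl_one_spin_plus: "cl_one \<in> carrier (spin_plus p q)"
proof -
  have "cl_one \<in> cl_even p q" by (auto simp: cl_even_def) (auto simp: cl_one_def split: if_splits)
  then show ?thesis by (simp add: spin_plus_carrier cl_vectors_complex)
qed

lemma cl_neg_spin_plus:
  assumes "s \<in> carrier (spin_plus p q)"
  shows "cl_neg s \<in> carrier (spin_plus p q)"
proof -
  have "cl_tilde (cl_neg s) = cl_neg (cl_tilde s)" by (simp add: cl_tilde_def cl_neg_def)
  moreover have "cl_neg s \<in> cl_even p q"
    using assms by (auto simp: spin_plus_carrier cl_even_def cl_neg_def cl_complex_def)
  ultimately show ?thesis
    using assms by (auto simp: spin_plus_carrier cl_mult_neg_left cl_mult_neg_right)
qed

lemma cl_bar_spin_plus: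
  assumes "s \<in> carrier (spin_plus p q)"
  shows "cl_bar s \<in> carrier (spin_plus p q)"
proof -
  have s: "s \<in> cl_even p q" "cl_mult p q s (cl_tilde s) = cl_one" "cl_mult p q (cl_tilde s) s = cl_one"
    "\<And>x. x\<in>cl_vectors p q \<Longrightarrow> cl_mult p q (cl_mult p q s x) (cl_tilde s) \<in> cl_vectors p q"
    using assms by (auto simp: spin_plus_carrier)
  have "cl_mult p q (cl_mult p q (cl_bar s) x) (cl_tilde (cl_bar s)) \<in> cl_vectors p q"
    if "x \<in> cl_vectors p q" for x
    using cl_bar_vectors[OF s(4)[OF cl_bar_vectors[OF that]]]
    by (simp add: cl_bar_mult cl_bar_tilde)
  moreover have "cl_mult p q (cl_bar s) (cl_tilde (cl_bar s)) = cl_one"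
    "cl_mult p q (cl_tilde (cl_bar s)) (cl_bar s) = cl_one"
    using arg_cong[OF s(2), of cl_bar] arg_cong[OF s(3), of cl_bar]
    by (simp_all add: cl_bar_mult cl_bar_tilde)
  ultimately show ?thesis
    using s(1) by (simp add: spin_plus_carrier cl_bar_even)
qed

section \<open>Stability of the vectors under conjugation by inverses\<close>

lemma cl_mult_sum_left:
  "cl_mult p q (\<lambda>S. \<Sum>i\<in>I. c i * A i S) B = (\<lambda>U. \<Sum>i\<in>I. c i * cl_mult p q (A i) B U)"
  unfolding cl_mult_def sum_distrib_left sum_distrib_right
  by (subst sum.swap) (simp add: mult.assoc)

lemma cl_mult_sum_right:
  "cl_mult p q B (\<lambda>S. \<Sum>i\<in>I. c i * A i S) = (\<lambda>U. \<Sum>i\<in>I. c i * cl_mult p q B (A i) U)"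
  unfolding cl_mult_def sum_distrib_left sum_distrib_right
  by (subst sum.swap) (simp add: ac_simps)

lemma cl_vectors_expand:
  assumes "x \<in> cl_vectors p q"
  shows "x = (\<lambda>S. \<Sum>i<p + q. x {i} * cl_gen i S)"
proof
  fix S
  show "x S = (\<Sum>i<p + q. x {i} * cl_gen i S)"
  proof (cases "\<exists>i<p + q. S = {i}")
    case True
    then obtain i where i: "i < p + q" "S = {i}" by blast
    have "(\<Sum>j<p + q. x {j} * cl_gen j S) = (\<Sum>j<p + q. if j = i then x {j} else 0)"
      unfolding cl_gen_def i by (intro sum.cong) auto
    then show ?thesis using i by simp
  next
    case False
    then have "(\<Sum>i<p + q. x {i} * cl_gen i S) = 0"
      by (intro sum.neutral) (auto simp: cl_gen_def)
    moreover have "x S = 0"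
    proof (rule ccontr)
      assume "x S \<noteq> 0"
      then have "S \<subseteq> {..<p + q}" "card S = 1" using assms by (auto simp: cl_vectors_def cl_complex_def)
      with False show False by (metis card_1_singletonE insert_subset lessThan_iff)
    qed
    ultimately show ?thesis by simp
  qed
qed

lemma cl_vectors_sum:
  "(\<lambda>S. \<Sum>i<p + q. c i * cl_gen i S) \<in> cl_vectors p q"
proof -
  have "\<exists>i<p + q. S = {i}" if nz: "(\<Sum>i<p + q. c i * cl_gen i S) \<noteq> 0" for S
  proof (rule ccontr)
    assume "\<not> ?thesis"
    then have "(\<Sum>i<p + q. c i * cl_gen i S) = 0"
      by (intro sum.neutral) (auto simp: cl_gen_def)
    with nz show False by simp
  qed
  then show ?thesis by (fastforce simp: cl_vectors_def cl_complex_def)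
qed

text \<open>
  Conjugation by \<open>s\<close> is an injective endomorphism of the finite-dimensional space of vectors, hence
  bijective, so that the vectors are also stable under conjugation by the inverse.
\<close>

lemma spin_plus_conj_surj:
  assumes s: "s \<in> carrier (spin_plus p q)" and x: "x \<in> cl_vectors p q"
  obtains y where "y \<in> cl_vectors p q" "x = cl_mult p q (cl_mult p q s y) (cl_tilde s)"
proof -
  let ?n = "p + q"
  define L where "L y = cl_mult p q (cl_mult p q s y) (cl_tilde s)" for y
  define \<phi> where "\<phi> v = (\<lambda>S. \<Sum>i<?n. v $ i * cl_gen i S)" for v
  \<comment> \<open>The matrix of \<open>L\<close> in the basis of generators: column
    \<open>i\<close> holds the coordinates of the image of \<open>cl_gen i\<close>.\<close>
  define M where "M = mat ?n ?n (\<lambda>(j, i). L (cl_gen i) {j})"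
  have sc[simp]: "s \<in> cl_complex p q" using s by (rule spin_plus_complex)
  have M: "M \<in> carrier_mat ?n ?n" by (simp add: M_def)
  have \<phi>V: "\<phi> v \<in> cl_vectors p q" for v unfolding \<phi>_def by (rule cl_vectors_sum)
  have LV: "L y \<in> cl_vectors p q" if "y \<in> cl_vectors p q" for y
    using s that by (simp add: L_def spin_plus_carrier)
  have \<phi>c: "\<phi> v {j} = v $ j" if "j < ?n" for v j
  proof -
    have "\<phi> v {j} = (\<Sum>i<?n. if i = j then v $ i else 0)"
      unfolding \<phi>_def cl_gen_def by (intro sum.cong) auto
    with that show ?thesis by simp
  qed
  have L\<phi>: "L (\<phi> v) = (\<lambda>S. \<Sum>i<?n. v $ i * L (cl_gen i) S)" for v
    unfolding L_def \<phi>_def by (simp only: cl_mult_sum_left cl_mult_sum_right)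
  have LM: "L (\<phi> v) = \<phi> (M *\<^sub>v v)" if v: "v \<in> carrier_vec ?n" for v
  proof -
    have "L (\<phi> v) {j} = (M *\<^sub>v v) $ j" if j: "j < ?n" for j
      using v j unfolding L\<phi>
      by (simp add: M_def scalar_prod_def ac_simps lessThan_atLeast0)
    then have "(\<lambda>S. \<Sum>i<?n. L (\<phi> v) {i} * cl_gen i S) = \<phi> (M *\<^sub>v v)"
      unfolding \<phi>_def[of "M *\<^sub>v v"] by simp
    with cl_vectors_expand[OF LV[OF \<phi>V]] show ?thesis by simp
  qed
  \<comment> \<open>Multiplying by the reversion on the left and by \<open>s\<close> on the right
    undoes \<open>L\<close>; this will give \<open>M\<close> a trivial kernel.\<close>
  have inj: "y = cl_mult p q (cl_mult p q (cl_tilde s) (L y)) s" if "y \<in> cl_complex p q" for y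
  proof -
    have "cl_mult p q (cl_mult p q (cl_tilde s) (L y)) s =
      cl_mult p q (cl_mult p q (cl_mult p q (cl_tilde s) s) y) (cl_mult p q (cl_tilde s) s)"
      using that unfolding L_def by (simp add: cl_mult_assoc)
    with s that show ?thesis by (simp add: spin_plus_carrier)
  qed
  have "det M \<noteq> 0"
  proof
    assume "det M = 0"
    then obtain v where v: "v \<in> carrier_vec ?n" "v \<noteq> 0\<^sub>v ?n" "M *\<^sub>v v = 0\<^sub>v ?n"
      using det_0_iff_vec_prod_zero[OF M] by blast
    have "L (\<phi> v) = cl_zero"
      unfolding LM[OF v(1)] v(3) by (simp add: \<phi>_def cl_zero_def)
    with inj[OF cl_vectors_complex[OF \<phi>V], of v] have "\<phi> v = cl_zero"
      by (simp add: cl_mult_zero_left cl_mult_zero_right)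
    then have "v $ j = 0" if "j < ?n" for j
      using \<phi>c[OF that, of v] by (simp add: cl_zero_def)
    with v(1) have "v = 0\<^sub>v ?n" by (intro eq_vecI) auto
    with v(2) show False by simp
  qed
  \<comment> \<open>The argument \<open>()\<close> fills the record extension of the ring of
    matrices.\<close>
  from det_non_zero_imp_unit[OF M this, of "()"]
  obtain B where B: "B \<in> carrier_mat ?n ?n" "M * B = 1\<^sub>m ?n"
    unfolding Units_def ring_mat_def by auto
  define u where "u = vec ?n (\<lambda>i. x {i})"
  have u: "u \<in> carrier_vec ?n" by (simp add: u_def)
  have "M *\<^sub>v (B *\<^sub>v u) = u"
    using assoc_mult_mat_vec[OF M B(1) u] B(2) u by simp
  then have "L (\<phi> (B *\<^sub>v u)) = \<phi> u"
    using LM[of "B *\<^sub>v u"] B(1) u by simp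
  moreover have "\<phi> u = (\<lambda>S. \<Sum>i<?n. x {i} * cl_gen i S)"
    unfolding \<phi>_def u_def by simp
  then have "\<phi> u = x"
    using cl_vectors_expand[OF x] by simp
  ultimately show thesis by (intro that[OF \<phi>V[of "B *\<^sub>v u"]]) (simp add: L_def)
qed

text \<open>Every vector is the conjugate by \<open>s\<close> of some vector, and conjugation by the
  reversion leads back to that vector. This supplies the inverses in the spin group.\<close>

lemma cl_tilde_spin_plus:
  assumes "s \<in> carrier (spin_plus p q)"
  shows "cl_tilde s \<in> carrier (spin_plus p q)"
proof -
  have [simp]: "s \<in> cl_complex p q" using assms by (rule spin_plus_complex)
  have s: "s \<in> cl_even p q" "cl_mult p q s (cl_tilde s) = cl_one" "cl_mult p q (cl_tilde s) s = cl_one"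
    "\<And>x. x\<in>cl_vectors p q \<Longrightarrow> cl_mult p q (cl_mult p q s x) (cl_tilde s) \<in> cl_vectors p q"
    using assms by (auto simp: spin_plus_carrier)
  have "cl_mult p q (cl_mult p q (cl_tilde s) x) s \<in> cl_vectors p q"
    if x: "x \<in> cl_vectors p q" for x
  proof -
    obtain y where y: "y \<in> cl_vectors p q" "x = cl_mult p q (cl_mult p q s y) (cl_tilde s)"
      using spin_plus_conj_surj[OF assms x] .
    have [simp]: "y \<in> cl_complex p q" using y(1) by (rule cl_vectors_complex)
    have "cl_mult p q (cl_mult p q (cl_tilde s) x) s =
      cl_mult p q (cl_mult p q (cl_mult p q (cl_tilde s) s) y) (cl_mult p q (cl_tilde s) s)"
      unfolding y(2) by (simp add: cl_mult_assoc)
    with s y(1) show ?thesis by simp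
  qed
  with s show ?thesis
    by (simp add: spin_plus_carrier cl_tilde_even)
qed

lemma group_spin_plus: "group (spin_plus p q)"
proof (rule groupI)
  fix x assume x: "x \<in> carrier (spin_plus p q)"
  then show "\<exists>y\<in>carrier (spin_plus p q). y \<otimes>\<^bsub>spin_plus p q\<^esub> x = \<one>\<^bsub>spin_plus p q\<^esub>"
    by (intro bexI[of _ "cl_tilde x"])
      (simp_all add: cl_tilde_spin_plus spin_plus_mult spin_plus_one, simp add: spin_plus_carrier)
qed (simp_all add: spin_plus_mult spin_plus_one spin_plus_mult_closed cl_one_spin_plus
      cl_mult_assoc spin_plus_complex)

lemma spin_plus_inv:
  assumes "s \<in> carrier (spin_plus p q)"
  shows "inv\<^bsub>spin_plus p q\<^esub> s = cl_tilde s"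
  using assms group.inv_equality[OF group_spin_plus _ assms cl_tilde_spin_plus[OF assms]]
  by (simp add: spin_plus_mult spin_plus_one spin_plus_carrier)

text \<open>
  On \<open>spin_plus\<close> the involution $\star$ is trivial and reversion is inversion, so the
  action of a label only depends on whether it contains the complex conjugation.
\<close>

lemma spin_action_eq:
  assumes "s \<in> carrier (spin_plus p q)"
  shows "spin_action p q (x, y, z) s = (if z then cl_bar s else s)"
proof -
  let ?u = "if z then cl_bar s else s"
  have u: "?u \<in> carrier (spin_plus p q)" using assms by (simp add: cl_bar_spin_plus)
  then have "cl_tilde ?u \<in> cl_even p q" "?u \<in> cl_even p q"
    using cl_tilde_spin_plus by (simp_all add: spin_plus_carrier)
  then have st: "cl_star (cl_tilde ?u) = cl_tilde ?u" "cl_star ?u = ?u" by (simp_all add: cl_star_even)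
  have "cl_transform (x, y, z) s = (if y then cl_tilde ?u else ?u)"
    using st by (cases z) auto
  then show ?thesis
    using spin_plus_inv[OF cl_tilde_spin_plus[OF u]] by (auto split: if_splits)
qed

section \<open>Semidirect products and their quotients by a central involution\<close>

lemma group_semidirect:
  assumes "group S" "group C"
    and closed: "\<And>c s. c \<in> carrier C \<Longrightarrow> s \<in> carrier S \<Longrightarrow> \<theta> c s \<in> carrier S"
    and hom: "\<And>c s t. c \<in> carrier C \<Longrightarrow> s \<in> carrier S \<Longrightarrow> t \<in> carrier S \<Longrightarrow>
      \<theta> c (s \<otimes>\<^bsub>S\<^esub> t) = \<theta> c s \<otimes>\<^bsub>S\<^esub> \<theta> c t"
    and act: "\<And>c d s. c \<in> carrier C \<Longrightarrow> d \<in> carrier C \<Longrightarrow> s \<in> carrier S \<Longrightarrow>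
      \<theta> (c \<otimes>\<^bsub>C\<^esub> d) s = \<theta> c (\<theta> d s)"
    and one: "\<And>s. s \<in> carrier S \<Longrightarrow> \<theta> \<one>\<^bsub>C\<^esub> s = s"
  shows "group (semidirect S C \<theta>)"
proof -
  interpret S: group S by fact
  interpret C: group C by fact
  show ?thesis
  proof (rule groupI)
    fix x assume "x \<in> carrier (semidirect S C \<theta>)"
    then obtain s c where x: "x = (s, c)" "s \<in> carrier S" "c \<in> carrier C"
      by (auto simp: semidirect_def)
    let ?y = "(\<theta> (inv\<^bsub>C\<^esub> c) (inv\<^bsub>S\<^esub> s), inv\<^bsub>C\<^esub> c)"
    have "\<theta> (inv\<^bsub>C\<^esub> c) (inv\<^bsub>S\<^esub> s) \<otimes>\<^bsub>S\<^esub> \<theta> (inv\<^bsub>C\<^esub> c) s = \<theta> (inv\<^bsub>C\<^esub> c) \<one>\<^bsub>S\<^esub>"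
      using x by (simp flip: hom)
    also have "\<dots> = \<one>\<^bsub>S\<^esub>"
    proof -
      \<comment> \<open>The image of the unit is an idempotent of a group, hence the unit.\<close>
      have k: "inv\<^bsub>C\<^esub> c \<in> carrier C" using x by simp
      have "\<theta> (inv\<^bsub>C\<^esub> c) \<one>\<^bsub>S\<^esub> \<otimes>\<^bsub>S\<^esub> \<theta> (inv\<^bsub>C\<^esub> c) \<one>\<^bsub>S\<^esub> = \<theta> (inv\<^bsub>C\<^esub> c) \<one>\<^bsub>S\<^esub>"
        using hom[OF k S.one_closed S.one_closed] by simp
      with closed[OF k S.one_closed] show ?thesis
        by (metis S.l_cancel_one')
    qed
    finally show "\<exists>y\<in>carrier (semidirect S C \<theta>).
        y \<otimes>\<^bsub>semidirect S C \<theta>\<^esub> x = \<one>\<^bsub>semidirect S C \<theta>\<^esub>"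
      using x closed by (intro bexI[of _ ?y]) (auto simp: semidirect_def)
  qed (auto simp: semidirect_def closed hom act one S.m_assoc C.m_assoc)
qed

lemma normal_central_involution:
  assumes "group G" and w: "w \<in> carrier G" "w \<otimes>\<^bsub>G\<^esub> w = \<one>\<^bsub>G\<^esub>"
    and central: "\<And>x. x \<in> carrier G \<Longrightarrow> x \<otimes>\<^bsub>G\<^esub> w = w \<otimes>\<^bsub>G\<^esub> x"
  shows "normal {\<one>\<^bsub>G\<^esub>, w} G"
proof -
  interpret group G by fact
  have "inv\<^bsub>G\<^esub> w = w" using w inv_equality by blast
  then have "subgroup {\<one>\<^bsub>G\<^esub>, w} G"
    using w by (intro subgroupI) auto
  moreover have "x \<otimes>\<^bsub>G\<^esub> h \<otimes>\<^bsub>G\<^esub> inv\<^bsub>G\<^esub> x \<in> {\<one>\<^bsub>G\<^esub>, w}" if "x \<in> carrier G" "h \<in> {\<one>\<^bsub>G\<^esub>, w}" for x h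
    using that w central[OF that(1)] by (auto simp: m_assoc)
  ultimately show ?thesis by (simp add: normal_inv_iff)
qed

text \<open>The label acts only through its conjugation bit, and this bit is additive along the
  projection, so the action is multiplicative. The pair of minus signs is central because
  \<open>z\<close> covers the trivial transformation and conjugation fixes
  \<open>cl_neg cl_one\<close>.\<close>

lemma group_cpt_pin:
  assumes "group C" "\<pi> \<in> hom C cpt_labels"
    and z: "z \<in> carrier C" "z \<otimes>\<^bsub>C\<^esub> z = \<one>\<^bsub>C\<^esub>" "\<pi> z = (False, False, False)"
    and central: "\<And>x. x \<in> carrier C \<Longrightarrow> x \<otimes>\<^bsub>C\<^esub> z = z \<otimes>\<^bsub>C\<^esub> x"
  shows "group (semidirect (spin_plus p q) C (\<lambda>c. spin_action p q (\<pi> c)))"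
    and "normal {(cl_one, \<one>\<^bsub>C\<^esub>), (cl_neg cl_one, z)}
      (semidirect (spin_plus p q) C (\<lambda>c. spin_action p q (\<pi> c)))"
    and "group (cpt_pin p q C \<pi> z)"
proof -
  let ?S = "spin_plus p q" and ?G = "semidirect (spin_plus p q) C (\<lambda>c. spin_action p q (\<pi> c))"
  interpret C: group C by fact
  interpret S: group ?S by (rule group_spin_plus)
  define \<theta> where "\<theta> c s = (if snd (snd (\<pi> c)) then cl_bar s else s)" for c s
  have act: "spin_action p q (\<pi> c) s = \<theta> c s" if "s \<in> carrier ?S" for c s
    using spin_action_eq[OF that] by (cases "\<pi> c") (simp add: \<theta>_def)
  have \<theta>c: "\<theta> c s \<in> carrier ?S" if "s \<in> carrier ?S" for c s
    using that by (simp add: \<theta>_def cl_bar_spin_plus)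
  have pm: "snd (snd (\<pi> (c \<otimes>\<^bsub>C\<^esub> d))) = (snd (snd (\<pi> c)) \<noteq> snd (snd (\<pi> d)))"
    if "c \<in> carrier C" "d \<in> carrier C" for c d
    using hom_mult[OF assms(2) that]
    by (simp add: cpt_labels_def bool_group_def DirProd_def case_prod_unfold)
  have p1: "\<not> snd (snd (\<pi> \<one>\<^bsub>C\<^esub>))"
    using pm[of "\<one>\<^bsub>C\<^esub>" "\<one>\<^bsub>C\<^esub>"] by auto
  show G: "group ?G"
    by (rule group_semidirect[OF group_spin_plus assms(1)])
      (simp_all add: act \<theta>c spin_plus_mult_closed spin_plus_mult, simp_all add: \<theta>_def pm p1 cl_bar_mult)
  have neg: "cl_neg cl_one \<in> carrier ?S" by (intro cl_neg_spin_plus cl_one_spin_plus)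
  have one: "\<one>\<^bsub>?G\<^esub> = (cl_one, \<one>\<^bsub>C\<^esub>)" by (simp add: semidirect_def spin_plus_one)
  have "normal {\<one>\<^bsub>?G\<^esub>, (cl_neg cl_one, z)} ?G"
  proof (rule normal_central_involution[OF G])
    show "(cl_neg cl_one, z) \<in> carrier ?G" using neg z by (simp add: semidirect_def)
    show "(cl_neg cl_one, z) \<otimes>\<^bsub>?G\<^esub> (cl_neg cl_one, z) = \<one>\<^bsub>?G\<^esub>"
      using neg z by (simp add: semidirect_def act spin_plus_mult spin_plus_one)
        (simp add: \<theta>_def cl_mult_neg_left)
  next
    fix x assume "x \<in> carrier ?G"
    then obtain s c where x: "x = (s, c)" "s \<in> carrier ?S" "c \<in> carrier C"
      by (auto simp: semidirect_def)
    show "x \<otimes>\<^bsub>?G\<^esub> (cl_neg cl_one, z) = (cl_neg cl_one, z) \<otimes>\<^bsub>?G\<^esub> x"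
      unfolding x(1) using neg z(3) x(2,3) central[OF x(3)]
      by (simp add: semidirect_def act spin_plus_mult)
        (simp add: \<theta>_def cl_bar_neg cl_mult_neg_left cl_mult_neg_right spin_plus_complex)
  qed
  then show N: "normal {(cl_one, \<one>\<^bsub>C\<^esub>), (cl_neg cl_one, z)} ?G"
    by (simp only: one)
  show "group (cpt_pin p q C \<pi> z)"
    unfolding cpt_pin_def by (rule normal.factorgroup_is_group[OF N])
qed

text \<open>First isomorphism theorem for \<open>h\<close> followed by the projection modulo the
  image of \<open>N\<close>; since \<open>h\<close> is injective, the kernel of this map is
  \<open>N\<close>.\<close>

lemma FactGroup_cong_iso:
  assumes "group G" "group H" "h \<in> iso G H" "normal N G" "normal (h ` N) H"
  shows "G Mod N \<cong> H Mod (h ` N)"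
proof -
  interpret G: group G by fact
  interpret H: group H by fact
  interpret N: normal N G by fact
  interpret M: normal "h ` N" H by fact
  let ?k = "(\<lambda>a. (h ` N) #>\<^bsub>H\<^esub> a) \<circ> h"
  have h: "h \<in> hom G H" "bij_betw h (carrier G) (carrier H)"
    using assms(3) by (auto simp: iso_def)
  have k: "?k \<in> hom G (H Mod (h ` N))"
    by (rule hom_compose[OF h(1) M.r_coset_hom_Mod])
  interpret k: group_hom G "H Mod (h ` N)" ?k
    using k M.factorgroup_is_group by (simp add: group_hom_def group_hom_axioms_def)
  have "?k ` carrier G = carrier (H Mod (h ` N))"
    unfolding carrier_FactGroup bij_betw_imp_surj_on[OF h(2), symmetric] image_comp ..
  moreover have "kernel G (H Mod (h ` N)) ?k = N"
  proof -
    have "h ` N #>\<^bsub>H\<^esub> h x = h ` N \<longleftrightarrow> x \<in> N" if x: "x \<in> carrier G" for x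
    proof -
      have hx: "h x \<in> carrier H" using h x by (auto simp: hom_def)
      have "h ` N #>\<^bsub>H\<^esub> h x = h ` N \<longleftrightarrow> h x \<in> h ` N"
        using hx M.is_subgroup by (metis H.coset_join1 H.coset_join2 M.subset)
      also have "\<dots> \<longleftrightarrow> x \<in> N"
        using h(2) x N.subset by (auto simp: bij_betw_def inj_on_def)
      finally show ?thesis .
    qed
    with N.subset show ?thesis by (auto simp: kernel_def)
  qed
  ultimately show ?thesis
    using k.FactGroup_iso by simp
qed

text \<open>The covering group depends on \<open>C\<close> only up to isomorphism:
  \<open>map_prod id h\<close> is an isomorphism of the semidirect products that carries one central
  subgroup to the other. It allows the group of signed matrices to be replaced by a concrete finite
  group.\<close>

lemma cpt_pin_transport:
  assumes "group C" "\<pi> \<in> hom C cpt_labels" "group D" "h \<in> iso C D"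
    and z: "z \<in> carrier C" "z \<otimes>\<^bsub>C\<^esub> z = \<one>\<^bsub>C\<^esub>" "\<pi> z = (False, False, False)"
    and central: "\<And>x. x \<in> carrier C \<Longrightarrow> x \<otimes>\<^bsub>C\<^esub> z = z \<otimes>\<^bsub>C\<^esub> x"
  shows "cpt_pin p q C \<pi> z \<cong> cpt_pin p q D (\<pi> \<circ> inv_into (carrier C) h) (h z)"
proof -
  interpret C: group C by fact
  interpret D: group D by fact
  let ?g = "inv_into (carrier C) h"
  let ?G = "semidirect (spin_plus p q) C (\<lambda>c. spin_action p q (\<pi> c))"
    and ?H = "semidirect (spin_plus p q) D (\<lambda>c. spin_action p q ((\<pi> \<circ> ?g) c))"
  have g: "?g \<in> iso D C" by (rule C.iso_set_sym[OF assms(4)])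
  have h: "h \<in> hom C D" "bij_betw h (carrier C) (carrier D)" "inj_on h (carrier C)"
    using assms(4) by (auto simp: iso_def bij_betw_def)
  have gh[simp]: "?g (h c) = c" if "c \<in> carrier C" for c
    using h(3) that by (rule inv_into_f_f)
  have hc[simp]: "h c \<in> carrier D" if "c \<in> carrier C" for c
    using h(1) that by (auto simp: hom_def)
  have h1: "h \<one>\<^bsub>C\<^esub> = \<one>\<^bsub>D\<^esub>" using hom_one[OF h(1) assms(1) assms(3)] .
  have pi: "\<pi> \<circ> ?g \<in> hom D cpt_labels"
    using hom_compose[OF _ assms(2), of ?g D] g by (simp add: iso_def)
  have D: "x \<otimes>\<^bsub>D\<^esub> h z = h z \<otimes>\<^bsub>D\<^esub> x" if xD: "x \<in> carrier D" for x
  proof -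
    obtain c where c: "c \<in> carrier C" "x = h c"
      using xD bij_betw_imp_surj_on[OF h(2)] by blast
    have "x \<otimes>\<^bsub>D\<^esub> h z = h (c \<otimes>\<^bsub>C\<^esub> z)" unfolding c(2) by (rule hom_mult[OF h(1) c(1) z(1), symmetric])
    also have "\<dots> = h (z \<otimes>\<^bsub>C\<^esub> c)" by (simp only: central[OF c(1)])
    also have "\<dots> = h z \<otimes>\<^bsub>D\<^esub> x" unfolding c(2) by (rule hom_mult[OF h(1) z(1) c(1)])
    finally show ?thesis .
  qed
  have zz: "h z \<in> carrier D" "h z \<otimes>\<^bsub>D\<^esub> h z = \<one>\<^bsub>D\<^esub>" "(\<pi> \<circ> ?g) (h z) = (False, False, False)"
    using z h1 by (simp_all add: hom_mult[OF h(1), symmetric])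
  note G = group_cpt_pin[OF assms(1,2) z central] and H = group_cpt_pin[OF assms(3) pi zz D]
  let ?k = "map_prod id h"
  have "?k \<in> iso ?G ?H"
  proof (rule isoI)
    show "?k \<in> hom ?G ?H"
      by (rule homI) (auto simp: semidirect_def hom_mult[OF h(1)])
    show "bij_betw ?k (carrier ?G) (carrier ?H)"
      using h(2) by (simp add: semidirect_def bij_betw_map_prod)
  qed
  moreover have "?k ` {(cl_one, \<one>\<^bsub>C\<^esub>), (cl_neg cl_one, z)} =
      {(cl_one, \<one>\<^bsub>D\<^esub>), (cl_neg cl_one, h z)}"
    using h1 by simp
  ultimately show ?thesis
    unfolding cpt_pin_def using FactGroup_cong_iso[OF G(1) H(1) _ G(2)] H(2) by metis
qed

section \<open>Products of spinbasis matrices\<close>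

lemma smult_smult_mat: "a \<cdot>\<^sub>m (b \<cdot>\<^sub>m (A :: complex mat)) = (a * b) \<cdot>\<^sub>m A"
  by (intro eq_matI) auto

lemma one_smult_mat [simp]: "1 \<cdot>\<^sub>m (A :: complex mat) = A"
  by (intro eq_matI) auto

lemma uminus_smult_mat: "- (A :: complex mat) = (- 1) \<cdot>\<^sub>m A"
  by (intro eq_matI) auto

lemma mat_cnj_mult:
  assumes "A \<in> carrier_mat N N" "B \<in> carrier_mat N N"
  shows "mat_cnj (A * B) = mat_cnj A * mat_cnj B"
  using assms by (intro eq_matI) (auto simp: mat_cnj_def scalar_prod_def)

lemma mat_cnj_smult: "mat_cnj (c \<cdot>\<^sub>m A) = cnj c \<cdot>\<^sub>m mat_cnj A"
  by (intro eq_matI) (auto simp: mat_cnj_def)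

lemma mat_cnj_one: "mat_cnj (1\<^sub>m N) = 1\<^sub>m N"
  by (intro eq_matI) (auto simp: mat_cnj_def)

lemma mat_cnj_carrier [simp]: "mat_cnj A \<in> carrier_mat n m \<longleftrightarrow> A \<in> carrier_mat n m"
  by (simp add: mat_cnj_def)

lemma transpose_smult: "transpose_mat (c \<cdot>\<^sub>m (A :: complex mat)) = c \<cdot>\<^sub>m transpose_mat A"
  by (intro eq_matI) auto

lemma mat_prod_empty [simp]: "mat_prod N Es {} = 1\<^sub>m N"
  by (simp add: mat_prod_def mat_list_prod_def)

text \<open>Ordered products unfold from the smallest index on, which is why the inductions on index
  sets insert a new minimum.\<close>

lemma mat_prod_insert_Min:
  assumes "finite S" "\<forall>i\<in>S. m < i"
  shows "mat_prod N Es (insert m S) = Es m * mat_prod N Es S"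
proof -
  have "m \<notin> S" using assms by auto
  then have "sorted_list_of_set (insert m S) = insort m (sorted_list_of_set S)"
    using assms by (simp add: sorted_list_of_set.sorted_key_list_of_set_insert)
  also have "\<dots> = m # sorted_list_of_set S"
    using assms by (intro insort_is_Cons) auto
  finally show ?thesis by (simp add: mat_prod_def mat_list_prod_def)
qed

locale spinor_matrices =
  fixes p q N :: nat and Es :: "nat \<Rightarrow> complex mat"
  assumes spinbasis: "spinbasis p q N Es" and even_dim: "even (p + q)"
begin

abbreviation n where "n \<equiv> p + q"
abbreviation E where "E \<equiv> mat_prod N Es"

lemma N_pos: "0 < N"
  using spinbasis by (simp add: spinbasis_def)

lemma Es_carrier [simp]: "i < n \<Longrightarrow> Es i \<in> carrier_mat N N"
  using spinbasis by (simp add: spinbasis_def)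

lemma fin: "S \<subseteq> {..<n} \<Longrightarrow> finite S"
  by (rule finite_subset[OF _ finite_lessThan])

lemma Es_mult:
  assumes "i < n" "j < n"
  shows "Es i * Es j = (if i = j then (gen_sign p i i) \<cdot>\<^sub>m 1\<^sub>m N else (- 1) \<cdot>\<^sub>m (Es j * Es i))"
proof (cases "i = j")
  case True
  have "Es i * Es i = (if i < p then 1\<^sub>m N else - 1\<^sub>m N)"
    using spinbasis assms unfolding spinbasis_def by blast
  with True show ?thesis by (simp add: gen_sign_def uminus_smult_mat)
next
  case False
  then have "Es i * Es j = - (Es j * Es i)"
    using spinbasis assms unfolding spinbasis_def by blast
  with False show ?thesis by (simp only: uminus_smult_mat if_False)
qed

lemma E_carrier:
  assumes "S \<subseteq> {..<n}"
  shows "E S \<in> carrier_mat N N"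
  using fin[OF assms] assms
proof (induction S rule: finite_linorder_min_induct)
  case (insert b A)
  then show ?case by (simp add: mat_prod_insert_Min mult_carrier_mat[of _ N N])
qed simp

lemma E_singleton: "i < n \<Longrightarrow> E {i} = Es i"
  using mat_prod_insert_Min[of "{}" i N Es] right_mult_one_mat[OF Es_carrier] by simp

lemma smult_mult:
  fixes c :: complex
  assumes "A \<in> carrier_mat N N" "B \<in> carrier_mat N N"
  shows "(c \<cdot>\<^sub>m A) * B = c \<cdot>\<^sub>m (A * B)" "A * (c \<cdot>\<^sub>m B) = c \<cdot>\<^sub>m (A * B)"
  using mult_smult_assoc_mat[OF assms, of c] mult_smult_distrib[OF assms, of c] by simp_all

text \<open>The generator moves to the right past all smaller indices at the cost of one sign each,
  and then is inserted or cancels against its equal; these are the factors of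
  \<open>gen_sign\<close>.\<close>

lemma Es_mult_E:
  assumes "i < n" "S \<subseteq> {..<n}"
  shows "Es i * E S = blade_sign p {i} S \<cdot>\<^sub>m E (sym_diff {i} S)"
  using fin[OF assms(2)] assms(2)
proof (induction S rule: finite_linorder_min_induct)
  case empty
  then show ?case using assms(1) mat_prod_insert_Min[of "{}" i N Es] by simp
next
  case (insert m S)
  then have m: "m < n" "S \<subseteq> {..<n}" "m \<notin> S" by auto
  have bs: "blade_sign p {i} (insert m S) = gen_sign p i m * blade_sign p {i} S"
    using insert.hyps m by (simp add: blade_sign_prod)
  have ES: "E S \<in> carrier_mat N N" using m by (simp add: E_carrier)
  have ins: "E (insert m S) = Es m * E S" using insert.hyps by (simp add: mat_prod_insert_Min)
  consider "i < m" | "i = m" | "m < i" by linarith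
  then show ?case
  proof cases
    case 1
    then have "sym_diff {i} (insert m S) = insert i (insert m S)" using insert.hyps by auto
    moreover have "E (insert i (insert m S)) = Es i * E (insert m S)"
      using 1 insert.hyps by (intro mat_prod_insert_Min) auto
    moreover have "blade_sign p {i} (insert m S) = 1"
      using 1 insert.hyps m unfolding bs by (simp add: blade_sign_prod gen_sign_def)
        (auto intro!: prod.neutral)
    ultimately show ?thesis by simp
  next
    case 2
    then have "sym_diff {i} (insert m S) = S" using m by auto
    moreover have "blade_sign p {m} S = 1"
      using insert.hyps by (simp add: blade_sign_prod gen_sign_def) (auto intro!: prod.neutral)
    moreover have "Es m * (Es m * E S) = gen_sign p m m \<cdot>\<^sub>m E S"
      using m ES Es_mult[of m m] by (simp add: assoc_mult_mat[of _ N N _ N _ N, symmetric] smult_mult)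
    ultimately show ?thesis using 2 bs by (simp add: ins)
  next
    case 3
    have sd: "sym_diff {i} (insert m S) = insert m (sym_diff {i} S)" using 3 m by auto
    have mem: "sym_diff {i} S \<subseteq> {..<n}" using assms(1) m by auto
    have "Es i * E (insert m S) = (Es i * Es m) * E S"
      using assms(1) m ES unfolding ins by (simp add: assoc_mult_mat[of _ N N _ N _ N])
    also have "\<dots> = (- 1) \<cdot>\<^sub>m (Es m * (Es i * E S))"
      using assms(1) m ES 3 Es_mult[of i m] by (simp add: smult_mult assoc_mult_mat[of _ N N _ N _ N] mult_carrier_mat[of _ N N])
    also have "\<dots> = (- blade_sign p {i} S) \<cdot>\<^sub>m (Es m * E (sym_diff {i} S))"
      using insert.IH m E_carrier[OF mem] by (simp add: smult_mult smult_smult_mat)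
    also have "Es m * E (sym_diff {i} S) = E (insert m (sym_diff {i} S))"
      using 3 insert.hyps by (intro mat_prod_insert_Min[symmetric]) auto
    finally show ?thesis unfolding sd using 3 by (simp add: bs gen_sign_def)
  qed
qed

text \<open>The smallest factor of \<open>S\<close> is split off and absorbed by
  \<open>Es_mult_E\<close>. Multiplicativity of the sign shows that matrices and blades have the
  same multiplication table.\<close>

lemma E_mult:
  assumes "S \<subseteq> {..<n}" "T \<subseteq> {..<n}"
  shows "E S * E T = blade_sign p S T \<cdot>\<^sub>m E (sym_diff S T)"
  using fin[OF assms(1)] assms(1)
proof (induction S rule: finite_linorder_min_induct)
  case empty
  then show ?case using E_carrier[OF assms(2)] by simp
next
  case (insert m S)
  then have m: "m < n" "S \<subseteq> {..<n}" "m \<notin> S" by auto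
  have ST: "sym_diff S T \<subseteq> {..<n}" using m assms(2) by auto
  have f: "finite S" "finite T" using insert.hyps fin assms by auto
  have sd: "insert m S = sym_diff {m} S" "sym_diff {m} (sym_diff S T) = sym_diff (insert m S) T"
    using m by auto
  have b1: "blade_sign p {m} S = 1"
    using insert.hyps by (simp add: blade_sign_prod gen_sign_def) (auto intro!: prod.neutral)
  have bs: "blade_sign p (insert m S) T = blade_sign p {m} T * blade_sign p S T"
    unfolding sd(1) using f by (intro blade_sign_sym_diff_left) auto
  have bs': "blade_sign p {m} (sym_diff S T) = blade_sign p {m} T"
    using f b1 by (simp add: blade_sign_sym_diff_right)
  have "E (insert m S) * E T = Es m * (E S * E T)"
    using insert.hyps m assms by (simp add: mat_prod_insert_Min assoc_mult_mat[of _ N N _ N _ N] E_carrier)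
  also have "\<dots> = blade_sign p S T \<cdot>\<^sub>m (Es m * E (sym_diff S T))"
    using insert.IH m E_carrier[OF ST] by (simp add: smult_mult)
  also have "\<dots> = blade_sign p (insert m S) T \<cdot>\<^sub>m E (sym_diff (insert m S) T)"
    using m ST unfolding bs by (simp add: Es_mult_E smult_smult_mat bs' sd(2) mult.commute)
  finally show ?case .
qed

lemma E_square:
  assumes "S \<subseteq> {..<n}"
  shows "E S * E S = blade_sign p S S \<cdot>\<^sub>m 1\<^sub>m N"
  using E_mult[OF assms assms] by simp

lemma smult_one_eq_iff:
  fixes c d :: complex
  shows "c \<cdot>\<^sub>m 1\<^sub>m N = d \<cdot>\<^sub>m 1\<^sub>m N \<longleftrightarrow> c = d"
proof
  assume "c \<cdot>\<^sub>m 1\<^sub>m N = d \<cdot>\<^sub>m 1\<^sub>m N"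
  from arg_cong[OF this, of "\<lambda>M. M $$ (0, 0)"] show "c = d" using N_pos by simp
qed simp

lemma E_commute:
  assumes "S \<subseteq> {..<n}" "T \<subseteq> {..<n}"
  shows "E S * E T = comm_sign S T \<cdot>\<^sub>m (E T * E S)"
proof -
  have e: "sym_diff T S = sym_diff S T" by blast
  have "comm_sign S T * blade_sign p T S = blade_sign p S T"
    unfolding comm_sign_blade_sign[OF fin[OF assms(1)] fin[OF assms(2)], of p]
    by (simp add: mult.assoc blade_sign_square)
  with assms show ?thesis by (simp add: E_mult e smult_smult_mat)
qed

text \<open>A nonempty blade anticommutes with some generator, while a scalar commutes with it; the
  scalar would be 0, although the square of a blade is plus or minus the unit matrix.\<close>

lemma E_scalar_imp_empty:
  assumes S: "S \<subseteq> {..<n}" and c: "E S = c \<cdot>\<^sub>m 1\<^sub>m N"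
  shows "S = {}"
proof (rule ccontr)
  assume ne: "S \<noteq> {}"
  have fS: "finite S" using S by (rule fin)
  obtain i where i: "i < n" "comm_sign {i} S = - 1"
  proof (cases "even (card S)")
    case True
    from ne obtain i where "i \<in> S" by blast
    then have "{i} \<inter> S = {i}" by blast
    with True \<open>i \<in> S\<close> S that[of i] show thesis by (auto simp: comm_sign_def)
  next
    case False
    then have "S \<noteq> {..<n}" using even_dim by auto
    then obtain i where "i < n" "i \<notin> S" using S by blast
    moreover from this have "{i} \<inter> S = {}" by blast
    ultimately show thesis using False that[of i] by (auto simp: comm_sign_def)
  qed
  have si: "{i} \<subseteq> {..<n}" using i by simp
  have Ei: "E {i} \<in> carrier_mat N N" using si by (rule E_carrier)
  have "c \<cdot>\<^sub>m E {i} = (- c) \<cdot>\<^sub>m E {i}"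
    using E_commute[OF si S] Ei unfolding c i(2) by (simp add: smult_mult smult_smult_mat)
  then have "(c \<cdot>\<^sub>m E {i}) * E {i} = ((- c) \<cdot>\<^sub>m E {i}) * E {i}" by simp
  then have "c * blade_sign p {i} {i} = - c * blade_sign p {i} {i}"
    using Ei by (simp only: smult_mult E_square[OF si] smult_smult_mat smult_one_eq_iff)
  then have "c = 0" using blade_sign_cases[of p "{i}" "{i}"] by auto
  have "E S * E S = (c * c) \<cdot>\<^sub>m 1\<^sub>m N" unfolding c by (simp add: smult_mult smult_smult_mat)
  then have "c * c = blade_sign p S S"
    using E_square[OF S] smult_one_eq_iff by metis
  with \<open>c = 0\<close> blade_sign_cases[of p S S] show False by auto
qed

text \<open>Multiplication by \<open>E T\<close> turns proportionality of two blades into scalarity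
  of the blade on the symmetric difference.\<close>

lemma E_eq_imp_eq:
  assumes S: "S \<subseteq> {..<n}" and T: "T \<subseteq> {..<n}" and e: "E S = c \<cdot>\<^sub>m E T"
  shows "S = T"
proof -
  have ST: "sym_diff S T \<subseteq> {..<n}" using S T by auto
  have "blade_sign p S T \<cdot>\<^sub>m E (sym_diff S T) = (c * blade_sign p T T) \<cdot>\<^sub>m 1\<^sub>m N"
    using E_mult[OF S T] E_carrier[OF T] unfolding e by (simp add: smult_mult E_square[OF T] smult_smult_mat)
  then have "blade_sign p S T \<cdot>\<^sub>m (blade_sign p S T \<cdot>\<^sub>m E (sym_diff S T)) =
      blade_sign p S T \<cdot>\<^sub>m ((c * blade_sign p T T) \<cdot>\<^sub>m 1\<^sub>m N)"
    by simp
  then have "E (sym_diff S T) = (blade_sign p S T * (c * blade_sign p T T)) \<cdot>\<^sub>m 1\<^sub>m N"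
    by (simp add: smult_smult_mat blade_sign_square)
  from E_scalar_imp_empty[OF ST this] show ?thesis by blast
qed

subsection \<open>Conjugation and transposition\<close>

lemma Es_nonzero:
  assumes "i < n"
  shows "Es i \<noteq> - Es i"
proof
  assume e: "Es i = - Es i"
  have s: "{i} \<subseteq> {..<n}" using assms by simp
  from e have e': "E {i} = (- 1) \<cdot>\<^sub>m E {i}"
    using assms by (simp add: E_singleton uminus_smult_mat[symmetric])
  then have "E {i} * E {i} = (- 1) \<cdot>\<^sub>m (E {i} * E {i})"
    using E_carrier[OF s] by (metis smult_mult(1))
  then show False
    using blade_sign_cases[of p "{i}" "{i}"]
    by (simp add: E_square[OF s] smult_smult_mat smult_one_eq_iff)
qed

abbreviation cplx where "cplx \<equiv> complex_indices n Es"
abbreviation skew where "skew \<equiv> skew_indices n Es"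

lemma mat_cnj_Es: "i < n \<Longrightarrow> mat_cnj (Es i) = (if i \<in> cplx then - 1 else 1) \<cdot>\<^sub>m Es i"
proof -
  assume i: "i < n"
  then have "mat_cnj (Es i) = Es i \<or> mat_cnj (Es i) = - Es i"
    using spinbasis unfolding spinbasis_def by blast
  with i show ?thesis unfolding complex_indices_def by (auto simp flip: uminus_smult_mat)
qed

lemma transpose_Es: "i < n \<Longrightarrow> transpose_mat (Es i) = (if i \<in> skew then - 1 else 1) \<cdot>\<^sub>m Es i"
proof -
  assume i: "i < n"
  then have "transpose_mat (Es i) = Es i \<or> transpose_mat (Es i) = - Es i"
    using spinbasis unfolding spinbasis_def by blast
  with i show ?thesis unfolding skew_indices_def by (auto simp flip: uminus_smult_mat)
qed

lemma real_indices_eq: "real_indices n Es = {..<n} - cplx"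
proof -
  have "mat_cnj (Es i) = Es i \<or> mat_cnj (Es i) = - Es i" if "i < n" for i
    using that spinbasis unfolding spinbasis_def by blast
  then show ?thesis using Es_nonzero unfolding real_indices_def complex_indices_def by force
qed

lemma sym_indices_eq: "sym_indices n Es = {..<n} - skew"
proof -
  have "transpose_mat (Es i) = Es i \<or> transpose_mat (Es i) = - Es i" if "i < n" for i
    using that spinbasis unfolding spinbasis_def by blast
  then show ?thesis using Es_nonzero unfolding sym_indices_def skew_indices_def by force
qed

lemma mat_cnj_E:
  assumes "S \<subseteq> {..<n}"
  shows "mat_cnj (E S) = (- 1) ^ card (S \<inter> cplx) \<cdot>\<^sub>m E S"
  using fin[OF assms] assms
proof (induction S rule: finite_linorder_min_induct)
  case (insert m S)
  then have m: "m < n" "S \<subseteq> {..<n}" "m \<notin> S" by auto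
  have "card (insert m S \<inter> cplx) = card (S \<inter> cplx) + (if m \<in> cplx then 1 else 0)"
    using insert.hyps m by (auto simp: Int_insert_left)
  then show ?case
    using insert m E_carrier[OF m(2)] mat_cnj_Es[OF m(1)]
    by (auto simp: mat_prod_insert_Min mat_cnj_mult[of _ N] smult_mult smult_smult_mat)
qed (simp add: mat_cnj_one)

text \<open>Transposition reverses the product, so the smallest factor ends up on the right and must
  pass \<open>card S\<close> anticommuting factors. These passages add up to the reversion sign,
  besides the signs of the skewsymmetric factors.\<close>

lemma transpose_E:
  assumes "S \<subseteq> {..<n}"
  shows "transpose_mat (E S) = ((- 1) ^ card (S \<inter> skew) * reversion_sign (card S)) \<cdot>\<^sub>m E S"
  using fin[OF assms] assms
proof (induction S rule: finite_linorder_min_induct)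
  case empty
  then show ?case by (simp add: reversion_sign_def)
next
  case (insert m S)
  then have m: "m < n" "S \<subseteq> {..<n}" "m \<notin> S" by auto
  let ?c = "(- 1) ^ card (S \<inter> skew) * reversion_sign (card S)" and ?t = "(if m \<in> skew then - 1 else 1) :: complex"
  have sk: "(- 1 :: complex) ^ card (insert m S \<inter> skew) = (- 1) ^ card (S \<inter> skew) * ?t"
    using insert.hyps m by (auto simp: Int_insert_left)
  have rv: "reversion_sign (card (insert m S)) = reversion_sign (card S) * (- 1) ^ card S"
    using insert.hyps m reversion_sign_add[of "card S" 1] by (simp add: reversion_sign_def)
  have "{m} \<inter> S = {}" using m by auto
  then have co: "E S * Es m = (- 1) ^ card S \<cdot>\<^sub>m (Es m * E S)"
    using E_commute[OF m(2), of "{m}"] m by (simp add: E_singleton comm_sign_def Int_commute)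
  have "transpose_mat (E (insert m S)) = transpose_mat (E S) * transpose_mat (Es m)"
    using insert.hyps m E_carrier[OF m(2)] by (simp add: mat_prod_insert_Min transpose_mult[of _ N N])
  also have "\<dots> = (?c * ?t) \<cdot>\<^sub>m (E S * Es m)"
    using insert.IH m E_carrier[OF m(2)] unfolding transpose_Es[OF m(1)]
    by (simp add: smult_mult smult_smult_mat mult.commute)
  also have "\<dots> = ((- 1) ^ card (insert m S \<inter> skew) * reversion_sign (card (insert m S))) \<cdot>\<^sub>m E (insert m S)"
    unfolding co sk rv using insert.hyps by (simp add: mat_prod_insert_Min smult_smult_mat ac_simps)
  finally show ?case .
qed

subsection \<open>The matrices of the transformations\<close>

definition E_set where
  "E_set = (if even (card skew) then skew else sym_indices n Es)"

definition Pi_set where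
  "Pi_set = (if even (card cplx) then cplx else real_indices n Es)"

text \<open>Additive in the label by construction. The matrices of \<open>ext_mat\<close> are the
  blades on these sets up to a sign, which depends on the order of the factors in C, K, S and
  F.\<close>

fun ext_set :: "cpt_label \<Rightarrow> nat set" where
  "ext_set (x, y, z) = sym_diff (if x then {..<n} else {})
     (sym_diff (if y then E_set else {}) (if z then Pi_set else {}))"

lemma E_set_subset: "E_set \<subseteq> {..<n}"
  by (auto simp: E_set_def skew_indices_def sym_indices_def)

lemma Pi_set_subset: "Pi_set \<subseteq> {..<n}"
  by (auto simp: Pi_set_def complex_indices_def real_indices_def)

lemma ext_set_subset: "ext_set v \<subseteq> {..<n}"
  using E_set_subset Pi_set_subset by (cases v) auto

lemma W_mat_E: "W_mat n N Es = E {..<n}"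
  by (simp add: W_mat_def)

lemma E_mat_E: "E_mat n N Es = E E_set"
  by (simp add: E_mat_def E_set_def)

lemma Pi_mat_E: "Pi_mat n N Es = E Pi_set"
  by (simp add: Pi_mat_def Pi_set_def)

lemma ext_mat_E: "\<exists>\<epsilon>. (\<epsilon> = 1 \<or> \<epsilon> = - 1) \<and> ext_mat n N Es v = \<epsilon> \<cdot>\<^sub>m E (ext_set v)"
proof -
  note s = E_set_subset Pi_set_subset
  have EW: "sym_diff E_set {..<n} \<subseteq> {..<n}" using s by auto
  have C: "C_mat n N Es = blade_sign p E_set {..<n} \<cdot>\<^sub>m E (sym_diff E_set {..<n})"
    using s by (simp add: C_mat_def W_mat_E E_mat_E E_mult)
  have K: "K_mat n N Es = blade_sign p Pi_set {..<n} \<cdot>\<^sub>m E (sym_diff Pi_set {..<n})"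
    using s by (simp add: K_mat_def W_mat_E Pi_mat_E E_mult)
  have S: "S_mat n N Es = blade_sign p Pi_set E_set \<cdot>\<^sub>m E (sym_diff Pi_set E_set)"
    using s by (simp add: S_mat_def E_mat_E Pi_mat_E E_mult)
  have F: "F_mat n N Es = (blade_sign p E_set {..<n} * blade_sign p Pi_set (sym_diff E_set {..<n})) \<cdot>\<^sub>m
      E (sym_diff Pi_set (sym_diff E_set {..<n}))"
    using s by (simp add: F_mat_def C Pi_mat_E E_mult[OF s(2) EW] smult_mult(2)[OF E_carrier[OF s(2)] E_carrier[OF EW]]
        smult_smult_mat)
  have sd: "sym_diff A B = sym_diff B A" "sym_diff A (sym_diff B C) = sym_diff C (sym_diff B A)"
    for A B C :: "nat set" by blast+
  obtain x y z where v: "v = (x, y, z)" by (cases v)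
  have I: ?thesis if "ext_mat n N Es v = \<delta> \<cdot>\<^sub>m E T" "\<delta> = 1 \<or> \<delta> = - 1" "T = ext_set v" for \<delta> T
    using that by blast
  have mult_cases: "a * b = 1 \<or> a * b = - 1" if "a = 1 \<or> a = - 1" "b = 1 \<or> b = - 1" for a b :: complex
    using that by auto
  note bs = blade_sign_cases
  show ?thesis
    apply (cases x; cases y; cases z)
    subgoal by (rule I[OF _ mult_cases[OF bs bs]], simp add: v F, simp add: v, rule sd)
    subgoal by (rule I[OF _ bs], simp add: v C, simp add: v, rule sd)
    subgoal by (rule I[OF _ bs], simp add: v K, simp add: v, rule sd)
    subgoal by (rule I[of 1 "{..<n}"]) (simp_all add: v W_mat_E)
    subgoal by (rule I[OF _ bs], simp add: v S, simp add: v, rule sd)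
    subgoal by (rule I[of 1 E_set]) (simp_all add: v E_mat_E)
    subgoal by (rule I[of 1 Pi_set]) (simp_all add: v Pi_mat_E)
    subgoal by (rule I[of 1 "{}"]) (simp_all add: v)
    done
qed

lemma comm_sign_all:
  assumes "S \<subseteq> {..<n}"
  shows "comm_sign {..<n} S = (- 1) ^ card S"
proof -
  have "{..<n} \<inter> S = S" using assms by blast
  with even_dim show ?thesis unfolding comm_sign_def minus_one_power_iff by auto
qed

text \<open>The commutation sign with \<open>D\<close> has the extra exponent
  \<open>card D * card S\<close>. It is even if \<open>D\<close> has even size; otherwise the
  complement, which is the symmetric difference of \<open>D\<close> with the full index set,
  contributes another \<open>card S\<close> and compensates for it.\<close>

lemma comm_sign_even_or_complement:
  assumes S: "S \<subseteq> {..<n}" and D: "D \<subseteq> {..<n}"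
  shows "comm_sign (if even (card D) then D else {..<n} - D) S = (- 1) ^ card (S \<inter> D)"
proof (cases "even (card D)")
  case True
  then show ?thesis by (simp add: comm_sign_def power_add power_mult Int_commute)
next
  case False
  have e: "{..<n} - D = sym_diff {..<n} D" using D by blast
  have "comm_sign ({..<n} - D) S = comm_sign {..<n} S * comm_sign D S"
    by (subst e) (rule comm_sign_sym_diff_left[OF finite_lessThan fin[OF D] fin[OF S]])
  also have "\<dots> = (- 1) ^ card S * ((- 1) ^ card S * (- 1) ^ card (S \<inter> D))"
    using False comm_sign_all[OF S] by (simp add: comm_sign_def power_add power_mult Int_commute)
  also have "\<dots> = (- 1) ^ card (S \<inter> D)"
    by (simp add: minus_one_power_square flip: mult.assoc)
  finally show ?thesis using False by simp
qed

lemma comm_sign_ext_set: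
  assumes S: "S \<subseteq> {..<n}"
  shows "comm_sign (ext_set (x, y, z)) S = (if x then (- 1) ^ card S else 1) *
    ((if y then (- 1) ^ card (S \<inter> skew) else 1) * (if z then (- 1) ^ card (S \<inter> cplx) else 1))"
proof -
  have "skew \<subseteq> {..<n}" "cplx \<subseteq> {..<n}" by (auto simp: skew_indices_def complex_indices_def)
  then have "comm_sign E_set S = (- 1) ^ card (S \<inter> skew)" "comm_sign Pi_set S = (- 1) ^ card (S \<inter> cplx)"
    unfolding E_set_def Pi_set_def sym_indices_eq real_indices_eq
    using comm_sign_even_or_complement[OF S] by blast+
  then show ?thesis
    unfolding ext_set.simps using fin[OF S] fin[OF E_set_subset] fin[OF Pi_set_subset]
    by (subst comm_sign_sym_diff_left; (subst comm_sign_sym_diff_left)?) (simp_all add: comm_sign_all[OF S])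
qed

lemma mat_transform_E:
  assumes "S \<subseteq> {..<n}"
  shows "mat_transform (x, y, z) (E S) =
    ((if y then (- 1) ^ card (S \<inter> skew) * reversion_sign (card S) else 1) *
     (if z then (- 1) ^ card (S \<inter> cplx) else 1)) \<cdot>\<^sub>m E S"
  using assms by (simp add: mat_cnj_E transpose_E transpose_smult smult_smult_mat mult.commute)

lemma mat_transform_carrier:
  "M \<in> carrier_mat N N \<Longrightarrow> mat_transform v M \<in> carrier_mat N N"
  by (cases v) simp

lemma mat_transform_add:
  assumes "A \<in> carrier_mat N N" "B \<in> carrier_mat N N"
  shows "mat_transform v (A + B) = mat_transform v A + mat_transform v B"
proof -
  have "mat_cnj (A + B) = mat_cnj A + mat_cnj B"
    using assms by (intro eq_matI) (auto simp: mat_cnj_def)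
  with assms show ?thesis by (cases v) (simp add: transpose_add[of _ N N])
qed

lemma mat_transform_smult:
  "mat_transform (x, y, z) (c \<cdot>\<^sub>m A) = (if z then cnj c else c) \<cdot>\<^sub>m mat_transform (x, y, z) A"
  by (simp add: mat_cnj_smult transpose_smult)

text \<open>Both sides are additive in the element and treat scalars alike, so blades suffice. There
  transposition and entrywise conjugation produce signs counting skewsymmetric and complex factors,
  besides the reversion sign. Conjugation by the matrix of the label cancels these counts and adds
  the grade sign if the label contains the star.\<close>

lemma represents_ext_mat: "represents p q N Es v (ext_mat n N Es v)"
proof -
  obtain x y z where v: "v = (x, y, z)" by (cases v)
  let ?U = "ext_set v" and ?X = "ext_mat n N Es v"
  obtain \<epsilon> where \<epsilon>: "\<epsilon> = 1 \<or> \<epsilon> = - 1" and X: "?X = \<epsilon> \<cdot>\<^sub>m E ?U" using ext_mat_E by blast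
  have U: "?U \<subseteq> {..<n}" by (rule ext_set_subset)
  \<comment> \<open>The inverse of \<open>?X\<close>: \<open>blade_sign p ?U ?U\<close> is the sign
    of the square of the blade.\<close>
  define Y where "Y = (\<epsilon> * blade_sign p ?U ?U) \<cdot>\<^sub>m E ?U"
  have c[simp]: "E ?U \<in> carrier_mat N N" "?X \<in> carrier_mat N N" "Y \<in> carrier_mat N N"
    using E_carrier[OF U] by (simp_all add: X Y_def)
  have XY: "?X * Y = 1\<^sub>m N" "Y * ?X = 1\<^sub>m N"
    using \<epsilon> by (auto simp: X Y_def smult_mult E_square[OF U] smult_smult_mat blade_sign_square)
  define \<tau> where "\<tau> S = (if x then (- 1) ^ card S else 1) * (if y then reversion_sign (card S) else 1)"
    for S :: "nat set"
  define cc where "cc a = (if z then cnj a else a)" for a :: complex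
  have tr: "cl_transform v A S = \<tau> S * cc (A S)" for A S
    unfolding v by (simp add: \<tau>_def cc_def cl_star_def cl_tilde_def cl_bar_def reversion_sign_def)
  have blade: "?X * mat_transform v (E S) * Y = \<tau> S \<cdot>\<^sub>m E S" if S: "S \<subseteq> {..<n}" for S
  proof -
    let ?m = "(if y then (- 1) ^ card (S \<inter> skew) * reversion_sign (card S) else 1) *
     (if z then (- 1) ^ card (S \<inter> cplx) else (1::complex))"
    note ES = E_carrier[OF S]
    have 1: "E ?U * E S * E ?U = (comm_sign ?U S * blade_sign p ?U ?U) \<cdot>\<^sub>m E S"
      using ES unfolding E_commute[OF U S]
      by (simp add: smult_mult assoc_mult_mat[of _ N N _ N _ N] E_square[OF U] smult_smult_mat)
    have 2: "?X * mat_transform v (E S) * Y = (\<epsilon> * ?m * (\<epsilon> * blade_sign p ?U ?U)) \<cdot>\<^sub>m (E ?U * E S * E ?U)"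
    proof -
      have mt: "mat_transform v (E S) = ?m \<cdot>\<^sub>m E S" unfolding v by (rule mat_transform_E[OF S])
      have "(a \<cdot>\<^sub>m A) * (b \<cdot>\<^sub>m B) * (k \<cdot>\<^sub>m A) = (a * b * k) \<cdot>\<^sub>m (A * B * A)"
        if "A \<in> carrier_mat N N" "B \<in> carrier_mat N N" for a b k and A B :: "complex mat"
        using that by (simp add: smult_mult smult_smult_mat mult_carrier_mat[of _ N N] ac_simps)
      from this[OF c(1) ES] show ?thesis unfolding mt unfolding X Y_def .
    qed
    have sq: "(if b then (- 1) ^ k else 1) * (if b then (- 1) ^ k else 1) = (1 :: complex)" for b and k :: nat
      by (simp add: minus_one_power_square)
    have "\<epsilon> * ?m * (\<epsilon> * blade_sign p ?U ?U) * (comm_sign ?U S * blade_sign p ?U ?U) =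
      ?m * comm_sign ?U S * (\<epsilon> * \<epsilon>) * (blade_sign p ?U ?U * blade_sign p ?U ?U)"
      by (simp only: ac_simps)
    also have "\<dots> = ?m * comm_sign ?U S" using \<epsilon> by (auto simp: blade_sign_square)
    also have "\<dots> = \<tau> S * (((if y then (- 1) ^ card (S \<inter> skew) else 1) * (if y then (- 1) ^ card (S \<inter> skew) else 1)) *
       ((if z then (- 1) ^ card (S \<inter> cplx) else 1) * (if z then (- 1) ^ card (S \<inter> cplx) else 1)))"
      unfolding v comm_sign_ext_set[OF S] \<tau>_def by (cases y; simp only: if_True if_False mult_1 mult_1_right ac_simps)
    finally have "\<epsilon> * ?m * (\<epsilon> * blade_sign p ?U ?U) * (comm_sign ?U S * blade_sign p ?U ?U) = \<tau> S"
      unfolding sq by simp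
    then show ?thesis unfolding 2 1 smult_smult_mat by simp
  qed
  \<comment> \<open>Restricting the sum to a family \<open>F\<close> of blades allows induction over
    the terms of \<open>spin_rep\<close>.\<close>
  define rep where "rep F A = mat N N (\<lambda>ij. \<Sum>S\<in>F. A S * (E S $$ ij))" for F and A :: clif
  have repc[simp]: "rep F A \<in> carrier_mat N N" for F A by (simp add: rep_def)
  have rep_insert: "rep (insert S F) A = A S \<cdot>\<^sub>m E S + rep F A"
    if "S \<notin> F" "finite F" "S \<subseteq> {..<n}" for S F A
    using that E_carrier[OF that(3)] by (intro eq_matI) (auto simp: rep_def)
  have main: "rep F (cl_transform v A) = ?X * mat_transform v (rep F A) * Y"
    if "finite F" "F \<subseteq> Pow {..<n}" for F A
    using that
  proof (induction F rule: finite_induct)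
    case empty
    have z: "rep {} A = 0\<^sub>m N N" for A by (intro eq_matI) (auto simp: rep_def)
    have "mat_transform v (0\<^sub>m N N) = 0\<^sub>m N N" unfolding v
      by (intro eq_matI) (auto simp: mat_cnj_def)
    then show ?case using right_mult_zero_mat[OF c(2)] left_mult_zero_mat[OF c(3)] by (simp add: z)
  next
    case (insert S F)
    then have S: "S \<subseteq> {..<n}" by simp
    note ES = E_carrier[OF S]
    have mt: "mat_transform v (E S) \<in> carrier_mat N N" "mat_transform v (rep F A) \<in> carrier_mat N N"
      by (rule mat_transform_carrier, simp add: ES)+
    have "mat_transform v (rep (insert S F) A) = cc (A S) \<cdot>\<^sub>m mat_transform v (E S) + mat_transform v (rep F A)"
      using insert.hyps S ES by (simp add: rep_insert mat_transform_add v mat_transform_smult cc_def del: mat_transform.simps)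
    then have "?X * mat_transform v (rep (insert S F) A) * Y =
        ?X * (cc (A S) \<cdot>\<^sub>m mat_transform v (E S)) * Y + ?X * mat_transform v (rep F A) * Y"
      using mt by (simp add: mult_add_distrib_mat[of _ N N _ N] add_mult_distrib_mat[of _ N N _ _ N]
          mult_carrier_mat[of _ N N])
    also have "?X * (cc (A S) \<cdot>\<^sub>m mat_transform v (E S)) * Y = cc (A S) \<cdot>\<^sub>m (?X * mat_transform v (E S) * Y)"
      using mt by (simp add: smult_mult mult_carrier_mat[of _ N N])
    also have "\<dots> = cl_transform v A S \<cdot>\<^sub>m E S"
      unfolding blade[OF S] tr by (simp add: smult_smult_mat mult.commute)
    also have "?X * mat_transform v (rep F A) * Y = rep F (cl_transform v A)"
      using insert by simp
    finally show ?case using insert.hyps S by (simp add: rep_insert)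
  qed
  have sr: "spin_rep p q N Es A = rep (Pow {..<n}) A" for A by (simp add: spin_rep_def rep_def)
  show ?thesis
    unfolding represents_def sr using main[OF _ order_refl] XY by (auto intro!: bexI[of _ Y])
qed

lemma spinor_system: "spinor_system p q N Es"
  using spinbasis represents_ext_mat by (simp add: spinor_system_def)

end

section \<open>Double coverings\<close>

lemma group_bool_group: "group bool_group"
  by (rule groupI) (auto simp: bool_group_def)

lemma group_cpt_labels: "group cpt_labels" and group_pt_labels: "group pt_labels"
  by (auto simp: cpt_labels_def pt_labels_def intro!: DirProd_group group_bool_group)

lemma carrier_labels [simp]: "carrier cpt_labels = UNIV" "carrier pt_labels = UNIV"
  by (auto simp: cpt_labels_def pt_labels_def bool_group_def)

lemma cpt_labels_mult: "(x, y, z) \<otimes>\<^bsub>cpt_labels\<^esub> (x', y', z') = (x \<noteq> x', y \<noteq> y', z \<noteq> z')"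
  and cpt_labels_one: "\<one>\<^bsub>cpt_labels\<^esub> = (False, False, False)"
  and pt_labels_mult: "(x, y) \<otimes>\<^bsub>pt_labels\<^esub> (x', y') = (x \<noteq> x', y \<noteq> y')"
  and pt_labels_one: "\<one>\<^bsub>pt_labels\<^esub> = (False, False)"
  by (auto simp: cpt_labels_def pt_labels_def bool_group_def)

lemma hom_pt_cpt:
  assumes "\<pi> \<in> hom C pt_labels"
  shows "(\<lambda>c. (fst (\<pi> c), snd (\<pi> c), False)) \<in> hom C cpt_labels"
proof (rule homI)
  fix x y assume "x \<in> carrier C" "y \<in> carrier C"
  with assms have "\<pi> (x \<otimes>\<^bsub>C\<^esub> y) = \<pi> x \<otimes>\<^bsub>pt_labels\<^esub> \<pi> y" by (rule hom_mult)
  then show "(fst (\<pi> (x \<otimes>\<^bsub>C\<^esub> y)), snd (\<pi> (x \<otimes>\<^bsub>C\<^esub> y)), False) =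
      (fst (\<pi> x), snd (\<pi> x), False) \<otimes>\<^bsub>cpt_labels\<^esub> (fst (\<pi> y), snd (\<pi> y), False)"
    by (cases "\<pi> x"; cases "\<pi> y") (simp add: cpt_labels_mult pt_labels_mult)
qed simp

definition sign_value :: "sign \<Rightarrow> complex" where
  "sign_value s = (case s of Plus \<Rightarrow> 1 | Minus \<Rightarrow> - 1)"

text \<open>A kernel of order two is central: a conjugate of \<open>z\<close> lies in it and differs
  from the unit, hence equals \<open>z\<close>. The square of \<open>z\<close> lies in it too and
  differs from \<open>z\<close>.\<close>

lemma double_covering_kernel:
  assumes "double_covering C Q \<pi> z" "group Q"
  shows "z \<in> carrier C" "z \<otimes>\<^bsub>C\<^esub> z = \<one>\<^bsub>C\<^esub>" "\<pi> z = \<one>\<^bsub>Q\<^esub>"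
    and "\<And>x. x \<in> carrier C \<Longrightarrow> x \<otimes>\<^bsub>C\<^esub> z = z \<otimes>\<^bsub>C\<^esub> x"
    and "\<And>x. x \<in> carrier C \<Longrightarrow> \<pi> x = \<one>\<^bsub>Q\<^esub> \<Longrightarrow> x = \<one>\<^bsub>C\<^esub> \<or> x = z"
proof -
  note d = assms(1)[unfolded double_covering_def]
  interpret group_hom C Q \<pi>
    using d assms(2) by (simp add: group_hom_def group_hom_axioms_def)
  have k: "kernel C Q \<pi> = {\<one>\<^bsub>C\<^esub>, z}" "z \<noteq> \<one>\<^bsub>C\<^esub>" using d by auto
  have "z \<in> kernel C Q \<pi>" using k by simp
  then show z: "z \<in> carrier C" "\<pi> z = \<one>\<^bsub>Q\<^esub>" by (auto simp: kernel_def)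
  show ker: "x = \<one>\<^bsub>C\<^esub> \<or> x = z" if "x \<in> carrier C" "\<pi> x = \<one>\<^bsub>Q\<^esub>" for x
    using k(1) that by (auto simp: kernel_def)
  have "z \<otimes>\<^bsub>C\<^esub> z \<noteq> z" using z k(2) by (metis G.l_cancel_one')
  with ker[of "z \<otimes>\<^bsub>C\<^esub> z"] z show "z \<otimes>\<^bsub>C\<^esub> z = \<one>\<^bsub>C\<^esub>" by simp
  show "x \<otimes>\<^bsub>C\<^esub> z = z \<otimes>\<^bsub>C\<^esub> x" if x: "x \<in> carrier C" for x
  proof -
    let ?y = "x \<otimes>\<^bsub>C\<^esub> z \<otimes>\<^bsub>C\<^esub> inv\<^bsub>C\<^esub> x"
    have y: "?y \<in> carrier C" "\<pi> ?y = \<one>\<^bsub>Q\<^esub>" using x z by simp_all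
    have e: "?y \<otimes>\<^bsub>C\<^esub> x = x \<otimes>\<^bsub>C\<^esub> z" using x z by (simp add: G.m_assoc)
    have "?y \<noteq> \<one>\<^bsub>C\<^esub>"
    proof
      assume "?y = \<one>\<^bsub>C\<^esub>"
      with e x have "x \<otimes>\<^bsub>C\<^esub> z = x" by simp
      with x z k(2) show False by (simp add: G.l_cancel_one)
    qed
    with ker[OF y] have "?y = z" by blast
    with e show ?thesis by simp
  qed
qed

lemma group_cpt_pin_covering:
  assumes "double_covering C cpt_labels \<pi> z"
  shows "group (cpt_pin p q C \<pi> z)"
proof (rule group_cpt_pin(3))
  note k = double_covering_kernel(1-4)[OF assms group_cpt_labels, unfolded cpt_labels_one]
  show "group C" "\<pi> \<in> hom C cpt_labels" using assms by (simp_all add: double_covering_def)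
  show "z \<in> carrier C" "z \<otimes>\<^bsub>C\<^esub> z = \<one>\<^bsub>C\<^esub>" "\<pi> z = (False, False, False)" by (rule k)+
  show "x \<otimes>\<^bsub>C\<^esub> z = z \<otimes>\<^bsub>C\<^esub> x" if "x \<in> carrier C" for x using that by (rule k)
qed

lemma group_pt_pin_covering:
  assumes "double_covering C pt_labels \<pi> z"
  shows "group (pt_pin p q C \<pi> z)"
proof -
  note k = double_covering_kernel(1-4)[OF assms group_pt_labels, unfolded pt_labels_one]
  show ?thesis
    unfolding pt_pin_def
  proof (rule group_cpt_pin(3))
    show "group C" "(\<lambda>c. (fst (\<pi> c), snd (\<pi> c), False)) \<in> hom C cpt_labels"
      using assms hom_pt_cpt by (auto simp: double_covering_def)
    show "z \<in> carrier C" "z \<otimes>\<^bsub>C\<^esub> z = \<one>\<^bsub>C\<^esub>" by (rule k)+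
    show "(fst (\<pi> z), snd (\<pi> z), False) = (False, False, False)" by (simp add: k(3))
    show "x \<otimes>\<^bsub>C\<^esub> z = z \<otimes>\<^bsub>C\<^esub> x" if "x \<in> carrier C" for x using that by (rule k)
  qed
qed

lemma double_covering_transport:
  assumes "double_covering C Q \<pi> z" "group Q" "lift_squares C \<pi> z \<sigma>" "group D" "h \<in> iso C D"
  shows "double_covering D Q (\<pi> \<circ> inv_into (carrier C) h) (h z)"
    and "lift_squares D (\<pi> \<circ> inv_into (carrier C) h) (h z) \<sigma>"
proof -
  let ?g = "inv_into (carrier C) h"
  note d = assms(1)[unfolded double_covering_def]
  note zk = double_covering_kernel[OF assms(1,2)]
  interpret C: group C using d by blast
  interpret D: group D by fact
  have g: "?g \<in> iso D C" by (rule C.iso_set_sym[OF assms(5)])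
  have h: "h \<in> hom C D" "bij_betw h (carrier C) (carrier D)" "inj_on h (carrier C)"
    using assms(5) by (auto simp: iso_def bij_betw_def)
  have im: "h ` carrier C = carrier D" using h(2) by (rule bij_betw_imp_surj_on)
  have gh[simp]: "?g (h c) = c" if "c \<in> carrier C" for c
    using h(3) that by (rule inv_into_f_f)
  have hc[simp]: "h c \<in> carrier D" if "c \<in> carrier C" for c
    using im that by blast
  have h1: "h \<one>\<^bsub>C\<^esub> = \<one>\<^bsub>D\<^esub>" using hom_one[OF h(1) C.is_group D.is_group] .
  have pi: "\<pi> \<circ> ?g \<in> hom D Q"
    using hom_compose[of ?g D C \<pi> Q] g d by (simp add: iso_def)
  have surj: "(\<pi> \<circ> ?g) ` carrier D = carrier Q"
    using d unfolding im[symmetric] image_image by simp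
  have z: "h z \<noteq> \<one>\<^bsub>D\<^esub>"
    using d h(3) zk(1) h1 by (metis C.one_closed inj_onD)
  have "kernel D Q (\<pi> \<circ> ?g) = h ` kernel C Q \<pi>"
    unfolding kernel_def im[symmetric] by (auto simp: image_iff)
  also have "\<dots> = {\<one>\<^bsub>D\<^esub>, h z}" using d h1 by simp
  finally show "double_covering D Q (\<pi> \<circ> ?g) (h z)"
    unfolding double_covering_def using pi surj z assms(4) by blast
  show "lift_squares D (\<pi> \<circ> ?g) (h z) \<sigma>"
    unfolding lift_squares_def
  proof
    fix x assume "x \<in> carrier D"
    then obtain c where c: "c \<in> carrier C" "x = h c" using im by blast
    have "x \<otimes>\<^bsub>D\<^esub> x = h (c \<otimes>\<^bsub>C\<^esub> c)" using c hom_mult[OF h(1)] by simp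
    also have "\<dots> = h (case \<sigma> (\<pi> c) of Plus \<Rightarrow> \<one>\<^bsub>C\<^esub> | Minus \<Rightarrow> z)"
      using assms(3) c unfolding lift_squares_def by simp
    also have "\<dots> = (case \<sigma> ((\<pi> \<circ> ?g) x) of Plus \<Rightarrow> \<one>\<^bsub>D\<^esub> | Minus \<Rightarrow> h z)"
      using c h1 by (simp split: sign.splits)
    finally show "x \<otimes>\<^bsub>D\<^esub> x = (case \<sigma> ((\<pi> \<circ> ?g) x) of Plus \<Rightarrow> \<one>\<^bsub>D\<^esub> | Minus \<Rightarrow> h z)" .
  qed
qed

text \<open>The eight labels with and the four labels without conjugation are treated at once:
  \<open>Q\<close> is the label group and \<open>V\<close> the additive assignment of index sets.
  The signs relating \<open>X\<close> to blades affect neither the squares nor the group of signed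
  matrices.\<close>

locale blade_family = spinor_matrices +
  fixes X :: "'v \<Rightarrow> complex mat" and V :: "'v \<Rightarrow> nat set" and Q :: "'v monoid"
  assumes group_Q: "group Q" and carrier_Q: "carrier Q = UNIV"
    and V_subset: "V v \<subseteq> {..<p + q}" and V_mult: "V (u \<otimes>\<^bsub>Q\<^esub> v) = sym_diff (V u) (V v)"
    and X_V: "\<exists>\<epsilon>. (\<epsilon> = 1 \<or> \<epsilon> = - 1) \<and> X v = \<epsilon> \<cdot>\<^sub>m mat_prod N Es (V v)"
begin

abbreviation G where "G \<equiv> signed_group N X"

lemma V_one: "V \<one>\<^bsub>Q\<^esub> = {}"
proof -
  interpret Q: group Q by (rule group_Q)
  show ?thesis using V_mult[of "\<one>\<^bsub>Q\<^esub>" "\<one>\<^bsub>Q\<^esub>"] by simp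
qed

lemma EV_carrier [simp]: "E (V v) \<in> carrier_mat N N"
  by (rule E_carrier[OF V_subset])

lemma X_square: "X v * X v = blade_sign p (V v) (V v) \<cdot>\<^sub>m 1\<^sub>m N"
proof -
  obtain \<epsilon> where "\<epsilon> = 1 \<or> \<epsilon> = - 1" "X v = \<epsilon> \<cdot>\<^sub>m E (V v)" using X_V by blast
  then show ?thesis by (auto simp: smult_mult E_square[OF V_subset] smult_smult_mat)
qed

lemma has_squares_iff:
  "has_squares N X \<sigma> \<longleftrightarrow> (\<forall>v. blade_sign p (V v) (V v) = sign_value (\<sigma> v))"
proof -
  have "(case s of Plus \<Rightarrow> 1\<^sub>m N | Minus \<Rightarrow> - 1\<^sub>m N) = sign_value s \<cdot>\<^sub>m 1\<^sub>m N" for s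
    by (simp add: sign_value_def uminus_smult_mat split: sign.splits)
  then show ?thesis by (simp add: has_squares_def X_square smult_one_eq_iff)
qed

lemma carrier_G: "M \<in> carrier G \<longleftrightarrow> (\<exists>v \<epsilon>. (\<epsilon> = 1 \<or> \<epsilon> = - 1) \<and> M = \<epsilon> \<cdot>\<^sub>m E (V v))"
proof -
  have "(M = X v \<or> M = - X v) \<longleftrightarrow> (\<exists>\<epsilon>. (\<epsilon> = 1 \<or> \<epsilon> = - 1) \<and> M = \<epsilon> \<cdot>\<^sub>m E (V v))" for v
  proof -
    obtain \<delta> where "\<delta> = 1 \<or> \<delta> = - 1" "X v = \<delta> \<cdot>\<^sub>m E (V v)" using X_V by blast
    then show ?thesis by (auto simp: uminus_smult_mat smult_smult_mat)
  qed
  then show ?thesis unfolding signed_group_def by auto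
qed

lemma group_G: "group G"
proof (rule groupI)
  fix M K assume "M \<in> carrier G" "K \<in> carrier G"
  then obtain u \<epsilon> v \<delta> where 1: "\<epsilon> = 1 \<or> \<epsilon> = - 1" "M = \<epsilon> \<cdot>\<^sub>m E (V u)"
    and 2: "\<delta> = 1 \<or> \<delta> = - 1" "K = \<delta> \<cdot>\<^sub>m E (V v)" unfolding carrier_G by blast
  have "M * K = (\<epsilon> * \<delta> * blade_sign p (V u) (V v)) \<cdot>\<^sub>m E (V (u \<otimes>\<^bsub>Q\<^esub> v))"
    by (simp add: 1 2 smult_mult smult_smult_mat E_mult[OF V_subset V_subset] V_mult ac_simps)
  moreover have "\<epsilon> * \<delta> * blade_sign p (V u) (V v) = 1 \<or> \<epsilon> * \<delta> * blade_sign p (V u) (V v) = - 1"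
    using 1 2 blade_sign_cases[of p "V u" "V v"] by auto
  ultimately show "M \<otimes>\<^bsub>G\<^esub> K \<in> carrier G"
    unfolding carrier_G by (auto simp: signed_group_def)
next
  show "\<one>\<^bsub>G\<^esub> \<in> carrier G" unfolding carrier_G
    by (intro exI[of _ "\<one>\<^bsub>Q\<^esub>"] exI[of _ 1]) (simp add: signed_group_def V_one)
next
  fix M K L assume "M \<in> carrier G" "K \<in> carrier G" "L \<in> carrier G"
  then have "M \<in> carrier_mat N N" "K \<in> carrier_mat N N" "L \<in> carrier_mat N N"
    unfolding carrier_G by auto
  then show "M \<otimes>\<^bsub>G\<^esub> K \<otimes>\<^bsub>G\<^esub> L = M \<otimes>\<^bsub>G\<^esub> (K \<otimes>\<^bsub>G\<^esub> L)"
    by (simp add: signed_group_def)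
next
  fix M assume "M \<in> carrier G"
  then obtain u \<epsilon> where 1: "\<epsilon> = 1 \<or> \<epsilon> = - 1" "M = \<epsilon> \<cdot>\<^sub>m E (V u)" unfolding carrier_G by blast
  then show "\<one>\<^bsub>G\<^esub> \<otimes>\<^bsub>G\<^esub> M = M" by (simp add: signed_group_def left_mult_one_mat[of _ N N])
  let ?K = "(\<epsilon> * blade_sign p (V u) (V u)) \<cdot>\<^sub>m E (V u)"
  have "?K * M = 1\<^sub>m N"
    using 1 by (auto simp: smult_mult smult_smult_mat E_square[OF V_subset] blade_sign_square)
  moreover have "?K \<in> carrier G"
    unfolding carrier_G using 1 blade_sign_cases[of p "V u" "V u"]
    by (intro exI[of _ u] exI[of _ "\<epsilon> * blade_sign p (V u) (V u)"]) auto
  ultimately show "\<exists>K\<in>carrier G. K \<otimes>\<^bsub>G\<^esub> M = \<one>\<^bsub>G\<^esub>"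
    by (auto simp: signed_group_def)
qed

text \<open>Proportional blades have equal index sets, so labels can be confused only where
  \<open>V\<close> takes the same value.\<close>

lemma distinct_iff: "distinct_up_to_sign X \<longleftrightarrow> inj V"
proof
  assume d: "distinct_up_to_sign X"
  show "inj V"
  proof (rule injI)
    fix u v assume e: "V u = V v"
    obtain \<epsilon> \<delta> where "\<epsilon> = 1 \<or> \<epsilon> = - 1" "X u = \<epsilon> \<cdot>\<^sub>m E (V u)" "\<delta> = 1 \<or> \<delta> = - 1" "X v = \<delta> \<cdot>\<^sub>m E (V v)"
      using X_V by metis
    with e have "X u = X v \<or> X u = - X v" by (auto simp: uminus_smult_mat smult_smult_mat)
    with d show "u = v" unfolding distinct_up_to_sign_def by blast
  qed
next
  assume inj: "inj V"
  show "distinct_up_to_sign X"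
    unfolding distinct_up_to_sign_def
  proof (intro allI impI)
    fix u v assume e: "X u = X v \<or> X u = - X v"
    obtain \<epsilon> \<delta> where 1: "\<epsilon> = 1 \<or> \<epsilon> = - 1" "X u = \<epsilon> \<cdot>\<^sub>m E (V u)" "\<delta> = 1 \<or> \<delta> = - 1" "X v = \<delta> \<cdot>\<^sub>m E (V v)"
      using X_V by metis
    with e obtain c where "\<epsilon> \<cdot>\<^sub>m E (V u) = c \<cdot>\<^sub>m E (V v)"
      by (auto simp: uminus_smult_mat smult_smult_mat)
    then have "\<epsilon> \<cdot>\<^sub>m (\<epsilon> \<cdot>\<^sub>m E (V u)) = \<epsilon> \<cdot>\<^sub>m (c \<cdot>\<^sub>m E (V v))" by simp
    with 1(1) have "E (V u) = (\<epsilon> * c) \<cdot>\<^sub>m E (V v)" by (auto simp: smult_smult_mat)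
    then have "V u = V v" by (rule E_eq_imp_eq[OF V_subset V_subset])
    with inj show "u = v" by (simp add: inj_eq)
  qed
qed

lemma signed_proj_eq:
  assumes "inj V" "\<epsilon> = 1 \<or> \<epsilon> = - 1"
  shows "signed_proj X (\<epsilon> \<cdot>\<^sub>m E (V v)) = v"
proof -
  obtain \<delta> where \<delta>: "\<delta> = 1 \<or> \<delta> = - 1" "X v = \<delta> \<cdot>\<^sub>m E (V v)" using X_V by metis
  have M: "\<epsilon> \<cdot>\<^sub>m E (V v) = X v \<or> \<epsilon> \<cdot>\<^sub>m E (V v) = - X v"
    using assms(2) \<delta> by (auto simp: uminus_smult_mat smult_smult_mat)
  show ?thesis
    unfolding signed_proj_def
  proof (rule the_equality[where P="\<lambda>u. \<epsilon> \<cdot>\<^sub>m E (V v) = X u \<or> \<epsilon> \<cdot>\<^sub>m E (V v) = - X u", OF M])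
    fix u assume "\<epsilon> \<cdot>\<^sub>m E (V v) = X u \<or> \<epsilon> \<cdot>\<^sub>m E (V v) = - X u"
    with M have "X u = X v \<or> X u = - X v" by (metis uminus_uminus_mat)
    with assms(1) show "u = v" unfolding distinct_iff[symmetric] distinct_up_to_sign_def by blast
  qed
qed

text \<open>An element determines its index set and therefore its label. Index sets of products are
  symmetric differences, so reading off the label is a homomorphism, and the signs of the empty
  blade form its kernel.\<close>

lemma double_covering_G:
  assumes inj: "inj V"
  shows "double_covering G Q (signed_proj X) (- 1\<^sub>m N)"
proof -
  note proj = signed_proj_eq[OF inj]
  have "signed_proj X \<in> hom G Q"
  proof (rule homI)
    fix M K assume "M \<in> carrier G" "K \<in> carrier G"
    then obtain u \<epsilon> v \<delta> where 1: "\<epsilon> = 1 \<or> \<epsilon> = - 1" "M = \<epsilon> \<cdot>\<^sub>m E (V u)"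
      and 2: "\<delta> = 1 \<or> \<delta> = - 1" "K = \<delta> \<cdot>\<^sub>m E (V v)" unfolding carrier_G by blast
    have "M * K = (\<epsilon> * \<delta> * blade_sign p (V u) (V v)) \<cdot>\<^sub>m E (V (u \<otimes>\<^bsub>Q\<^esub> v))"
      by (simp add: 1 2 smult_mult smult_smult_mat E_mult[OF V_subset V_subset] V_mult ac_simps)
    moreover have "\<epsilon> * \<delta> * blade_sign p (V u) (V v) = 1 \<or> \<epsilon> * \<delta> * blade_sign p (V u) (V v) = - 1"
      using 1 2 blade_sign_cases[of p "V u" "V v"] by auto
    ultimately have "signed_proj X (M * K) = u \<otimes>\<^bsub>Q\<^esub> v" using proj by metis
    then show "signed_proj X (M \<otimes>\<^bsub>G\<^esub> K) = signed_proj X M \<otimes>\<^bsub>Q\<^esub> signed_proj X K"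
      using 1 2 proj by (simp add: signed_group_def)
  qed (simp add: carrier_Q)
  moreover have "signed_proj X ` carrier G = UNIV"
  proof -
    have "v \<in> signed_proj X ` carrier G" for v
      using proj[of 1 v] carrier_G by (metis image_eqI)
    then show ?thesis by blast
  qed
  moreover have "- 1\<^sub>m N \<noteq> (1\<^sub>m N :: complex mat)"
    using smult_one_eq_iff[of "- 1" 1] by (simp add: uminus_smult_mat)
  moreover have "kernel G Q (signed_proj X) = {1\<^sub>m N, - 1\<^sub>m N}"
  proof -
    have "M \<in> kernel G Q (signed_proj X) \<longleftrightarrow> (\<exists>\<epsilon>. (\<epsilon> = 1 \<or> \<epsilon> = - 1) \<and> M = \<epsilon> \<cdot>\<^sub>m E (V \<one>\<^bsub>Q\<^esub>))" for M
    proof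
      assume "M \<in> kernel G Q (signed_proj X)"
      then have "M \<in> carrier G" "signed_proj X M = \<one>\<^bsub>Q\<^esub>" by (auto simp: kernel_def)
      then show "\<exists>\<epsilon>. (\<epsilon> = 1 \<or> \<epsilon> = - 1) \<and> M = \<epsilon> \<cdot>\<^sub>m E (V \<one>\<^bsub>Q\<^esub>)"
        unfolding carrier_G using proj by metis
    next
      assume "\<exists>\<epsilon>. (\<epsilon> = 1 \<or> \<epsilon> = - 1) \<and> M = \<epsilon> \<cdot>\<^sub>m E (V \<one>\<^bsub>Q\<^esub>)"
      then obtain \<epsilon> where \<epsilon>: "\<epsilon> = 1 \<or> \<epsilon> = - 1" "M = \<epsilon> \<cdot>\<^sub>m E (V \<one>\<^bsub>Q\<^esub>)" by blast
      then have "M \<in> carrier G" unfolding carrier_G by blast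
      with \<epsilon> proj show "M \<in> kernel G Q (signed_proj X)" by (simp add: kernel_def)
    qed
    moreover have "(\<exists>\<epsilon>. (\<epsilon> = 1 \<or> \<epsilon> = - 1) \<and> M = \<epsilon> \<cdot>\<^sub>m E (V \<one>\<^bsub>Q\<^esub>)) \<longleftrightarrow> M = 1\<^sub>m N \<or> M = - 1\<^sub>m N"
      for M :: "complex mat"
      unfolding V_one mat_prod_empty uminus_smult_mat using one_smult_mat by metis
    ultimately show ?thesis by blast
  qed
  ultimately show ?thesis
    unfolding double_covering_def using group_G by (simp add: carrier_Q) (simp add: signed_group_def)
qed

lemma lift_squares_G:
  assumes inj: "inj V" and sq: "has_squares N X \<sigma>"
  shows "lift_squares G (signed_proj X) (- 1\<^sub>m N) \<sigma>"
  unfolding lift_squares_def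
proof
  fix M assume "M \<in> carrier G"
  then obtain u \<epsilon> where 1: "\<epsilon> = 1 \<or> \<epsilon> = - 1" "M = \<epsilon> \<cdot>\<^sub>m E (V u)" unfolding carrier_G by blast
  then have "signed_proj X M = u" using signed_proj_eq[OF inj] by simp
  moreover have "M * M = blade_sign p (V u) (V u) \<cdot>\<^sub>m 1\<^sub>m N"
    using 1 by (auto simp: smult_mult smult_smult_mat E_square[OF V_subset])
  then have "M * M = X u * X u" by (simp add: X_square)
  moreover have "M \<otimes>\<^bsub>G\<^esub> M = M * M" "\<one>\<^bsub>G\<^esub> = 1\<^sub>m N" by (simp_all add: signed_group_def)
  ultimately show "M \<otimes>\<^bsub>G\<^esub> M = (case \<sigma> (signed_proj X M) of Plus \<Rightarrow> \<one>\<^bsub>G\<^esub> | Minus \<Rightarrow> - 1\<^sub>m N)"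
    using sq by (cases "\<sigma> u") (simp_all add: has_squares_def)
qed

end

section \<open>The families of CPT and PT matrices\<close>

context spinor_matrices
begin

lemma ext_set_mult: "ext_set (u \<otimes>\<^bsub>cpt_labels\<^esub> v) = sym_diff (ext_set u) (ext_set v)"
proof -
  obtain x y z x' y' z' where "u = (x, y, z)" "v = (x', y', z')" by (metis prod_cases3)
  then show ?thesis
    by (cases x; cases y; cases z; cases x'; cases y'; cases z') (simp_all add: cpt_labels_mult, blast+)
qed

lemma blade_family_cpt: "blade_family p q N Es (ext_mat n N Es) ext_set cpt_labels"
  by (intro blade_family.intro blade_family_axioms.intro spinor_matrices_axioms)
    (rule group_cpt_labels carrier_labels ext_set_subset ext_set_mult ext_mat_E)+

lemma blade_family_pt: "blade_family p q N Es (pt_mat n N Es) (\<lambda>v. ext_set (fst v, snd v, False)) pt_labels"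
proof (intro blade_family.intro blade_family_axioms.intro spinor_matrices_axioms)
  fix u v
  have "(fst (u \<otimes>\<^bsub>pt_labels\<^esub> v), snd (u \<otimes>\<^bsub>pt_labels\<^esub> v), False) =
    (fst u, snd u, False) \<otimes>\<^bsub>cpt_labels\<^esub> (fst v, snd v, False)"
    by (cases u; cases v) (simp add: cpt_labels_mult pt_labels_mult)
  then show "ext_set (fst (u \<otimes>\<^bsub>pt_labels\<^esub> v), snd (u \<otimes>\<^bsub>pt_labels\<^esub> v), False) =
      sym_diff (ext_set (fst u, snd u, False)) (ext_set (fst v, snd v, False))"
    by (simp only: ext_set_mult)
next
  fix v
  have "pt_mat n N Es v = ext_mat n N Es (fst v, snd v, False)" by (cases v) simp
  then show "\<exists>\<epsilon>. (\<epsilon> = 1 \<or> \<epsilon> = - 1) \<and> pt_mat n N Es v = \<epsilon> \<cdot>\<^sub>m E (ext_set (fst v, snd v, False))"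
    by (simp only: ext_mat_E)
qed (rule group_pt_labels carrier_labels ext_set_subset)+

text \<open>Reduces a structure to the combinatorics of index sets: the representation property
  holds for every spinbasis here, and the covering and the group axioms follow from
  injectivity.\<close>

lemma cpt_structure_iff:
  "cpt_structure p q N Es \<sigma> \<longleftrightarrow> inj ext_set \<and>
     (\<forall>v. blade_sign p (ext_set v) (ext_set v) = sign_value (cpt_sign_at \<sigma> v))"
proof -
  interpret blade_family p q N Es "ext_mat n N Es" ext_set cpt_labels by (rule blade_family_cpt)
  have "group (Pin_cpt p q N Es)" if "inj ext_set"
    unfolding Pin_cpt_def cpt_cover_def by (rule group_cpt_pin_covering[OF double_covering_G[OF that]])
  then show ?thesis
    unfolding cpt_structure_def cpt_cover_def has_squares_iff distinct_iff
    using double_covering_G spinor_system by auto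
qed

lemma pt_structure_iff:
  "pt_structure p q N Es \<sigma> \<longleftrightarrow> distinct_up_to_sign (pt_mat n N Es) \<and> has_squares N (pt_mat n N Es) (pt_sign_at \<sigma>)"
proof -
  let ?V = "\<lambda>v. ext_set (fst v, snd v, False)"
  interpret blade_family p q N Es "pt_mat n N Es" ?V pt_labels by (rule blade_family_pt)
  have "group (Pin_pt p q N Es)" if "inj ?V"
    unfolding Pin_pt_def pt_cover_def by (rule group_pt_pin_covering[OF double_covering_G[OF that]])
  then show ?thesis
    unfolding pt_structure_def pt_cover_def distinct_iff
    using double_covering_G spinor_system by auto
qed

end

lemma cpt_structure_covering:
  assumes "cpt_structure p q N Es \<sigma>" "even (p + q)"
  shows "double_covering (cpt_cover (p + q) N Es) cpt_labels (signed_proj (ext_mat (p + q) N Es)) (- 1\<^sub>m N)"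
    and "lift_squares (cpt_cover (p + q) N Es) (signed_proj (ext_mat (p + q) N Es)) (- 1\<^sub>m N) (cpt_sign_at \<sigma>)"
proof -
  interpret spinor_matrices p q N Es
    using assms by unfold_locales (auto simp: cpt_structure_def spinor_system_def)
  interpret blade_family p q N Es "ext_mat n N Es" ext_set cpt_labels by (rule blade_family_cpt)
  have "inj ext_set" "has_squares N (ext_mat n N Es) (cpt_sign_at \<sigma>)"
    using assms(1) distinct_iff by (auto simp: cpt_structure_def)
  then show "double_covering (cpt_cover (p + q) N Es) cpt_labels (signed_proj (ext_mat (p + q) N Es)) (- 1\<^sub>m N)"
    "lift_squares (cpt_cover (p + q) N Es) (signed_proj (ext_mat (p + q) N Es)) (- 1\<^sub>m N) (cpt_sign_at \<sigma>)"
    unfolding cpt_cover_def using double_covering_G lift_squares_G by blast+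
qed

lemma Pin_cpt_isI:
  assumes "cpt_structure p q N Es \<sigma>" "even (p + q)" "cpt_cover (p + q) N Es \<cong> C" "group C"
  shows "Pin_cpt_is p q N Es \<sigma> C"
proof -
  note d = cpt_structure_covering[OF assms(1,2)]
  note k = double_covering_kernel[OF d(1) group_cpt_labels, unfolded cpt_labels_one]
  obtain h where h: "h \<in> iso (cpt_cover (p + q) N Es) C" using assms(3) by (auto simp: is_iso_def)
  have "Pin_cpt p q N Es \<cong> cpt_pin p q C (signed_proj (ext_mat (p + q) N Es) \<circ>
      inv_into (carrier (cpt_cover (p + q) N Es)) h) (h (- 1\<^sub>m N))"
    unfolding Pin_cpt_def
  proof (rule cpt_pin_transport)
    show "group (cpt_cover (p + q) N Es)" "signed_proj (ext_mat (p + q) N Es) \<in> hom (cpt_cover (p + q) N Es) cpt_labels"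
      using d(1) by (simp_all add: double_covering_def)
  qed (rule h assms k | erule k)+
  with double_covering_transport[OF d(1) group_cpt_labels d(2) assms(4) h] assms(3) show ?thesis
    unfolding Pin_cpt_is_def by blast
qed

lemma pt_structure_covering:
  assumes "pt_structure p q N Es \<sigma>" "even (p + q)"
  shows "double_covering (pt_cover (p + q) N Es) pt_labels (signed_proj (pt_mat (p + q) N Es)) (- 1\<^sub>m N)"
    and "lift_squares (pt_cover (p + q) N Es) (signed_proj (pt_mat (p + q) N Es)) (- 1\<^sub>m N) (pt_sign_at \<sigma>)"
proof -
  interpret spinor_matrices p q N Es
    using assms by unfold_locales (auto simp: pt_structure_def spinor_system_def)
  let ?V = "\<lambda>v. ext_set (fst v, snd v, False)"
  interpret blade_family p q N Es "pt_mat n N Es" ?V pt_labels by (rule blade_family_pt)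
  have "inj ?V" "has_squares N (pt_mat n N Es) (pt_sign_at \<sigma>)"
    using assms(1) distinct_iff by (auto simp: pt_structure_def)
  then show "double_covering (pt_cover (p + q) N Es) pt_labels (signed_proj (pt_mat (p + q) N Es)) (- 1\<^sub>m N)"
    "lift_squares (pt_cover (p + q) N Es) (signed_proj (pt_mat (p + q) N Es)) (- 1\<^sub>m N) (pt_sign_at \<sigma>)"
    unfolding pt_cover_def using double_covering_G lift_squares_G by blast+
qed

lemma Pin_pt_isI:
  assumes "pt_structure p q N Es \<sigma>" "even (p + q)" "pt_cover (p + q) N Es \<cong> C" "group C"
  shows "Pin_pt_is p q N Es \<sigma> C"
proof -
  note d = pt_structure_covering[OF assms(1,2)]
  note k = double_covering_kernel[OF d(1) group_pt_labels, unfolded pt_labels_one]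
  let ?\<pi> = "signed_proj (pt_mat (p + q) N Es)"
  obtain h where h: "h \<in> iso (pt_cover (p + q) N Es) C" using assms(3) by (auto simp: is_iso_def)
  let ?g = "inv_into (carrier (pt_cover (p + q) N Es)) h"
  have "cpt_pin p q (pt_cover (p + q) N Es) (\<lambda>c. (fst (?\<pi> c), snd (?\<pi> c), False)) (- 1\<^sub>m N) \<cong>
      cpt_pin p q C ((\<lambda>c. (fst (?\<pi> c), snd (?\<pi> c), False)) \<circ> ?g) (h (- 1\<^sub>m N))"
  proof (rule cpt_pin_transport)
    show "group (pt_cover (p + q) N Es)"
      "(\<lambda>c. (fst (?\<pi> c), snd (?\<pi> c), False)) \<in> hom (pt_cover (p + q) N Es) cpt_labels"
      using d(1) hom_pt_cpt by (auto simp: double_covering_def)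
    show "(fst (?\<pi> (- 1\<^sub>m N)), snd (?\<pi> (- 1\<^sub>m N)), False) = (False, False, False)" by (simp add: k(3))
  qed (rule h assms k | erule k)+
  then have "Pin_pt p q N Es \<cong> pt_pin p q C (?\<pi> \<circ> ?g) (h (- 1\<^sub>m N))"
    unfolding Pin_pt_def pt_pin_def by (simp add: comp_def)
  with double_covering_transport[OF d(1) group_pt_labels d(2) assms(4) h] assms(3) show ?thesis
    unfolding Pin_pt_is_def by blast
qed

section \<open>Classification of the finite groups by signatures\<close>

text \<open>
  A double covering of an elementary Abelian 2-group is determined by the central element \<open>z\<close> and
  lifts \<open>x\<close>, \<open>y\<close>, \<open>w\<close> of a basis, subject to power and commutation relations with values
  in \<open>{1, z}\<close>; its elements are the words $z^e x^a y^b w^c$ with exponents in $\{0, 1\}$. The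
  bits \<open>k1\<close>, \<open>k2\<close>, \<open>k3\<close> record the squares and \<open>k12\<close>, \<open>k13\<close>, \<open>k23\<close> the commutators.
\<close>

type_synonym relation_bits = "bool \<times> bool \<times> bool \<times> bool \<times> bool \<times> bool"

definition bit_pow :: "('a, 'm) monoid_scheme \<Rightarrow> 'a \<Rightarrow> bool \<Rightarrow> 'a" where
  "bit_pow G x b = (if b then x else \<one>\<^bsub>G\<^esub>)"

definition word :: "('a, 'm) monoid_scheme \<Rightarrow> 'a \<Rightarrow> 'a \<Rightarrow> 'a \<Rightarrow> 'a \<Rightarrow> bool \<times> bool \<times> bool \<times> bool \<Rightarrow> 'a" where
  "word G z x y w = (\<lambda>(e, a, b, c).
     bit_pow G z e \<otimes>\<^bsub>G\<^esub> (bit_pow G x a \<otimes>\<^bsub>G\<^esub> (bit_pow G y b \<otimes>\<^bsub>G\<^esub> bit_pow G w c)))"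

fun relations :: "('a, 'm) monoid_scheme \<Rightarrow> 'a \<Rightarrow> 'a \<Rightarrow> 'a \<Rightarrow> 'a \<Rightarrow> relation_bits \<Rightarrow> bool" where
  "relations G z x y w (k1, k2, k3, k12, k13, k23) \<longleftrightarrow>
     z \<in> carrier G \<and> x \<in> carrier G \<and> y \<in> carrier G \<and> w \<in> carrier G \<and>
     z \<otimes>\<^bsub>G\<^esub> z = \<one>\<^bsub>G\<^esub> \<and>
     x \<otimes>\<^bsub>G\<^esub> z = z \<otimes>\<^bsub>G\<^esub> x \<and> y \<otimes>\<^bsub>G\<^esub> z = z \<otimes>\<^bsub>G\<^esub> y \<and> w \<otimes>\<^bsub>G\<^esub> z = z \<otimes>\<^bsub>G\<^esub> w \<and>
     x \<otimes>\<^bsub>G\<^esub> x = bit_pow G z k1 \<and> y \<otimes>\<^bsub>G\<^esub> y = bit_pow G z k2 \<and> w \<otimes>\<^bsub>G\<^esub> w = bit_pow G z k3 \<and>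
     y \<otimes>\<^bsub>G\<^esub> x = bit_pow G z k12 \<otimes>\<^bsub>G\<^esub> (x \<otimes>\<^bsub>G\<^esub> y) \<and>
     w \<otimes>\<^bsub>G\<^esub> x = bit_pow G z k13 \<otimes>\<^bsub>G\<^esub> (x \<otimes>\<^bsub>G\<^esub> w) \<and>
     w \<otimes>\<^bsub>G\<^esub> y = bit_pow G z k23 \<otimes>\<^bsub>G\<^esub> (y \<otimes>\<^bsub>G\<^esub> w)"

text \<open>The first component collects both powers of \<open>z\<close>, a square for each
  generator occurring in both words, and a commutator whenever a generator of the left word has to
  pass an earlier generator of the right word.\<close>

fun word_mult :: "relation_bits \<Rightarrow> bool \<times> bool \<times> bool \<times> bool \<Rightarrow> bool \<times> bool \<times> bool \<times> bool \<Rightarrow>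
    bool \<times> bool \<times> bool \<times> bool" where
  "word_mult (k1, k2, k3, k12, k13, k23) (e, a, b, c) (e', a', b', c') =
     ((((((((e \<noteq> e') \<noteq> (a \<and> a' \<and> k1)) \<noteq> (b \<and> b' \<and> k2)) \<noteq> (c \<and> c' \<and> k3)) \<noteq> (b \<and> a' \<and> k12)) \<noteq>
        (c \<and> a' \<and> k13)) \<noteq> (c \<and> b' \<and> k23)), a \<noteq> a', b \<noteq> b', c \<noteq> c')"

lemma xor_ac:
  "(((a :: bool) \<noteq> b) \<noteq> c) = (a \<noteq> (b \<noteq> c))" "((a :: bool) \<noteq> b) = (b \<noteq> a)"
  "((a :: bool) \<noteq> (b \<noteq> c)) = (b \<noteq> (a \<noteq> c))"
  by auto

text \<open>Powers of \<open>z\<close> are central and move to the front. Sorting the generators and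
  merging equal ones gives one more power of \<open>z\<close> for each relation applied.\<close>

lemma word_hom:
  assumes "group G" and rel: "relations G z x y w k"
  shows "word G z x y w u \<otimes>\<^bsub>G\<^esub> word G z x y w v = word G z x y w (word_mult k u v)"
proof -
  interpret group G by fact
  obtain k1 k2 k3 k12 k13 k23 where k: "k = (k1, k2, k3, k12, k13, k23)" by (metis prod.collapse)
  obtain e a b c where u: "u = (e, a, b, c)" by (metis prod.collapse)
  obtain e' a' b' c' where v: "v = (e', a', b', c')" by (metis prod.collapse)
  define P where "P = bit_pow G"
  note r = rel[unfolded k relations.simps, folded P_def]
  have [simp]: "z \<in> carrier G" "x \<in> carrier G" "y \<in> carrier G" "w \<in> carrier G" using r by blast+
  have P_closed[simp]: "g \<in> carrier G \<Longrightarrow> P g f \<in> carrier G" for g f by (simp add: P_def bit_pow_def)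
  have z_comm: "g \<otimes>\<^bsub>G\<^esub> P z f = P z f \<otimes>\<^bsub>G\<^esub> g" if "g \<in> {x, y, w, z}" for g f
    using that r by (auto simp: P_def bit_pow_def)
  have z_left: "P g h \<otimes>\<^bsub>G\<^esub> (P z f \<otimes>\<^bsub>G\<^esub> t) = P z f \<otimes>\<^bsub>G\<^esub> (P g h \<otimes>\<^bsub>G\<^esub> t)"
    if "g \<in> {x, y, w}" "t \<in> carrier G" for g f h t
  proof -
    have g: "g \<in> carrier G" using that by auto
    have "P g h \<otimes>\<^bsub>G\<^esub> P z f = P z f \<otimes>\<^bsub>G\<^esub> P g h"
      using z_comm[of g f] that g by (auto simp: P_def bit_pow_def)
    with g that show ?thesis by (simp flip: m_assoc)
  qed
  have zz: "P z f \<otimes>\<^bsub>G\<^esub> (P z h \<otimes>\<^bsub>G\<^esub> t) = P z (f \<noteq> h) \<otimes>\<^bsub>G\<^esub> t" if "t \<in> carrier G" for f h t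
  proof -
    have "P z f \<otimes>\<^bsub>G\<^esub> P z h = P z (f \<noteq> h)" using r by (auto simp: P_def bit_pow_def)
    with that show ?thesis by (simp flip: m_assoc)
  qed
  have sq: "P g f \<otimes>\<^bsub>G\<^esub> (P g h \<otimes>\<^bsub>G\<^esub> t) = P z (f \<and> h \<and> l) \<otimes>\<^bsub>G\<^esub> (P g (f \<noteq> h) \<otimes>\<^bsub>G\<^esub> t)"
    "P g f \<otimes>\<^bsub>G\<^esub> P g h = P z (f \<and> h \<and> l) \<otimes>\<^bsub>G\<^esub> P g (f \<noteq> h)"
    if "g \<otimes>\<^bsub>G\<^esub> g = P z l" "g \<in> carrier G" "t \<in> carrier G" for g l f h t
  proof -
    show e: "P g f \<otimes>\<^bsub>G\<^esub> P g h = P z (f \<and> h \<and> l) \<otimes>\<^bsub>G\<^esub> P g (f \<noteq> h)"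
      using that by (auto simp: P_def bit_pow_def)
    show "P g f \<otimes>\<^bsub>G\<^esub> (P g h \<otimes>\<^bsub>G\<^esub> t) = P z (f \<and> h \<and> l) \<otimes>\<^bsub>G\<^esub> (P g (f \<noteq> h) \<otimes>\<^bsub>G\<^esub> t)"
      using e that by (simp flip: m_assoc)
  qed
  have co: "P g f \<otimes>\<^bsub>G\<^esub> (P g' h \<otimes>\<^bsub>G\<^esub> t) = P z (f \<and> h \<and> l) \<otimes>\<^bsub>G\<^esub> (P g' h \<otimes>\<^bsub>G\<^esub> (P g f \<otimes>\<^bsub>G\<^esub> t))"
    if "g \<otimes>\<^bsub>G\<^esub> g' = P z l \<otimes>\<^bsub>G\<^esub> (g' \<otimes>\<^bsub>G\<^esub> g)" "g \<in> carrier G" "g' \<in> carrier G" "t \<in> carrier G"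
    for g g' l f h t
  proof -
    have e: "P g f \<otimes>\<^bsub>G\<^esub> P g' h = P z (f \<and> h \<and> l) \<otimes>\<^bsub>G\<^esub> (P g' h \<otimes>\<^bsub>G\<^esub> P g f)"
      using that by (auto simp: P_def bit_pow_def)
    then have "P g f \<otimes>\<^bsub>G\<^esub> P g' h \<otimes>\<^bsub>G\<^esub> t = P z (f \<and> h \<and> l) \<otimes>\<^bsub>G\<^esub> (P g' h \<otimes>\<^bsub>G\<^esub> P g f) \<otimes>\<^bsub>G\<^esub> t"
      by simp
    with that show ?thesis by (simp add: m_assoc)
  qed
  have zl: "P x h \<otimes>\<^bsub>G\<^esub> (P z f \<otimes>\<^bsub>G\<^esub> t) = P z f \<otimes>\<^bsub>G\<^esub> (P x h \<otimes>\<^bsub>G\<^esub> t)"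
    "P y h \<otimes>\<^bsub>G\<^esub> (P z f \<otimes>\<^bsub>G\<^esub> t) = P z f \<otimes>\<^bsub>G\<^esub> (P y h \<otimes>\<^bsub>G\<^esub> t)"
    "P w h \<otimes>\<^bsub>G\<^esub> (P z f \<otimes>\<^bsub>G\<^esub> t) = P z f \<otimes>\<^bsub>G\<^esub> (P w h \<otimes>\<^bsub>G\<^esub> t)"
    if "t \<in> carrier G" for f h t using that z_left by simp_all
  have rr: "x \<otimes>\<^bsub>G\<^esub> x = P z k1" "y \<otimes>\<^bsub>G\<^esub> y = P z k2" "w \<otimes>\<^bsub>G\<^esub> w = P z k3"
    "y \<otimes>\<^bsub>G\<^esub> x = P z k12 \<otimes>\<^bsub>G\<^esub> (x \<otimes>\<^bsub>G\<^esub> y)" "w \<otimes>\<^bsub>G\<^esub> x = P z k13 \<otimes>\<^bsub>G\<^esub> (x \<otimes>\<^bsub>G\<^esub> w)"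
    "w \<otimes>\<^bsub>G\<^esub> y = P z k23 \<otimes>\<^bsub>G\<^esub> (y \<otimes>\<^bsub>G\<^esub> w)" using r by blast+
  note mem = \<open>x \<in> carrier G\<close> \<open>y \<in> carrier G\<close> \<open>w \<in> carrier G\<close> \<open>z \<in> carrier G\<close>
  note closed = m_closed P_closed mem
  have "word G z x y w u \<otimes>\<^bsub>G\<^esub> word G z x y w v =
    P z (((((((e \<noteq> e') \<noteq> (c \<and> a' \<and> k13)) \<noteq> (b \<and> a' \<and> k12)) \<noteq> (a \<and> a' \<and> k1)) \<noteq> (c \<and> b' \<and> k23)) \<noteq> (b \<and> b' \<and> k2)) \<noteq> (c \<and> c' \<and> k3)) \<otimes>\<^bsub>G\<^esub>
    (P x (a \<noteq> a') \<otimes>\<^bsub>G\<^esub> (P y (b \<noteq> b') \<otimes>\<^bsub>G\<^esub> P w (c \<noteq> c')))"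
    (is "_ = P z ?f \<otimes>\<^bsub>G\<^esub> ?t")
  proof -
    have "word G z x y w u \<otimes>\<^bsub>G\<^esub> word G z x y w v = P z e \<otimes>\<^bsub>G\<^esub> (P z e' \<otimes>\<^bsub>G\<^esub> (P x a \<otimes>\<^bsub>G\<^esub> (P y b \<otimes>\<^bsub>G\<^esub>
        (P w c \<otimes>\<^bsub>G\<^esub> (P x a' \<otimes>\<^bsub>G\<^esub> (P y b' \<otimes>\<^bsub>G\<^esub> P w c'))))))"
      unfolding u v word_def prod.case P_def[symmetric]
      by (simp only: m_assoc zl closed)
    \<comment> \<open>The second power of \<open>x\<close> travels left past \<open>w\<close> and
      \<open>y\<close> and merges with the first one; after that the second power of
      \<open>y\<close> passes \<open>w\<close>.\<close>
    also have "\<dots> = P z e \<otimes>\<^bsub>G\<^esub> (P z e' \<otimes>\<^bsub>G\<^esub> (P z (c \<and> a' \<and> k13) \<otimes>\<^bsub>G\<^esub> (P z (b \<and> a' \<and> k12) \<otimes>\<^bsub>G\<^esub> (P z (a \<and> a' \<and> k1) \<otimes>\<^bsub>G\<^esub>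
        (P x (a \<noteq> a') \<otimes>\<^bsub>G\<^esub> (P y b \<otimes>\<^bsub>G\<^esub> (P w c \<otimes>\<^bsub>G\<^esub> (P y b' \<otimes>\<^bsub>G\<^esub> P w c'))))))))"
      by (simp only: co[OF rr(5)] co[OF rr(4)] sq(1)[OF rr(1)] zl closed)
    also have "\<dots> = P z e \<otimes>\<^bsub>G\<^esub> (P z e' \<otimes>\<^bsub>G\<^esub> (P z (c \<and> a' \<and> k13) \<otimes>\<^bsub>G\<^esub> (P z (b \<and> a' \<and> k12) \<otimes>\<^bsub>G\<^esub> (P z (a \<and> a' \<and> k1) \<otimes>\<^bsub>G\<^esub>
        (P z (c \<and> b' \<and> k23) \<otimes>\<^bsub>G\<^esub> (P z (c \<and> c' \<and> k3) \<otimes>\<^bsub>G\<^esub> (P z (b \<and> b' \<and> k2) \<otimes>\<^bsub>G\<^esub>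
        (P x (a \<noteq> a') \<otimes>\<^bsub>G\<^esub> (P y (b \<noteq> b') \<otimes>\<^bsub>G\<^esub> P w (c \<noteq> c'))))))))))"
      by (simp only: co[OF rr(6)] sq(1)[OF rr(2)] sq(2)[OF rr(3) mem(3) one_closed] zl closed)
    also have "\<dots> = P z ?f \<otimes>\<^bsub>G\<^esub> ?t"
      by (simp only: zz closed)
        (rule arg_cong[where f="\<lambda>f. P z f \<otimes>\<^bsub>G\<^esub> ?t"], simp only: xor_ac)
    finally show ?thesis .
  qed
  also have "?f = ((((((((e \<noteq> e') \<noteq> (a \<and> a' \<and> k1)) \<noteq> (b \<and> b' \<and> k2)) \<noteq> (c \<and> c' \<and> k3)) \<noteq> (b \<and> a' \<and> k12)) \<noteq>
        (c \<and> a' \<and> k13)) \<noteq> (c \<and> b' \<and> k23)))"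
    by (simp only: xor_ac)
  finally show ?thesis by (simp add: u v k word_def P_def)
qed

text \<open>Words multiply by the same rule in both groups, so matching equal words is an
  isomorphism. \<open>K\<close> restricts the last exponent: \<open>UNIV\<close> for eight labels
  and \<open>{False}\<close> for four, where only two lifts are independent.\<close>

lemma word_iso:
  assumes "group G" "relations G z x y w k" "bij_betw (word G z x y w) (UNIV \<times> UNIV \<times> UNIV \<times> K) (carrier G)"
    and "group H" "relations H z' x' y' w' k" "bij_betw (word H z' x' y' w') (UNIV \<times> UNIV \<times> UNIV \<times> K) (carrier H)"
    and K: "\<And>a b. a \<in> K \<Longrightarrow> b \<in> K \<Longrightarrow> (a \<noteq> b) \<in> K"
  shows "G \<cong> H"
proof -
  let ?A = "UNIV \<times> UNIV \<times> UNIV \<times> K :: (bool \<times> bool \<times> bool \<times> bool) set"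
  let ?g = "word G z x y w" and ?h = "word H z' x' y' w'"
  let ?i = "inv_into ?A ?g"
  have i: "?i (?g u) = u" if "u \<in> ?A" for u
    using assms(3) that by (auto simp: bij_betw_def)
  have A: "word_mult k u v \<in> ?A" if "u \<in> ?A" "v \<in> ?A" for u v
  proof -
    obtain k1 k2 k3 k12 k13 k23 e a b c e' a' b' c' where
      e: "k = (k1, k2, k3, k12, k13, k23)" "u = (e, a, b, c)" "v = (e', a', b', c')"
      by (metis prod.collapse)
    have "(c \<noteq> c') \<in> K" using that K unfolding e by blast
    then show ?thesis unfolding e word_mult.simps mem_Times_iff fst_conv snd_conv by (intro conjI UNIV_I)
  qed
  have "?h \<circ> ?i \<in> hom G H"
  proof (rule homI)
    fix s assume "s \<in> carrier G"
    then have "s \<in> ?g ` ?A" by (simp only: bij_betw_imp_surj_on[OF assms(3)])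
    then obtain u where u: "u \<in> ?A" "s = ?g u" by (rule imageE)
    have "?h u \<in> carrier H" by (rule bij_betw_apply[OF assms(6) u(1)])
    then show "(?h \<circ> ?i) s \<in> carrier H" unfolding u(2) comp_apply i[OF u(1)] .
  next
    fix s t assume st: "s \<in> carrier G" "t \<in> carrier G"
    then have "s \<in> ?g ` ?A" "t \<in> ?g ` ?A" by (simp_all only: bij_betw_imp_surj_on[OF assms(3)])
    then obtain u v where u: "u \<in> ?A" "s = ?g u" and v: "v \<in> ?A" "t = ?g v"
      by (elim imageE)
    show "(?h \<circ> ?i) (s \<otimes>\<^bsub>G\<^esub> t) = (?h \<circ> ?i) s \<otimes>\<^bsub>H\<^esub> (?h \<circ> ?i) t"
      unfolding comp_apply u(2) v(2) i[OF u(1)] i[OF v(1)] word_hom[OF assms(4,5)]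
        word_hom[OF assms(1,2)] i[OF A[OF u(1) v(1)]] ..
  qed
  moreover have "bij_betw (?h \<circ> ?i) (carrier G) (carrier H)"
    by (rule bij_betw_trans[OF bij_betw_inv_into[OF assms(3)] assms(6)])
  ultimately show ?thesis by (auto simp: is_iso_def iso_def)
qed

subsection \<open>Generators of a double covering\<close>

text \<open>The commutator bits are the polar form of the quadratic form that records the signs of
  the squares.\<close>

definition sign_bits :: "('v \<Rightarrow> sign) \<Rightarrow> 'v monoid \<Rightarrow> 'v \<Rightarrow> 'v \<Rightarrow> 'v \<Rightarrow> relation_bits" where
  "sign_bits \<sigma> Q u v t =
     (let m = (\<lambda>u. \<sigma> u = Minus); c = (\<lambda>u v. m (u \<otimes>\<^bsub>Q\<^esub> v) \<noteq> (m u \<noteq> m v))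
      in (m u, m v, m t, c u v, c u t, c v t))"

text \<open>The commutator of two lifts lies over the unit because \<open>Q\<close> is Abelian, so
  it is a power of \<open>z\<close>. Then the square of the product is this power times the product
  of the squares, and comparing signs determines it.\<close>

lemma lift_commutation:
  assumes d: "double_covering C Q \<pi> z" and Q: "comm_group Q" and l: "lift_squares C \<pi> z \<sigma>"
    and x: "x \<in> carrier C" and y: "y \<in> carrier C"
  shows "x \<otimes>\<^bsub>C\<^esub> x = bit_pow C z (\<sigma> (\<pi> x) = Minus)"
    and "y \<otimes>\<^bsub>C\<^esub> x = bit_pow C z ((\<sigma> (\<pi> x \<otimes>\<^bsub>Q\<^esub> \<pi> y) = Minus) \<noteq> ((\<sigma> (\<pi> x) = Minus) \<noteq> (\<sigma> (\<pi> y) = Minus)))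
      \<otimes>\<^bsub>C\<^esub> (x \<otimes>\<^bsub>C\<^esub> y)"
proof -
  interpret Q: comm_group Q by fact
  note k = double_covering_kernel[OF d Q.is_group]
  interpret group_hom C Q \<pi>
    using d Q.is_group by (simp add: double_covering_def group_hom_def group_hom_axioms_def)
  have z1: "z \<noteq> \<one>\<^bsub>C\<^esub>" using d by (simp add: double_covering_def)
  have sq: "g \<otimes>\<^bsub>C\<^esub> g = bit_pow C z (\<sigma> (\<pi> g) = Minus)" if "g \<in> carrier C" for g
    using l that by (auto simp: lift_squares_def bit_pow_def split: sign.splits)
  then show "x \<otimes>\<^bsub>C\<^esub> x = bit_pow C z (\<sigma> (\<pi> x) = Minus)" using x by blast
  let ?c = "y \<otimes>\<^bsub>C\<^esub> x \<otimes>\<^bsub>C\<^esub> inv\<^bsub>C\<^esub> (x \<otimes>\<^bsub>C\<^esub> y)"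
  have c: "?c \<in> carrier C" using x y by simp
  have "\<pi> ?c = \<pi> y \<otimes>\<^bsub>Q\<^esub> \<pi> x \<otimes>\<^bsub>Q\<^esub> inv\<^bsub>Q\<^esub> (\<pi> y \<otimes>\<^bsub>Q\<^esub> \<pi> x)"
    using x y by (simp add: Q.m_comm)
  also have "\<dots> = \<one>\<^bsub>Q\<^esub>" using x y by (intro Q.r_inv) simp
  finally have "\<exists>f. ?c = bit_pow C z f"
    using k(5)[OF c] by (metis bit_pow_def)
  then obtain f where f: "?c = bit_pow C z f" by blast
  have yx: "y \<otimes>\<^bsub>C\<^esub> x = bit_pow C z f \<otimes>\<^bsub>C\<^esub> (x \<otimes>\<^bsub>C\<^esub> y)"
    unfolding f[symmetric] using x y by (simp add: G.m_assoc)
  have pc: "bit_pow C z h \<in> carrier C" for h using k(1) by (simp add: bit_pow_def)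
  have com: "g \<otimes>\<^bsub>C\<^esub> bit_pow C z h = bit_pow C z h \<otimes>\<^bsub>C\<^esub> g" if "g \<in> carrier C" for g h
    using k(4)[OF that] that by (simp add: bit_pow_def)
  have add: "bit_pow C z h \<otimes>\<^bsub>C\<^esub> bit_pow C z h' = bit_pow C z (h \<noteq> h')" for h h'
    using k(1,2) by (auto simp: bit_pow_def)
  have "(x \<otimes>\<^bsub>C\<^esub> y) \<otimes>\<^bsub>C\<^esub> (x \<otimes>\<^bsub>C\<^esub> y) = x \<otimes>\<^bsub>C\<^esub> ((y \<otimes>\<^bsub>C\<^esub> x) \<otimes>\<^bsub>C\<^esub> y)"
    using x y by (simp add: G.m_assoc)
  also have "\<dots> = x \<otimes>\<^bsub>C\<^esub> bit_pow C z f \<otimes>\<^bsub>C\<^esub> (x \<otimes>\<^bsub>C\<^esub> (y \<otimes>\<^bsub>C\<^esub> y))"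
    unfolding yx using x y pc by (simp add: G.m_assoc)
  also have "\<dots> = bit_pow C z f \<otimes>\<^bsub>C\<^esub> ((x \<otimes>\<^bsub>C\<^esub> x) \<otimes>\<^bsub>C\<^esub> (y \<otimes>\<^bsub>C\<^esub> y))"
    unfolding com[OF x] using x y pc by (simp add: G.m_assoc)
  also have "\<dots> = bit_pow C z (f \<noteq> ((\<sigma> (\<pi> x) = Minus) \<noteq> (\<sigma> (\<pi> y) = Minus)))"
    by (simp only: sq[OF x] sq[OF y] add)
  finally have "bit_pow C z (\<sigma> (\<pi> x \<otimes>\<^bsub>Q\<^esub> \<pi> y) = Minus) =
      bit_pow C z (f \<noteq> ((\<sigma> (\<pi> x) = Minus) \<noteq> (\<sigma> (\<pi> y) = Minus)))"
    using sq[of "x \<otimes>\<^bsub>C\<^esub> y"] x y by simp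
  then have ff: "f = ((\<sigma> (\<pi> x \<otimes>\<^bsub>Q\<^esub> \<pi> y) = Minus) \<noteq> ((\<sigma> (\<pi> x) = Minus) \<noteq> (\<sigma> (\<pi> y) = Minus)))"
    using z1 by (auto simp: bit_pow_def split: if_splits)
  show "y \<otimes>\<^bsub>C\<^esub> x = bit_pow C z ((\<sigma> (\<pi> x \<otimes>\<^bsub>Q\<^esub> \<pi> y) = Minus) \<noteq> ((\<sigma> (\<pi> x) = Minus) \<noteq> (\<sigma> (\<pi> y) = Minus)))
      \<otimes>\<^bsub>C\<^esub> (x \<otimes>\<^bsub>C\<^esub> y)" using yx unfolding ff .
qed

lemma covering_lift:
  assumes "double_covering C Q \<pi> z" "u \<in> carrier Q"
  obtains x where "x \<in> carrier C" "\<pi> x = u"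
proof -
  have "u \<in> \<pi> ` carrier C" using assms by (simp add: double_covering_def)
  with that show thesis by blast
qed

lemma covering_relations:
  assumes d: "double_covering C Q \<pi> z" and Q: "comm_group Q" and l: "lift_squares C \<pi> z \<sigma>"
    and x: "x \<in> carrier C" and y: "y \<in> carrier C" and w: "w \<in> carrier C"
  shows "relations C z x y w (sign_bits \<sigma> Q (\<pi> x) (\<pi> y) (\<pi> w))"
proof -
  interpret Q: comm_group Q by fact
  note k = double_covering_kernel[OF d Q.is_group]
  note c = lift_commutation[OF d Q l]
  show ?thesis
    unfolding sign_bits_def Let_def relations.simps
    using k(1,2) k(4)[OF x] k(4)[OF y] k(4)[OF w] c(1)[OF x x] c(1)[OF y y] c(1)[OF w w]
      c(2)[OF x y] c(2)[OF x w] c(2)[OF y w] x y w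
    by blast
qed

lemma covering_word_proj:
  assumes d: "double_covering C Q \<pi> z" and Q: "group Q"
    and x: "x \<in> carrier C" and y: "y \<in> carrier C" and w: "w \<in> carrier C"
  shows "word C z x y w r \<in> carrier C"
    and "\<pi> (word C z x y w (e, s)) = word Q \<one>\<^bsub>Q\<^esub> (\<pi> x) (\<pi> y) (\<pi> w) (False, s)"
proof -
  note k = double_covering_kernel[OF d Q]
  interpret group_hom C Q \<pi>
    using d Q by (simp add: double_covering_def group_hom_def group_hom_axioms_def)
  have pc: "bit_pow C g h \<in> carrier C" if "g \<in> carrier C" for g h using that by (simp add: bit_pow_def)
  show "word C z x y w r \<in> carrier C"
    using x y w k(1) by (cases r) (simp add: word_def pc)
  have pi_pow: "\<pi> (bit_pow C g h) = bit_pow Q (\<pi> g) h" for g h by (simp add: bit_pow_def)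
  show "\<pi> (word C z x y w (e, s)) = word Q \<one>\<^bsub>Q\<^esub> (\<pi> x) (\<pi> y) (\<pi> w) (False, s)"
  proof (cases s)
    case (fields a b c)
    have "bit_pow Q \<one>\<^bsub>Q\<^esub> e = bit_pow Q \<one>\<^bsub>Q\<^esub> False" by (simp add: bit_pow_def)
    then show ?thesis using x y w k(1,3) unfolding fields by (simp add: word_def pc pi_pow)
  qed
qed

text \<open>The projection of a word recovers the exponents of the basis lifts; what remains is an
  element of the kernel, recorded by the exponent of \<open>z\<close>.\<close>

lemma covering_word_bij:
  assumes d: "double_covering C Q \<pi> z" and Q: "group Q"
    and x: "x \<in> carrier C" and y: "y \<in> carrier C" and w: "w \<in> carrier C"
    and basis: "bij_betw (\<lambda>s. word Q \<one>\<^bsub>Q\<^esub> (\<pi> x) (\<pi> y) (\<pi> w) (False, s)) (UNIV \<times> UNIV \<times> K) (carrier Q)"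
  shows "bij_betw (word C z x y w) (UNIV \<times> UNIV \<times> UNIV \<times> K) (carrier C)"
proof -
  note k = double_covering_kernel[OF d Q]
  interpret group_hom C Q \<pi>
    using d Q by (simp add: double_covering_def group_hom_def group_hom_axioms_def)
  have z1: "z \<noteq> \<one>\<^bsub>C\<^esub>" using d by (simp add: double_covering_def)
  have pc: "bit_pow C g h \<in> carrier C" if "g \<in> carrier C" for g h using that by (simp add: bit_pow_def)
  note closed = covering_word_proj(1)[OF d Q x y w] and pi = covering_word_proj(2)[OF d Q x y w]
  have split: "word C z x y w (e, s) = bit_pow C z e \<otimes>\<^bsub>C\<^esub> word C z x y w (False, s)" for e s
    using x y w k(1) by (cases s) (simp add: word_def pc bit_pow_def[of _ z False])
  show ?thesis
  proof (rule bij_betw_imageI)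
    show "inj_on (word C z x y w) (UNIV \<times> UNIV \<times> UNIV \<times> K)"
    proof (rule inj_onI)
      fix r r' assume r: "r \<in> UNIV \<times> UNIV \<times> UNIV \<times> K" "r' \<in> UNIV \<times> UNIV \<times> UNIV \<times> K"
        and e: "word C z x y w r = word C z x y w r'"
      obtain f s f' s' where rs: "r = (f, s)" "r' = (f', s')" by (metis prod.collapse)
      have "word Q \<one>\<^bsub>Q\<^esub> (\<pi> x) (\<pi> y) (\<pi> w) (False, s) = word Q \<one>\<^bsub>Q\<^esub> (\<pi> x) (\<pi> y) (\<pi> w) (False, s')"
        using arg_cong[OF e, of \<pi>] unfolding rs pi .
      moreover have "s \<in> UNIV \<times> UNIV \<times> K" "s' \<in> UNIV \<times> UNIV \<times> K" using r rs by (simp_all add: mem_Times_iff)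
      ultimately have s: "s = s'" using inj_onD[OF bij_betw_imp_inj_on[OF basis]] by blast
      have "bit_pow C z f = bit_pow C z f'"
        using e unfolding rs s split[of f] split[of f'] using closed pc[OF k(1)] by simp
      then have "f = f'" using z1 by (auto simp: bit_pow_def split: if_splits)
      with s rs show "r = r'" by simp
    qed
    show "word C z x y w ` (UNIV \<times> UNIV \<times> UNIV \<times> K) = carrier C"
    proof
      show "word C z x y w ` (UNIV \<times> UNIV \<times> UNIV \<times> K) \<subseteq> carrier C" using closed by blast
      show "carrier C \<subseteq> word C z x y w ` (UNIV \<times> UNIV \<times> UNIV \<times> K)"
      proof
        fix g assume g: "g \<in> carrier C"
        then have "\<pi> g \<in> carrier Q" by simp
        then obtain s where s: "s \<in> UNIV \<times> UNIV \<times> K" "\<pi> g = word Q \<one>\<^bsub>Q\<^esub> (\<pi> x) (\<pi> y) (\<pi> w) (False, s)"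
          using basis unfolding bij_betw_def by blast
        let ?h = "word C z x y w (False, s)"
        have h: "?h \<in> carrier C" "\<pi> ?h = \<pi> g" using closed s pi by simp_all
        have "\<pi> (g \<otimes>\<^bsub>C\<^esub> inv\<^bsub>C\<^esub> ?h) = \<one>\<^bsub>Q\<^esub>" using g h by simp
        then obtain f where f: "g \<otimes>\<^bsub>C\<^esub> inv\<^bsub>C\<^esub> ?h = bit_pow C z f"
          using k(5)[of "g \<otimes>\<^bsub>C\<^esub> inv\<^bsub>C\<^esub> ?h"] g h by (metis G.inv_closed G.m_closed bit_pow_def)
        have "g = bit_pow C z f \<otimes>\<^bsub>C\<^esub> ?h"
          unfolding f[symmetric] using g h by (simp add: G.m_assoc)
        then have "g = word C z x y w (f, s)" by (simp only: split[of f])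
        with s show "g \<in> word C z x y w ` (UNIV \<times> UNIV \<times> UNIV \<times> K)" by blast
      qed
    qed
  qed
qed

text \<open>Lifts of a basis satisfy relations dictated by the signs alone, whatever lifts are
  chosen. This leads from a signature to a named finite group with the same relations.\<close>

lemma covering_iso:
  assumes d: "double_covering C Q \<pi> z" and Q: "comm_group Q" and l: "lift_squares C \<pi> z \<sigma>"
    and uvt: "u \<in> carrier Q" "v \<in> carrier Q" "t \<in> carrier Q"
    and basis: "bij_betw (\<lambda>s. word Q \<one>\<^bsub>Q\<^esub> u v t (False, s)) (UNIV \<times> UNIV \<times> K) (carrier Q)"
    and H: "group H" "relations H z' x' y' w' (sign_bits \<sigma> Q u v t)"
      "bij_betw (word H z' x' y' w') (UNIV \<times> UNIV \<times> UNIV \<times> K) (carrier H)"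
    and K: "\<And>a b. a \<in> K \<Longrightarrow> b \<in> K \<Longrightarrow> (a \<noteq> b) \<in> K"
  shows "C \<cong> H"
proof -
  interpret Q: comm_group Q by fact
  have C: "group C" using d by (simp add: double_covering_def)
  obtain x where x: "x \<in> carrier C" "\<pi> x = u" using covering_lift[OF d uvt(1)] .
  obtain y where y: "y \<in> carrier C" "\<pi> y = v" using covering_lift[OF d uvt(2)] .
  obtain w where w: "w \<in> carrier C" "\<pi> w = t" using covering_lift[OF d uvt(3)] .
  have "relations C z x y w (sign_bits \<sigma> Q u v t)"
    using covering_relations[OF d Q l x(1) y(1) w(1)] unfolding x y w .
  moreover have "bij_betw (word C z x y w) (UNIV \<times> UNIV \<times> UNIV \<times> K) (carrier C)"
    by (rule covering_word_bij[OF d Q.is_group x(1) y(1) w(1)]) (simp only: x y w basis)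
  ultimately show ?thesis using word_iso[OF C _ _ H] K by blast
qed

subsection \<open>Labels\<close>

lemma comm_group_cpt_labels: "comm_group cpt_labels" and comm_group_pt_labels: "comm_group pt_labels"
  by (rule group.group_comm_groupI; (rule group_cpt_labels group_pt_labels)?;
      auto simp: cpt_labels_def pt_labels_def bool_group_def)+

fun label_comb :: "cpt_label \<Rightarrow> cpt_label \<Rightarrow> cpt_label \<Rightarrow> bool \<times> bool \<times> bool \<Rightarrow> cpt_label" where
  "label_comb (u1, u2, u3) (v1, v2, v3) (t1, t2, t3) (a, b, c) =
     (((a \<and> u1) \<noteq> (b \<and> v1)) \<noteq> (c \<and> t1), ((a \<and> u2) \<noteq> (b \<and> v2)) \<noteq> (c \<and> t2),
      ((a \<and> u3) \<noteq> (b \<and> v3)) \<noteq> (c \<and> t3))"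

lemma word_cpt_labels: "word cpt_labels \<one>\<^bsub>cpt_labels\<^esub> u v t (False, s) = label_comb u v t s"
proof -
  obtain u1 u2 u3 v1 v2 v3 t1 t2 t3 a b c where
    "u = (u1, u2, u3)" "v = (v1, v2, v3)" "t = (t1, t2, t3)" "s = (a, b, c)"
    by (metis prod_cases3)
  then show ?thesis
    by (cases a; cases b; cases c) (auto simp: word_def bit_pow_def cpt_labels_mult cpt_labels_one)
qed

text \<open>Linear independence over the field with two elements; among eight labels three
  independent ones form a basis.\<close>

definition label_basis :: "cpt_label \<Rightarrow> cpt_label \<Rightarrow> cpt_label \<Rightarrow> bool" where
  "label_basis u v t \<longleftrightarrow>
     (\<forall>a b c. label_comb u v t (a, b, c) = (False, False, False) \<longrightarrow> \<not> a \<and> \<not> b \<and> \<not> c)"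

lemma label_basis_bij:
  assumes "label_basis u v t"
  shows "bij_betw (\<lambda>s. word cpt_labels \<one>\<^bsub>cpt_labels\<^esub> u v t (False, s)) (UNIV \<times> UNIV \<times> UNIV) (carrier cpt_labels)"
proof -
  obtain u1 u2 u3 v1 v2 v3 t1 t2 t3 where
    uvt: "u = (u1, u2, u3)" "v = (v1, v2, v3)" "t = (t1, t2, t3)"
    by (metis prod_cases3)
  have "inj (label_comb u v t)"
  proof (rule injI)
    fix s s' assume e: "label_comb u v t s = label_comb u v t s'"
    obtain a b c a' b' c' where s: "s = (a, b, c)" "s' = (a', b', c')" by (metis prod_cases3)
    have xor: "(((a \<noteq> a') \<and> p) \<noteq> ((b \<noteq> b') \<and> q)) \<noteq> ((c \<noteq> c') \<and> r) \<longleftrightarrow> False"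
      if "((a \<and> p) \<noteq> (b \<and> q)) \<noteq> (c \<and> r) \<longleftrightarrow> ((a' \<and> p) \<noteq> (b' \<and> q)) \<noteq> (c' \<and> r)" for p q r
      using that by (cases p; cases q; cases r; simp; argo)
    have "label_comb u v t (a \<noteq> a', b \<noteq> b', c \<noteq> c') = (False, False, False)"
      using e unfolding s uvt label_comb.simps prod.inject by (elim conjE) (intro conjI xor)
    with assms have "\<not> (a \<noteq> a') \<and> \<not> (b \<noteq> b') \<and> \<not> (c \<noteq> c')" unfolding label_basis_def by blast
    with s show "s = s'" by simp
  qed
  then have "bij (label_comb u v t)"
    by (intro bijI finite_UNIV_inj_surj) auto
  then show ?thesis by (simp add: word_cpt_labels)
qed

section \<open>Isomorphism type, parity and linearity of a signature\<close>

definition has_basis :: "cpt_sign \<Rightarrow> relation_bits \<Rightarrow> bool" where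
  "has_basis \<sigma> k \<longleftrightarrow> (\<exists>u v t. label_basis u v t \<and> sign_bits (cpt_sign_at \<sigma>) cpt_labels u v t = k)"

lemma has_basis_iso:
  assumes "double_covering C cpt_labels \<pi> z" "lift_squares C \<pi> z (cpt_sign_at \<sigma>)" "has_basis \<sigma> k"
    "group H" "relations H z' x' y' w' k" "bij_betw (word H z' x' y' w') UNIV (carrier H)"
  shows "C \<cong> H"
proof -
  obtain u v t where "label_basis u v t" "sign_bits (cpt_sign_at \<sigma>) cpt_labels u v t = k"
    using assms(3) by (auto simp: has_basis_def)
  then show ?thesis
    using covering_iso[OF assms(1) comm_group_cpt_labels assms(2) _ _ _ label_basis_bij assms(4)] assms(5,6)
    by simp
qed

definition even_signature :: "cpt_sign \<Rightarrow> bool" where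
  "even_signature \<sigma> = (case \<sigma> of (a, b, c, d, e, f, g) \<Rightarrow> even (minuses [a, b, c, d, e, f, g]))"

text \<open>The signs are the values of a polynomial of degree at most 2 in three variables over the
  field with two elements, and such a polynomial takes the value 1 an even number of times.\<close>

lemma covering_even_signature:
  assumes d: "double_covering C cpt_labels \<pi> z" and l: "lift_squares C \<pi> z (cpt_sign_at \<sigma>)"
  shows "even_signature \<sigma>"
proof -
  let ?u = "(True, False, False)" and ?v = "(False, True, False)" and ?t = "(False, False, True)"
  have C: "group C" using d by (simp add: double_covering_def)
  have mem: "v \<in> carrier cpt_labels" for v by simp
  obtain x where x: "x \<in> carrier C" "\<pi> x = ?u" using covering_lift[OF d mem] .
  obtain y where y: "y \<in> carrier C" "\<pi> y = ?v" using covering_lift[OF d mem] .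
  obtain w where w: "w \<in> carrier C" "\<pi> w = ?t" using covering_lift[OF d mem] .
  note k = double_covering_kernel[OF d group_cpt_labels]
  interpret group C by fact
  have z1: "z \<noteq> \<one>\<^bsub>C\<^esub>" using d by (simp add: double_covering_def)
  note proj = covering_word_proj[OF d group_cpt_labels x(1) y(1) w(1), unfolded x y w word_cpt_labels]
  obtain k1 k2 k3 k12 k13 k23 where kk: "sign_bits (cpt_sign_at \<sigma>) cpt_labels ?u ?v ?t = (k1, k2, k3, k12, k13, k23)"
    by (metis prod.collapse)
  have rel: "relations C z x y w (k1, k2, k3, k12, k13, k23)"
    using covering_relations[OF d comm_group_cpt_labels l x(1) y(1) w(1)] unfolding x y w kk .
  \<comment> \<open>Squaring the word with exponents \<open>a\<close>, \<open>b\<close>,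
    \<open>c\<close> expresses the sign at each label through the six relation bits; the parity is
    then checked for all values of the bits.\<close>
  have \<sigma>: "cpt_sign_at \<sigma> (a, b, c) = Minus \<longleftrightarrow>
      ((((((a \<and> k1) \<noteq> (b \<and> k2)) \<noteq> (c \<and> k3)) \<noteq> (b \<and> a \<and> k12)) \<noteq> (c \<and> a \<and> k13)) \<noteq> (c \<and> b \<and> k23))"
    (is "?l \<longleftrightarrow> ?r") for a b c
  proof -
    let ?g = "word C z x y w (False, a, b, c)"
    have "?g \<otimes>\<^bsub>C\<^esub> ?g = word C z x y w (?r, False, False, False)"
      using word_hom[OF C rel, of "(False, a, b, c)" "(False, a, b, c)"] by simp
    also have "\<dots> = bit_pow C z ?r" using k(1) by (simp add: word_def bit_pow_def)
    finally have "?g \<otimes>\<^bsub>C\<^esub> ?g = bit_pow C z ?r" .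
    moreover have "\<pi> ?g = (a, b, c)" by (simp add: proj(2))
    ultimately have "bit_pow C z ?r = (case cpt_sign_at \<sigma> (a, b, c) of Plus \<Rightarrow> \<one>\<^bsub>C\<^esub> | Minus \<Rightarrow> z)"
      using l proj(1)[of "(False, a, b, c)"] unfolding lift_squares_def by metis
    with z1 show ?thesis
      by (cases "cpt_sign_at \<sigma> (a, b, c)"; cases ?r) (auto simp only: bit_pow_def if_True if_False sign.case sign.distinct simp_thms)
  qed
  obtain a b c d e f g where s: "\<sigma> = (a, b, c, d, e, f, g)" by (metis prod.collapse)
  note v = \<sigma>[of True False False] \<sigma>[of False True False] \<sigma>[of True True False] \<sigma>[of False False True]
    \<sigma>[of True False True] \<sigma>[of False True True] \<sigma>[of True True True]
  show ?thesis
    using v unfolding s even_signature_def minuses_def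
    by (cases k1; cases k2; cases k3; cases k12; cases k13; cases k23) simp_all
qed

definition linear_signature :: "cpt_sign \<Rightarrow> bool" where
  "linear_signature \<sigma> \<longleftrightarrow> (\<forall>u v. (cpt_sign_at \<sigma> (u \<otimes>\<^bsub>cpt_labels\<^esub> v) = Minus) =
     ((cpt_sign_at \<sigma> u = Minus) \<noteq> (cpt_sign_at \<sigma> v = Minus)))"

text \<open>Trivial commutators mean that the polar form vanishes.\<close>

lemma comm_group_linear_signature:
  assumes d: "double_covering C cpt_labels \<pi> z" and l: "lift_squares C \<pi> z (cpt_sign_at \<sigma>)"
    and C: "comm_group C"
  shows "linear_signature \<sigma>"
  unfolding linear_signature_def
proof (intro allI)
  fix u v
  interpret comm_group C by fact
  have mem: "v \<in> carrier cpt_labels" for v by simp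
  obtain x where x: "x \<in> carrier C" "\<pi> x = u" using covering_lift[OF d mem] .
  obtain y where y: "y \<in> carrier C" "\<pi> y = v" using covering_lift[OF d mem] .
  have z: "z \<in> carrier C" "z \<noteq> \<one>\<^bsub>C\<^esub>"
    using d double_covering_kernel(1)[OF d group_cpt_labels] by (simp_all add: double_covering_def)
  let ?f = "(cpt_sign_at \<sigma> (u \<otimes>\<^bsub>cpt_labels\<^esub> v) = Minus) \<noteq>
     ((cpt_sign_at \<sigma> u = Minus) \<noteq> (cpt_sign_at \<sigma> v = Minus))"
  have "bit_pow C z ?f \<otimes>\<^bsub>C\<^esub> (x \<otimes>\<^bsub>C\<^esub> y) = x \<otimes>\<^bsub>C\<^esub> y"
    using lift_commutation(2)[OF d comm_group_cpt_labels l x(1) y(1)] x y m_comm[OF y(1) x(1)] by simp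
  then have "bit_pow C z ?f = \<one>\<^bsub>C\<^esub>"
    using x y z by (simp add: bit_pow_def split: if_splits)
  with z(2) show "(cpt_sign_at \<sigma> (u \<otimes>\<^bsub>cpt_labels\<^esub> v) = Minus) =
     ((cpt_sign_at \<sigma> u = Minus) \<noteq> (cpt_sign_at \<sigma> v = Minus))"
    by (auto simp: bit_pow_def split: if_splits)
qed

subsection \<open>The concrete groups\<close>

lemma group_Z2: "comm_group Z2" and group_Z4: "comm_group Z4"
  by (simp_all add: Z2_def Z4_def abelian_integer_mod_group)

lemma interval_cases: "{0..<2} = {0, 1 :: int}" "{0..<4} = {0, 1, 2, 3 :: int}"
  by auto

lemma Z2_simps: "carrier Z2 = {0, 1}" "\<one>\<^bsub>Z2\<^esub> = 0" "i \<otimes>\<^bsub>Z2\<^esub> j = (i + j) mod 2"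
  and Z4_simps: "carrier Z4 = {0, 1, 2, 3}" "\<one>\<^bsub>Z4\<^esub> = 0" "i \<otimes>\<^bsub>Z4\<^esub> j = (i + j) mod 4"
  by (auto simp: Z2_def Z4_def integer_mod_group_def integer_group_def interval_cases)

lemma D4_simps: "carrier D4 = {0, 1, 2, 3} \<times> {0, 1}" "\<one>\<^bsub>D4\<^esub> = (0, 0)"
  "(i, j) \<otimes>\<^bsub>D4\<^esub> (k, l) = ((if j = 0 then i + k else i - k) mod 4, (j + l) mod 2)"
  and Q4_simps: "carrier Q4 = {0, 1, 2, 3} \<times> {0, 1}" "\<one>\<^bsub>Q4\<^esub> = (0, 0)"
  "(i, j) \<otimes>\<^bsub>Q4\<^esub> (k, l) = ((if j = 0 then i + k else i - k + 2 * l) mod 4, (j + l) mod 2)"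
  by (simp_all add: D4_def Q4_def interval_cases)

lemma group_D4: "group D4"
proof (rule groupI)
  fix x y assume "x \<in> carrier D4" "y \<in> carrier D4"
  then show "x \<otimes>\<^bsub>D4\<^esub> y \<in> carrier D4"
    by (cases x; cases y) (simp only: D4_simps mem_Times_iff fst_conv snd_conv insert_iff empty_iff
        simp_thms, elim conjE disjE; simp)
next
  fix x y z assume "x \<in> carrier D4" "y \<in> carrier D4" "z \<in> carrier D4"
  then show "x \<otimes>\<^bsub>D4\<^esub> y \<otimes>\<^bsub>D4\<^esub> z = x \<otimes>\<^bsub>D4\<^esub> (y \<otimes>\<^bsub>D4\<^esub> z)"
    by (cases x; cases y; cases z) (simp only: D4_simps mem_Times_iff fst_conv snd_conv insert_iff empty_iff
        simp_thms, elim conjE disjE; simp)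
next
  fix x assume x: "x \<in> carrier D4"
  then show "\<one>\<^bsub>D4\<^esub> \<otimes>\<^bsub>D4\<^esub> x = x" by (auto simp: D4_simps)
  obtain i j where "x = (i, j)" by (cases x)
  with x show "\<exists>y\<in>carrier D4. y \<otimes>\<^bsub>D4\<^esub> x = \<one>\<^bsub>D4\<^esub>"
    by (intro bexI[of _ "(if j = 0 then - i mod 4 else i, j)"]) (auto simp: D4_simps)
qed (simp add: D4_simps)

lemma group_Q4: "group Q4"
proof (rule groupI)
  fix x y assume "x \<in> carrier Q4" "y \<in> carrier Q4"
  then show "x \<otimes>\<^bsub>Q4\<^esub> y \<in> carrier Q4"
    by (cases x; cases y) (simp only: Q4_simps mem_Times_iff fst_conv snd_conv insert_iff empty_iff
        simp_thms, elim conjE disjE; simp)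
next
  fix x y z assume "x \<in> carrier Q4" "y \<in> carrier Q4" "z \<in> carrier Q4"
  then show "x \<otimes>\<^bsub>Q4\<^esub> y \<otimes>\<^bsub>Q4\<^esub> z = x \<otimes>\<^bsub>Q4\<^esub> (y \<otimes>\<^bsub>Q4\<^esub> z)"
    by (cases x; cases y; cases z) (simp only: Q4_simps mem_Times_iff fst_conv snd_conv insert_iff empty_iff
        simp_thms, elim conjE disjE; simp)
next
  fix x assume x: "x \<in> carrier Q4"
  then show "\<one>\<^bsub>Q4\<^esub> \<otimes>\<^bsub>Q4\<^esub> x = x" by (auto simp: Q4_simps)
  obtain i j where "x = (i, j)" by (cases x)
  with x show "\<exists>y\<in>carrier Q4. y \<otimes>\<^bsub>Q4\<^esub> x = \<one>\<^bsub>Q4\<^esub>"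
    by (intro bexI[of _ "(if j = 0 then - i mod 4 else (i + 2) mod 4, j)"]) (auto simp: Q4_simps)
qed (simp add: Q4_simps)

lemma word_image: "word G z x y w ` UNIV = (\<Union>e. \<Union>a. \<Union>b. \<Union>c. {word G z x y w (e, a, b, c)})"
proof (intro equalityI subsetI)
  fix g assume "g \<in> word G z x y w ` UNIV"
  then obtain r where r: "g = word G z x y w r" by (rule imageE)
  obtain e a b c where "r = (e, a, b, c)" by (cases r)
  with r show "g \<in> (\<Union>e. \<Union>a. \<Union>b. \<Union>c. {word G z x y w (e, a, b, c)})" by blast
qed blast

text \<open>There are 16 exponent vectors, so a surjection onto a carrier of size 16 is
  injective.\<close>

lemma word_bij:
  assumes "card (carrier G) = 16" "carrier G = (\<Union>e. \<Union>a. \<Union>b. \<Union>c. {word G z x y w (e, a, b, c)})"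
  shows "bij_betw (word G z x y w) UNIV (carrier G)"
  unfolding bij_betw_def
proof
  show im: "word G z x y w ` UNIV = carrier G" unfolding assms(2) by (rule word_image)
  show "inj (word G z x y w)"
    by (rule eq_card_imp_inj_on)
      (simp_all only: im assms(1), simp_all add: card_cartesian_product flip: UNIV_Times_UNIV)
qed

lemma word_image_pt: "word G z x y w ` (UNIV \<times> UNIV \<times> UNIV \<times> {False}) =
    (\<Union>e. \<Union>a. \<Union>b. {word G z x y w (e, a, b, False)})"
proof (intro equalityI subsetI)
  fix g assume "g \<in> word G z x y w ` (UNIV \<times> UNIV \<times> UNIV \<times> {False})"
  then obtain r where r: "g = word G z x y w r" "r \<in> UNIV \<times> UNIV \<times> UNIV \<times> {False}" by (rule imageE)
  obtain e a b c where "r = (e, a, b, c)" by (cases r)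
  with r show "g \<in> (\<Union>e. \<Union>a. \<Union>b. {word G z x y w (e, a, b, False)})" by blast
qed blast

lemma word_bij_pt:
  assumes "card (carrier G) = 8" "carrier G = (\<Union>e. \<Union>a. \<Union>b. {word G z x y w (e, a, b, False)})"
  shows "bij_betw (word G z x y w) (UNIV \<times> UNIV \<times> UNIV \<times> {False}) (carrier G)"
  unfolding bij_betw_def
proof
  show im: "word G z x y w ` (UNIV \<times> UNIV \<times> UNIV \<times> {False}) = carrier G"
    unfolding assms(2) by (rule word_image_pt)
  show "inj_on (word G z x y w) (UNIV \<times> UNIV \<times> UNIV \<times> {False})"
    by (rule eq_card_imp_inj_on) (simp_all only: im assms(1), simp_all add: card_cartesian_product)
qed

lemma Z2222_presentation:
  "relations (Z2 \<times>\<times> Z2 \<times>\<times> Z2 \<times>\<times> Z2) (1, 0, 0, 0) (0, 1, 0, 0) (0, 0, 1, 0) (0, 0, 0, 1) (False, False, False, False, False, False)"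
  "bij_betw (word (Z2 \<times>\<times> Z2 \<times>\<times> Z2 \<times>\<times> Z2) (1, 0, 0, 0) (0, 1, 0, 0) (0, 0, 1, 0) (0, 0, 0, 1)) UNIV (carrier (Z2 \<times>\<times> Z2 \<times>\<times> Z2 \<times>\<times> Z2))"
proof -
  show "relations (Z2 \<times>\<times> Z2 \<times>\<times> Z2 \<times>\<times> Z2) (1, 0, 0, 0) (0, 1, 0, 0) (0, 0, 1, 0) (0, 0, 0, 1) (False, False, False, False, False, False)"
    by (simp add: bit_pow_def Z2_simps)
  show "bij_betw (word (Z2 \<times>\<times> Z2 \<times>\<times> Z2 \<times>\<times> Z2) (1, 0, 0, 0) (0, 1, 0, 0) (0, 0, 1, 0) (0, 0, 0, 1)) UNIV (carrier (Z2 \<times>\<times> Z2 \<times>\<times> Z2 \<times>\<times> Z2))"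
  proof (rule word_bij)
    show "card (carrier (Z2 \<times>\<times> Z2 \<times>\<times> Z2 \<times>\<times> Z2)) = 16" by (simp add: Z2_simps card_cartesian_product)
    show "carrier (Z2 \<times>\<times> Z2 \<times>\<times> Z2 \<times>\<times> Z2) = (\<Union>e. \<Union>a. \<Union>b. \<Union>c. {word (Z2 \<times>\<times> Z2 \<times>\<times> Z2 \<times>\<times> Z2) (1, 0, 0, 0) (0, 1, 0, 0) (0, 0, 1, 0) (0, 0, 0, 1) (e, a, b, c)})"
      by (auto simp: UNIV_bool word_def bit_pow_def Z2_simps)
  qed
qed

text \<open>The kernel element is the square of the generator of order four; all commutator bits
  vanish.\<close>

lemma Z4Z2Z2_presentation:
  "relations (Z4 \<times>\<times> Z2 \<times>\<times> Z2) (2, 0, 0) (1, 0, 0) (0, 1, 0) (0, 0, 1) (True, False, False, False, False, False)"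
  "bij_betw (word (Z4 \<times>\<times> Z2 \<times>\<times> Z2) (2, 0, 0) (1, 0, 0) (0, 1, 0) (0, 0, 1)) UNIV (carrier (Z4 \<times>\<times> Z2 \<times>\<times> Z2))"
proof -
  show "relations (Z4 \<times>\<times> Z2 \<times>\<times> Z2) (2, 0, 0) (1, 0, 0) (0, 1, 0) (0, 0, 1) (True, False, False, False, False, False)"
    by (simp add: bit_pow_def Z2_simps Z4_simps)
  show "bij_betw (word (Z4 \<times>\<times> Z2 \<times>\<times> Z2) (2, 0, 0) (1, 0, 0) (0, 1, 0) (0, 0, 1)) UNIV (carrier (Z4 \<times>\<times> Z2 \<times>\<times> Z2))"
  proof (rule word_bij)
    show "card (carrier (Z4 \<times>\<times> Z2 \<times>\<times> Z2)) = 16" by (simp add: Z2_simps Z4_simps card_cartesian_product)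
    show "carrier (Z4 \<times>\<times> Z2 \<times>\<times> Z2) = (\<Union>e. \<Union>a. \<Union>b. \<Union>c. {word (Z4 \<times>\<times> Z2 \<times>\<times> Z2) (2, 0, 0) (1, 0, 0) (0, 1, 0) (0, 0, 1) (e, a, b, c)})"
      by (auto simp: UNIV_bool word_def bit_pow_def Z2_simps Z4_simps)
  qed
qed

text \<open>\<open>(1, 0)\<close> and \<open>(0, 1)\<close> are quaternion units with common square
  \<open>(2, 0)\<close>, and the factor \<open>Z2\<close> supplies a central lift of square
  1.\<close>

lemma Q4Z2_presentation:
  "relations (Q4 \<times>\<times> Z2) ((2, 0), 0) ((1, 0), 0) ((0, 1), 0) ((0, 0), 1) (True, True, False, True, False, False)"
  "bij_betw (word (Q4 \<times>\<times> Z2) ((2, 0), 0) ((1, 0), 0) ((0, 1), 0) ((0, 0), 1)) UNIV (carrier (Q4 \<times>\<times> Z2))"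
proof -
  show "relations (Q4 \<times>\<times> Z2) ((2, 0), 0) ((1, 0), 0) ((0, 1), 0) ((0, 0), 1) (True, True, False, True, False, False)"
    by (simp add: bit_pow_def Z2_simps Q4_simps)
  show "bij_betw (word (Q4 \<times>\<times> Z2) ((2, 0), 0) ((1, 0), 0) ((0, 1), 0) ((0, 0), 1)) UNIV (carrier (Q4 \<times>\<times> Z2))"
  proof (rule word_bij)
    show "card (carrier (Q4 \<times>\<times> Z2)) = 16" by (simp add: Z2_simps Q4_simps card_cartesian_product)
    show "carrier (Q4 \<times>\<times> Z2) = (\<Union>e. \<Union>a. \<Union>b. \<Union>c. {word (Q4 \<times>\<times> Z2) ((2, 0), 0) ((1, 0), 0) ((0, 1), 0) ((0, 0), 1) (e, a, b, c)})"
      by (auto simp: UNIV_bool word_def bit_pow_def Z2_simps Q4_simps)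
  qed
qed

text \<open>A rotation of order four with square \<open>(2, 0)\<close>, a reflection that inverts
  it, and a central involution from the factor \<open>Z2\<close>.\<close>

lemma D4Z2_presentation:
  "relations (D4 \<times>\<times> Z2) ((2, 0), 0) ((1, 0), 0) ((0, 1), 0) ((0, 0), 1) (True, False, False, True, False, False)"
  "bij_betw (word (D4 \<times>\<times> Z2) ((2, 0), 0) ((1, 0), 0) ((0, 1), 0) ((0, 0), 1)) UNIV (carrier (D4 \<times>\<times> Z2))"
proof -
  show "relations (D4 \<times>\<times> Z2) ((2, 0), 0) ((1, 0), 0) ((0, 1), 0) ((0, 0), 1) (True, False, False, True, False, False)"
    by (simp add: bit_pow_def Z2_simps D4_simps)
  show "bij_betw (word (D4 \<times>\<times> Z2) ((2, 0), 0) ((1, 0), 0) ((0, 1), 0) ((0, 0), 1)) UNIV (carrier (D4 \<times>\<times> Z2))"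
  proof (rule word_bij)
    show "card (carrier (D4 \<times>\<times> Z2)) = 16" by (simp add: Z2_simps D4_simps card_cartesian_product)
    show "carrier (D4 \<times>\<times> Z2) = (\<Union>e. \<Union>a. \<Union>b. \<Union>c. {word (D4 \<times>\<times> Z2) ((2, 0), 0) ((1, 0), 0) ((0, 1), 0) ((0, 0), 1) (e, a, b, c)})"
      by (auto simp: UNIV_bool word_def bit_pow_def Z2_simps D4_simps)
  qed
qed

text \<open>For coverings of the four-group the fourth generator is the neutral element with
  exponent fixed to \<open>False\<close>, so the machinery of three basis lifts applies
  unchanged.\<close>

lemma Z222_presentation:
  "relations (Z2 \<times>\<times> Z2 \<times>\<times> Z2) (1, 0, 0) (0, 1, 0) (0, 0, 1) (0, 0, 0) (False, False, False, False, False, False)"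
  "bij_betw (word (Z2 \<times>\<times> Z2 \<times>\<times> Z2) (1, 0, 0) (0, 1, 0) (0, 0, 1) (0, 0, 0)) (UNIV \<times> UNIV \<times> UNIV \<times> {False}) (carrier (Z2 \<times>\<times> Z2 \<times>\<times> Z2))"
proof -
  show "relations (Z2 \<times>\<times> Z2 \<times>\<times> Z2) (1, 0, 0) (0, 1, 0) (0, 0, 1) (0, 0, 0) (False, False, False, False, False, False)"
    by (simp add: bit_pow_def Z2_simps)
  show "bij_betw (word (Z2 \<times>\<times> Z2 \<times>\<times> Z2) (1, 0, 0) (0, 1, 0) (0, 0, 1) (0, 0, 0)) (UNIV \<times> UNIV \<times> UNIV \<times> {False}) (carrier (Z2 \<times>\<times> Z2 \<times>\<times> Z2))"
  proof (rule word_bij_pt)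
    show "card (carrier (Z2 \<times>\<times> Z2 \<times>\<times> Z2)) = 8" by (simp add: Z2_simps card_cartesian_product)
    show "carrier (Z2 \<times>\<times> Z2 \<times>\<times> Z2) = (\<Union>e. \<Union>a. \<Union>b. {word (Z2 \<times>\<times> Z2 \<times>\<times> Z2) (1, 0, 0) (0, 1, 0) (0, 0, 1) (0, 0, 0) (e, a, b, False)})"
      by (auto simp: UNIV_bool word_def bit_pow_def Z2_simps)
  qed
qed

lemma Z2Z4_presentation:
  "relations (Z2 \<times>\<times> Z4) (0, 2) (0, 1) (1, 0) (0, 0) (True, False, False, False, False, False)"
  "bij_betw (word (Z2 \<times>\<times> Z4) (0, 2) (0, 1) (1, 0) (0, 0)) (UNIV \<times> UNIV \<times> UNIV \<times> {False}) (carrier (Z2 \<times>\<times> Z4))"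
proof -
  show "relations (Z2 \<times>\<times> Z4) (0, 2) (0, 1) (1, 0) (0, 0) (True, False, False, False, False, False)"
    by (simp add: bit_pow_def Z2_simps Z4_simps)
  show "bij_betw (word (Z2 \<times>\<times> Z4) (0, 2) (0, 1) (1, 0) (0, 0)) (UNIV \<times> UNIV \<times> UNIV \<times> {False}) (carrier (Z2 \<times>\<times> Z4))"
  proof (rule word_bij_pt)
    show "card (carrier (Z2 \<times>\<times> Z4)) = 8" by (simp add: Z2_simps Z4_simps card_cartesian_product)
    show "carrier (Z2 \<times>\<times> Z4) = (\<Union>e. \<Union>a. \<Union>b. {word (Z2 \<times>\<times> Z4) (0, 2) (0, 1) (1, 0) (0, 0) (e, a, b, False)})"
      by (auto simp: UNIV_bool word_def bit_pow_def Z2_simps Z4_simps)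
  qed
qed

lemma Q4_presentation:
  "relations (Q4) (2, 0) (1, 0) (0, 1) (0, 0) (True, True, False, True, False, False)"
  "bij_betw (word (Q4) (2, 0) (1, 0) (0, 1) (0, 0)) (UNIV \<times> UNIV \<times> UNIV \<times> {False}) (carrier (Q4))"
proof -
  show "relations (Q4) (2, 0) (1, 0) (0, 1) (0, 0) (True, True, False, True, False, False)"
    by (simp add: bit_pow_def Q4_simps)
  show "bij_betw (word (Q4) (2, 0) (1, 0) (0, 1) (0, 0)) (UNIV \<times> UNIV \<times> UNIV \<times> {False}) (carrier (Q4))"
  proof (rule word_bij_pt)
    show "card (carrier (Q4)) = 8" by (simp add: Q4_simps card_cartesian_product)
    show "carrier (Q4) = (\<Union>e. \<Union>a. \<Union>b. {word (Q4) (2, 0) (1, 0) (0, 1) (0, 0) (e, a, b, False)})"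
      by (auto simp: UNIV_bool word_def bit_pow_def Q4_simps)
  qed
qed

lemma D4_presentation:
  "relations (D4) (2, 0) (1, 0) (0, 1) (0, 0) (True, False, False, True, False, False)"
  "bij_betw (word (D4) (2, 0) (1, 0) (0, 1) (0, 0)) (UNIV \<times> UNIV \<times> UNIV \<times> {False}) (carrier (D4))"
proof -
  show "relations (D4) (2, 0) (1, 0) (0, 1) (0, 0) (True, False, False, True, False, False)"
    by (simp add: bit_pow_def D4_simps)
  show "bij_betw (word (D4) (2, 0) (1, 0) (0, 1) (0, 0)) (UNIV \<times> UNIV \<times> UNIV \<times> {False}) (carrier (D4))"
  proof (rule word_bij_pt)
    show "card (carrier (D4)) = 8" by (simp add: D4_simps card_cartesian_product)
    show "carrier (D4) = (\<Union>e. \<Union>a. \<Union>b. {word (D4) (2, 0) (1, 0) (0, 1) (0, 0) (e, a, b, False)})"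
      by (auto simp: UNIV_bool word_def bit_pow_def D4_simps)
  qed
qed

section \<open>Real matrices\<close>

definition block :: "complex mat \<Rightarrow> complex mat \<Rightarrow> complex mat \<Rightarrow> complex mat \<Rightarrow> complex mat" where
  "block = four_block_mat"

context
  fixes N :: nat
begin

lemma block_carrier:
  "A \<in> carrier_mat N N \<Longrightarrow> D \<in> carrier_mat N N \<Longrightarrow> block A B C D \<in> carrier_mat (N + N) (N + N)"
  by (simp add: block_def)

lemma block_mult:
  assumes "A \<in> carrier_mat N N" "B \<in> carrier_mat N N" "C \<in> carrier_mat N N" "D \<in> carrier_mat N N"
    "A' \<in> carrier_mat N N" "B' \<in> carrier_mat N N" "C' \<in> carrier_mat N N" "D' \<in> carrier_mat N N"
  shows "block A B C D * block A' B' C' D' =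
    block (A * A' + B * C') (A * B' + B * D') (C * A' + D * C') (C * B' + D * D')"
  unfolding block_def using assms by (rule mult_four_block_mat)

lemma block_uminus:
  assumes "A \<in> carrier_mat N N" "B \<in> carrier_mat N N" "C \<in> carrier_mat N N" "D \<in> carrier_mat N N"
  shows "- block A B C D = block (- A) (- B) (- C) (- D)"
  unfolding block_def using assms by (intro eq_matI) auto

lemma block_transpose:
  assumes "A \<in> carrier_mat N N" "B \<in> carrier_mat N N" "C \<in> carrier_mat N N" "D \<in> carrier_mat N N"
  shows "transpose_mat (block A B C D) =
    block (transpose_mat A) (transpose_mat C) (transpose_mat B) (transpose_mat D)"
  unfolding block_def by (rule transpose_four_block_mat[OF assms])

lemma block_mat_cnj:
  assumes "A \<in> carrier_mat N N" "B \<in> carrier_mat N N" "C \<in> carrier_mat N N" "D \<in> carrier_mat N N"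
  shows "mat_cnj (block A B C D) = block (mat_cnj A) (mat_cnj B) (mat_cnj C) (mat_cnj D)"
  unfolding block_def mat_cnj_def by (rule map_four_block_mat[OF assms])

lemma block_one: "1\<^sub>m (N + N) = block (1\<^sub>m N) (0\<^sub>m N N) (0\<^sub>m N N) (1\<^sub>m N)"
  by (simp add: block_def)

end

lemma mat_cnj_uminus: "mat_cnj (- A) = - mat_cnj A"
  by (intro eq_matI) (auto simp: mat_cnj_def)

lemma mat_cnj_zero: "mat_cnj (0\<^sub>m n m) = 0\<^sub>m n m"
  by (intro eq_matI) (auto simp: mat_cnj_def)

lemma uminus_zero_mat: "- (0\<^sub>m n m :: complex mat) = 0\<^sub>m n m"
  by (intro eq_matI) auto

text \<open>
  \<open>R True\<close> enumerates \<open>k\<close> symmetric real matrices with square \<open>1\<close> and \<open>R False\<close>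
  enumerates \<open>l\<close> skewsymmetric ones with square \<open>-1\<close>.
\<close>

definition real_system :: "nat \<Rightarrow> nat \<Rightarrow> nat \<Rightarrow> (bool \<Rightarrow> nat \<Rightarrow> complex mat) \<Rightarrow> bool" where
  "real_system k l N R \<longleftrightarrow> 0 < N \<and>
     (\<forall>s i. i < (if s then k else l) \<longrightarrow> R s i \<in> carrier_mat N N \<and>
        R s i * R s i = (if s then 1\<^sub>m N else - 1\<^sub>m N) \<and> mat_cnj (R s i) = R s i \<and>
        transpose_mat (R s i) = (if s then R s i else - R s i)) \<and>
     (\<forall>s i t j. i < (if s then k else l) \<longrightarrow> j < (if t then k else l) \<longrightarrow> (s, i) \<noteq> (t, j) \<longrightarrow>
        R s i * R t j = - (R t j * R s i))"

lemma real_system_mono: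
  assumes "real_system k l N R" "k' \<le> k" "l' \<le> l"
  shows "real_system k' l' N R"
proof -
  have "i < (if s then k else l)" if "i < (if s then k' else l')" for s i
    using that assms(2,3) by (simp split: if_splits)
  with assms(1) show ?thesis unfolding real_system_def by blast
qed

text \<open>\<open>block_X\<close>, \<open>block_Y\<close> and \<open>block_Z\<close> are Kronecker
  products with the Pauli matrix sigma_x, with i sigma_y and with sigma_z; all three of these
  factors are real and they anticommute.\<close>

definition block_X :: "nat \<Rightarrow> complex mat" where
  "block_X N = block (0\<^sub>m N N) (1\<^sub>m N) (1\<^sub>m N) (0\<^sub>m N N)"

definition block_Y :: "nat \<Rightarrow> complex mat" where
  "block_Y N = block (0\<^sub>m N N) (1\<^sub>m N) (- 1\<^sub>m N) (0\<^sub>m N N)"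

definition block_Z :: "nat \<Rightarrow> complex mat \<Rightarrow> complex mat" where
  "block_Z N A = block A (0\<^sub>m N N) (0\<^sub>m N N) (- A)"

lemma block_XYZ:
  assumes A: "A \<in> carrier_mat N N" and B: "B \<in> carrier_mat N N"
  shows "block_X N * block_X N = 1\<^sub>m (N + N)" "block_Y N * block_Y N = - 1\<^sub>m (N + N)"
    "block_Z N A * block_Z N B = block (A * B) (0\<^sub>m N N) (0\<^sub>m N N) (A * B)"
    "block_X N * block_Y N = - (block_Y N * block_X N)"
    "block_X N * block_Z N A = - (block_Z N A * block_X N)"
    "block_Y N * block_Z N A = - (block_Z N A * block_Y N)"
  using A B
  by (simp_all add: block_X_def block_Y_def block_Z_def block_one block_mult[of _ N] block_uminus[of _ N]
      uminus_zero_mat left_add_zero_mat[of _ N N] right_add_zero_mat[of _ N N] left_mult_zero_mat[of _ N N] right_mult_zero_mat[of _ N N]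
      left_mult_one_mat[of _ N N] right_mult_one_mat[of _ N N])

lemma block_XYZ_cnj:
  assumes A: "A \<in> carrier_mat N N"
  shows "mat_cnj (block_X N) = block_X N" "mat_cnj (block_Y N) = block_Y N"
    "mat_cnj (block_Z N A) = block_Z N (mat_cnj A)"
    "transpose_mat (block_X N) = block_X N" "transpose_mat (block_Y N) = - block_Y N"
    "transpose_mat (block_Z N A) = block_Z N (transpose_mat A)"
    "block_Z N (- A) = - block_Z N A"
  using A
  by (simp_all add: block_X_def block_Y_def block_Z_def block_mat_cnj[of _ N] block_transpose[of _ N]
      block_uminus[of _ N] mat_cnj_uminus mat_cnj_zero mat_cnj_one uminus_zero_mat transpose_uminus)

lemma block_XYZ_carrier:
  "block_X N \<in> carrier_mat (N + N) (N + N)" "block_Y N \<in> carrier_mat (N + N) (N + N)"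
  "A \<in> carrier_mat N N \<Longrightarrow> block_Z N A \<in> carrier_mat (N + N) (N + N)"
  by (simp_all add: block_X_def block_Y_def block_Z_def block_carrier)

lemma block_Z_diag_uminus:
  assumes "A \<in> carrier_mat N N"
  shows "block (- A) (0\<^sub>m N N) (0\<^sub>m N N) (- A) = - block A (0\<^sub>m N N) (0\<^sub>m N N) A"
  using assms by (simp add: block_uminus[of _ N] uminus_zero_mat)

text \<open>The matrix form of the periodicity of Clifford algebras under adding a generator of each
  sign. The old matrices appear on the diagonal with opposite signs, so that they anticommute with
  the new symmetric and the new skewsymmetric matrix, which take the indices \<open>k\<close> and
  \<open>l\<close>.\<close>

lemma real_system_double:
  assumes R: "real_system k l N R"
  shows "real_system (Suc k) (Suc l) (N + N)
    (\<lambda>s i. if s \<and> i = k then block_X N else if \<not> s \<and> i = l then block_Y N else block_Z N (R s i))"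
    (is "real_system _ _ _ ?R")
proof -
  have r: "R s i \<in> carrier_mat N N" "R s i * R s i = (if s then 1\<^sub>m N else - 1\<^sub>m N)"
    "mat_cnj (R s i) = R s i" "transpose_mat (R s i) = (if s then R s i else - R s i)"
    if "i < (if s then k else l)" for s i
    using R that unfolding real_system_def by blast+
  have anti: "R s i * R t j = - (R t j * R s i)"
    if "i < (if s then k else l)" "j < (if t then k else l)" "(s, i) \<noteq> (t, j)" for s i t j
    using R that unfolding real_system_def by blast
  have anti_Z: "block_Z N (R s i) * block_Z N (R t j) = - (block_Z N (R t j) * block_Z N (R s i))"
    if "i < (if s then k else l)" "j < (if t then k else l)" "(s, i) \<noteq> (t, j)" for s i t j
    using r(1)[OF that(1)] r(1)[OF that(2)] anti[OF that]
    by (simp add: block_XYZ(3) block_Z_diag_uminus mult_carrier_mat[of _ N N])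
  have anti_swap: "block_Z N A * block_X N = - (block_X N * block_Z N A)"
    "block_Z N A * block_Y N = - (block_Y N * block_Z N A)" "block_Y N * block_X N = - (block_X N * block_Y N)"
    if "A \<in> carrier_mat N N" for A
    using block_XYZ(4-6)[OF that that] by simp_all
  have idx: "i < (if s then k else l)" if "i < (if s then Suc k else Suc l)" "\<not> (s \<and> i = k)" "\<not> (\<not> s \<and> i = l)" for s i
    using that by (auto split: if_splits)
  define R' where "R' = (\<lambda>s i. if s \<and> i = k then block_X N else if \<not> s \<and> i = l then block_Y N else block_Z N (R s i))"
  have cases: "R' s i = block_X N \<and> s \<and> i = k \<or> R' s i = block_Y N \<and> \<not> s \<and> i = l \<or>
      R' s i = block_Z N (R s i) \<and> i < (if s then k else l)" if "i < (if s then Suc k else Suc l)" for s i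
    unfolding R'_def using idx[OF that] by auto
  show ?thesis
    unfolding R'_def[symmetric] unfolding real_system_def
  proof (intro conjI allI impI)
    show "0 < N + N" using R by (simp add: real_system_def)
  next
    fix s i assume i: "i < (if s then Suc k else Suc l)"
    show "R' s i \<in> carrier_mat (N + N) (N + N)"
      using cases[OF i]
    proof (elim disjE conjE)
      assume e: "R' s i = block_Z N (R s i)" "i < (if s then k else l)"
      show ?thesis unfolding e(1) by (rule block_XYZ_carrier(3)[OF r(1)[OF e(2)]])
    qed (simp_all only: block_XYZ_carrier(1,2))
    show "R' s i * R' s i = (if s then 1\<^sub>m (N + N) else - 1\<^sub>m (N + N))"
      using cases[OF i]
    proof (elim disjE conjE)
      assume e: "R' s i = block_Z N (R s i)" "i < (if s then k else l)"
      then show ?thesis using r(1,2)[OF e(2)] unfolding e(1)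
        by (simp add: block_XYZ(3) block_Z_diag_uminus block_one)
    qed (simp_all only: block_XYZ(1,2)[OF one_carrier_mat one_carrier_mat] if_True if_False simp_thms)
    show "mat_cnj (R' s i) = R' s i"
      using cases[OF i]
    proof (elim disjE conjE)
      assume e: "R' s i = block_Z N (R s i)" "i < (if s then k else l)"
      then show ?thesis using r(1,3)[OF e(2)] unfolding e(1) by (simp add: block_XYZ_cnj(3))
    qed (simp_all only: block_XYZ_cnj(1,2)[OF one_carrier_mat])
    show "transpose_mat (R' s i) = (if s then R' s i else - R' s i)"
      using cases[OF i]
    proof (elim disjE conjE)
      assume e: "R' s i = block_Z N (R s i)" "i < (if s then k else l)"
      then show ?thesis using r(1,4)[OF e(2)] unfolding e(1) by (cases s) (simp_all add: block_XYZ_cnj(6,7))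
    qed (simp_all only: block_XYZ_cnj(4,5)[OF one_carrier_mat] if_True if_False)
  next
    fix s i t j assume i: "i < (if s then Suc k else Suc l)" and j: "j < (if t then Suc k else Suc l)"
      and ne: "(s, i) \<noteq> (t, j)"
    show "R' s i * R' t j = - (R' t j * R' s i)"
      using cases[OF i] cases[OF j]
    proof (elim disjE conjE)
      assume e: "R' s i = block_Z N (R s i)" "i < (if s then k else l)"
        "R' t j = block_Z N (R t j)" "j < (if t then k else l)"
      show ?thesis unfolding e(1,3) by (rule anti_Z[OF e(2,4) ne])
    next
      assume e: "R' s i = block_Z N (R s i)" "i < (if s then k else l)" "R' t j = block_X N"
      show ?thesis unfolding e(1,3) using anti_swap(1)[OF r(1)[OF e(2)]] .
    next
      assume e: "R' s i = block_Z N (R s i)" "i < (if s then k else l)" "R' t j = block_Y N"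
      show ?thesis unfolding e(1,3) using anti_swap(2)[OF r(1)[OF e(2)]] .
    next
      assume e: "R' t j = block_Z N (R t j)" "j < (if t then k else l)" "R' s i = block_X N"
      show ?thesis unfolding e(1,3) using block_XYZ(5)[OF r(1)[OF e(2)] r(1)[OF e(2)]] .
    next
      assume e: "R' t j = block_Z N (R t j)" "j < (if t then k else l)" "R' s i = block_Y N"
      show ?thesis unfolding e(1,3) using block_XYZ(6)[OF r(1)[OF e(2)] r(1)[OF e(2)]] .
    next
      assume e: "R' s i = block_X N" "R' t j = block_Y N"
      show ?thesis unfolding e using block_XYZ(4)[OF one_carrier_mat one_carrier_mat] .
    next
      assume e: "R' s i = block_Y N" "R' t j = block_X N"
      show ?thesis unfolding e using anti_swap(3)[OF one_carrier_mat] .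
    qed (use ne in simp_all)
  qed
qed

lemma real_system_exists_split: "\<exists>R. real_system m m (2 ^ m) R"
proof (induction m)
  case 0
  have "real_system 0 0 1 (\<lambda>s i. 1\<^sub>m (1 :: nat))" by (simp add: real_system_def)
  then show ?case by auto
next
  case (Suc m)
  then obtain R where "real_system m m (2 ^ m) R" by blast
  from real_system_double[OF this] show ?case by (auto simp: mult_2)
qed

text \<open>The two real Pauli matrices sigma_x and sigma_z. They start the series in which
  symmetric matrices outnumber skewsymmetric ones by two.\<close>

lemma real_system_two: "real_system 2 0 2 (\<lambda>s i. if i = 0 then block_X 1 else block_Z 1 (1\<^sub>m 1))"
proof -
  have e: "(1 + 1 :: nat) = 2" by simp
  note b = block_XYZ[OF one_carrier_mat[of 1] one_carrier_mat[of 1], unfolded e]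
    and c = block_XYZ_cnj[OF one_carrier_mat[of 1]] and d = block_XYZ_carrier[where N=1, unfolded e]
  have z: "block_Z 1 (1\<^sub>m 1) * block_Z 1 (1\<^sub>m 1) = 1\<^sub>m 2"
    unfolding b(3) using block_one[of 1] by (simp add: numeral_2_eq_2)
  have x: "block_Z 1 (1\<^sub>m 1) * block_X 1 = - (block_X 1 * block_Z 1 (1\<^sub>m 1))"
    using b(5) by simp
  have "(s \<and> i < 2) = (s \<and> (i = 0 \<or> i = 1))" for s and i :: nat by auto
  then show ?thesis
    unfolding real_system_def using b(1,5) z x c(1,3,4,6) d(1,3)
    by (auto simp: mat_cnj_one less_2_cases_iff)
qed

lemma real_system_exists_two: "\<exists>R. real_system (m + 2) m (2 ^ (m + 1)) R"
proof (induction m)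
  case 0
  show ?case using real_system_two by (auto simp: numeral_2_eq_2)
next
  case (Suc m)
  then obtain R where "real_system (m + 2) m (2 ^ (m + 1)) R" by blast
  from real_system_double[OF this] show ?case by (auto simp: mult_2)
qed

section \<open>Spinbases with given numbers of real and complex, symmetric and skewsymmetric matrices\<close>

text \<open>
  The indices are grouped into real symmetric, complex skewsymmetric (both with square \<open>1\<close>),
  complex symmetric and real skewsymmetric (both with square \<open>-1\<close>) matrices, of which there are
  \<open>\<alpha>\<close>, \<open>\<beta>\<close>, \<open>\<gamma>\<close>, \<open>\<delta>\<close>. A matrix with square \<open>\<plusminus>1\<close> that is real up to the factor \<open>\<i>\<close>
  and unitary belongs to one of these groups.
\<close>

locale spinor_counts =
  fixes \<alpha> \<beta> \<gamma> \<delta> N :: nat and R :: "bool \<Rightarrow> nat \<Rightarrow> complex mat"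
  assumes R: "real_system (\<alpha> + \<gamma>) (\<beta> + \<delta>) N R" and even_total: "even (\<alpha> + \<beta> + \<gamma> + \<delta>)"
begin

abbreviation p where "p \<equiv> \<alpha> + \<beta>"
abbreviation q where "q \<equiv> \<gamma> + \<delta>"

definition is_cplx :: "nat \<Rightarrow> bool" where "is_cplx i \<longleftrightarrow> \<alpha> \<le> i \<and> i < p + \<gamma>"
definition is_sym :: "nat \<Rightarrow> bool" where "is_sym i \<longleftrightarrow> i < \<alpha> \<or> (p \<le> i \<and> i < p + \<gamma>)"
text \<open>The real symmetric matrices supply the real symmetric group and then the complex
  symmetric one; the real skewsymmetric matrices supply the complex group and then the real one.
  Thus index \<open>p + j\<close> of the third group uses number \<open>\<alpha> + j\<close>, which
  explains the subtraction of \<open>\<beta>\<close>.\<close>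

definition idx :: "nat \<Rightarrow> nat" where
  "idx i = (if i < \<alpha> then i else if i < p then i - \<alpha> else if i < p + \<gamma> then i - \<beta> else i - (\<alpha> + \<gamma>))"

text \<open>The imaginary unit reverses the sign of the square and the behaviour under conjugation
  but preserves the symmetry type, so two kinds of real matrices yield all four groups.\<close>

definition mats :: "nat \<Rightarrow> complex mat" where
  "mats i = (if is_cplx i then \<i> else 1) \<cdot>\<^sub>m R (is_sym i) (idx i)"

lemma idx_less: "i < p + q \<Longrightarrow> idx i < (if is_sym i then \<alpha> + \<gamma> else \<beta> + \<delta>)"
  by (auto simp: idx_def is_sym_def)

lemma idx_inj: "i < p + q \<Longrightarrow> j < p + q \<Longrightarrow> i \<noteq> j \<Longrightarrow> (is_sym i, idx i) \<noteq> (is_sym j, idx j)"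
  by (auto simp: idx_def is_sym_def split: if_splits)

lemma R_facts:
  assumes "i < p + q"
  shows "R (is_sym i) (idx i) \<in> carrier_mat N N"
    "R (is_sym i) (idx i) * R (is_sym i) (idx i) = (if is_sym i then 1\<^sub>m N else - 1\<^sub>m N)"
    "mat_cnj (R (is_sym i) (idx i)) = R (is_sym i) (idx i)"
    "transpose_mat (R (is_sym i) (idx i)) = (if is_sym i then R (is_sym i) (idx i) else - R (is_sym i) (idx i))"
  using R idx_less[OF assms] unfolding real_system_def by blast+

lemma mats_facts:
  assumes i: "i < p + q"
  shows "mats i \<in> carrier_mat N N" "mats i * mats i = (if i < p then 1\<^sub>m N else - 1\<^sub>m N)"
    "mat_cnj (mats i) = (if is_cplx i then - mats i else mats i)"
    "transpose_mat (mats i) = (if is_sym i then mats i else - mats i)"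
proof -
  note r = R_facts[OF i]
  show c: "mats i \<in> carrier_mat N N" using r(1) by (simp add: mats_def)
  have sm: "(c \<cdot>\<^sub>m A) * (c \<cdot>\<^sub>m A) = (c * c) \<cdot>\<^sub>m (A * A)" if "A \<in> carrier_mat N N" for c and A :: "complex mat"
    using that mult_smult_assoc_mat[of A N N _ N] mult_smult_distrib[of A N N A N]
    by (simp add: smult_smult_mat)
  have "(if is_cplx i then \<i> else 1) * (if is_cplx i then \<i> else 1) = (if is_cplx i then - 1 else (1 :: complex))"
    by simp
  then have "mats i * mats i = (if is_cplx i then - 1 else 1) \<cdot>\<^sub>m (if is_sym i then 1\<^sub>m N else - 1\<^sub>m N)"
    unfolding mats_def sm[OF r(1)] r(2) by simp
  also have "\<dots> = (if i < p then 1\<^sub>m N else - 1\<^sub>m N)"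
    using i by (auto simp: is_cplx_def is_sym_def uminus_smult_mat smult_smult_mat)
  finally show "mats i * mats i = (if i < p then 1\<^sub>m N else - 1\<^sub>m N)" .
  show "mat_cnj (mats i) = (if is_cplx i then - mats i else mats i)"
    unfolding mats_def mat_cnj_smult r(3) by (simp add: uminus_smult_mat smult_smult_mat)
  show "transpose_mat (mats i) = (if is_sym i then mats i else - mats i)"
    unfolding mats_def transpose_smult r(4) by (simp add: uminus_smult_mat smult_smult_mat)
qed

lemma spinbasis_mats: "spinbasis p q N mats"
  unfolding spinbasis_def
proof (intro conjI allI impI)
  show "0 < N" using R by (simp add: real_system_def)
  fix i assume i: "i < p + q"
  show "mats i \<in> carrier_mat N N" "mats i * mats i = (if i < p then 1\<^sub>m N else - 1\<^sub>m N)"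
    "mat_cnj (mats i) = mats i \<or> mat_cnj (mats i) = - mats i"
    "transpose_mat (mats i) = mats i \<or> transpose_mat (mats i) = - mats i"
    using mats_facts[OF i] by simp_all
  fix j assume j: "j < p + q" and ne: "i \<noteq> j"
  let ?A = "R (is_sym i) (idx i)" and ?B = "R (is_sym j) (idx j)"
  have AB: "?A * ?B = - (?B * ?A)"
    using R idx_less[OF i] idx_less[OF j] idx_inj[OF i j ne] unfolding real_system_def by blast
  have sm: "(c \<cdot>\<^sub>m A) * (d \<cdot>\<^sub>m B) = (c * d) \<cdot>\<^sub>m (A * B)"
    if "A \<in> carrier_mat N N" "B \<in> carrier_mat N N" for c d and A B :: "complex mat"
    using that mult_smult_assoc_mat[of A N N _ N] mult_smult_distrib[of A N N B N]
    by (simp add: smult_smult_mat)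
  show "mats i * mats j = - (mats j * mats i)"
    unfolding mats_def sm[OF R_facts(1)[OF i] R_facts(1)[OF j]] sm[OF R_facts(1)[OF j] R_facts(1)[OF i]] AB
    by (simp only: uminus_smult_mat smult_smult_mat) (simp add: mult.commute)
qed

sublocale spinor_matrices p q N mats
  using spinbasis_mats even_total by unfold_locales (simp_all add: add.assoc)

lemma complex_indices_mats: "complex_indices (p + q) mats = {i. i < p + q \<and> is_cplx i}"
  using mats_facts(3) Es_nonzero unfolding complex_indices_def by (auto split: if_splits)

lemma skew_indices_mats: "skew_indices (p + q) mats = {i. i < p + q \<and> \<not> is_sym i}"
  using mats_facts(4) Es_nonzero unfolding skew_indices_def by (auto split: if_splits)

section \<open>Blades that are unions of the four groups of indices\<close>

definition group_flag :: "bool \<times> bool \<times> bool \<times> bool \<Rightarrow> nat \<Rightarrow> bool" where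
  "group_flag = (\<lambda>(b1, b2, b3, b4) i. if i < \<alpha> then b1 else if i < p then b2 else if i < p + \<gamma> then b3 else b4)"

definition blk :: "bool \<times> bool \<times> bool \<times> bool \<Rightarrow> nat set" where
  "blk f = {i. i < p + q \<and> group_flag f i}"

end

fun xor_flags :: "bool \<times> bool \<times> bool \<times> bool \<Rightarrow> bool \<times> bool \<times> bool \<times> bool \<Rightarrow> bool \<times> bool \<times> bool \<times> bool" where
  "xor_flags (a, b, c, d) (a', b', c', d') = (a \<noteq> a', b \<noteq> b', c \<noteq> c', d \<noteq> d')"

fun flags_card :: "nat \<times> nat \<times> nat \<times> nat \<Rightarrow> bool \<times> bool \<times> bool \<times> bool \<Rightarrow> nat" where
  "flags_card (\<alpha>, \<beta>, \<gamma>, \<delta>) (b1, b2, b3, b4) =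
     (if b1 then \<alpha> else 0) + (if b2 then \<beta> else 0) + (if b3 then \<gamma> else 0) + (if b4 then \<delta> else 0)"

text \<open>The exponent of \<open>blade_sign_self\<close>: the inverted pairs, and the factors of
  square -1, which make up the last two groups.\<close>

fun flags_minus :: "nat \<times> nat \<times> nat \<times> nat \<Rightarrow> bool \<times> bool \<times> bool \<times> bool \<Rightarrow> bool" where
  "flags_minus (\<alpha>, \<beta>, \<gamma>, \<delta>) (b1, b2, b3, b4) =
     (let k = flags_card (\<alpha>, \<beta>, \<gamma>, \<delta>) (b1, b2, b3, b4)
      in odd (k * (k - 1) div 2 + flags_card (\<alpha>, \<beta>, \<gamma>, \<delta>) (False, False, b3, b4)))"

text \<open>The flags follow the order of the groups: skewsymmetric matrices are the second and
  fourth, complex ones the second and third. An odd number of them switches to the complementary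
  flags.\<close>

fun label_flags :: "nat \<times> nat \<times> nat \<times> nat \<Rightarrow> cpt_label \<Rightarrow> bool \<times> bool \<times> bool \<times> bool" where
  "label_flags (\<alpha>, \<beta>, \<gamma>, \<delta>) (x, y, z) =
     (let e = even (\<beta> + \<delta>); c = even (\<beta> + \<gamma>) in
      xor_flags (x, x, x, x)
        (xor_flags (y \<and> \<not> e, y \<and> e, y \<and> \<not> e, y \<and> e) (z \<and> \<not> c, z \<and> c, z \<and> c, z \<and> \<not> c)))"

context spinor_counts
begin

abbreviation counts where "counts \<equiv> (\<alpha>, \<beta>, \<gamma>, \<delta>)"

lemma blk_sym_diff: "sym_diff (blk f) (blk g) = blk (xor_flags f g)"
  by (cases f; cases g) (auto simp: blk_def group_flag_def split: if_splits)

lemma blk_decompose: "blk (b1, b2, b3, b4) = (if b1 then {..<\<alpha>} else {}) \<union> ((if b2 then {\<alpha>..<p} else {}) \<union>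
    ((if b3 then {p..<p + \<gamma>} else {}) \<union> (if b4 then {p + \<gamma>..<p + q} else {})))"
  by (auto simp: blk_def group_flag_def split: if_splits)

lemma card_blk: "card (blk f) = flags_card counts f"
proof -
  obtain b1 b2 b3 b4 where f: "f = (b1, b2, b3, b4)" by (cases f)
  show ?thesis
    unfolding f blk_decompose
    by (subst card_Un_disjoint; (subst card_Un_disjoint; (subst card_Un_disjoint)?)?) auto
qed

lemma card_blk_negative: "card {i \<in> blk (b1, b2, b3, b4). p \<le> i} = flags_card counts (False, False, b3, b4)"
proof -
  have "{i \<in> blk (b1, b2, b3, b4). p \<le> i} = blk (False, False, b3, b4)"
    by (auto simp: blk_def group_flag_def split: if_splits)
  then show ?thesis by (simp only: card_blk)
qed

lemma blade_sign_blk: "blade_sign p (blk f) (blk f) = (if flags_minus counts f then - 1 else 1)"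
proof -
  obtain b1 b2 b3 b4 where f: "f = (b1, b2, b3, b4)" by (cases f)
  have fin: "finite (blk f)" by (simp add: blk_def)
  show ?thesis
    unfolding blade_sign_self[OF fin] unfolding f reversion_sign_def card_blk card_blk_negative
    by (simp only: flags_minus.simps Let_def power_add[symmetric] minus_one_power_iff) simp
qed

lemma ext_set_blk: "ext_set v = blk (label_flags counts v)"
proof -
  obtain x y z where v: "v = (x, y, z)" by (cases v)
  have all: "{..<p + q} = blk (True, True, True, True)" and none: "{} = blk (False, False, False, False)"
    by (auto simp: blk_def group_flag_def)
  have skew: "skew_indices (p + q) mats = blk (False, True, False, True)"
    unfolding skew_indices_mats by (auto simp: blk_def group_flag_def is_sym_def split: if_splits)
  have cplx: "complex_indices (p + q) mats = blk (False, True, True, False)"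
    unfolding complex_indices_mats by (auto simp: blk_def group_flag_def is_cplx_def split: if_splits)
  have compl: "{..<p + q} - blk f = blk (xor_flags (True, True, True, True) f)" for f
    unfolding blk_sym_diff[symmetric] all[symmetric] by (auto simp: blk_def)
  have E: "E_set = (if even (\<beta> + \<delta>) then blk (False, True, False, True) else blk (True, False, True, False))"
    unfolding E_set_def sym_indices_eq skew card_blk compl by simp
  have P: "Pi_set = (if even (\<beta> + \<gamma>) then blk (False, True, True, False) else blk (True, False, False, True))"
    unfolding Pi_set_def real_indices_eq cplx card_blk compl by simp
  have a: "(if x then {..<p + q} else {}) = blk (x, x, x, x)" unfolding all none by simp
  have b: "(if y then E_set else {}) = blk (y \<and> \<not> even (\<beta> + \<delta>), y \<and> even (\<beta> + \<delta>), y \<and> \<not> even (\<beta> + \<delta>), y \<and> even (\<beta> + \<delta>))"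
    unfolding E none by simp
  have c: "(if z then Pi_set else {}) = blk (z \<and> \<not> even (\<beta> + \<gamma>), z \<and> even (\<beta> + \<gamma>), z \<and> even (\<beta> + \<gamma>), z \<and> \<not> even (\<beta> + \<gamma>))"
    unfolding P none by simp
  show ?thesis
    unfolding v ext_set.simps a b c blk_sym_diff label_flags.simps Let_def ..
qed

text \<open>Index sets are additive in the label, so injectivity is triviality of the
  kernel.\<close>

lemma ext_set_inj:
  assumes "\<forall>v. v \<noteq> (False, False, False) \<longrightarrow> flags_card counts (label_flags counts v) \<noteq> 0"
  shows "inj ext_set"
proof (rule injI)
  fix u v assume "ext_set u = ext_set v"
  then have "ext_set (u \<otimes>\<^bsub>cpt_labels\<^esub> v) = {}" unfolding ext_set_mult by simp
  then have "flags_card counts (label_flags counts (u \<otimes>\<^bsub>cpt_labels\<^esub> v)) = 0"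
    unfolding ext_set_blk card_blk[symmetric] by simp
  with assms have "u \<otimes>\<^bsub>cpt_labels\<^esub> v = (False, False, False)" by blast
  then show "u = v" by (cases u; cases v) (simp add: cpt_labels_mult)
qed

end

section \<open>Division rings of real Clifford algebras\<close>

lemma cl_real_mult:
  assumes "A \<in> cl_real p q" "B \<in> cl_real p q"
  shows "cl_mult p q A B \<in> cl_real p q"
proof -
  have "cl_mult p q A B U \<in> \<real>" for U
    unfolding cl_mult_def using assms by (intro sum_in_Reals Reals_mult) (auto simp: cl_real_def)
  with assms show ?thesis by (simp add: cl_real_def)
qed

lemma cl_real_add: "A \<in> cl_real p q \<Longrightarrow> B \<in> cl_real p q \<Longrightarrow> cl_add A B \<in> cl_real p q"
  unfolding cl_real_def mem_Collect_eq using cl_add_closed by (auto simp: cl_add_def)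

lemma cl_real_scale: "A \<in> cl_real p q \<Longrightarrow> r \<in> \<real> \<Longrightarrow> cl_scale r A \<in> cl_real p q"
  unfolding cl_real_def mem_Collect_eq using cl_scale_closed by (auto simp: cl_scale_def)

lemma cl_real_blade: "S \<subseteq> {..<p + q} \<Longrightarrow> cl_blade S \<in> cl_real p q"
  unfolding cl_real_def mem_Collect_eq using cl_blade_closed by (auto simp: cl_blade_def)

lemma cl_real_one: "cl_one \<in> cl_real p q"
  unfolding cl_one_blade by (rule cl_real_blade) simp

lemma cl_blade_commute:
  assumes "S \<subseteq> {..<p + q}" "T \<subseteq> {..<p + q}"
  shows "cl_mult p q (cl_blade S) (cl_blade T) = cl_scale (comm_sign S T) (cl_mult p q (cl_blade T) (cl_blade S))"
proof -
  have f: "finite S" "finite T" using assms by (auto intro: finite_subset)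
  have e: "sym_diff T S = sym_diff S T" by blast
  have "blade_sign p S T = comm_sign S T * blade_sign p T S"
    unfolding comm_sign_blade_sign[OF f, of p] by (simp add: mult.assoc blade_sign_square)
  with assms show ?thesis by (simp add: cl_mult_blade e) (simp add: cl_scale_def mult.assoc)
qed

lemma cl_scale_one [simp]: "cl_scale 1 A = A"
  by (simp add: cl_scale_def)

lemma cl_scale_scale: "cl_scale a (cl_scale b A) = cl_scale (a * b) A"
  by (simp add: cl_scale_def mult.assoc)

lemma cl_add_zero [simp]: "cl_add A cl_zero = A" "cl_add cl_zero A = A"
  by (simp_all add: cl_add_def cl_zero_def)

definition half_idem :: "nat set \<Rightarrow> clif" where
  "half_idem T = cl_scale (1 / 2) (cl_add cl_one (cl_blade T))"

fun idem :: "nat \<Rightarrow> nat \<Rightarrow> nat set list \<Rightarrow> clif" where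
  "idem p q [] = cl_one"
| "idem p q (T # Ts) = cl_mult p q (half_idem T) (idem p q Ts)"

text \<open>Each set has an index occurring in no later set of the list. This independence keeps the
  product of the idempotents \<open>half_idem\<close> from vanishing.\<close>

fun fresh_sets :: "nat set list \<Rightarrow> bool" where
  "fresh_sets [] \<longleftrightarrow> True"
| "fresh_sets (T # Ts) \<longleftrightarrow> \<not> T \<subseteq> \<Union> (set Ts) \<and> fresh_sets Ts"

text \<open>
  Commuting blades \<open>e_T\<close> with square \<open>1\<close> give the idempotent $f = \prod_T (1 + e_T)/2$. In
  \<open>f C\<ell> f\<close> the blades that anticommute with some \<open>e_T\<close> vanish, and the \<open>e_T\<close> become \<open>f\<close>.
\<close>

definition spanned_by :: "nat \<Rightarrow> nat \<Rightarrow> clif \<Rightarrow> nat set set \<Rightarrow> nat set \<Rightarrow> bool" where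
  "spanned_by p q f \<S> S \<longleftrightarrow> (\<exists>c S'. c \<in> \<real> \<and> S' \<in> \<S> \<and>
     cl_mult p q f (cl_blade S) = cl_scale c (cl_mult p q f (cl_blade S')))"

locale commuting_blades =
  fixes p q :: nat and Ts :: "nat set list"
  assumes Ts_subset: "\<And>T. T \<in> set Ts \<Longrightarrow> T \<subseteq> {..<p + q}"
    and Ts_square: "\<And>T. T \<in> set Ts \<Longrightarrow> blade_sign p T T = 1"
    and Ts_comm: "\<And>S T. S \<in> set Ts \<Longrightarrow> T \<in> set Ts \<Longrightarrow> comm_sign S T = 1"
    and Ts_fresh: "fresh_sets Ts"
begin

abbreviation mult (infixl "\<diamondop>" 70) where "A \<diamondop> B \<equiv> cl_mult p q A B"
abbreviation f where "f \<equiv> idem p q Ts"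
abbreviation e where "e \<equiv> cl_blade"

lemma half_idem_real: "T \<in> set Ts \<Longrightarrow> half_idem T \<in> cl_real p q"
  unfolding half_idem_def by (intro cl_real_scale cl_real_add cl_real_one cl_real_blade Ts_subset) simp_all

lemma idem_real: "set Rs \<subseteq> set Ts \<Longrightarrow> idem p q Rs \<in> cl_real p q"
  by (induction Rs) (simp_all add: cl_real_one cl_real_mult half_idem_real)

lemma f_real: "f \<in> cl_real p q"
  by (rule idem_real) simp

lemma f_complex [simp]: "f \<in> cl_complex p q"
  by (rule cl_real_complex[OF f_real])

lemma e_complex [simp]: "T \<in> set Ts \<Longrightarrow> e T \<in> cl_complex p q"
  using Ts_subset by simp

lemma half_idem_commute:
  assumes "A \<in> cl_complex p q" "A \<diamondop> e T = e T \<diamondop> A"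
  shows "A \<diamondop> half_idem T = half_idem T \<diamondop> A"
  unfolding half_idem_def cl_mult_scale_right cl_mult_scale_left cl_mult_add_left cl_mult_add_right
  using assms by simp

lemma idem_commute:
  assumes "set Rs \<subseteq> set Ts" "A \<in> cl_complex p q" "\<And>T. T \<in> set Rs \<Longrightarrow> A \<diamondop> e T = e T \<diamondop> A"
  shows "A \<diamondop> idem p q Rs = idem p q Rs \<diamondop> A"
  using assms
proof (induction Rs)
  case (Cons T Rs)
  have c: "half_idem T \<in> cl_complex p q" "idem p q Rs \<in> cl_complex p q"
    using Cons.prems by (auto intro: cl_real_complex half_idem_real idem_real)
  have "A \<diamondop> idem p q (T # Rs) = A \<diamondop> half_idem T \<diamondop> idem p q Rs"
    using Cons.prems c by (simp add: cl_mult_assoc)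
  also have "\<dots> = half_idem T \<diamondop> (A \<diamondop> idem p q Rs)"
    using Cons.prems c by (simp add: half_idem_commute cl_mult_assoc)
  also have "\<dots> = idem p q (T # Rs) \<diamondop> A"
    using Cons c by (simp add: cl_mult_assoc)
  finally show ?case .
qed simp

lemma e_commute_f:
  assumes "S \<subseteq> {..<p + q}" "\<And>T. T \<in> set Ts \<Longrightarrow> comm_sign T S = 1"
  shows "e S \<diamondop> f = f \<diamondop> e S"
proof (rule idem_commute)
  fix T assume T: "T \<in> set Ts"
  show "e S \<diamondop> e T = e T \<diamondop> e S"
    using cl_blade_commute[OF assms(1) Ts_subset[OF T]] assms(2)[OF T] by (simp add: comm_sign_commute)
qed (use assms in simp_all)

lemma e_mult_half_idem:
  assumes "T \<in> set Ts"
  shows "e T \<diamondop> half_idem T = half_idem T"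
proof -
  have "e T \<diamondop> e T = cl_one"
    using cl_mult_blade[OF Ts_subset[OF assms], of T] by (simp add: Ts_square[OF assms] cl_one_blade)
  with assms show ?thesis
    unfolding half_idem_def cl_mult_scale_right cl_mult_add_right by (simp add: cl_add_def add.commute)
qed

lemma e_mult_idem:
  assumes "set Rs \<subseteq> set Ts" "T \<in> set Rs"
  shows "e T \<diamondop> idem p q Rs = idem p q Rs"
  using assms
proof (induction Rs)
  case (Cons R Rs)
  have c: "half_idem R \<in> cl_complex p q" "idem p q Rs \<in> cl_complex p q" "e T \<in> cl_complex p q"
    using Cons.prems by (auto intro: cl_real_complex half_idem_real idem_real e_complex)
  show ?case
  proof (cases "T = R")
    case True
    then have "e T \<diamondop> (half_idem R \<diamondop> idem p q Rs) = (e R \<diamondop> half_idem R) \<diamondop> idem p q Rs"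
      using c by (simp add: cl_mult_assoc)
    with Cons.prems show ?thesis by (simp add: e_mult_half_idem)
  next
    case False
    then have T: "T \<in> set Rs" using Cons.prems by simp
    have RT: "R \<in> set Ts" "T \<in> set Ts" using Cons.prems by auto
    have "e T \<diamondop> e R = e R \<diamondop> e T"
      using cl_blade_commute[OF Ts_subset[OF RT(2)] Ts_subset[OF RT(1)]] Ts_comm[OF RT(2,1)] by simp
    then have "e T \<diamondop> half_idem R = half_idem R \<diamondop> e T" using c by (simp add: half_idem_commute)
    then have "e T \<diamondop> (half_idem R \<diamondop> idem p q Rs) = half_idem R \<diamondop> (e T \<diamondop> idem p q Rs)"
      using c by (simp flip: cl_mult_assoc)
    with Cons T show ?thesis by simp
  qed
qed simp

lemma e_mult_f: "T \<in> set Ts \<Longrightarrow> e T \<diamondop> f = f"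
  by (rule e_mult_idem) simp_all

lemma f_mult_e:
  assumes "T \<in> set Ts"
  shows "f \<diamondop> e T = f"
  using e_commute_f[OF Ts_subset[OF assms]] e_mult_f[OF assms] Ts_comm assms by simp

lemma f_idem: "f \<diamondop> f = f"
proof -
  have "idem p q Rs \<diamondop> f = f" if "set Rs \<subseteq> set Ts" for Rs
    using that
  proof (induction Rs)
    case (Cons T Rs)
    have c: "half_idem T \<in> cl_complex p q" "idem p q Rs \<in> cl_complex p q"
      using Cons.prems by (auto intro: cl_real_complex half_idem_real idem_real)
    have "half_idem T \<diamondop> f = f"
      unfolding half_idem_def cl_mult_scale_left cl_mult_add_left using Cons.prems
      by (simp add: e_mult_f) (simp add: cl_scale_def cl_add_def)
    with Cons c show ?case by (simp add: cl_mult_assoc)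
  qed simp
  then show ?thesis by simp
qed

text \<open>A factor \<open>e T\<close> can be inserted beside \<open>f\<close> without effect, but
  moving it across \<open>e S\<close> changes the sign, so the product equals its negative.\<close>

lemma f_e_f_zero:
  assumes S: "S \<subseteq> {..<p + q}" and T: "T \<in> set Ts" "comm_sign T S \<noteq> 1"
  shows "f \<diamondop> e S \<diamondop> f = cl_zero"
proof -
  have cm: "comm_sign T S = - 1" using T(2) comm_sign_cases by blast
  have c: "e S \<in> cl_complex p q" "e T \<in> cl_complex p q" using S T by simp_all
  have "f \<diamondop> e S \<diamondop> f = f \<diamondop> (e T \<diamondop> e S) \<diamondop> f"
    using c f_mult_e[OF T(1)] by (simp flip: cl_mult_assoc)
  also have "\<dots> = cl_scale (- 1) (f \<diamondop> (e S \<diamondop> e T) \<diamondop> f)"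
    by (simp add: cl_blade_commute[OF Ts_subset[OF T(1)] S] cm cl_mult_scale_left cl_mult_scale_right)
  also have "f \<diamondop> (e S \<diamondop> e T) \<diamondop> f = f \<diamondop> e S \<diamondop> f"
    using c e_mult_f[OF T(1)] by (simp add: cl_mult_assoc)
  finally show ?thesis
    by (simp add: fun_eq_iff cl_scale_def cl_zero_def)
qed

lemma f_e_sym_diff:
  assumes S: "S \<subseteq> {..<p + q}" and T: "T \<in> set Ts"
  shows "f \<diamondop> e S = cl_scale (blade_sign p T S) (f \<diamondop> e (sym_diff T S))"
proof -
  have "f \<diamondop> e S = f \<diamondop> (e T \<diamondop> e S)"
    using S T f_mult_e[OF T] by (simp flip: cl_mult_assoc)
  then show ?thesis
    using cl_mult_blade[OF Ts_subset[OF T], of S] by (simp add: cl_mult_scale_right)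
qed

text \<open>The coefficient at the empty set is halved by each factor: the only other contribution
  is the coefficient of the remaining product at \<open>T\<close>, which vanishes because
  \<open>T\<close> has a fresh index.\<close>

lemma f_nonzero: "f \<noteq> cl_zero"
proof -
  have "idem p q Rs {} \<noteq> 0 \<and> (\<forall>U. idem p q Rs U \<noteq> 0 \<longrightarrow> U \<subseteq> \<Union> (set Rs))"
    if "set Rs \<subseteq> set Ts" "fresh_sets Rs" for Rs
    using that
  proof (induction Rs)
    case Nil
    then show ?case by (simp add: cl_one_def)
  next
    case (Cons T Rs)
    let ?g = "idem p q Rs"
    have T: "T \<subseteq> {..<p + q}" using Cons.prems Ts_subset by simp
    have IH: "?g {} \<noteq> 0" "?g U \<noteq> 0 \<Longrightarrow> U \<subseteq> \<Union> (set Rs)" for U using Cons by auto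
    have g: "idem p q (T # Rs) U = 1 / 2 * (?g U + ?g (sym_diff T U) * blade_sign p T (sym_diff T U))" for U
      by (simp add: half_idem_def cl_mult_scale_left cl_mult_add_left cl_mult_blade_left[OF T])
        (simp add: cl_scale_def cl_add_def)
    have "?g T = 0" using IH(2)[of T] Cons.prems(2) by auto
    then have "idem p q (T # Rs) {} \<noteq> 0" unfolding g using IH(1) by simp
    moreover have "U \<subseteq> \<Union> (set (T # Rs))" if "idem p q (T # Rs) U \<noteq> 0" for U
    proof -
      have "?g U \<noteq> 0 \<or> ?g (sym_diff T U) \<noteq> 0" using that unfolding g by auto
      then show ?thesis using IH(2)[of U] IH(2)[of "sym_diff T U"] by auto
    qed
    ultimately show ?case by blast
  qed
  from this[OF order_refl Ts_fresh] have "f {} \<noteq> 0" by blast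
  then show ?thesis by (auto simp: cl_zero_def)
qed

text \<open>\<open>\<iota>\<close> maps the expected division ring into the centralizer of
  \<open>f\<close>, and multiplying by \<open>f\<close> leads onto the corner: \<open>span\<close>
  handles the blades that survive, and inverses of differences give injectivity. A division ring has
  no idempotents besides 0 and 1, which makes \<open>f\<close> primitive.\<close>

lemma corner_division:
  fixes \<iota> :: "'k \<Rightarrow> clif" and R :: "'k ring"
  assumes R: "carrier R = UNIV"
    and real: "\<And>x. \<iota> x \<in> cl_real p q" and comm: "\<And>x. \<iota> x \<diamondop> f = f \<diamondop> \<iota> x"
    and one: "\<iota> \<one>\<^bsub>R\<^esub> = cl_one" and zero: "\<iota> \<zero>\<^bsub>R\<^esub> = cl_zero"
    and add: "\<And>x y. \<iota> (x \<oplus>\<^bsub>R\<^esub> y) = cl_add (\<iota> x) (\<iota> y)"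
    and mult: "\<And>x y. \<iota> (x \<otimes>\<^bsub>R\<^esub> y) = \<iota> x \<diamondop> \<iota> y"
    and scale: "\<And>r x. \<exists>y. \<iota> y = cl_scale (of_real r) (\<iota> x)"
    and inverse: "\<And>x y. x \<noteq> y \<Longrightarrow> \<exists>w\<in>cl_complex p q. cl_add (\<iota> x) (cl_neg (\<iota> y)) \<diamondop> w = cl_one"
    and span: "\<And>S. S \<subseteq> {..<p + q} \<Longrightarrow> (\<And>T. T \<in> set Ts \<Longrightarrow> comm_sign T S = 1) \<Longrightarrow> \<exists>x. f \<diamondop> e S = f \<diamondop> \<iota> x"
  shows "primitive_idempotent p q f" and "corner_ring p q f \<simeq> R"
proof -
  note [simp] = cl_real_complex[OF real]
  let ?g = "\<lambda>x. f \<diamondop> \<iota> x"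
  have g_inj: "x = y" if "?g x = ?g y" for x y
  proof (rule ccontr)
    assume "x \<noteq> y"
    then obtain w where w: "w \<in> cl_complex p q" "cl_add (\<iota> x) (cl_neg (\<iota> y)) \<diamondop> w = cl_one"
      using inverse by blast
    have "f \<diamondop> cl_add (\<iota> x) (cl_neg (\<iota> y)) = cl_zero"
      unfolding cl_mult_add_right cl_mult_neg_right that by (simp add: cl_add_def cl_neg_def cl_zero_def)
    then have "f \<diamondop> cl_add (\<iota> x) (cl_neg (\<iota> y)) \<diamondop> w = cl_zero" by (simp add: cl_mult_zero_left)
    then have "f = cl_zero" using w by (simp add: cl_mult_assoc)
    with f_nonzero show False ..
  qed
  have g_f: "f \<diamondop> \<iota> x \<diamondop> f = ?g x" for x
    using f_idem by (simp add: cl_mult_assoc comm) (simp flip: cl_mult_assoc)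
  have g_mult: "?g x \<diamondop> ?g y = ?g (x \<otimes>\<^bsub>R\<^esub> y)" for x y
  proof -
    have "?g x \<diamondop> ?g y = (f \<diamondop> \<iota> x \<diamondop> f) \<diamondop> \<iota> y" by (simp add: cl_mult_assoc)
    then show ?thesis unfolding g_f mult by (simp add: cl_mult_assoc)
  qed
  have g_add: "cl_add (?g x) (?g y) = ?g (x \<oplus>\<^bsub>R\<^esub> y)" for x y
    unfolding add cl_mult_add_right ..
  have corner_blade: "\<exists>x. f \<diamondop> cl_scale (of_real r) (e S) \<diamondop> f = ?g x" if S: "S \<subseteq> {..<p + q}" for r S
  proof -
    have "\<exists>x. f \<diamondop> e S \<diamondop> f = ?g x"
    proof (cases "\<forall>T\<in>set Ts. comm_sign T S = 1")
      case True
      then obtain x where x: "f \<diamondop> e S = ?g x" using span[OF S] by blast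
      then show ?thesis using g_f by metis
    next
      case False
      then have "f \<diamondop> e S \<diamondop> f = ?g \<zero>\<^bsub>R\<^esub>" using f_e_f_zero[OF S] by (auto simp: zero cl_mult_zero_right)
      then show ?thesis by blast
    qed
    then obtain x where x: "f \<diamondop> e S \<diamondop> f = ?g x" by blast
    obtain y where "\<iota> y = cl_scale (of_real r) (\<iota> x)" using scale by blast
    then have "f \<diamondop> cl_scale (of_real r) (e S) \<diamondop> f = ?g y"
      by (simp add: cl_mult_scale_left cl_mult_scale_right x)
    then show ?thesis by blast
  qed
  \<comment> \<open>Induction on a finite family containing the support of \<open>A\<close>,
    splitting off one blade at a time.\<close>
  have corner_fin: "\<exists>x. f \<diamondop> A \<diamondop> f = ?g x"
    if "finite F" "F \<subseteq> Pow {..<p + q}" "A \<in> cl_real p q" "\<And>S. A S \<noteq> 0 \<Longrightarrow> S \<in> F" for F A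
    using that
  proof (induction F arbitrary: A rule: finite_induct)
    case empty
    then have "A = cl_zero" by (auto simp: cl_zero_def)
    then have "f \<diamondop> A \<diamondop> f = ?g \<zero>\<^bsub>R\<^esub>" by (simp add: zero cl_mult_zero_left cl_mult_zero_right)
    then show ?case by blast
  next
    case (insert S F)
    let ?B = "A(S := 0)"
    obtain r where r: "A S = of_real r" using insert.prems(2) by (auto simp: cl_real_def elim: Reals_cases)
    have A: "A = cl_add (cl_scale (of_real r) (e S)) ?B"
      by (auto simp: fun_eq_iff cl_add_def cl_scale_def cl_blade_def r)
    have "?B \<in> cl_real p q" using insert.prems(2) by (auto simp: cl_real_def cl_complex_def)
    then obtain y where y: "f \<diamondop> ?B \<diamondop> f = ?g y"
      using insert.IH[of ?B] insert.prems by (metis Pow_iff fun_upd_apply insertE insert_subset)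
    obtain x where x: "f \<diamondop> cl_scale (of_real r) (e S) \<diamondop> f = ?g x"
      using corner_blade[of S r] insert.prems(1) by auto
    have "f \<diamondop> A \<diamondop> f = cl_add (?g x) (?g y)"
      unfolding x[symmetric] y[symmetric] by (subst A) (simp only: cl_mult_add_left cl_mult_add_right)
    then show ?case unfolding g_add by blast
  qed
  have corner: "\<exists>x. f \<diamondop> A \<diamondop> f = ?g x" if A: "A \<in> cl_real p q" for A
  proof (rule corner_fin[OF _ order_refl A])
    show "finite (Pow {..<p + q})" by simp
    show "S \<in> Pow {..<p + q}" if "A S \<noteq> 0" for S
      using that cl_complex_zero[OF cl_real_complex[OF A], of S] by blast
  qed
  have car: "carrier (corner_ring p q f) = range ?g"
  proof -
    have "?g x \<in> (\<lambda>A. f \<diamondop> A \<diamondop> f) ` cl_real p q" for x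
      using g_f[of x] real by (metis image_eqI)
    moreover have "f \<diamondop> A \<diamondop> f \<in> range ?g" if "A \<in> cl_real p q" for A
      using corner[OF that] by (metis rangeI)
    ultimately show ?thesis unfolding corner_ring_def by auto
  qed
  let ?h = "inv_into UNIV ?g"
  have inj: "inj ?g" by (rule injI) (rule g_inj)
  have hg[simp]: "?h (?g x) = x" for x by (rule inv_into_f_f[OF inj]) simp
  have "?h \<in> ring_iso (corner_ring p q f) R"
  proof (rule ring_iso_memI)
    fix A B assume "A \<in> carrier (corner_ring p q f)" "B \<in> carrier (corner_ring p q f)"
    then obtain x y where xy: "A = ?g x" "B = ?g y" unfolding car by blast
    have m: "A \<otimes>\<^bsub>corner_ring p q f\<^esub> B = ?g (x \<otimes>\<^bsub>R\<^esub> y)" "A \<oplus>\<^bsub>corner_ring p q f\<^esub> B = ?g (x \<oplus>\<^bsub>R\<^esub> y)"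
      using g_mult g_add by (simp_all add: corner_ring_def xy)
    show "?h (A \<otimes>\<^bsub>corner_ring p q f\<^esub> B) = ?h A \<otimes>\<^bsub>R\<^esub> ?h B" "?h (A \<oplus>\<^bsub>corner_ring p q f\<^esub> B) = ?h A \<oplus>\<^bsub>R\<^esub> ?h B"
      unfolding m hg unfolding xy hg by simp_all
  next
    have "\<one>\<^bsub>corner_ring p q f\<^esub> = ?g \<one>\<^bsub>R\<^esub>" by (simp add: corner_ring_def one)
    then show "?h \<one>\<^bsub>corner_ring p q f\<^esub> = \<one>\<^bsub>R\<^esub>" by (simp only: hg)
    show "bij_betw ?h (carrier (corner_ring p q f)) (carrier R)"
      unfolding car R by (intro bij_betw_inv_into inj_on_imp_bij_betw inj)
  qed (simp add: R)
  then show "corner_ring p q f \<simeq> R" by (auto simp: is_ring_iso_def)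
  show "primitive_idempotent p q f"
    unfolding primitive_idempotent_def
  proof (intro conjI f_real f_nonzero f_idem notI)
    assume "\<exists>g\<in>cl_real p q. \<exists>h\<in>cl_real p q. g \<noteq> cl_zero \<and> h \<noteq> cl_zero \<and> g \<diamondop> g = g \<and> h \<diamondop> h = h \<and>
      g \<diamondop> h = cl_zero \<and> h \<diamondop> g = cl_zero \<and> f = cl_add g h"
    then obtain g h where gh: "g \<in> cl_real p q" "h \<in> cl_real p q" "g \<noteq> cl_zero" "h \<noteq> cl_zero" "g \<diamondop> g = g"
      "h \<diamondop> h = h" "g \<diamondop> h = cl_zero" "h \<diamondop> g = cl_zero" "f = cl_add g h" by blast
    \<comment> \<open>Orthogonality puts the summand \<open>g\<close> into the corner. Being nonzero
      and idempotent there, it equals \<open>f\<close>, so the other summand vanishes.\<close>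
    have "f \<diamondop> g \<diamondop> f = g"
      unfolding gh(9) by (simp add: cl_mult_add_left cl_mult_add_right gh(5,7,8))
    then obtain x where x: "g = ?g x" using corner[OF gh(1)] by auto
    have "x \<noteq> \<zero>\<^bsub>R\<^esub>" using gh(3) x by (auto simp: zero cl_mult_zero_right)
    then obtain w where w: "w \<in> cl_complex p q" "\<iota> x \<diamondop> w = cl_one"
      using inverse[of x "\<zero>\<^bsub>R\<^esub>"] by (auto simp: zero cl_neg_def cl_zero_def cl_add_def)
    have "?g x = ?g (x \<otimes>\<^bsub>R\<^esub> x)" using gh(5) unfolding x g_mult by simp
    then have "f \<diamondop> \<iota> x \<diamondop> w = f \<diamondop> (\<iota> x \<diamondop> \<iota> x) \<diamondop> w" by (simp only: mult)
    then have "f = f \<diamondop> \<iota> x" using w by (simp add: cl_mult_assoc)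
    with x gh(9) have "g = cl_add g h" by simp
    then have "h = cl_zero" by (simp add: fun_eq_iff cl_add_def cl_zero_def)
    with gh(4) show False ..
  qed
qed

end

subsection \<open>Pairs of a positive and a negative generator\<close>

text \<open>The two generators of a pair anticommute and have squares of opposite sign, so their
  product has square 1; products for disjoint pairs commute because they are even.\<close>

fun sign_pairs :: "nat \<Rightarrow> nat \<Rightarrow> nat set list" where
  "sign_pairs p 0 = []"
| "sign_pairs p (Suc m) = {m, p + m} # sign_pairs p m"

lemma set_sign_pairs: "set (sign_pairs p m) = (\<lambda>i. {i, p + i}) ` {..<m}"
  by (induction m) (auto simp: lessThan_Suc)

lemma Union_sign_pairs: "\<Union> (set (sign_pairs p m)) = {..<m} \<union> {p..<p + m}"
  unfolding set_sign_pairs by (auto simp: image_iff) (metis le_add_diff_inverse lessThan_iff nat_add_left_cancel_less)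

lemma fresh_sign_pairs: "m \<le> p \<Longrightarrow> fresh_sets (sign_pairs p m)"
  by (induction m) (auto simp: Union_sign_pairs)

lemma sign_pair_square: "i < p \<Longrightarrow> blade_sign p {i, p + i} {i, p + i} = 1"
proof -
  assume i: "i < p"
  then have "{j \<in> {i, p + i}. p \<le> j} = {p + i}" "card {i, p + i} = 2" by auto
  then show ?thesis unfolding blade_sign_self[OF finite.insertI[OF finite.insertI[OF finite.emptyI]]]
    by (simp add: reversion_sign_def)
qed

lemma comm_sign_pair:
  assumes "0 < p"
  shows "comm_sign {i, p + i} S = (- 1) ^ card ({i, p + i} \<inter> S)"
proof -
  have "card {i, p + i} = 2" using assms by simp
  then show ?thesis by (simp add: comm_sign_def power_add power_mult)
qed

lemma comm_sign_pair_disjoint: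
  assumes "0 < p" "i \<notin> S" "p + i \<notin> S"
  shows "comm_sign {i, p + i} S = 1"
proof -
  have "{i, p + i} \<inter> S = {}" using assms by auto
  then show ?thesis unfolding comm_sign_pair[OF assms(1)] by simp
qed

lemma comm_sign_pairs:
  assumes "i < p" "j < p"
  shows "comm_sign {i, p + i} {j, p + j} = 1"
proof (cases "i = j")
  case True
  with assms show ?thesis by (simp add: comm_sign_pair)
next
  case False
  with assms show ?thesis by (intro comm_sign_pair_disjoint) auto
qed

text \<open>A blade commuting with a pair contains both of its members or none. Multiplying by the
  pair removes both and, next to \<open>f\<close>, costs only a sign; by induction on the size only
  blades away from all pairs remain.\<close>

lemma (in commuting_blades) pairs_reduction:
  assumes pairs: "set (sign_pairs p m) \<subseteq> set Ts" and m: "m \<le> p"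
    and base: "\<And>S. S \<subseteq> {..<p + q} \<Longrightarrow> (\<And>T. T \<in> set Ts \<Longrightarrow> comm_sign T S = 1) \<Longrightarrow>
      S \<inter> ({..<m} \<union> {p..<p + m}) = {} \<Longrightarrow> P S"
    and step: "\<And>S T. S \<subseteq> {..<p + q} \<Longrightarrow> T \<in> set Ts \<Longrightarrow> P (sym_diff T S) \<Longrightarrow> P S"
    and S: "S \<subseteq> {..<p + q}" "\<And>T. T \<in> set Ts \<Longrightarrow> comm_sign T S = 1"
  shows "P S"
  using S
proof (induction "card S" arbitrary: S rule: less_induct)
  case less
  show ?case
  proof (cases "S \<inter> ({..<m} \<union> {p..<p + m}) = {}")
    case True
    with base less.prems show ?thesis by blast
  next
    case False
    then have "S \<inter> \<Union> (set (sign_pairs p m)) \<noteq> {}" by (simp only: Union_sign_pairs not_False_eq_True)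
    then obtain i where i: "i < m" "S \<inter> {i, p + i} \<noteq> {}" unfolding set_sign_pairs by blast
    let ?T = "{i, p + i}"
    have T: "?T \<in> set Ts" using pairs i(1) unfolding set_sign_pairs by blast
    have p: "0 < p" "i < p" using i(1) m by auto
    have fS: "finite S" using less.prems(1) by (auto intro: finite_subset)
    have "even (card (?T \<inter> S))"
      using less.prems(2)[OF T] unfolding comm_sign_pair[OF p(1)] by (simp add: minus_one_power_iff split: if_splits)
    moreover have "card (?T \<inter> S) \<noteq> 0" using i(2) fS by auto
    moreover have "card (?T \<inter> S) \<le> card ?T" by (rule card_mono) auto
    moreover have "card ?T = 2" using p by simp
    moreover have "k = 2" if "even k" "k \<noteq> 0" "k \<le> 2" for k :: nat using that by presburger
    ultimately have "card (?T \<inter> S) = card ?T" by metis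
    then have "?T \<inter> S = ?T" by (intro card_subset_eq) auto
    then have TS: "?T \<subseteq> S" by blast
    then have sd: "sym_diff ?T S = S - ?T" by blast
    have "P (sym_diff ?T S)"
    proof (rule less.hyps)
      show "card (sym_diff ?T S) < card S" unfolding sd
        by (rule psubset_card_mono[OF fS]) (use TS in auto)
      show "sym_diff ?T S \<subseteq> {..<p + q}" using less.prems(1) unfolding sd by blast
      fix T' assume T': "T' \<in> set Ts"
      have "finite T'" using Ts_subset[OF T'] by (auto intro: finite_subset)
      then show "comm_sign T' (sym_diff ?T S) = 1"
        using fS less.prems(2)[OF T'] Ts_comm[OF T' T] by (subst comm_sign_sym_diff_right) auto
    qed
    then show ?thesis by (rule step[OF less.prems(1) T])
  qed
qed

subsection \<open>The real and the quaternionic case\<close>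

lemma (in commuting_blades) real_typeI:
  assumes span: "\<And>S. S \<subseteq> {..<p + q} \<Longrightarrow> (\<And>T. T \<in> set Ts \<Longrightarrow> comm_sign T S = 1) \<Longrightarrow>
    \<exists>c. c \<in> \<real> \<and> f \<diamondop> e S = cl_scale c f"
  shows "real_type p q"
proof -
  let ?\<iota> = "\<lambda>x :: real. cl_scale (of_real x) cl_one"
  let ?R = real_ring
  have 1: "carrier ?R = UNIV" by (simp add: real_ring_def)
  have 2: "?\<iota> x \<in> cl_real p q" for x by (intro cl_real_scale cl_real_one) simp
  have 3: "?\<iota> x \<diamondop> f = f \<diamondop> ?\<iota> x" for x by (simp add: cl_mult_scale_left cl_mult_scale_right)
  have 4: "?\<iota> \<one>\<^bsub>?R\<^esub> = cl_one" by (simp add: real_ring_def)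
  have 5: "?\<iota> \<zero>\<^bsub>?R\<^esub> = cl_zero" by (simp add: real_ring_def cl_scale_def cl_zero_def)
  have 6: "?\<iota> (x \<oplus>\<^bsub>?R\<^esub> y) = cl_add (?\<iota> x) (?\<iota> y)" for x y
    by (simp add: real_ring_def cl_scale_def cl_add_def distrib_right)
  have 7: "?\<iota> (x \<otimes>\<^bsub>?R\<^esub> y) = ?\<iota> x \<diamondop> ?\<iota> y" for x y
    by (simp add: real_ring_def cl_mult_scale_left cl_mult_scale_right cl_scale_scale mult.commute)
  have 8: "\<exists>y. ?\<iota> y = cl_scale (of_real r) (?\<iota> x)" for r x
    by (rule exI[of _ "r * x"]) (simp add: cl_scale_scale)
  have 9: "\<exists>w\<in>cl_complex p q. cl_add (?\<iota> x) (cl_neg (?\<iota> y)) \<diamondop> w = cl_one" if "x \<noteq> y" for x y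
  proof
    have "cl_add (?\<iota> x) (cl_neg (?\<iota> y)) = ?\<iota> (x - y)"
      by (simp add: cl_scale_def cl_add_def cl_neg_def left_diff_distrib)
    then show "cl_add (?\<iota> x) (cl_neg (?\<iota> y)) \<diamondop> ?\<iota> (1 / (x - y)) = cl_one"
      using that by (simp add: cl_mult_scale_left cl_mult_scale_right cl_scale_scale flip: of_real_diff of_real_mult)
  qed simp
  have 10: "\<exists>x. f \<diamondop> e S = f \<diamondop> ?\<iota> x"
    if S: "S \<subseteq> {..<p + q}" "\<And>T. T \<in> set Ts \<Longrightarrow> comm_sign T S = 1" for S
  proof -
    obtain c where "c \<in> \<real>" "f \<diamondop> e S = cl_scale c f" using span[OF S] by blast
    then show ?thesis by (auto simp: cl_mult_scale_right elim!: Reals_cases)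
  qed
  show ?thesis
    using corner_division[of ?R ?\<iota>, OF 1 2 3 4 5 6 7 8 9 10] unfolding real_type_def by blast
qed

lemma quat_mult_inverse:
  assumes "m = a * a + b * b + c * c + d * d" "m \<noteq> 0"
  shows "quat_mult (a, b, c, d) (a / m, - b / m, - c / m, - d / m) = (1, 0, 0, 0)"
proof -
  have "a * (a / m) - b * (- b / m) - c * (- c / m) - d * (- d / m) =
      (a * a + b * b + c * c + d * d) / m"
    by (simp add: add_divide_distrib)
  also have "\<dots> = 1" using assms by simp
  finally show ?thesis by simp
qed

text \<open>Two anticommuting blades of square -1 and their product satisfy Hamilton's relations. A
  nonzero quaternion is inverted by its conjugate divided by its norm.\<close>

lemma (in commuting_blades) quat_typeI:
  assumes U: "U \<subseteq> {..<p + q}" "blade_sign p U U = - 1" "\<And>T. T \<in> set Ts \<Longrightarrow> comm_sign T U = 1"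
    and V: "V \<subseteq> {..<p + q}" "blade_sign p V V = - 1" "\<And>T. T \<in> set Ts \<Longrightarrow> comm_sign T V = 1"
    and UV: "comm_sign U V = - 1"
    and span: "\<And>S. S \<subseteq> {..<p + q} \<Longrightarrow> (\<And>T. T \<in> set Ts \<Longrightarrow> comm_sign T S = 1) \<Longrightarrow>
      spanned_by p q f {{}, U, V, sym_diff U V} S"
  shows "quat_type p q"
proof -
  define u where "u = e U"
  define v where "v = e V"
  define w where "w = u \<diamondop> v"
  have [simp]: "u \<in> cl_complex p q" "v \<in> cl_complex p q" "w \<in> cl_complex p q"
    using U V by (simp_all add: u_def v_def w_def)
  have fc: "u \<diamondop> f = f \<diamondop> u" "v \<diamondop> f = f \<diamondop> v"
    unfolding u_def v_def by (intro e_commute_f U V; assumption)+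
  have fw: "w \<diamondop> f = f \<diamondop> w"
    unfolding w_def by (simp add: cl_mult_assoc fc) (simp add: fc flip: cl_mult_assoc)
  have uu: "u \<diamondop> u = cl_scale (- 1) cl_one" and vv: "v \<diamondop> v = cl_scale (- 1) cl_one"
    and vu: "v \<diamondop> u = cl_scale (- 1) w"
    using cl_mult_blade[OF U(1), of U] cl_mult_blade[OF V(1), of V] cl_blade_commute[OF V(1) U(1)] U(2) V(2) UV
    by (simp_all add: u_def v_def w_def cl_one_blade comm_sign_commute)
  have uw: "u \<diamondop> w = cl_scale (- 1) v"
    by (simp add: w_def uu cl_mult_scale_left flip: cl_mult_assoc)
  have wv: "w \<diamondop> v = cl_scale (- 1) u"
    by (simp add: w_def vv cl_mult_scale_right cl_mult_assoc)
  have wu: "w \<diamondop> u = v"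
    by (simp add: w_def cl_mult_assoc vu cl_mult_scale_right) (simp add: w_def[symmetric] uw cl_scale_scale)
  have vw: "v \<diamondop> w = u"
    unfolding w_def by (simp add: vu wv cl_mult_scale_left cl_scale_scale flip: cl_mult_assoc)
  have ww: "w \<diamondop> w = cl_scale (- 1) cl_one"
  proof -
    have "w \<diamondop> w = u \<diamondop> (v \<diamondop> w)" by (subst w_def) (simp add: cl_mult_assoc)
    then show ?thesis by (simp add: vw uu)
  qed
  let ?R = quat_ring
  define \<iota> where "\<iota> = (\<lambda>(a, b, c, d). cl_add (cl_scale (of_real a) cl_one) (cl_add (cl_scale (of_real b) u)
    (cl_add (cl_scale (of_real c) v) (cl_scale (of_real d) w))) )"
  have \<iota>: "\<iota> (a, b, c, d) = cl_add (cl_scale (of_real a) cl_one) (cl_add (cl_scale (of_real b) u)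
    (cl_add (cl_scale (of_real c) v) (cl_scale (of_real d) w)))" for a b c d
    by (simp add: \<iota>_def)
  have real: "u \<in> cl_real p q" "v \<in> cl_real p q" "w \<in> cl_real p q"
    using U V by (simp_all add: u_def v_def w_def cl_real_blade cl_real_mult)
  have 1: "carrier ?R = UNIV" by (simp add: quat_ring_def)
  have 2: "\<iota> x \<in> cl_real p q" for x
    by (cases x) (simp add: \<iota> cl_real_add cl_real_scale cl_real_one real)
  have 3: "\<iota> x \<diamondop> f = f \<diamondop> \<iota> x" for x
    by (cases x) (simp add: \<iota> cl_mult_add_left cl_mult_add_right cl_mult_scale_left cl_mult_scale_right fc fw)
  have 4: "\<iota> \<one>\<^bsub>?R\<^esub> = cl_one" by (simp add: quat_ring_def \<iota>) (simp add: cl_scale_def cl_add_def)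
  have 5: "\<iota> \<zero>\<^bsub>?R\<^esub> = cl_zero" by (simp add: quat_ring_def \<iota>) (simp add: cl_scale_def cl_add_def cl_zero_def)
  have 6: "\<iota> (x \<oplus>\<^bsub>?R\<^esub> y) = cl_add (\<iota> x) (\<iota> y)" for x y
    by (cases x; cases y) (simp add: quat_ring_def \<iota>, simp add: cl_scale_def cl_add_def fun_eq_iff algebra_simps)
  have m: "\<iota> (quat_mult x y) = \<iota> x \<diamondop> \<iota> y" for x y
  proof -
    obtain a b c d a' b' c' d' where xy: "x = (a, b, c, d)" "y = (a', b', c', d')" by (metis prod.collapse)
    show ?thesis
      unfolding xy quat_mult.simps \<iota> cl_mult_add_left cl_mult_add_right cl_mult_scale_left cl_mult_scale_right
        uu vv ww vu uw wv wu vw w_def[symmetric]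
      by (simp add: uu vv ww vu uw wv wu vw) (simp add: cl_scale_def cl_add_def fun_eq_iff algebra_simps)
  qed
  have 7: "\<iota> (x \<otimes>\<^bsub>?R\<^esub> y) = \<iota> x \<diamondop> \<iota> y" for x y
    using m by (simp add: quat_ring_def)
  have 8: "\<exists>y. \<iota> y = cl_scale (of_real r) (\<iota> x)" for r x
  proof -
    obtain a b c d where x: "x = (a, b, c, d)" by (cases x)
    have "\<iota> (r * a, r * b, r * c, r * d) = cl_scale (of_real r) (\<iota> x)"
      unfolding x \<iota> by (simp add: cl_scale_def cl_add_def fun_eq_iff algebra_simps)
    then show ?thesis by blast
  qed
  have 9: "\<exists>w\<in>cl_complex p q. cl_add (\<iota> x) (cl_neg (\<iota> y)) \<diamondop> w = cl_one" if ne: "x \<noteq> y" for x y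
  proof -
    obtain a b c d a' b' c' d' where xy: "x = (a, b, c, d)" "y = (a', b', c', d')" by (metis prod.collapse)
    let ?a = "a - a'" and ?b = "b - b'" and ?c = "c - c'" and ?d = "d - d'"
    let ?n = "?a * ?a + ?b * ?b + ?c * ?c + ?d * ?d"
    let ?y = "(?a / ?n, - ?b / ?n, - ?c / ?n, - ?d / ?n)"
    have "?n \<noteq> 0"
    proof
      assume "?n = 0"
      then have "?a = 0 \<and> ?b = 0 \<and> ?c = 0 \<and> ?d = 0"
        by (smt (verit) mult_eq_0_iff not_real_square_gt_zero)
      with ne xy show False by simp
    qed
    then have "quat_mult (?a, ?b, ?c, ?d) ?y = (1, 0, 0, 0)"
      by (rule quat_mult_inverse[OF refl])
    moreover have "cl_add (\<iota> x) (cl_neg (\<iota> y)) = \<iota> (?a, ?b, ?c, ?d)"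
      unfolding xy \<iota> by (simp add: cl_scale_def cl_add_def cl_neg_def fun_eq_iff algebra_simps)
    ultimately have "cl_add (\<iota> x) (cl_neg (\<iota> y)) \<diamondop> \<iota> ?y = \<iota> (1, 0, 0, 0)"
      by (simp only: m[symmetric])
    also have "\<dots> = cl_one" using 4 by (simp add: quat_ring_def)
    finally show ?thesis using cl_real_complex[OF 2[of ?y]] by (intro bexI[of _ "\<iota> ?y"])
  qed
  have base: "\<exists>x. \<iota> x = e S'" if "S' \<in> {{}, U, V, sym_diff U V}" for S'
  proof -
    have z: "\<iota> (1, 0, 0, 0) = e {}" "\<iota> (0, 1, 0, 0) = e U" "\<iota> (0, 0, 1, 0) = e V" "\<iota> (0, 0, 0, r) = cl_scale (of_real r) w" for r
      unfolding \<iota> u_def[symmetric] v_def[symmetric] cl_one_blade[symmetric]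
      by (simp_all add: cl_scale_def cl_add_def)
    \<comment> \<open>The product of the two units is the blade on \<open>sym_diff U V\<close> only
      up to sign; the sign is absorbed into the last coordinate.\<close>
    have "w = cl_scale (blade_sign p U V) (e (sym_diff U V))"
      unfolding w_def u_def v_def by (rule cl_mult_blade[OF U(1)])
    then have "cl_scale (blade_sign p U V) w = e (sym_diff U V)"
      by (simp add: cl_scale_scale blade_sign_square)
    moreover obtain r where "blade_sign p U V = of_real r" using blade_sign_real[of p U V] by (rule Reals_cases)
    ultimately have "\<iota> (0, 0, 0, r) = e (sym_diff U V)" using z(4) by simp
    with z that show ?thesis by blast
  qed
  have 10: "\<exists>x. f \<diamondop> e S = f \<diamondop> \<iota> x"
    if S: "S \<subseteq> {..<p + q}" "\<And>T. T \<in> set Ts \<Longrightarrow> comm_sign T S = 1" for S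
  proof -
    obtain c S' where c: "c \<in> \<real>" "S' \<in> {{}, U, V, sym_diff U V}" "f \<diamondop> e S = cl_scale c (f \<diamondop> e S')"
      using span[OF S] unfolding spanned_by_def by blast
    obtain r where r: "c = of_real r" using c(1) by (rule Reals_cases)
    obtain x where x: "\<iota> x = e S'" using base[OF c(2)] by blast
    obtain y where "\<iota> y = cl_scale (of_real r) (\<iota> x)" using 8 by blast
    then have "f \<diamondop> e S = f \<diamondop> \<iota> y" by (simp add: c(3) r x cl_mult_scale_right)
    then show ?thesis by blast
  qed
  show ?thesis
    using corner_division[of ?R \<iota>, OF 1 2 3 4 5 6 7 8 9 10] unfolding quat_type_def by blast
qed

lemma (in commuting_blades) span_step:
  assumes "S \<subseteq> {..<p + q}" "T \<in> set Ts"
    "spanned_by p q f \<S> (sym_diff T S)"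
  shows "spanned_by p q f \<S> S"
proof -
  obtain c S' where c: "c \<in> \<real>" "S' \<in> \<S>" "f \<diamondop> e (sym_diff T S) = cl_scale c (f \<diamondop> e S')"
    using assms(3) unfolding spanned_by_def by blast
  have "f \<diamondop> e S = cl_scale (blade_sign p T S * c) (f \<diamondop> e S')"
    unfolding f_e_sym_diff[OF assms(1,2)] c(3) cl_scale_scale ..
  with c show ?thesis unfolding spanned_by_def
    by (intro exI[of _ "blade_sign p T S * c"] exI[of _ S']) simp
qed

lemma (in commuting_blades) span_refl:
  assumes "S \<in> \<S>"
  shows "spanned_by p q f \<S> S"
  unfolding spanned_by_def using assms by (intro exI[of _ 1] exI[of _ S]) simp

lemma (in commuting_blades) real_type_span:
  assumes "\<And>S. S \<subseteq> {..<p + q} \<Longrightarrow> (\<And>T. T \<in> set Ts \<Longrightarrow> comm_sign T S = 1) \<Longrightarrow>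
    spanned_by p q f {{}} S"
  shows "real_type p q"
proof (rule real_typeI)
  fix S assume "S \<subseteq> {..<p + q}" "\<And>T. T \<in> set Ts \<Longrightarrow> comm_sign T S = 1"
  then obtain c where "c \<in> \<real>" "f \<diamondop> e S = cl_scale c (f \<diamondop> e {})" using assms unfolding spanned_by_def by blast
  then show "\<exists>c. c \<in> \<real> \<and> f \<diamondop> e S = cl_scale c f"
    by (auto simp flip: cl_one_blade)
qed

lemma commuting_sign_pairs:
  assumes "m \<le> p" "m \<le> q"
  shows "commuting_blades p q (sign_pairs p m)"
  using assms by unfold_locales (auto simp: set_sign_pairs sign_pair_square comm_sign_pairs fresh_sign_pairs)

text \<open>The pairs exhaust all generators, so only the empty blade survives the
  reduction.\<close>

lemma real_type_split: "real_type m m"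
proof -
  interpret commuting_blades m m "sign_pairs m m" by (rule commuting_sign_pairs) simp_all
  show ?thesis
  proof (rule real_type_span)
    fix S assume S: "S \<subseteq> {..<m + m}" "\<And>T. T \<in> set (sign_pairs m m) \<Longrightarrow> comm_sign T S = 1"
    show "spanned_by m m f {{}} S"
    proof (rule pairs_reduction[OF order_refl order_refl _ _ S])
      fix S assume "S \<subseteq> {..<m + m}" "S \<inter> ({..<m} \<union> {m..<m + m}) = {}"
      moreover have "{..<m + m} = {..<m} \<union> {m..<m + m}" by auto
      ultimately have "S \<in> {{}}" by blast
      then show "spanned_by m m f {{}} S" by (rule span_refl)
    qed (rule span_step)
  qed
qed

text \<open>The pairs leave the generators \<open>m\<close> and \<open>m + 1\<close>, both of square
  1. Adding \<open>{m}\<close> to the commuting blades eliminates every remaining blade that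
  contains \<open>m + 1\<close> and identifies \<open>{m}\<close> with the empty blade.\<close>

lemma real_type_two: "real_type (m + 2) m"
proof -
  let ?p = "m + 2" and ?Ts = "{m} # sign_pairs (m + 2) m"
  have sq: "blade_sign ?p {m} {m} = 1" by (simp add: blade_sign_gen)
  have cm: "comm_sign {i, ?p + i} {m} = 1" if "i < m" for i
    using that by (intro comm_sign_pair_disjoint) auto
  have mm: "comm_sign {m} {m} = 1" by (simp add: comm_sign_def)
  interpret P: commuting_blades ?p m "sign_pairs ?p m" by (rule commuting_sign_pairs) simp_all
  have cm': "comm_sign T {m} = 1" if "T \<in> set (sign_pairs ?p m)" for T
    using that cm unfolding set_sign_pairs by blast
  interpret commuting_blades ?p m ?Ts
  proof unfold_locales
    fix T assume "T \<in> set ?Ts"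
    then have T: "T = {m} \<or> T \<in> set (sign_pairs ?p m)" by simp
    show "T \<subseteq> {..<?p + m}" using T P.Ts_subset by auto
    show "blade_sign ?p T T = 1" using T P.Ts_square sq by metis
    fix S assume "S \<in> set ?Ts"
    then have S: "S = {m} \<or> S \<in> set (sign_pairs ?p m)" by simp
    show "comm_sign T S = 1"
      using S T P.Ts_comm mm cm' comm_sign_commute by metis
  next
    show "fresh_sets ?Ts" using P.Ts_fresh by (simp add: Union_sign_pairs)
  qed
  show ?thesis
  proof (rule real_type_span)
    fix S assume S: "S \<subseteq> {..<?p + m}" "\<And>T. T \<in> set ?Ts \<Longrightarrow> comm_sign T S = 1"
    show "spanned_by (m + 2) m f {{}} S"
    proof (rule pairs_reduction[OF _ _ _ _ S])
      show "set (sign_pairs ?p m) \<subseteq> set ?Ts" "m \<le> ?p" by auto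
    next
      fix S assume S: "S \<subseteq> {..<?p + m}" "\<And>T. T \<in> set ?Ts \<Longrightarrow> comm_sign T S = 1"
        "S \<inter> ({..<m} \<union> {?p..<?p + m}) = {}"
      have "i = m \<or> i = m + 1" if "i \<in> S" for i
      proof (rule ccontr)
        assume "\<not> ?thesis"
        then have "i < m \<or> ?p \<le> i" by arith
        moreover have "i < ?p + m" using that S(1) by blast
        ultimately have "i \<in> {..<m} \<union> {?p..<?p + m}" by (simp only: Un_iff lessThan_iff atLeastLessThan_iff) blast
        with that S(3) show False by blast
      qed
      then have sub: "S \<subseteq> {m, m + 1}" by blast
      have "S \<noteq> {m + 1}" "S \<noteq> {m, m + 1}"
        using S(2)[of "{m}"] by (auto simp: comm_sign_def)
      with sub have "S = {} \<or> S = {m}" by blast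
      then show "spanned_by (m + 2) m f {{}} S"
      proof
        assume "S = {m}"
        then have "sym_diff {m} S \<in> {{}}" by simp
        then show ?thesis by (intro span_step[OF S(1), of "{m}"] span_refl) simp_all
      qed (intro span_refl, simp)
    qed (rule span_step)
  qed
qed

text \<open>The pairs leave two generators of square -1, which become the quaternion units.\<close>

lemma quat_type_two: "quat_type m (m + 2)"
proof -
  interpret commuting_blades m "m + 2" "sign_pairs m m" by (rule commuting_sign_pairs) simp_all
  let ?U = "{2 * m}" and ?V = "{2 * m + 1}"
  have cm: "comm_sign T {j} = 1" if "T \<in> set (sign_pairs m m)" "2 * m \<le> j" for T j
    using that unfolding set_sign_pairs by (auto intro!: comm_sign_pair_disjoint)
  show ?thesis
  proof (rule quat_typeI[of ?U ?V])
    show "?U \<subseteq> {..<m + (m + 2)}" "?V \<subseteq> {..<m + (m + 2)}" by auto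
    show "blade_sign m ?U ?U = - 1" "blade_sign m ?V ?V = - 1" by (simp_all add: blade_sign_gen)
    show "comm_sign ?U ?V = - 1" by (simp add: comm_sign_def)
    fix S assume S: "S \<subseteq> {..<m + (m + 2)}" "\<And>T. T \<in> set (sign_pairs m m) \<Longrightarrow> comm_sign T S = 1"
    show "spanned_by m (m + 2) f {{}, ?U, ?V, sym_diff ?U ?V} S"
    proof (rule pairs_reduction[OF order_refl order_refl _ _ S])
      fix S assume S: "S \<subseteq> {..<m + (m + 2)}" "S \<inter> ({..<m} \<union> {m..<m + m}) = {}"
      have "i = 2 * m \<or> i = 2 * m + 1" if "i \<in> S" for i
      proof (rule ccontr)
        assume "\<not> ?thesis"
        then have "i < m + m \<or> m + (m + 2) \<le> i" by arith
        moreover have "i < m + (m + 2)" using that S(1) by blast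
        ultimately have "i \<in> {..<m} \<union> {m..<m + m}" by auto
        with that S(2) show False by blast
      qed
      then have "S \<subseteq> {2 * m, 2 * m + 1}" by blast
      then have "S = {} \<or> S = ?U \<or> S = ?V \<or> S = {2 * m, 2 * m + 1}" by blast
      moreover have "sym_diff ?U ?V = {2 * m, 2 * m + 1}" by auto
      ultimately have "S \<in> {{}, ?U, ?V, sym_diff ?U ?V}" by auto
      then show "spanned_by m (m + 2) f {{}, ?U, ?V, sym_diff ?U ?V} S"
        by (rule span_refl)
    qed (rule span_step)
  qed (intro cm; simp)+
qed

lemma even_subset_three:
  assumes d: "a \<noteq> b" "a \<noteq> c" "b \<noteq> c" and S: "S \<subseteq> {a, b, c}" "even (card S)"
  shows "S \<in> {{}, {a, b}, {b, c}, {a, c}}"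
proof (cases "a \<in> S")
  case a: True
  show ?thesis
  proof (cases "b \<in> S")
    case True
    then have "S = (if c \<in> S then {a, b, c} else {a, b})" using S(1) a by auto
    moreover have "S \<noteq> {a, b, c}" using S(2) d by auto
    ultimately have "S = {a, b}" by metis
    then show ?thesis by simp
  next
    case False
    then have "S = (if c \<in> S then {a, c} else {a})" using S(1) a by auto
    moreover have "S \<noteq> {a}" using S(2) by auto
    ultimately have "S = {a, c}" by metis
    then show ?thesis by simp
  qed
next
  case a: False
  show ?thesis
  proof (cases "b \<in> S")
    case True
    then have "S = (if c \<in> S then {b, c} else {b})" using S(1) a by auto
    moreover have "S \<noteq> {b}" using S(2) by auto
    ultimately have "S = {b, c}" by metis
    then show ?thesis by simp
  next
    case False
    then have "S = (if c \<in> S then {c} else {})" using S(1) a by auto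
    moreover have "S \<noteq> {c}" using S(2) by auto
    ultimately have "S = {}" by metis
    then show ?thesis by simp
  qed
qed

lemma even_subset_four:
  assumes d: "distinct [a, b, c, d]" and S: "S \<subseteq> {a, b, c, d}" "even (card S)"
  shows "S \<in> {{}, {a, b}, {b, c}, {a, c}} \<or> sym_diff {a, b, c, d} S \<in> {{}, {a, b}, {b, c}, {a, c}}"
proof (cases "d \<in> S")
  case False
  then have "S \<subseteq> {a, b, c}" using S(1) by blast
  with even_subset_three[of a b c S] d S(2) show ?thesis by simp
next
  case True
  have fin: "finite S" using S(1) by (rule finite_subset) simp
  have "sym_diff {a, b, c, d} S \<subseteq> {a, b, c}" using True S(1) by blast
  moreover have "even (card (sym_diff {a, b, c, d} S))"
    using card_sym_diff[of "{a, b, c, d}" S] fin S(2) d by simp presburger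
  ultimately show ?thesis using even_subset_three[of a b c "sym_diff {a, b, c, d} S"] d by simp
qed

text \<open>The pairs leave four generators of square -1, whose product has square 1 and is added to
  the commuting blades. Among the remaining blades this keeps the even ones and identifies
  complements; the four classes are spanned by the quaternion units.\<close>

lemma quat_type_four: "quat_type m (m + 4)"
proof -
  let ?a = "2 * m" and ?b = "2 * m + 1" and ?c = "2 * m + 2" and ?d = "2 * m + 3"
  let ?L = "{?a, ?b, ?c, ?d}" and ?Ts = "{?a, ?b, ?c, ?d} # sign_pairs m m"
  let ?U = "{?a, ?b}" and ?V = "{?b, ?c}"
  have sq: "blade_sign m ?L ?L = 1"
  proof -
    have "{i \<in> ?L. m \<le> i} = ?L" "finite ?L" "card ?L = 4" by auto
    then show ?thesis by (simp add: blade_sign_self reversion_sign_def)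
  qed
  have cm: "comm_sign T S = 1" if "T \<in> set (sign_pairs m m)" "S \<subseteq> {2 * m..}" for T S
    using that unfolding set_sign_pairs by (auto intro!: comm_sign_pair_disjoint)
  have LL: "comm_sign ?L ?L = 1" by (simp add: comm_sign_def)
  interpret P: commuting_blades m "m + 4" "sign_pairs m m" by (rule commuting_sign_pairs) simp_all
  have sub: "?L \<subseteq> {2 * m..}" "?L \<subseteq> {..<m + (m + 4)}" by auto
  interpret commuting_blades m "m + 4" ?Ts
  proof unfold_locales
    fix T assume "T \<in> set ?Ts"
    then have T: "T = ?L \<or> T \<in> set (sign_pairs m m)" by simp
    show "T \<subseteq> {..<m + (m + 4)}" "blade_sign m T T = 1"
      using T P.Ts_subset P.Ts_square sq sub by metis+
    fix S assume "S \<in> set ?Ts"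
    then have S: "S = ?L \<or> S \<in> set (sign_pairs m m)" by simp
    show "comm_sign T S = 1"
      using S T P.Ts_comm LL cm sub(1) comm_sign_commute by metis
  next
    show "fresh_sets ?Ts" using P.Ts_fresh by (simp add: Union_sign_pairs)
  qed
  have UL: "comm_sign ?L ?U = 1" "comm_sign ?L ?V = 1" by (simp_all add: comm_sign_def)
  have UVL: "sym_diff ?U ?V = {?a, ?c}" by auto
  show ?thesis
  proof (rule quat_typeI[of ?U ?V])
    show "?U \<subseteq> {..<m + (m + 4)}" "?V \<subseteq> {..<m + (m + 4)}" by auto
    have "{i \<in> ?U. m \<le> i} = ?U" "{i \<in> ?V. m \<le> i} = ?V" "finite ?U" "finite ?V" "card ?U = 2" "card ?V = 2" by auto
    then show "blade_sign m ?U ?U = - 1" "blade_sign m ?V ?V = - 1"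
      by (simp_all add: blade_sign_self reversion_sign_def)
    have "?U \<inter> ?V = {?b}" by auto
    then show "comm_sign ?U ?V = - 1" by (simp add: comm_sign_def)
    show "comm_sign T ?U = 1" "comm_sign T ?V = 1" if "T \<in> set ?Ts" for T
      using that UL cm[of T ?U] cm[of T ?V] by auto
    fix S assume S: "S \<subseteq> {..<m + (m + 4)}" "\<And>T. T \<in> set ?Ts \<Longrightarrow> comm_sign T S = 1"
    let ?\<S> = "{{}, ?U, ?V, sym_diff ?U ?V}"
    show "spanned_by m (m + 4) f ?\<S> S"
    proof (rule pairs_reduction[OF _ order_refl _ _ S])
      show "set (sign_pairs m m) \<subseteq> set ?Ts" by auto
    next
      fix S assume S: "S \<subseteq> {..<m + (m + 4)}" "\<And>T. T \<in> set ?Ts \<Longrightarrow> comm_sign T S = 1"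
        "S \<inter> ({..<m} \<union> {m..<m + m}) = {}"
      have "i = ?a \<or> i = ?b \<or> i = ?c \<or> i = ?d" if "i \<in> S" for i
      proof (rule ccontr)
        assume "\<not> ?thesis"
        then have "i < m + m \<or> m + (m + 4) \<le> i" by arith
        moreover have "i < m + (m + 4)" using that S(1) by blast
        ultimately have "i \<in> {..<m} \<union> {m..<m + m}" by auto
        with that S(3) show False by blast
      qed
      then have sub: "S \<subseteq> ?L" by blast
      then have "?L \<inter> S = S" by blast
      moreover have "card ?L = 4" by simp
      ultimately have "even (card S)"
        using S(2)[of ?L] by (simp add: comm_sign_def minus_one_power_iff split: if_splits)
      with even_subset_four[of ?a ?b ?c ?d S] sub have "S \<in> ?\<S> \<or> sym_diff ?L S \<in> ?\<S>"
        unfolding UVL by simp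
      then show "spanned_by m (m + 4) f ?\<S> S"
      proof
        assume "sym_diff ?L S \<in> ?\<S>"
        then show ?thesis by (intro span_step[OF S(1), of ?L] span_refl) simp_all
      qed (rule span_refl)
    qed (rule span_step)
  qed
qed

section \<open>Realization of the signatures\<close>

text \<open>Nonzero cardinalities give distinct matrices. The excess of 4 or 2 of negative over
  positive generators gives the residues 4 and 6 of \<open>p - q\<close> modulo 8, and it agrees
  with \<open>a\<close> because the square of the volume element depends only on this residue. The
  last line names the two cases in which repeated doubling reaches the irreducible degree.\<close>

definition realizes :: "cpt_sign \<Rightarrow> nat \<times> nat \<times> nat \<times> nat \<Rightarrow> bool" where
  "realizes \<sigma> = (\<lambda>(\<alpha>, \<beta>, \<gamma>, \<delta>).
     (\<forall>v\<in>{(True, False, False), (False, True, False), (True, True, False), (False, False, True),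
           (True, False, True), (False, True, True), (True, True, True)}.
        flags_card (\<alpha>, \<beta>, \<gamma>, \<delta>) (label_flags (\<alpha>, \<beta>, \<gamma>, \<delta>) v) \<noteq> 0 \<and>
        (cpt_sign_at \<sigma> v = Minus) = flags_minus (\<alpha>, \<beta>, \<gamma>, \<delta>) (label_flags (\<alpha>, \<beta>, \<gamma>, \<delta>) v)) \<and>
     \<gamma> + \<delta> = \<alpha> + \<beta> + (if cpt_sign_at \<sigma> (True, False, False) = Plus then 4 else 2) \<and>
     (cpt_sign_at \<sigma> (False, False, True) = Minus \<longrightarrow> \<alpha> + \<gamma> = \<beta> + \<delta> \<or> \<alpha> + \<gamma> = \<beta> + \<delta> + 2))"

text \<open>
  For \<open>d = -\<close> the real matrices generate a matrix algebra over the reals, whose degree is that of the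
  irreducible representation; for \<open>d = +\<close> they are taken from a larger algebra of this kind.
\<close>

lemma realizes_cpt_structure:
  assumes "realizes \<sigma> t"
  shows "\<exists>p q N Es. (int p - int q) mod 8 = (if cpt_sign_at \<sigma> (True, False, False) = Plus then 4 else 6) \<and>
    quat_type p q \<and> cpt_structure p q N Es \<sigma> \<and>
    (cpt_sign_at \<sigma> (False, False, True) = Minus \<longrightarrow> N = 2 ^ ((p + q) div 2))"
proof -
  obtain \<alpha> \<beta> \<gamma> \<delta> where t: "t = (\<alpha>, \<beta>, \<gamma>, \<delta>)" by (metis prod.collapse)
  let ?a = "cpt_sign_at \<sigma> (True, False, False)" and ?d = "cpt_sign_at \<sigma> (False, False, True)"
  let ?p = "\<alpha> + \<beta>" and ?q = "\<gamma> + \<delta>"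
  note r = assms[unfolded realizes_def t prod.case]
  have labels: "flags_card (\<alpha>, \<beta>, \<gamma>, \<delta>) (label_flags (\<alpha>, \<beta>, \<gamma>, \<delta>) v) \<noteq> 0"
    "(cpt_sign_at \<sigma> v = Minus) = flags_minus (\<alpha>, \<beta>, \<gamma>, \<delta>) (label_flags (\<alpha>, \<beta>, \<gamma>, \<delta>) v)"
    if "v \<noteq> (False, False, False)" for v
  proof -
    have "v \<in> {(True, False, False), (False, True, False), (True, True, False), (False, False, True),
        (True, False, True), (False, True, True), (True, True, True)}"
      using that by (cases v) auto
    with r show "flags_card (\<alpha>, \<beta>, \<gamma>, \<delta>) (label_flags (\<alpha>, \<beta>, \<gamma>, \<delta>) v) \<noteq> 0"
      "(cpt_sign_at \<sigma> v = Minus) = flags_minus (\<alpha>, \<beta>, \<gamma>, \<delta>) (label_flags (\<alpha>, \<beta>, \<gamma>, \<delta>) v)"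
      by blast+
  qed
  have q: "?q = ?p + (if ?a = Plus then 4 else 2)" using r by blast
  have md: "?d = Minus \<longrightarrow> \<alpha> + \<gamma> = \<beta> + \<delta> \<or> \<alpha> + \<gamma> = \<beta> + \<delta> + 2" using r by blast
  have "\<exists>N R. real_system (\<alpha> + \<gamma>) (\<beta> + \<delta>) N R \<and> (?d = Minus \<longrightarrow> N = 2 ^ ((?p + ?q) div 2))"
  proof (cases "?d = Minus")
    case True
    with md consider "\<alpha> + \<gamma> = \<beta> + \<delta>" | "\<alpha> + \<gamma> = \<beta> + \<delta> + 2" by blast
    then show ?thesis
    proof cases
      case 1
      then have "(?p + ?q) div 2 = \<beta> + \<delta>" by simp
      with 1 show ?thesis using real_system_exists_split[of "\<beta> + \<delta>"] by auto
    next
      case 2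
      then have "(?p + ?q) div 2 = \<beta> + \<delta> + 1" by simp
      with 2 show ?thesis using real_system_exists_two[of "\<beta> + \<delta>"] by auto
    qed
  next
    case False
    obtain R where "real_system (max (\<alpha> + \<gamma>) (\<beta> + \<delta>)) (max (\<alpha> + \<gamma>) (\<beta> + \<delta>)) (2 ^ max (\<alpha> + \<gamma>) (\<beta> + \<delta>)) R"
      using real_system_exists_split by blast
    then have "real_system (\<alpha> + \<gamma>) (\<beta> + \<delta>) (2 ^ max (\<alpha> + \<gamma>) (\<beta> + \<delta>)) R"
      by (rule real_system_mono) simp_all
    with False show ?thesis by blast
  qed
  then obtain N R where R: "real_system (\<alpha> + \<gamma>) (\<beta> + \<delta>) N R" and N: "?d = Minus \<longrightarrow> N = 2 ^ ((?p + ?q) div 2)"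
    by blast
  have "?q = ?p + 4 \<or> ?q = ?p + 2" using q by (simp split: if_splits)
  then have "even (\<alpha> + \<beta> + \<gamma> + \<delta>)" by presburger
  with R interpret spinor_counts \<alpha> \<beta> \<gamma> \<delta> N R by unfold_locales
  have "blade_sign ?p (ext_set v) (ext_set v) = sign_value (cpt_sign_at \<sigma> v)" for v
  proof (cases "v = (False, False, False)")
    case True
    obtain a b c d e f g where "\<sigma> = (a, b, c, d, e, f, g)" by (metis prod.collapse)
    with True show ?thesis by (simp add: sign_value_def)
  next
    case False
    have "cpt_sign_at \<sigma> v = (if flags_minus counts (label_flags counts v) then Minus else Plus)"
      using labels(2)[OF False] sign.exhaust by metis
    then show ?thesis unfolding ext_set_blk blade_sign_blk by (simp add: sign_value_def)
  qed
  moreover have "inj ext_set" by (rule ext_set_inj) (use labels(1) in blast)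
  ultimately have "cpt_structure ?p ?q N mats \<sigma>" unfolding cpt_structure_iff by blast
  moreover have "quat_type ?p ?q" "(int ?p - int ?q) mod 8 = (if ?a = Plus then 4 else 6)"
    unfolding q using quat_type_two quat_type_four by auto
  ultimately show ?thesis using N by blast
qed

text \<open>
  The rows are indexed by the minuses among \<open>a\<close>, \<open>b\<close>, \<open>c\<close> and the columns by those among \<open>d\<close>, \<open>e\<close>, \<open>f\<close>;
  the sign \<open>g\<close> is determined by parity. The entries were found by a search.
\<close>

definition minus_index :: "sign \<Rightarrow> sign \<Rightarrow> sign \<Rightarrow> nat" where
  "minus_index a b c = (if a = Minus then 4 else 0) + (if b = Minus then 2 else 0) + (if c = Minus then 1 else 0)"

definition count_table :: "(nat \<times> nat \<times> nat \<times> nat) list list" where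
  "count_table = [
    [(0, 4, 4, 4), (1, 1, 1, 5), (1, 0, 1, 4), (0, 3, 4, 3), (0, 1, 4, 1), (1, 2, 5, 2), (1, 3, 5, 3), (0, 2, 4, 2)],
    [(1, 0, 4, 1), (0, 3, 3, 4), (1, 3, 0, 8), (0, 2, 3, 3), (0, 4, 7, 1), (1, 1, 4, 2), (0, 1, 3, 2), (1, 2, 4, 3)],
    [(0, 1, 1, 4), (1, 2, 2, 5), (0, 4, 1, 7), (1, 1, 2, 4), (1, 3, 6, 2), (0, 2, 5, 1), (1, 0, 2, 3), (0, 3, 5, 2)],
    [(1, 3, 3, 5), (0, 2, 2, 4), (0, 1, 2, 3), (1, 2, 3, 4), (1, 0, 3, 2), (0, 3, 6, 1), (0, 4, 6, 2), (1, 1, 3, 3)],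
    [(1, 1, 0, 4), (0, 4, 3, 3), (1, 4, 0, 7), (0, 3, 3, 2), (2, 3, 5, 2), (1, 2, 4, 1), (0, 2, 3, 1), (1, 3, 4, 2)],
    [(1, 4, 3, 4), (0, 3, 2, 3), (0, 2, 2, 2), (1, 3, 3, 3), (1, 1, 3, 1), (2, 2, 4, 2), (0, 1, 2, 1), (1, 2, 3, 2)],
    [(0, 5, 4, 3), (1, 2, 1, 4), (1, 1, 1, 3), (0, 4, 4, 2), (2, 0, 2, 2), (1, 3, 5, 1), (1, 0, 1, 2), (0, 3, 4, 1)],
    [(0, 2, 1, 3), (1, 3, 2, 4), (0, 1, 1, 2), (1, 2, 2, 3), (1, 0, 2, 1), (2, 1, 3, 2), (1, 1, 2, 2), (0, 4, 5, 1)]]"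

text \<open>The condition is arithmetic on four numbers, so the 64 table entries are verified by
  evaluation.\<close>

lemma count_table_realizes:
  assumes "even_signature (a, b, c, d, e, f, g)"
  shows "realizes (a, b, c, d, e, f, g) (count_table ! minus_index a b c ! minus_index d e f)"
  using assms
  by (cases a; cases b; cases c; cases d; cases e; cases f; cases g;
      simp add: even_signature_def minuses_def minus_index_def count_table_def; simp add: realizes_def)

text \<open>Parity makes the last sign a function \<open>G\<close> of the other six, which are
  free.\<close>

lemma card_even_signature: "card {\<sigma>. even_signature \<sigma>} = 64"
proof -
  define G where "G = (\<lambda>(a, b, c, d, e, f). if even (minuses [a, b, c, d, e, f]) then Plus else Minus)"
  let ?h = "\<lambda>(a, b, c, d, e, f). (a, b, c, d, e, f, G (a, b, c, d, e, f))"
  have m: "minuses [a, b, c, d, e, f, g] = minuses [a, b, c, d, e, f] + (if g = Minus then 1 else 0)" for a b c d e f g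
    by (simp add: minuses_def)
  have G: "even_signature (a, b, c, d, e, f, g) \<longleftrightarrow> g = G (a, b, c, d, e, f)" for a b c d e f g
    unfolding even_signature_def prod.case m G_def by (cases g) simp_all
  have "{\<sigma>. even_signature \<sigma>} = range ?h"
  proof (intro equalityI subsetI)
    fix \<sigma> assume "\<sigma> \<in> {\<sigma>. even_signature \<sigma>}"
    moreover obtain a b c d e f g where \<sigma>: "\<sigma> = (a, b, c, d, e, f, g)" by (metis prod.collapse)
    ultimately have "\<sigma> = ?h (a, b, c, d, e, f)" by (simp add: G)
    then show "\<sigma> \<in> range ?h" by (rule range_eqI)
  next
    fix \<sigma> assume "\<sigma> \<in> range ?h"
    then obtain x where x: "\<sigma> = ?h x" by (rule rangeE)
    obtain a b c d e f where "x = (a, b, c, d, e, f)" by (metis prod.collapse)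
    with x show "\<sigma> \<in> {\<sigma>. even_signature \<sigma>}" by (simp add: G)
  qed
  moreover have "inj ?h" by (rule injI) (simp split: prod.splits)
  ultimately have "card {\<sigma>. even_signature \<sigma>} = card (UNIV :: (sign \<times> sign \<times> sign \<times> sign \<times> sign \<times> sign) set)"
    by (simp only: card_image)
  also have "\<dots> = card (UNIV :: sign set) ^ 6"
    unfolding UNIV_Times_UNIV[symmetric] card_cartesian_product by (simp add: eval_nat_numeral)
  also have "(UNIV :: sign set) = {Plus, Minus}" using sign.exhaust by blast
  also have "card {Plus, Minus} = 2" by simp
  finally show ?thesis by simp
qed

section \<open>The groups of the signatures\<close>

text \<open>With 2 or 6 minuses the first two generators carry the relations of \<open>D4\<close> or
  \<open>Q4\<close> and the third commutes with both. With 4 minuses the bits are those of the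
  Abelian case.\<close>

definition group_bits :: "cpt_sign \<Rightarrow> relation_bits" where
  "group_bits = (\<lambda>(a, b, c, d, e, f, g). let m = minuses [a, b, c, d, e, f, g] in
     if m = 0 then (False, False, False, False, False, False)
     else if m = 2 then (True, False, False, True, False, False)
     else if m = 6 then (True, True, False, True, False, False)
     else (True, False, False, False, False, False))"

text \<open>A linear form is determined by \<open>a\<close>, \<open>b\<close> and \<open>d\<close>,
  its values at the generating labels of W, E and Pi; the other four signs are sums.\<close>

fun linear_signs :: "cpt_sign \<Rightarrow> bool" where
  "linear_signs (a, b, c, d, e, f, g) \<longleftrightarrow>
     (c = Minus) = ((a = Minus) \<noteq> (b = Minus)) \<and> (e = Minus) = ((a = Minus) \<noteq> (d = Minus)) \<and>
     (f = Minus) = ((b = Minus) \<noteq> (d = Minus)) \<and> (g = Minus) = ((c = Minus) \<noteq> (d = Minus))"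

lemma linear_signature_signs:
  assumes "linear_signature \<sigma>"
  shows "linear_signs \<sigma>"
proof -
  obtain a b c d e f g where \<sigma>: "\<sigma> = (a, b, c, d, e, f, g)" by (metis prod.collapse)
  note l = assms[unfolded linear_signature_def, rule_format]
  show ?thesis
    using l[of "(True, False, False)" "(False, True, False)"] l[of "(True, False, False)" "(False, False, True)"]
      l[of "(False, True, False)" "(False, False, True)"] l[of "(True, True, False)" "(False, False, True)"]
    by (simp add: \<sigma> cpt_labels_mult)
qed

text \<open>Binary digits: 1, 2 and 4 stand for W, E and Pi.\<close>

definition label_of :: "nat \<Rightarrow> cpt_label" where
  "label_of i = (odd i, odd (i div 2), odd (i div 4))"

text \<open>
  Where the signature has four minuses and the group is not Abelian, no basis is needed and the
  entry is arbitrary.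
\<close>

definition basis_table :: "(nat \<times> nat \<times> nat) list list" where
  "basis_table = [
    [(1, 2, 4), (6, 2, 1), (5, 1, 2), (5, 1, 3), (4, 1, 3), (4, 1, 2), (4, 2, 1), (4, 1, 2)],
    [(3, 1, 4), (3, 1, 5), (3, 1, 6), (1, 2, 4), (4, 1, 7), (1, 2, 4), (1, 2, 4), (1, 2, 4)],
    [(2, 1, 5), (2, 1, 4), (2, 1, 7), (1, 2, 4), (2, 1, 6), (1, 2, 4), (1, 2, 4), (1, 2, 4)],
    [(2, 4, 1), (2, 1, 4), (1, 2, 4), (1, 2, 4), (1, 2, 4), (1, 2, 4), (2, 1, 6), (2, 4, 1)],
    [(1, 2, 6), (1, 2, 7), (1, 2, 4), (1, 2, 4), (1, 2, 5), (1, 2, 4), (1, 2, 4), (1, 2, 4)],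
    [(1, 4, 2), (1, 2, 4), (1, 2, 4), (1, 2, 4), (1, 2, 4), (1, 2, 5), (1, 2, 4), (1, 4, 2)],
    [(1, 4, 3), (1, 2, 4), (1, 2, 4), (1, 4, 3), (1, 3, 5), (1, 2, 4), (1, 2, 4), (1, 4, 3)],
    [(1, 2, 4), (1, 2, 4), (1, 2, 4), (1, 2, 4), (1, 2, 4), (1, 2, 5), (1, 2, 6), (1, 2, 7)]]"

text \<open>An evaluation of all cases. In a non-Abelian case the vanishing of the last two
  commutator bits forces the third label of the table to span the radical of the polar form.\<close>

lemma basis_table_has_basis:
  assumes "even_signature (a, b, c, d, e, f, g)"
    and "minuses [a, b, c, d, e, f, g] = 4 \<longrightarrow> linear_signs (a, b, c, d, e, f, g)"
  shows "has_basis (a, b, c, d, e, f, g) (group_bits (a, b, c, d, e, f, g))"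
proof -
  have *: "case basis_table ! minus_index a b c ! minus_index d e f of (i, j, k) \<Rightarrow>
      label_basis (label_of i) (label_of j) (label_of k) \<and>
      sign_bits (cpt_sign_at (a, b, c, d, e, f, g)) cpt_labels (label_of i) (label_of j) (label_of k) =
        group_bits (a, b, c, d, e, f, g)"
    using assms
    by (cases a; cases b; cases c; cases d; cases e; cases f; cases g;
        simp add: even_signature_def minuses_def minus_index_def basis_table_def;
        simp add: label_of_def label_basis_def all_bool_eq; simp add: sign_bits_def cpt_labels_mult;
        simp add: group_bits_def minuses_def)
  obtain i j k where "basis_table ! minus_index a b c ! minus_index d e f = (i, j, k)"
    by (metis prod.collapse)
  with * have "label_basis (label_of i) (label_of j) (label_of k) \<and>
      sign_bits (cpt_sign_at (a, b, c, d, e, f, g)) cpt_labels (label_of i) (label_of j) (label_of k) =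
        group_bits (a, b, c, d, e, f, g)"
    by simp
  then show ?thesis unfolding has_basis_def by blast
qed

lemma cpt_structure_even_signature:
  assumes "cpt_structure p q N Es \<sigma>" "even (p + q)"
  shows "even_signature \<sigma>"
  by (rule covering_even_signature[OF cpt_structure_covering[OF assms]])

lemma group_products: "group (Z2 \<times>\<times> Z2 \<times>\<times> Z2 \<times>\<times> Z2)" "group (Z4 \<times>\<times> Z2 \<times>\<times> Z2)" "group (Q4 \<times>\<times> Z2)"
  "group (D4 \<times>\<times> Z2)" "group (Z2 \<times>\<times> Z2 \<times>\<times> Z2)" "group (Z2 \<times>\<times> Z4)"
  using group_Z2 group_Z4 group_D4 group_Q4
  by (simp_all add: DirProd_group comm_group_def)

lemma comm_group_products: "comm_group (Z2 \<times>\<times> Z2 \<times>\<times> Z2 \<times>\<times> Z2)" "comm_group (Z4 \<times>\<times> Z2 \<times>\<times> Z2)"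
  using comm_groupE(4)[OF group_Z2] comm_groupE(4)[OF group_Z4]
  by (auto intro!: group.group_comm_groupI group_products)

section \<open>From signatures to existence of covering groups\<close>

lemma covers_iso:
  assumes s: "cpt_structure p q N Es \<sigma>" and ev: "even (p + q)" and k: "has_basis \<sigma> k"
    and H: "group H" "relations H z' x' y' w' k" "bij_betw (word H z' x' y' w') UNIV (carrier H)"
  shows "cpt_cover (p + q) N Es \<cong> H" and "Pin_cpt_is p q N Es \<sigma> H"
proof -
  show i: "cpt_cover (p + q) N Es \<cong> H"
    by (rule has_basis_iso[OF cpt_structure_covering[OF s ev] k H])
  show "Pin_cpt_is p q N Es \<sigma> H" by (rule Pin_cpt_isI[OF s ev i H(1)])
qed

lemma cliffordianI:
  assumes s: "cpt_structure p q N Es \<sigma>" and ev: "even (p + q)" and "\<not> linear_signs \<sigma>"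
  shows "cliffordian p q N Es"
  unfolding cliffordian_def
  using comm_group_linear_signature[OF cpt_structure_covering[OF s ev]] linear_signature_signs assms(3) by blast

lemma not_cliffordianI:
  assumes s: "cpt_structure p q N Es \<sigma>" and ev: "even (p + q)" and i: "cpt_cover (p + q) N Es \<cong> H" and H: "comm_group H"
  shows "\<not> cliffordian p q N Es"
proof -
  have g: "group (cpt_cover (p + q) N Es)"
    using cpt_structure_covering(1)[OF s ev] by (simp add: double_covering_def)
  then have "comm_group (cpt_cover (p + q) N Es)"
    using comm_group.iso_imp_comm_group[OF H group.iso_sym[OF g i]] group.is_monoid[OF g] by blast
  then show ?thesis by (simp add: cliffordian_def)
qed

text \<open>The table supplies one structure, whereas \<open>P\<close> is established for every
  structure with the given signature: the finite group depends on the signature alone.\<close>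

lemma even_signature_realized:
  assumes "even_signature \<sigma>" and r: "r = (if cpt_sign_at \<sigma> (True, False, False) = Plus then 4 else 6)"
    and P: "\<And>p q N Es. cpt_structure p q N Es \<sigma> \<Longrightarrow> even (p + q) \<Longrightarrow> P p q N Es"
  shows "cpt_realized r \<sigma> P"
proof -
  obtain a b c d e f g where "\<sigma> = (a, b, c, d, e, f, g)" by (metis prod.collapse)
  with assms(1) obtain t where "realizes \<sigma> t" using count_table_realizes by blast
  then obtain p q N Es where *: "(int p - int q) mod 8 = r" "quat_type p q" "cpt_structure p q N Es \<sigma>"
    "cpt_sign_at \<sigma> (False, False, True) = Minus \<longrightarrow> N = 2 ^ ((p + q) div 2)"
    using realizes_cpt_structure[of \<sigma> t] unfolding r by blast
  have "even (p + q)" using *(1) unfolding r by (auto split: if_splits) presburger+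
  with * P show ?thesis unfolding cpt_realized_def by blast
qed

lemma realized_iff_even_signature: "(\<exists>r\<in>{4, 6}. cpt_realized r \<sigma> (\<lambda>p q N Es. True)) \<longleftrightarrow> even_signature \<sigma>"
proof
  assume "\<exists>r\<in>{4, 6}. cpt_realized r \<sigma> (\<lambda>p q N Es. True)"
  then obtain p q N Es where *: "(int p - int q) mod 8 \<in> {4, 6}" "cpt_structure p q N Es \<sigma>"
    unfolding cpt_realized_def by blast
  have "even (p + q)" using *(1) by auto presburger+
  with *(2) show "even_signature \<sigma>" by (rule cpt_structure_even_signature)
next
  assume "even_signature \<sigma>"
  from even_signature_realized[OF this refl, of "\<lambda>p q N Es. True"]
  show "\<exists>r\<in>{4, 6}. cpt_realized r \<sigma> (\<lambda>p q N Es. True)" by (auto split: if_splits)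
qed

text \<open>The residue \<open>r\<close> is dictated by \<open>a\<close>, the square of the volume
  element. The five conclusions correspond to the possible numbers of minuses, with 4 split by
  linearity.\<close>

lemma signature_exists:
  fixes a b c d e f g :: sign
  defines "\<sigma> \<equiv> (a, b, c, d, e, f, g)"
  assumes r: "r = (if a = Plus then 4 else 6)"
  shows non_cliffordian_Z2222: "minuses [a, b, c, d, e, f, g] = 0 \<Longrightarrow>
      non_cliffordian_exists r \<sigma> (Z2 \<times>\<times> Z2 \<times>\<times> Z2 \<times>\<times> Z2)"
    and non_cliffordian_Z4Z2Z2: "minuses [a, b, c, d, e, f, g] = 4 \<Longrightarrow> linear_signs \<sigma> \<Longrightarrow>
      non_cliffordian_exists r \<sigma> (Z4 \<times>\<times> Z2 \<times>\<times> Z2)"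
    and cliffordian_Q4Z2: "minuses [a, b, c, d, e, f, g] = 6 \<Longrightarrow> cliffordian_exists r \<sigma> (Q4 \<times>\<times> Z2)"
    and cliffordian_D4Z2: "minuses [a, b, c, d, e, f, g] = 2 \<Longrightarrow> cliffordian_exists r \<sigma> (D4 \<times>\<times> Z2)"
    and cliffordian_star: "minuses [a, b, c, d, e, f, g] = 4 \<Longrightarrow> \<not> linear_signs \<sigma> \<Longrightarrow> cliffordian_star_exists r \<sigma>"
proof -
  let ?m = "minuses [a, b, c, d, e, f, g]"
  have r': "r = (if cpt_sign_at \<sigma> (True, False, False) = Plus then 4 else 6)" by (simp add: r \<sigma>_def)
  have ev: "even_signature \<sigma>" if "even ?m" using that by (simp add: even_signature_def \<sigma>_def)
  have basis: "has_basis \<sigma> (group_bits \<sigma>)" if "even ?m" "?m = 4 \<longrightarrow> linear_signs \<sigma>"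
    using basis_table_has_basis ev that unfolding \<sigma>_def by blast
  \<comment> \<open>A nonzero linear form on the eight labels takes each value four times.\<close>
  have lin: "?m = 0 \<or> ?m = 4" if "linear_signs \<sigma>"
    using that unfolding \<sigma>_def minuses_def
    by (cases a; cases b; cases c; cases d; cases e; cases f; cases g; simp)
  have bits: "group_bits \<sigma> = (let m = ?m in
     if m = 0 then (False, False, False, False, False, False)
     else if m = 2 then (True, False, False, True, False, False)
     else if m = 6 then (True, True, False, True, False, False)
     else (True, False, False, False, False, False))"
    by (simp add: group_bits_def \<sigma>_def)
  show "non_cliffordian_exists r \<sigma> (Z2 \<times>\<times> Z2 \<times>\<times> Z2 \<times>\<times> Z2)" if m: "?m = 0"
    unfolding non_cliffordian_exists_def
  proof (rule even_signature_realized[OF ev r'])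
    have b: "has_basis \<sigma> (False, False, False, False, False, False)" using basis m bits by simp
    fix p q N Es assume s: "cpt_structure p q N Es \<sigma>" "even (p + q)"
    note i = covers_iso[OF s b group_products(1) Z2222_presentation]
    with not_cliffordianI[OF s i(1) comm_group_products(1)]
    show "\<not> cliffordian p q N Es \<and> Pin_cpt_is p q N Es \<sigma> (Z2 \<times>\<times> Z2 \<times>\<times> Z2 \<times>\<times> Z2)" by blast
  qed (simp add: m)
  show "non_cliffordian_exists r \<sigma> (Z4 \<times>\<times> Z2 \<times>\<times> Z2)" if m: "?m = 4" and l: "linear_signs \<sigma>"
    unfolding non_cliffordian_exists_def
  proof (rule even_signature_realized[OF ev r'])
    have b: "has_basis \<sigma> (True, False, False, False, False, False)" using basis m l bits by simp
    fix p q N Es assume s: "cpt_structure p q N Es \<sigma>" "even (p + q)"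
    note i = covers_iso[OF s b group_products(2) Z4Z2Z2_presentation]
    with not_cliffordianI[OF s i(1) comm_group_products(2)]
    show "\<not> cliffordian p q N Es \<and> Pin_cpt_is p q N Es \<sigma> (Z4 \<times>\<times> Z2 \<times>\<times> Z2)" by blast
  qed (simp add: m)
  show "cliffordian_exists r \<sigma> (Q4 \<times>\<times> Z2)" if m: "?m = 6"
    unfolding cliffordian_exists_def
  proof (rule even_signature_realized[OF ev r'])
    have b: "has_basis \<sigma> (True, True, False, True, False, False)" using basis m bits by simp
    have nl: "\<not> linear_signs \<sigma>" using lin m by auto
    fix p q N Es assume s: "cpt_structure p q N Es \<sigma>" "even (p + q)"
    show "cliffordian p q N Es \<and> Pin_cpt_is p q N Es \<sigma> (Q4 \<times>\<times> Z2)"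
      using covers_iso(2)[OF s b group_products(3) Q4Z2_presentation] cliffordianI[OF s nl] by blast
  qed (simp add: m)
  show "cliffordian_exists r \<sigma> (D4 \<times>\<times> Z2)" if m: "?m = 2"
    unfolding cliffordian_exists_def
  proof (rule even_signature_realized[OF ev r'])
    have b: "has_basis \<sigma> (True, False, False, True, False, False)" using basis m bits by simp
    have nl: "\<not> linear_signs \<sigma>" using lin m by auto
    fix p q N Es assume s: "cpt_structure p q N Es \<sigma>" "even (p + q)"
    show "cliffordian p q N Es \<and> Pin_cpt_is p q N Es \<sigma> (D4 \<times>\<times> Z2)"
      using covers_iso(2)[OF s b group_products(4) D4Z2_presentation] cliffordianI[OF s nl] by blast
  qed (simp add: m)
  show "cliffordian_star_exists r \<sigma>" if m: "?m = 4" and nl: "\<not> linear_signs \<sigma>"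
  proof -
    have "pluses [a, b, c, d, e, f, g] = 3"
      using m unfolding minuses_def pluses_def
      by (cases a; cases b; cases c; cases d; cases e; cases f; cases g; simp)
    moreover have "cpt_realized r \<sigma> cliffordian"
      by (rule even_signature_realized[OF ev r']) (use m nl cliffordianI in auto)
    ultimately show ?thesis using m by (simp add: cliffordian_star_exists_def \<sigma>_def)
  qed
qed

section \<open>PT-structures\<close>

lemma word_pt_labels: "word pt_labels \<one>\<^bsub>pt_labels\<^esub> (u1, u2) (v1, v2) t (False, a, b, False) =
    ((a \<and> u1) \<noteq> (b \<and> v1), (a \<and> u2) \<noteq> (b \<and> v2))"
  by (cases a; cases b) (simp_all add: word_def bit_pow_def pt_labels_mult pt_labels_one)

text \<open>Two distinct nonneutral labels generate the four-group; the third generator is neutral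
  and its exponent is fixed.\<close>

lemma pt_label_basis:
  assumes "u \<noteq> v" "u \<noteq> (False, False)" "v \<noteq> (False, False)"
  shows "bij_betw (\<lambda>s. word pt_labels \<one>\<^bsub>pt_labels\<^esub> u v \<one>\<^bsub>pt_labels\<^esub> (False, s)) (UNIV \<times> UNIV \<times> {False})
    (carrier pt_labels)"
proof -
  let ?f = "\<lambda>s. word pt_labels \<one>\<^bsub>pt_labels\<^esub> u v \<one>\<^bsub>pt_labels\<^esub> (False, s)"
  obtain u1 u2 v1 v2 where uv: "u = (u1, u2)" "v = (v1, v2)" by (metis prod.collapse)
  have "x \<in> ?f ` (UNIV \<times> UNIV \<times> {False})" for x
  proof -
    have "\<exists>a b. ?f (a, b, False) = x"
      using assms unfolding uv word_pt_labels
      by (cases x; cases u1; cases u2; cases v1; cases v2) (auto simp: ex_bool_eq)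
    then show ?thesis by blast
  qed
  then have im: "?f ` (UNIV \<times> UNIV \<times> {False}) = carrier pt_labels" by auto
  moreover have "inj_on ?f (UNIV \<times> UNIV \<times> {False})"
    by (rule eq_card_imp_inj_on)
      (simp_all only: im, simp_all add: card_cartesian_product flip: UNIV_Times_UNIV)
  ultimately show ?thesis by (simp add: bij_betw_def)
qed

lemma pt_iso:
  assumes s: "pt_structure p q N Es \<sigma>" and ev: "even (p + q)"
    and uv: "u \<noteq> v" "u \<noteq> (False, False)" "v \<noteq> (False, False)"
    and k: "sign_bits (pt_sign_at \<sigma>) pt_labels u v \<one>\<^bsub>pt_labels\<^esub> = k"
    and H: "group H" "relations H z' x' y' w' k"
      "bij_betw (word H z' x' y' w') (UNIV \<times> UNIV \<times> UNIV \<times> {False}) (carrier H)"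
  shows "Pin_pt_is p q N Es \<sigma> H"
proof -
  have "pt_cover (p + q) N Es \<cong> H"
    by (rule covering_iso[OF pt_structure_covering(1)[OF s ev] comm_group_pt_labels pt_structure_covering(2)[OF s ev]
        _ _ _ pt_label_basis[OF uv] H(1) _ H(3)]) (simp_all add: k H(2))
  then show ?thesis by (rule Pin_pt_isI[OF s ev _ H(1)])
qed

lemma sign_bits_pt: "sign_bits (pt_sign_at \<sigma>) pt_labels u v \<one>\<^bsub>pt_labels\<^esub> =
    (pt_sign_at \<sigma> u = Minus, pt_sign_at \<sigma> v = Minus, False,
     (pt_sign_at \<sigma> (u \<otimes>\<^bsub>pt_labels\<^esub> v) = Minus) \<noteq> ((pt_sign_at \<sigma> u = Minus) \<noteq> (pt_sign_at \<sigma> v = Minus)), False, False)"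
proof -
  obtain a b c where "\<sigma> = (a, b, c)" by (metis prod.collapse)
  then have "pt_sign_at \<sigma> \<one>\<^bsub>pt_labels\<^esub> = Plus" by (simp add: pt_labels_one)
  then show ?thesis
    using group.is_monoid[OF group_pt_labels] by (simp add: sign_bits_def Let_def monoid.r_one)
qed

lemma pt_structure_type:
  assumes s: "pt_structure p q N Es \<sigma>" and ev: "even (p + q)"
  shows "pt_type p q N Es \<sigma>"
proof -
  obtain a b c where \<sigma>: "\<sigma> = (a, b, c)" by (metis prod.collapse)
  let ?S = "pt_sign_at \<sigma>"
  have Z222: "Pin_pt_is p q N Es \<sigma> (Z2 \<times>\<times> Z2 \<times>\<times> Z2)"
    if "u \<noteq> v" "u \<noteq> (False, False)" "v \<noteq> (False, False)" "?S u = Plus" "?S v = Plus" "?S (u \<otimes>\<^bsub>pt_labels\<^esub> v) = Plus" for u v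
    by (rule pt_iso[OF s ev that(1-3) _ group_products(5) Z222_presentation]) (simp add: sign_bits_pt that)
  have D4: "Pin_pt_is p q N Es \<sigma> D4"
    if "u \<noteq> v" "u \<noteq> (False, False)" "v \<noteq> (False, False)" "?S u = Minus" "?S v = Plus" "?S (u \<otimes>\<^bsub>pt_labels\<^esub> v) = Plus" for u v
    by (rule pt_iso[OF s ev that(1-3) _ group_D4 D4_presentation]) (simp add: sign_bits_pt that)
  have Z2Z4: "Pin_pt_is p q N Es \<sigma> (Z2 \<times>\<times> Z4)"
    if "u \<noteq> v" "u \<noteq> (False, False)" "v \<noteq> (False, False)" "?S u = Minus" "?S v = Plus" "?S (u \<otimes>\<^bsub>pt_labels\<^esub> v) = Minus" for u v
    by (rule pt_iso[OF s ev that(1-3) _ group_products(6) Z2Z4_presentation]) (simp add: sign_bits_pt that)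
  have Q4: "Pin_pt_is p q N Es \<sigma> Q4"
    if "u \<noteq> v" "u \<noteq> (False, False)" "v \<noteq> (False, False)" "?S u = Minus" "?S v = Minus" "?S (u \<otimes>\<^bsub>pt_labels\<^esub> v) = Minus" for u v
    by (rule pt_iso[OF s ev that(1-3) _ group_Q4 Q4_presentation]) (simp add: sign_bits_pt that)
  let ?P = "(True, False)" and ?T = "(False, True)" and ?PT = "(True, True)"
  \<comment> \<open>The pairs of labels run through the positions of the exceptional sign: the only
    minus for \<open>D4\<close>, the only plus for \<open>Z2 \<times>\<times> Z4\<close>.\<close>
  note pt = Z222[of ?P ?T] D4[of ?P ?T] D4[of ?T ?P] D4[of ?PT ?P] Z2Z4[of ?P ?T] Z2Z4[of ?T ?P] Z2Z4[of ?P ?PT] Q4[of ?P ?T]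
  show ?thesis
    using pt unfolding pt_type_def \<sigma> prod.case pluses_def
    by (cases a; cases b; cases c; simp add: pt_labels_mult)
qed

context spinor_counts
begin

lemma pt_structure_counts:
  assumes "\<forall>v\<in>{(True, False), (False, True), (True, True)}.
      flags_card counts (label_flags counts (fst v, snd v, False)) \<noteq> 0 \<and>
      (pt_sign_at \<sigma> v = Minus) = flags_minus counts (label_flags counts (fst v, snd v, False))"
  shows "pt_structure p q N mats \<sigma>"
proof -
  let ?V = "\<lambda>v. ext_set (fst v, snd v, False)"
  interpret blade_family p q N mats "pt_mat n N mats" ?V pt_labels by (rule blade_family_pt)
  have labels: "flags_card counts (label_flags counts (fst v, snd v, False)) \<noteq> 0 \<and>
      (pt_sign_at \<sigma> v = Minus) = flags_minus counts (label_flags counts (fst v, snd v, False))"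
    if "v \<noteq> (False, False)" for v
  proof -
    have "v \<in> {(True, False), (False, True), (True, True)}" using that by (cases v) auto
    with assms show ?thesis by blast
  qed
  have "inj ?V"
  proof (rule injI)
    fix u v assume "?V u = ?V v"
    then have "?V (u \<otimes>\<^bsub>pt_labels\<^esub> v) = {}" unfolding V_mult by simp
    then have "flags_card counts (label_flags counts (fst (u \<otimes>\<^bsub>pt_labels\<^esub> v), snd (u \<otimes>\<^bsub>pt_labels\<^esub> v), False)) = 0"
      unfolding ext_set_blk card_blk[symmetric] by simp
    with labels have "u \<otimes>\<^bsub>pt_labels\<^esub> v = (False, False)" by blast
    then show "u = v" by (cases u; cases v) (simp add: pt_labels_mult)
  qed
  then have d: "distinct_up_to_sign (pt_mat n N mats)" by (simp only: distinct_iff)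
  have "blade_sign p (?V v) (?V v) = sign_value (pt_sign_at \<sigma> v)" for v
  proof (cases "v = (False, False)")
    case True
    obtain a b c where "\<sigma> = (a, b, c)" by (metis prod.collapse)
    with True show ?thesis by (simp add: sign_value_def)
  next
    case False
    then have "pt_sign_at \<sigma> v = (if flags_minus counts (label_flags counts (fst v, snd v, False)) then Minus else Plus)"
      using labels[OF False] by (cases "pt_sign_at \<sigma> v") simp_all
    then show ?thesis unfolding ext_set_blk blade_sign_blk by (simp add: sign_value_def)
  qed
  then have "has_squares N (pt_mat n N mats) (pt_sign_at \<sigma>)" unfolding has_squares_iff by (rule allI)
  with d show ?thesis unfolding pt_structure_iff by (rule conjI)
qed

end

text \<open>All matrices are taken real, \<open>p\<close> symmetric and \<open>q\<close>
  skewsymmetric ones, so Pi is an empty product. The two differences \<open>p - q\<close> are those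
  for which real matrices of the irreducible degree were constructed.\<close>

lemma pt_structure_exists:
  assumes pq: "p = q \<or> p = q + 2"
    and v: "\<forall>v\<in>{(True, False), (False, True), (True, True)}.
      flags_card (p, 0, 0, q) (label_flags (p, 0, 0, q) (fst v, snd v, False)) \<noteq> 0 \<and>
      (pt_sign_at \<sigma> v = Minus) = flags_minus (p, 0, 0, q) (label_flags (p, 0, 0, q) (fst v, snd v, False))"
  shows "\<exists>p q Es. (int p - int q) mod 8 \<in> {0, 2} \<and> real_type p q \<and>
        Pi_mat (p + q) (2 ^ ((p + q) div 2)) Es = 1\<^sub>m (2 ^ ((p + q) div 2)) \<and>
        pt_structure p q (2 ^ ((p + q) div 2)) Es \<sigma> \<and>
        pt_type p q (2 ^ ((p + q) div 2)) Es \<sigma>"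
proof -
  let ?N = "2 ^ ((p + q) div 2)"
  have ev: "even (p + q)" and mod: "(int p - int q) mod 8 \<in> {0, 2}" and rt: "real_type p q"
    using pq real_type_split real_type_two by auto
  have "\<exists>R. real_system p q ?N R"
    using pq real_system_exists_split[of q] real_system_exists_two[of q] by auto
  then obtain R where R: "real_system p q ?N R" by blast
  interpret spinor_counts p 0 0 q ?N R using R ev by unfold_locales simp_all
  have st: "pt_structure p q ?N mats \<sigma>" using pt_structure_counts[of \<sigma>] v by simp
  have "complex_indices (p + q) mats = {}" using complex_indices_mats by (auto simp: is_cplx_def)
  then have "Pi_set = {}" unfolding Pi_set_def by simp
  then have "Pi_mat (p + q) ?N mats = 1\<^sub>m ?N" using Pi_mat_E by simp
  with st mod rt pt_structure_type[OF st ev] show ?thesis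
    by (intro exI[of _ p] exI[of _ q] exI[of _ mats] conjI)
qed

lemma pt_structures: "\<exists>p q Es. (int p - int q) mod 8 \<in> {0, 2} \<and> real_type p q \<and>
        Pi_mat (p + q) (2 ^ ((p + q) div 2)) Es = 1\<^sub>m (2 ^ ((p + q) div 2)) \<and>
        pt_structure p q (2 ^ ((p + q) div 2)) Es (a, b, c) \<and>
        pt_type p q (2 ^ ((p + q) div 2)) Es (a, b, c)"
proof (cases a; cases b; cases c)
  \<comment> \<open>The difference \<open>p - q\<close> is 0 or 2 according to \<open>a\<close>, and
    the residue of \<open>q\<close> modulo 4 then determines \<open>b\<close> and \<open>c\<close>.
    Residue 0 is represented by 4, since for \<open>q\<close> equal to 0 the product E of the
    skewsymmetric matrices would be empty.\<close>
  note ex = pt_structure_exists[where \<sigma>="(a, b, c)"]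
  show ?thesis if "a = Plus" "b = Plus" "c = Plus" by (rule ex[of 4 4]) (simp_all add: that Let_def)
  show ?thesis if "a = Plus" "b = Plus" "c = Minus" by (rule ex[of 1 1]) (simp_all add: that Let_def)
  show ?thesis if "a = Plus" "b = Minus" "c = Plus" by (rule ex[of 3 3]) (simp_all add: that Let_def)
  show ?thesis if "a = Plus" "b = Minus" "c = Minus" by (rule ex[of 2 2]) (simp_all add: that Let_def)
  show ?thesis if "a = Minus" "b = Plus" "c = Plus" by (rule ex[of 5 3]) (simp_all add: that Let_def)
  show ?thesis if "a = Minus" "b = Plus" "c = Minus" by (rule ex[of 6 4]) (simp_all add: that Let_def)
  show ?thesis if "a = Minus" "b = Minus" "c = Plus" by (rule ex[of 4 2]) (simp_all add: that Let_def)
  show ?thesis if "a = Minus" "b = Minus" "c = Minus" by (rule ex[of 3 1]) (simp_all add: that Let_def)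
qed

text \<open>If Pi is scalar, \<open>Pi_set\<close> is empty and the conjugation bit of a label no
  longer affects its index set. So K, S, F agree with W, E, C up to sign and repeat their squares,
  and the square of Pi is Plus.\<close>

lemma real_case_reduction:
  assumes m: "(int p - int q) mod 8 \<in> {0, 2}" and sys: "spinor_system p q N Es"
    and Pi: "Pi_mat (p + q) N Es = k \<cdot>\<^sub>m 1\<^sub>m N"
  shows "carrier (cpt_cover (p + q) N Es) = carrier (pt_cover (p + q) N Es)"
    and "\<exists>a b c. has_squares N (ext_mat (p + q) N Es) (cpt_sign_at (a, b, c, Plus, a, b, c)) \<and>
           (distinct_up_to_sign (pt_mat (p + q) N Es) \<longrightarrow>
              pt_structure p q N Es (a, b, c) \<and> pt_type p q N Es (a, b, c))"
proof -
  have ev: "even (p + q)" using m by auto presburger+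
  interpret spinor_matrices p q N Es
    using sys ev by unfold_locales (auto simp: spinor_system_def)
  interpret C: blade_family p q N Es "ext_mat n N Es" ext_set cpt_labels by (rule blade_family_cpt)
  let ?V = "\<lambda>v. ext_set (fst v, snd v, False)"
  interpret P: blade_family p q N Es "pt_mat n N Es" ?V pt_labels by (rule blade_family_pt)
  have Pi0: "Pi_set = {}"
    using E_scalar_imp_empty[OF Pi_set_subset] Pi unfolding Pi_mat_E by blast
  have ext: "ext_set (x, y, z) = ?V (x, y)" for x y z by (simp add: Pi0)
  have "(\<exists>v. \<exists>\<epsilon>. (\<epsilon> = 1 \<or> \<epsilon> = - 1) \<and> M = \<epsilon> \<cdot>\<^sub>m E (ext_set v)) \<longleftrightarrow>
      (\<exists>v. \<exists>\<epsilon>. (\<epsilon> = 1 \<or> \<epsilon> = - 1) \<and> M = \<epsilon> \<cdot>\<^sub>m E (?V v))" for M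
    using ext by (metis prod_cases3)
  then show "carrier (cpt_cover n N Es) = carrier (pt_cover n N Es)"
    unfolding cpt_cover_def pt_cover_def set_eq_iff C.carrier_G P.carrier_G by blast
  define sgn where "sgn v = (if blade_sign p (?V v) (?V v) = 1 then Plus else Minus)" for v
  have sgn: "blade_sign p (?V v) (?V v) = sign_value (sgn v)" for v
    using blade_sign_cases[of p "?V v" "?V v"] by (auto simp: sgn_def sign_value_def)
  have one: "sgn (False, False) = Plus" by (simp add: sgn_def)
  let ?a = "sgn (True, False)" and ?b = "sgn (False, True)" and ?c = "sgn (True, True)"
  have cpt: "cpt_sign_at (?a, ?b, ?c, Plus, ?a, ?b, ?c) (x, y, z) = sgn (x, y)" for x y z
    by (cases x; cases y; cases z) (simp_all only: cpt_sign_at.simps one)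
  have pt: "pt_sign_at (?a, ?b, ?c) (x, y) = sgn (x, y)" for x y
    by (cases x; cases y) (simp_all only: pt_sign_at.simps one)
  have "has_squares N (ext_mat n N Es) (cpt_sign_at (?a, ?b, ?c, Plus, ?a, ?b, ?c))"
    unfolding C.has_squares_iff
  proof
    fix v :: "bool \<times> bool \<times> bool"
    obtain x y z where v: "v = (x, y, z)" by (rule prod_cases3)
    show "blade_sign p (ext_set v) (ext_set v) = sign_value (cpt_sign_at (?a, ?b, ?c, Plus, ?a, ?b, ?c) v)"
      unfolding v cpt by (subst (1 2) ext) (rule sgn)
  qed
  moreover have "has_squares N (pt_mat n N Es) (pt_sign_at (?a, ?b, ?c))"
    unfolding P.has_squares_iff
  proof
    fix v :: "bool \<times> bool"
    obtain x y where v: "v = (x, y)" by (rule prod.exhaust)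
    show "blade_sign p (?V v) (?V v) = sign_value (pt_sign_at (?a, ?b, ?c) v)"
      unfolding sgn v pt by (rule refl)
  qed
  then have "distinct_up_to_sign (pt_mat n N Es) \<longrightarrow> pt_structure p q N Es (?a, ?b, ?c)"
    unfolding pt_structure_iff by blast
  ultimately show "\<exists>a b c. has_squares N (ext_mat n N Es) (cpt_sign_at (a, b, c, Plus, a, b, c)) \<and>
           (distinct_up_to_sign (pt_mat n N Es) \<longrightarrow>
              pt_structure p q N Es (a, b, c) \<and> pt_type p q N Es (a, b, c))"
    using pt_structure_type[OF _ ev] by blast
qed

section \<open>The theorem\<close>

lemma covering_signature_linear:
  assumes "covering_signature \<sigma> (Z4 \<times>\<times> Z2 \<times>\<times> Z2)"
  shows "linear_signs \<sigma>"
  using assms comm_group_linear_signature[OF _ _ comm_group_products(2)] linear_signature_signs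
  unfolding covering_signature_def by blast

lemma non_cliffordian_covering_signature:
  "non_cliffordian_exists r \<sigma> C \<Longrightarrow> covering_signature \<sigma> C"
  unfolding non_cliffordian_exists_def cpt_realized_def Pin_cpt_is_def covering_signature_def by blast

lemma minuses_Cons [simp]: "minuses (Plus # xs) = minuses xs" "minuses (Minus # xs) = Suc (minuses xs)" "minuses [] = 0"
  by (simp_all add: minuses_def)

lemma pluses_minuses: "pluses [d, e, f, g] = 4 - m \<Longrightarrow> m \<le> 4 \<Longrightarrow> minuses [d, e, f, g] = m"
  by (cases d; cases e; cases f; cases g; simp add: pluses_def)

text \<open>A linear signature with four minuses would be realized with the Abelian group and so be
  a covering signature of it.\<close>

lemma cliffordian_star_covering:
  assumes "r = (if a = Plus then 4 else 6)" "minuses [a, b, c, d, e, f, g] = 4"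
    "\<not> covering_signature (a, b, c, d, e, f, g) (Z4 \<times>\<times> Z2 \<times>\<times> Z2)"
  shows "cliffordian_star_exists r (a, b, c, d, e, f, g)"
proof (rule cliffordian_star[OF assms(1,2)])
  show "\<not> linear_signs (a, b, c, d, e, f, g)"
    using non_cliffordian_covering_signature[OF non_cliffordian_Z4Z2Z2[OF assms(1,2)]] assms(3) by (rule contrapos_nn[rotated])
qed

text \<open>For two pluses among the last four signs the prefixes with \<open>b\<close> and
  \<open>c\<close> of a given kind admit both Abelian and non-Abelian coverings. These signatures
  are told apart by \<open>covering_signature\<close>, which here amounts to linearity, and the
  existential clauses ensure that the conditional ones are not vacuous.\<close>

theorem theorem12:
  shows
    "(\<forall>p q N Es. (int p - int q) mod 8 \<in> {0, 2} \<and> real_type p q \<and> spinor_system p q N Es \<and>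
        (\<exists>k. Pi_mat (p + q) N Es = k \<cdot>\<^sub>m 1\<^sub>m N) \<longrightarrow>
        carrier (cpt_cover (p + q) N Es) = carrier (pt_cover (p + q) N Es) \<and>
        (\<exists>a b c. has_squares N (ext_mat (p + q) N Es) (cpt_sign_at (a, b, c, Plus, a, b, c)) \<and>
           (distinct_up_to_sign (pt_mat (p + q) N Es) \<longrightarrow>
              pt_structure p q N Es (a, b, c) \<and> pt_type p q N Es (a, b, c)))) \<and>
     (\<forall>a b c. \<exists>p q Es. (int p - int q) mod 8 \<in> {0, 2} \<and> real_type p q \<and>
        Pi_mat (p + q) (2 ^ ((p + q) div 2)) Es = 1\<^sub>m (2 ^ ((p + q) div 2)) \<and>
        pt_structure p q (2 ^ ((p + q) div 2)) Es (a, b, c) \<and>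
        pt_type p q (2 ^ ((p + q) div 2)) Es (a, b, c)) \<and>
     card {\<sigma>. \<exists>r\<in>{4, 6}. cpt_realized r \<sigma> (\<lambda>p q N Es. True)} = 64 \<and>
     non_cliffordian_exists 4 (Plus, Plus, Plus, Plus, Plus, Plus, Plus)
       (Z2 \<times>\<times> Z2 \<times>\<times> Z2 \<times>\<times> Z2) \<and>
     non_cliffordian_exists 4 (Plus, Plus, Plus, Minus, Minus, Minus, Minus)
       (Z4 \<times>\<times> Z2 \<times>\<times> Z2) \<and>
     (\<forall>(a, b, c) \<in> {(Minus, Plus, Minus), (Minus, Minus, Plus)}.
        (\<forall>d e f g. pluses [d, e, f, g] = 2 \<and>
           covering_signature (a, b, c, d, e, f, g) (Z4 \<times>\<times> Z2 \<times>\<times> Z2) \<longrightarrow>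
           non_cliffordian_exists 6 (a, b, c, d, e, f, g) (Z4 \<times>\<times> Z2 \<times>\<times> Z2)) \<and>
        (\<exists>d e f g. pluses [d, e, f, g] = 2 \<and>
           non_cliffordian_exists 6 (a, b, c, d, e, f, g) (Z4 \<times>\<times> Z2 \<times>\<times> Z2))) \<and>
     cliffordian_exists 4 (Plus, Minus, Minus, Minus, Minus, Minus, Minus) (Q4 \<times>\<times> Z2) \<and>
     cliffordian_exists 6 (Minus, Plus, Minus, Minus, Minus, Minus, Minus) (Q4 \<times>\<times> Z2) \<and>
     cliffordian_exists 6 (Minus, Minus, Plus, Minus, Minus, Minus, Minus) (Q4 \<times>\<times> Z2) \<and>
     (\<forall>d e f g. pluses [d, e, f, g] = 1 \<longrightarrow>
        cliffordian_exists 6 (Minus, Minus, Minus, d, e, f, g) (Q4 \<times>\<times> Z2)) \<and>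
     cliffordian_exists 4 (Plus, Minus, Minus, Plus, Plus, Plus, Plus) (D4 \<times>\<times> Z2) \<and>
     (\<forall>d e f g. pluses [d, e, f, g] = 2 \<longrightarrow>
        cliffordian_exists 4 (Plus, Plus, Plus, d, e, f, g) (D4 \<times>\<times> Z2)) \<and>
     (\<forall>d e f g. pluses [d, e, f, g] = 3 \<longrightarrow>
        cliffordian_exists 4 (Plus, Minus, Plus, d, e, f, g) (D4 \<times>\<times> Z2) \<and>
        cliffordian_exists 4 (Plus, Plus, Minus, d, e, f, g) (D4 \<times>\<times> Z2)) \<and>
     (\<forall>(a, b, c) \<in> {(Minus, Plus, Minus), (Minus, Minus, Plus)}.
        cliffordian_exists 6 (a, b, c, Plus, Plus, Plus, Plus) (D4 \<times>\<times> Z2)) \<and>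
     (\<forall>d e f g. pluses [d, e, f, g] = 3 \<longrightarrow>
        cliffordian_exists 6 (Minus, Plus, Plus, d, e, f, g) (D4 \<times>\<times> Z2)) \<and>
     ((\<forall>d e f g. pluses [d, e, f, g] = 2 \<and>
           \<not> covering_signature (Plus, Minus, Minus, d, e, f, g) (Z4 \<times>\<times> Z2 \<times>\<times> Z2) \<longrightarrow>
           cliffordian_star_exists 4 (Plus, Minus, Minus, d, e, f, g)) \<and>
        (\<forall>d e f g. pluses [d, e, f, g] = 2 \<longrightarrow>
           cpt_realized 4 (Plus, Minus, Minus, d, e, f, g) (\<lambda>p q N Es. True)) \<and>
        (\<exists>d e f g. pluses [d, e, f, g] = 2 \<and>
           cliffordian_star_exists 4 (Plus, Minus, Minus, d, e, f, g))) \<and>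
     (\<forall>d e f g. pluses [d, e, f, g] = 1 \<longrightarrow>
        cliffordian_star_exists 4 (Plus, Minus, Plus, d, e, f, g) \<and>
        cliffordian_star_exists 4 (Plus, Plus, Minus, d, e, f, g)) \<and>
     (\<forall>(a, b, c) \<in> {(Minus, Plus, Minus), (Minus, Minus, Plus)}.
        (\<forall>d e f g. pluses [d, e, f, g] = 2 \<and>
           \<not> covering_signature (a, b, c, d, e, f, g) (Z4 \<times>\<times> Z2 \<times>\<times> Z2) \<longrightarrow>
           cliffordian_star_exists 6 (a, b, c, d, e, f, g)) \<and>
        (\<exists>d e f g. pluses [d, e, f, g] = 2 \<and>
           cliffordian_star_exists 6 (a, b, c, d, e, f, g))) \<and>
     (\<forall>d e f g. pluses [d, e, f, g] = 3 \<longrightarrow>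
        cliffordian_star_exists 6 (Minus, Minus, Minus, d, e, f, g))"
proof (intro conjI, goal_cases)
  case 1
  show ?case
    by (intro allI impI; elim conjE exE; intro conjI; rule real_case_reduction)
next
  case 2
  show ?case using pt_structures by blast
next
  case 3
  show ?case unfolding realized_iff_even_signature by (rule card_even_signature)
next
  case 4
  show ?case by (rule non_cliffordian_Z2222) simp_all
next
  case 5
  show ?case by (rule non_cliffordian_Z4Z2Z2) simp_all
next
  case 6
  have "non_cliffordian_exists 6 (a, b, c, d, e, f, g) (Z4 \<times>\<times> Z2 \<times>\<times> Z2)"
    if "(a, b, c) \<in> {(Minus, Plus, Minus), (Minus, Minus, Plus)}" "pluses [d, e, f, g] = 2"
      "covering_signature (a, b, c, d, e, f, g) (Z4 \<times>\<times> Z2 \<times>\<times> Z2)" for a b c d e f g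
  proof (rule non_cliffordian_Z4Z2Z2)
    show "minuses [a, b, c, d, e, f, g] = 4" "6 = (if a = Plus then 4 else 6 :: int)"
      using that(1) pluses_minuses[of d e f g 2] that(2) by auto
    show "linear_signs (a, b, c, d, e, f, g)" using that(3) by (rule covering_signature_linear)
  qed
  \<comment> \<open>The linear forms with values (Minus, Plus, Plus) and (Minus, Minus, Plus) at W,
    E and Pi.\<close>
  moreover have "non_cliffordian_exists 6 (Minus, Plus, Minus, Plus, Minus, Plus, Minus) (Z4 \<times>\<times> Z2 \<times>\<times> Z2)"
    "non_cliffordian_exists 6 (Minus, Minus, Plus, Plus, Minus, Minus, Plus) (Z4 \<times>\<times> Z2 \<times>\<times> Z2)"
    by (rule non_cliffordian_Z4Z2Z2; simp)+
  moreover have "pluses [Plus, Minus, Plus, Minus] = 2" "pluses [Plus, Minus, Minus, Plus] = 2"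
    by (simp_all add: pluses_def)
  ultimately show ?case by blast
next
  case 7
  show ?case by (rule cliffordian_Q4Z2) simp_all
next
  case 8
  show ?case by (rule cliffordian_Q4Z2) simp_all
next
  case 9
  show ?case by (rule cliffordian_Q4Z2) simp_all
next
  case 10
  show ?case
    by (intro allI impI conjI; rule cliffordian_Q4Z2; simp add: pluses_minuses[where m=3])
next
  case 11
  show ?case by (rule cliffordian_D4Z2) simp_all
next
  case 12
  show ?case
    by (intro allI impI conjI; rule cliffordian_D4Z2; simp add: pluses_minuses[where m=2])
next
  case 13
  show ?case
    by (intro allI impI conjI; rule cliffordian_D4Z2; simp add: pluses_minuses[where m=1])
next
  case 14
  have "cliffordian_exists 6 (Minus, Plus, Minus, Plus, Plus, Plus, Plus) (D4 \<times>\<times> Z2)"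
    "cliffordian_exists 6 (Minus, Minus, Plus, Plus, Plus, Plus, Plus) (D4 \<times>\<times> Z2)"
    by (rule cliffordian_D4Z2; simp)+
  then show ?case by blast
next
  case 15
  show ?case
    by (intro allI impI conjI; rule cliffordian_D4Z2; simp add: pluses_minuses[where m=1])
next
  case 16
  show ?case
    by (intro allI impI; elim conjE; rule cliffordian_star_covering) (simp_all add: pluses_minuses[where m=2])
next
  case 17
  show ?case
    by (intro allI impI; rule even_signature_realized)
      (simp_all add: even_signature_def pluses_minuses[where m=2])
next
  case 18
  \<comment> \<open>Linearity fails at \<open>e\<close>: with \<open>a\<close> and \<open>d\<close>
    both Plus it would have to be Plus.\<close>
  have "cliffordian_star_exists 4 (Plus, Minus, Minus, Plus, Minus, Plus, Minus)"
    by (rule cliffordian_star) simp_all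
  moreover have "pluses [Plus, Minus, Plus, Minus] = 2" by (simp add: pluses_def)
  ultimately show ?case by blast
next
  case 19
  show ?case
    by (intro allI impI conjI; rule cliffordian_star; simp add: pluses_minuses[where m=3])
next
  case 20
  have "cliffordian_star_exists 6 (a, b, c, d, e, f, g)"
    if "(a, b, c) \<in> {(Minus, Plus, Minus), (Minus, Minus, Plus)}" "pluses [d, e, f, g] = 2"
      "\<not> covering_signature (a, b, c, d, e, f, g) (Z4 \<times>\<times> Z2 \<times>\<times> Z2)" for a b c d e f g
  proof (rule cliffordian_star_covering[OF _ _ that(3)])
    show "minuses [a, b, c, d, e, f, g] = 4" "6 = (if a = Plus then 4 else 6 :: int)"
      using that(1) pluses_minuses[of d e f g 2] that(2) by auto
  qed
  \<comment> \<open>Linearity fails at \<open>e\<close> again: with \<open>a\<close> Minus and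
    \<open>d\<close> Plus it would have to be Minus.\<close>
  moreover have "cliffordian_star_exists 6 (Minus, Plus, Minus, Plus, Plus, Minus, Minus)"
    "cliffordian_star_exists 6 (Minus, Minus, Plus, Plus, Plus, Minus, Minus)"
    by (rule cliffordian_star; simp)+
  moreover have "pluses [Plus, Plus, Minus, Minus] = 2" by (simp add: pluses_def)
  ultimately show ?case by blast
next
  case 21
  show ?case
    by (intro allI impI conjI; rule cliffordian_star; simp add: pluses_minuses[where m=1])
qed

end
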